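(* Let $N>1$ and let $\mu$ be a Siegel measure on $\mathcal{M}_N$. There exists a constant $c(\mu)<\infty$ such that: I. If $\psi\ge0$ is a Borel function on $\mathbf{R}^N$, then $$\int_{\mathcal{M}_N}\hat\psi(\nu)\,\mu(d\nu)=c(\mu)\int_{\mathbf{R}^N}\psi(u)\,du .$$ II. If $\sigma_N$ is the area of the unit sphere in $\mathbf{R}^N$, then $$\lim_{R\to\infty}\left\|\frac{N_\nu(R)}{R^N}-c(\mu)\frac{\sigma_N}{N}\right\|_{L^1(\mu)}=0 .$$ III. If $\mu$ is supported on $\mathcal{M}_N^e=\{\nu\in\mathcal{M}_N\mid \nu(-U)=\nu(U),\ U\text{ Borel}\}$, then for all $\psi\in C_c(\mathbf{R}^N)$ $$\lim_{R\to\infty}\left\|\frac1{R^N}\int_{\mathbf{R}^N}\psi\left(\frac vR\right)\nu(dv)-c(\mu)\int_{\mathbf{R}^N}\psi(u)\,du\right\|_{L^1(\mu)}=0 .$$ If $N>2$, and if $\mu$ is such that $\hat\psi\in L^2(\mu)$ for all $\psi\in C_c(\mathbf{R}^N)$, then the convergence in II, and (under the hypothesis of III) the convergence in III, also hold pointwise for $\mu$-a.e. $\nu$; that is, $N_\nu(R)/R^N\to c(\mu)\sigma_N/N$ and $R^{-N}\int\psi(v/R)\,\nu(dv)\to c(\mu)\int\psi(u)\,du$ as $R\to\infty$.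
   Context: For a Borel measure $\nu$ on $\mathbf{R}^N$ put $N_\nu(R)=\nu(B(0,R))$, with $B(0,R)$ the open ball of radius $R$ about $0$, and $M(\nu)=\sup_{R>0}N_\nu(R)/R^N$. $\mathcal{M}_N$ is the set of Borel measures $\nu$ on $\mathbf{R}^N$ with $M(\nu)<\infty$, endowed with the $C_c(\mathbf{R}^N)$ weak-$*$ topology (the smallest topology making $\nu\mapsto\int\psi\,d\nu$ continuous for each $\psi\in C_c(\mathbf{R}^N)$) and its Borel $\sigma$-algebra. For a Borel function $\psi\geq 0$ (or $\psi\in C_c(\mathbf{R}^N)$), $\hat\psi(\nu)=\int_{\mathbf{R}^N}\psi(u)\,\nu(du)$. The group $G_N=\mathrm{SL}(N,\mathbf{R})$ acts on $\mathcal{M}_N$ by pushing measures forward under linear maps, $(g\nu)(E)=\nu(g^{-1}E)$. A Siegel measure is a Borel probability measure $\mu$ on $\mathcal{M}_N$ which is invariant and ergodic for this $G_N$-action. $du$ is Lebesgue measure. *)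

theory Defs
  imports "HOL-Probability.Probability"
begin

text \<open>
  Throughout, \<open>\<real>\<^sup>N\<close> is \<^typ>\<open>real ^ 'n\<close> with \<open>N = CARD('n)\<close>.
\<close>

definition mass_in_ball :: "(real ^ 'n) measure \<Rightarrow> real \<Rightarrow> ennreal"
  where "mass_in_ball \<nu> R = emeasure \<nu> (ball 0 R)"

definition growth_bound :: "(real ^ 'n) measure \<Rightarrow> ennreal"
  where "growth_bound \<nu> = (SUP R\<in>{0<..}. mass_in_ball \<nu> R / ennreal (R ^ CARD('n)))"

definition growth_measures :: "(real ^ 'n) measure set"
  where "growth_measures = {\<nu>. sets \<nu> = sets borel \<and> growth_bound \<nu> < \<infinity>}"

definition Cc :: "(real ^ 'n \<Rightarrow> real) set"
  where "Cc = {\<psi>. continuous_on UNIV \<psi> \<and> compact (closure {x. \<psi> x \<noteq> 0})}"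

definition hat :: "(real ^ 'n \<Rightarrow> real) \<Rightarrow> (real ^ 'n) measure \<Rightarrow> real"
  where "hat \<psi> \<nu> = (\<integral>u. \<psi> u \<partial>\<nu>)"

definition nn_hat :: "(real ^ 'n \<Rightarrow> ennreal) \<Rightarrow> (real ^ 'n) measure \<Rightarrow> ennreal"
  where "nn_hat \<psi> \<nu> = (\<integral>\<^sup>+u. \<psi> u \<partial>\<nu>)"

definition weak_star_topology :: "(real ^ 'n) measure topology"
  where "weak_star_topology = topology_generated_by
    {{\<nu> \<in> growth_measures. hat \<psi> \<nu> \<in> U} | \<psi> U. \<psi> \<in> Cc \<and> open U}"

definition growth_measures_borel :: "(real ^ 'n) measure measure"
  where "growth_measures_borel = sigma growth_measures {W. openin weak_star_topology W}"

definition SL :: "(real ^ 'n ^ 'n) set"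
  where "SL = {A. det A = 1}"

definition act :: "real ^ 'n ^ 'n \<Rightarrow> (real ^ 'n) measure \<Rightarrow> (real ^ 'n) measure"
  where "act A \<nu> = distr \<nu> borel (\<lambda>x. A *v x)"

definition SL_invariant :: "(real ^ 'n) measure measure \<Rightarrow> bool"
  where "SL_invariant \<mu> \<longleftrightarrow> (\<forall>A\<in>SL. distr \<mu> growth_measures_borel (act A) = \<mu>)"

definition SL_ergodic :: "(real ^ 'n) measure measure \<Rightarrow> bool"
  where "SL_ergodic \<mu> \<longleftrightarrow>
    (\<forall>E\<in>sets \<mu>. (\<forall>A\<in>SL. act A ` E = E) \<longrightarrow> emeasure \<mu> E = 0 \<or> emeasure \<mu> E = 1)"

definition Siegel_measure :: "(real ^ 'n) measure measure \<Rightarrow> bool"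
  where "Siegel_measure \<mu> \<longleftrightarrow>
    sets \<mu> = sets growth_measures_borel \<and> prob_space \<mu> \<and> SL_invariant \<mu> \<and> SL_ergodic \<mu>"

definition even_growth_measures :: "(real ^ 'n) measure set"
  where "even_growth_measures =
    {\<nu> \<in> growth_measures. \<forall>U\<in>sets borel. emeasure \<nu> (uminus ` U) = emeasure \<nu> U}"

text \<open>
  The area of a hypersurface is its Minkowski content of codimension one: the volume of the
  open \<open>\<epsilon>\<close>-neighbourhood divided by its thickness \<open>2\<epsilon>\<close>, as \<open>\<epsilon> \<rightarrow> 0\<close>.
\<close>

definition hypersurface_area :: "(real ^ 'n) set \<Rightarrow> real"
  where "hypersurface_area S =
    Lim (at_right 0) (\<lambda>\<epsilon>. measure lborel {x. infdist x S < \<epsilon>} / (2 * \<epsilon>))"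

definition unit_sphere_area :: "('n::finite) itself \<Rightarrow> real"
  where "unit_sphere_area _ = hypersurface_area (sphere (0 :: real ^ 'n) 1)"

lemma topspace_weak_star_topology [simp]: "topspace weak_star_topology = growth_measures"
proof -
  have "(\<lambda>_. 0) \<in> Cc" by (simp add: Cc_def)
  then have "growth_measures \<in>
      {{\<nu> \<in> growth_measures. hat \<psi> \<nu> \<in> U} | \<psi> U. \<psi> \<in> Cc \<and> open U}"
    by (intro CollectI exI[of _ "\<lambda>_. 0"] exI[of _ UNIV]) auto
  then show ?thesis
    unfolding weak_star_topology_def topology_generated_by_topspace by blast
qed

lemma infdist_unit_sphere:
  fixes x :: "real ^ 'n"
  shows "infdist x (sphere 0 1) = \<bar>norm x - 1\<bar>"
proof -
  define y :: "real ^ 'n" where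
    "y = (if x = 0 then SOME v. norm v = 1 else x /\<^sub>R norm x)"
  have "\<exists>v :: real ^ 'n. norm v = 1" using vector_choose_size[of 1] by auto
  from someI_ex[OF this] have y: "norm y = 1" by (auto simp: y_def)
  have "dist x y = \<bar>norm x - 1\<bar>"
  proof (cases "x = 0")
    case False
    have "x - y = (norm x - 1) *\<^sub>R (x /\<^sub>R norm x)"
      using False by (simp add: y_def algebra_simps)
    then have "norm (x - y) = \<bar>norm x - 1\<bar> * norm (x /\<^sub>R norm x)"
      by (metis norm_scaleR)
    then show ?thesis using False by (simp add: dist_norm)
  qed (use y in \<open>simp add: dist_norm\<close>)
  moreover have "\<bar>norm x - 1\<bar> \<le> dist x z" if "z \<in> sphere 0 1" for z
    using that norm_triangle_ineq3[of x z] by (simp add: dist_norm)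
  moreover have "y \<in> sphere 0 1" using y by simp
  ultimately show ?thesis
    by (intro antisym) (metis infdist_le, subst infdist_notempty, auto intro!: cINF_greatest)
qed

lemma unit_sphere_area_eq:
  "unit_sphere_area TYPE('n::finite) = real CARD('n) * unit_ball_vol (real CARD('n))"
proof -
  let ?N = "CARD('n)" and ?S = "sphere (0 :: real ^ 'n) 1"
  let ?p = "\<lambda>r::real. unit_ball_vol (real ?N) * r ^ ?N"
  have vol: "measure lborel {x. infdist x ?S < e} / (2 * e) =
      (?p (1 + e) - ?p (1 - e)) / (2 * e)" if "0 < e" "e < 1" for e
  proof -
    have "{x. infdist x ?S < e} = ball 0 (1 + e) - cball 0 (1 - e)"
      by (auto simp: infdist_unit_sphere)
    moreover have "measure lborel (ball (0 :: real ^ 'n) (1 + e) - cball 0 (1 - e)) =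
        measure lborel (ball (0 :: real ^ 'n) (1 + e)) -
        measure lborel (cball (0 :: real ^ 'n) (1 - e))"
      using that by (intro measure_Diff) (auto simp: emeasure_ball)
    ultimately show ?thesis
      using that by (simp add: content_ball content_cball)
  qed
  have d: "(?p has_real_derivative unit_ball_vol (real ?N) * real ?N) (at 1)"
    by (auto intro!: derivative_eq_intros)
  from d[unfolded DERIV_def]
  have a: "((\<lambda>h. (?p (1 + h) - ?p 1) / h) \<longlongrightarrow> unit_ball_vol (real ?N) * real ?N) (at 0)" .
  have "filterlim uminus (at (0::real)) (at_right 0)"
    by (auto simp: filterlim_at eventually_at_filter intro!: tendsto_eq_intros)
  from filterlim_compose[OF a this]
  have b: "((\<lambda>h. (?p (1 - h) - ?p 1) / (- h)) \<longlongrightarrow> unit_ball_vol (real ?N) * real ?N) (at_right 0)"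
    by simp
  have "((\<lambda>h. (1/2) * ((?p (1 + h) - ?p 1) / h + (?p (1 - h) - ?p 1) / (- h)))
      \<longlongrightarrow> (1/2) * (unit_ball_vol (real ?N) * real ?N + unit_ball_vol (real ?N) * real ?N)) (at_right 0)"
    by (intro tendsto_intros b tendsto_within_subset[OF a subset_UNIV])
  moreover have "\<forall>\<^sub>F h in at_right 0.
      (1/2) * ((?p (1 + h) - ?p 1) / h + (?p (1 - h) - ?p 1) / (- h)) =
      measure lborel {x. infdist x ?S < h} / (2 * h)"
    using eventually_at_right_real[OF zero_less_one]
    by eventually_elim (subst vol, auto simp: field_simps)
  ultimately have "((\<lambda>h. measure lborel {x. infdist x ?S < h} / (2 * h))
      \<longlongrightarrow> (1/2) * (unit_ball_vol (real ?N) * real ?N + unit_ball_vol (real ?N) * real ?N)) (at_right 0)"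
    by (rule Lim_transform_eventually)
  then have "((\<lambda>h. measure lborel {x. infdist x ?S < h} / (2 * h))
      \<longlongrightarrow> real ?N * unit_ball_vol (real ?N)) (at_right 0)"
    by (simp add: mult.commute)
  then show ?thesis
    unfolding unit_sphere_area_def hypersurface_area_def
    by (intro tendsto_Lim) auto
qed

end

theory Submission
  imports Defs "HOL-Real_Asymp.Real_Asymp"
begin

text \<open>
  A Mautner argument shows that every single transvection \<open>u\<close> acts ergodically. The points of a
  Siegel-random \<open>\<nu>\<close> in a sector \<open>a \<le> x\<^sub>i / x\<^sub>j < b\<close> of a bounded set are counted by Birkhoff averages:
  \<open>u\<close> shifts the slope \<open>x\<^sub>i / x\<^sub>j\<close>, so a long sector is a union of translates of a short one, and a
  diagonal matrix maps it to the dilate of a fixed sector. Since \<open>N\<^sub>\<nu>(R) / R\<^sup>N\<close> is bounded, these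
  averages are bounded, which forces the counting functions to be integrable; their mean is an
  \<open>SL\<close>-invariant measure without mass at the origin, hence a multiple of Lebesgue measure. The
  ergodic theorem then gives convergence in \<open>L\<^sup>1\<close> for sectors, and by approximation for all Lebesgue
  integrable functions.

  For \<open>N > 2\<close> an \<open>SL\<close>-invariant measure on pairs of independent vectors is a multiple of Lebesgue
  measure, so the variance of \<open>R\<^sup>-\<^sup>N \<integral> \<psi>(v / R) \<nu>(dv)\<close> comes from the dependent pairs only. They
  contribute \<open>O(R\<^sup>-\<^sup>N)\<close>, which is summable along geometric sequences of radii, and the growth bound
  interpolates between the radii.
\<close>

section \<open>Ergodic averages\<close>

text \<open>Nothing in the hypotheses makes a counting function \<mu>-integrable:
  \<open>growth_bound\<close> is finite at each \<nu> but may have infinite mean. Hence ergodic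
  averages are first taken of truncations \<open>min f m\<close>; the truncated means stay below a
  multiple of \<open>growth_bound \<nu>\<close> for one \<nu> and all m at once. The diagonal matrix
  that turns an orbit sum into a count over a dilate changes with the length of the sum, so
  pointwise limits cannot be carried across it. Norms in L1(\<mu>) can, because every matrix
  preserves \<mu>; this is why convergence in mean comes first and almost sure convergence has to
  wait for second moments. Ergodicity is assumed for strictly invariant sets, while the Mautner
  argument yields sets invariant up to null sets that vary with the matrix; averaging over matrices
  bridges this gap. For N = 2 the determinant of a pair is itself invariant, so pairs carry many
  invariant measures. Second moments are only taken of differences of two dilates. These have
  Lebesgue integral zero, so the constant in front of Lebesgue measure on pairs drops out and need
  not be identified.\<close>

fun sup_partial_sums :: "('a \<Rightarrow> 'a) \<Rightarrow> ('a \<Rightarrow> real) \<Rightarrow> nat \<Rightarrow> 'a \<Rightarrow> real" where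
  "sup_partial_sums T f 0 x = 0"
| "sup_partial_sums T f (Suc n) x = max 0 (f x + sup_partial_sums T f n (T x))"

lemma sup_partial_sums_nonneg: "0 \<le> sup_partial_sums T f n x"
  by (cases n) auto

lemma sup_partial_sums_Suc_mono: "sup_partial_sums T f n x \<le> sup_partial_sums T f (Suc n) x"
proof (induction n arbitrary: x)
  case (Suc n)
  show ?case using Suc[of "T x"] by (simp del: sup_partial_sums.simps add: sup_partial_sums.simps(2)[of T f n x] sup_partial_sums.simps(2)[of T f "Suc n" x] max.coboundedI2)
qed simp

lemma sup_partial_sums_mono: "m \<le> n \<Longrightarrow> sup_partial_sums T f m x \<le> sup_partial_sums T f n x"
  by (rule lift_Suc_mono_le[of "\<lambda>n. sup_partial_sums T f n x"]) (rule sup_partial_sums_Suc_mono)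

lemma sum_iterates_Suc:
  fixes f :: "'a \<Rightarrow> real"
  shows "(\<Sum>k<Suc n. f ((T ^^ k) x)) = f x + (\<Sum>k<n. f ((T ^^ k) (T x)))"
  by (subst sum.lessThan_Suc_shift) (simp add: funpow_swap1)

text \<open>Unrolling the recursion, \<open>sup_partial_sums T f n\<close> is the maximum of the
  partial sums of lengths 0 to n; length 0 accounts for the \<open>max 0\<close>.\<close>

lemma partial_sum_le_sup_partial_sums: "(\<Sum>k<n. f ((T ^^ k) x)) \<le> sup_partial_sums T f n x"
proof (induction n arbitrary: x)
  case (Suc n)
  show ?case unfolding sum_iterates_Suc using Suc[of "T x"] by simp
qed simp

locale mpt = prob_space M for M :: "'a measure" +
  fixes T :: "'a \<Rightarrow> 'a"
  assumes T_measurable [measurable]: "T \<in> measurable M M"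
    and T_preserves: "distr M M T = M"
begin

lemma integrable_comp: 
  fixes f :: "'a \<Rightarrow> real"
  assumes "integrable M f" shows "integrable M (\<lambda>x. f (T x))"
  using integrable_distr[OF T_measurable, of f] assms by (simp add: T_preserves)

lemma integral_comp:
  fixes f :: "'a \<Rightarrow> real"
  assumes [measurable]: "f \<in> borel_measurable M" shows "(\<integral>x. f (T x) \<partial>M) = (\<integral>x. f x \<partial>M)"
  using integral_distr[OF T_measurable, of f] by (simp add: T_preserves)

lemma funpow_preserves: "distr M M (T ^^ k) = M"
proof (induction k)
  case (Suc k)
  have "distr M M (T ^^ Suc k) = distr (distr M M (T ^^ k)) M T"
    by (subst distr_distr) simp_all
  then show ?case unfolding Suc T_preserves .
qed (simp add: distr_id id_def)

lemma mpt_funpow: "mpt M (T ^^ k)"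
  by unfold_locales (simp_all add: funpow_preserves)

lemma integrable_sup_partial_sums:
  assumes f: "integrable M f" shows "integrable M (sup_partial_sums T f n)"
proof (induction n)
  case (Suc n)
  have "integrable M (\<lambda>x. max 0 (f x + sup_partial_sums T f n (T x)))"
    using f integrable_comp[OF Suc] by (intro integrable_max) auto
  then show ?case by simp
qed simp

text \<open>Garsia's argument: where the maximum \<open>?m\<close> is positive it equals
  \<open>f\<close> plus an earlier maximum at \<open>T x\<close>, so
  \<open>?m x - ?m (T x) \<le> f x\<close>; elsewhere the left side is at most 0. The integral of
  the left side vanishes by invariance.\<close>

lemma maximal_inequality:
  assumes f: "integrable M f"
  shows "0 \<le> (\<integral>x. indicator {x. 0 < sup_partial_sums T f n x} x * f x \<partial>M)"
proof (cases n)
  case (Suc n')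
  let ?m = "sup_partial_sums T f n" and ?A = "{x. 0 < sup_partial_sums T f n x}"
  note i = integrable_sup_partial_sums[OF f, of n]
  have [measurable]: "?m \<in> borel_measurable M" "f \<in> borel_measurable M"
    using i f by auto
  have A: "{x\<in>space M. 0 < ?m x} \<in> sets M" by measurable
  have "0 = (\<integral>x. ?m x - ?m (T x) \<partial>M)"
    using i integrable_comp[OF i] by (simp add: integral_comp)
  also have "\<dots> \<le> (\<integral>x. indicator ?A x * f x \<partial>M)"
  proof (rule integral_mono)
    show "integrable M (\<lambda>x. ?m x - ?m (T x))"
      using i integrable_comp[OF i] by simp
    have "integrable M (\<lambda>x. indicator {x\<in>space M. 0 < ?m x} x * f x)"
      using integrable_real_mult_indicator[OF A f] by (simp add: mult.commute)
    then show "integrable M (\<lambda>x. indicator ?A x * f x)"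
      by (rule Bochner_Integration.integrable_cong[THEN iffD1, rotated 2]) (auto simp: indicator_def)
    fix x assume "x \<in> space M"
    show "?m x - ?m (T x) \<le> indicator ?A x * f x"
    proof (cases "0 < ?m x")
      case True
      then have "?m x = f x + sup_partial_sums T f n' (T x)" by (simp add: Suc max_def split: if_splits)
      moreover have "sup_partial_sums T f n' (T x) \<le> ?m (T x)"
        using sup_partial_sums_Suc_mono[of T f n' "T x"] by (simp add: Suc)
      ultimately show ?thesis using True by simp
    next
      case False
      then show ?thesis using sup_partial_sums_nonneg[of T f n "T x"] by simp
    qed
  qed
  finally show ?thesis .
qed simp

end

locale ergodic_mpt = mpt +
  assumes ergodic: "\<And>E. E \<in> sets M \<Longrightarrow> T -` E \<inter> space M = E \<Longrightarrow> prob E = 0 \<or> prob E = 1"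
begin

text \<open>Having unbounded orbit sums is a T-invariant property, so it has probability 0 or 1.
  Were it 1, the sets of the maximal inequality would exhaust the space and force a nonnegative
  mean.\<close>

lemma AE_bounded_partial_sums:
  fixes g :: "'a \<Rightarrow> real"
  assumes g: "integrable M g" and neg: "(\<integral>x. g x \<partial>M) < 0"
  shows "AE x in M. \<exists>K::nat. \<forall>n. (\<Sum>k<n. g ((T ^^ k) x)) \<le> K"
proof -
  have [measurable]: "g \<in> borel_measurable M" using g by auto
  define S where "S n x = (\<Sum>k<n. g ((T ^^ k) x))" for n x
  have [measurable]: "S n \<in> borel_measurable M" for n
    unfolding S_def by measurable
  define B where "B = {x \<in> space M. \<not> (\<exists>K::nat. \<forall>n. S n x \<le> K)}"
  have [measurable]: "B \<in> sets M" unfolding B_def by measurable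
  have S_Suc: "S (Suc n) x = g x + S n (T x)" for n x
    unfolding S_def by (rule sum_iterates_Suc)
  \<comment> \<open>Shifting the start changes each partial sum by the single term
    \<open>g x\<close>, so boundedness passes both ways.\<close>
  have bdd_T: "(\<exists>K::nat. \<forall>n. S n (T x) \<le> K) \<longleftrightarrow> (\<exists>K::nat. \<forall>n. S n x \<le> K)" for x
  proof
    assume "\<exists>K::nat. \<forall>n. S n (T x) \<le> K"
    then obtain K :: nat where K: "\<And>n. S n (T x) \<le> K" by blast
    obtain L :: nat where L: "\<bar>g x\<bar> + real K \<le> L" using real_arch_simple by blast
    have "S n x \<le> L" for n
    proof (cases n)
      case 0 then show ?thesis by (simp add: S_def)
    next
      case (Suc m) show ?thesis unfolding Suc S_Suc using K[of m] L by linarith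
    qed
    then show "\<exists>K::nat. \<forall>n. S n x \<le> K" by blast
  next
    assume "\<exists>K::nat. \<forall>n. S n x \<le> K"
    then obtain K :: nat where K: "\<And>n. S n x \<le> K" by blast
    obtain L :: nat where L: "\<bar>g x\<bar> + real K \<le> L" using real_arch_simple by blast
    have "S n (T x) \<le> L" for n
      using S_Suc[of n x] K[of "Suc n"] L by linarith
    then show "\<exists>K::nat. \<forall>n. S n (T x) \<le> K" by blast
  qed
  have "T -` B \<inter> space M = B"
    unfolding B_def vimage_Collect_eq using measurable_space[OF T_measurable] by (simp add: bdd_T Int_def conj_commute cong: conj_cong)
  then have "prob B = 0 \<or> prob B = 1" by (rule ergodic[rotated]) simp
  moreover have "prob B \<noteq> 1"
  proof
    assume "prob B = 1"
    then have AE: "AE x in M. x \<in> B" by (simp add: prob_eq_1)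
    have "(\<lambda>n. \<integral>x. indicator {x. 0 < sup_partial_sums T g n x} x * g x \<partial>M) \<longlonglongrightarrow> (\<integral>x. g x \<partial>M)"
    proof (rule integral_dominated_convergence[where w = "\<lambda>x. \<bar>g x\<bar>"])
      show "AE x in M. (\<lambda>n. indicator {x. 0 < sup_partial_sums T g n x} x * g x) \<longlonglongrightarrow> g x"
        using AE
      proof eventually_elim
        case (elim x)
        then have "\<exists>n. \<not> S n x \<le> real 0" unfolding B_def by blast
        then obtain n where "0 < S n x" by (auto simp: not_le)
        then have n: "0 < sup_partial_sums T g n x"
          using partial_sum_le_sup_partial_sums[of g T x n] unfolding S_def by linarith
        have "\<forall>\<^sub>F m in sequentially. indicator {x. 0 < sup_partial_sums T g m x} x * g x = g x"
          using eventually_ge_at_top[of n]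
          by eventually_elim (use sup_partial_sums_mono[of n _ T g x] n in \<open>auto simp: indicator_def intro: less_le_trans\<close>)
        then show ?case by (rule tendsto_eventually)
      qed
      have "sup_partial_sums T g n \<in> borel_measurable M" for n 
        using integrable_sup_partial_sums[OF g] by auto
      note [measurable] = this
      have "(\<lambda>x. (if 0 < sup_partial_sums T g n x then g x else 0)) \<in> borel_measurable M" for n
        by measurable
      then show "(\<lambda>x. indicator {x. 0 < sup_partial_sums T g n x} x * g x) \<in> borel_measurable M" for n
        by (rule measurable_cong[THEN iffD1, rotated]) (auto simp: indicator_def)
    qed (use g in \<open>auto simp: indicator_def\<close>)
    moreover have "0 \<le> (\<integral>x. indicator {x. 0 < sup_partial_sums T g n x} x * g x \<partial>M)" for n
      by (rule maximal_inequality[OF g])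
    ultimately have "0 \<le> (\<integral>x. g x \<partial>M)" by (intro LIMSEQ_le_const) auto
    with neg show False by simp
  qed
  ultimately have "AE x in M. x \<notin> B"
    by (auto simp: AE_iff_measurable[OF _ refl] prob_eq_0)
  then show ?thesis by (rule AE_mp) (auto simp: B_def S_def intro!: AE_I2)
qed

text \<open>Subtracting slightly more than the mean makes the mean negative, so the partial sums
  stay bounded above and their averages have upper limit at most 0. Countably many \<open>j\<close>
  give one null set for all \<open>e\<close>.\<close>

lemma AE_ergodic_average_eventually_less:
  fixes f :: "'a \<Rightarrow> real"
  assumes f: "integrable M f"
  shows "AE x in M. \<forall>e>0. \<forall>\<^sub>F n in sequentially. (\<Sum>k<n. f ((T ^^ k) x)) / n < (\<integral>x. f x \<partial>M) + e"
proof -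
  let ?I = "\<integral>x. f x \<partial>M"
  have "AE x in M. \<forall>j::nat. \<exists>K::nat. \<forall>n. (\<Sum>k<n. f ((T ^^ k) x) - ?I - 1 / Suc j) \<le> K"
    unfolding AE_all_countable
  proof
    fix j :: nat
    show "AE x in M. \<exists>K::nat. \<forall>n. (\<Sum>k<n. f ((T ^^ k) x) - ?I - 1 / Suc j) \<le> K"
      using f by (intro AE_bounded_partial_sums[of "\<lambda>x. f x - ?I - 1 / Suc j"]) (auto simp: prob_space)
  qed
  then show ?thesis
  proof eventually_elim
    case (elim x)
    show ?case
    proof (intro allI impI)
      fix e :: real assume "0 < e"
      then obtain j where j: "1 / Suc j < e / 2"
        using nat_approx_posE[of "e / 2"] by auto
      from elim obtain K :: nat where K: "\<And>n. (\<Sum>k<n. f ((T ^^ k) x) - ?I - 1 / Suc j) \<le> K" by blast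
      have "(\<lambda>n. real K / real n) \<longlonglongrightarrow> 0" by (rule lim_const_over_n)
      then have "\<forall>\<^sub>F n in sequentially. real K / real n < e / 2"
        using \<open>0 < e\<close> by (intro order_tendstoD(2)) auto
      then show "\<forall>\<^sub>F n in sequentially. (\<Sum>k<n. f ((T ^^ k) x)) / n < ?I + e"
        using eventually_gt_at_top[of 0]
      proof eventually_elim
        case (elim n)
        have "(\<Sum>k<n. f ((T ^^ k) x)) - n * (?I + 1 / Suc j) \<le> K"
          using K[of n] by (simp add: sum_subtractf algebra_simps)
        then have "(\<Sum>k<n. f ((T ^^ k) x)) \<le> n * (?I + 1 / Suc j) + K" by linarith
        also have "\<dots> = n * (?I + 1 / Suc j + K / n)"
          using elim(2) by (simp add: distrib_left)
        finally have "(\<Sum>k<n. f ((T ^^ k) x)) / n \<le> ?I + 1 / Suc j + K / n"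
          using elim(2) by (metis mult.commute of_nat_0_less_iff pos_divide_le_eq)
        then show ?case using elim(1) j by linarith
      qed
    qed
  qed
qed

theorem AE_ergodic_average_tendsto:
  fixes f :: "'a \<Rightarrow> real"
  assumes f: "integrable M f"
  shows "AE x in M. (\<lambda>n. (\<Sum>k<n. f ((T ^^ k) x)) / n) \<longlonglongrightarrow> (\<integral>x. f x \<partial>M)"
proof -
  have "integrable M (\<lambda>x. - f x)" using f by simp
  from AE_ergodic_average_eventually_less[OF f] AE_ergodic_average_eventually_less[OF this]
  show ?thesis
  proof eventually_elim
    case (elim x)
    show ?case
    proof (rule order_tendstoI)
      fix a assume a: "a < (\<integral>x. f x \<partial>M)"
      then have "\<forall>\<^sub>F n in sequentially. (\<Sum>k<n. - f ((T ^^ k) x)) / n < (\<integral>x. - f x \<partial>M) + ((\<integral>x. f x \<partial>M) - a)"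
        using elim(2) by (metis diff_gt_0_iff_gt)
      then show "\<forall>\<^sub>F n in sequentially. a < (\<Sum>k<n. f ((T ^^ k) x)) / n"
        by eventually_elim (simp add: sum_negf)
    next
      fix a assume a: "(\<integral>x. f x \<partial>M) < a"
      then have "\<forall>\<^sub>F n in sequentially. (\<Sum>k<n. f ((T ^^ k) x)) / n < (\<integral>x. f x \<partial>M) + (a - (\<integral>x. f x \<partial>M))"
        using elim(1) by (metis diff_gt_0_iff_gt)
      then show "\<forall>\<^sub>F n in sequentially. (\<Sum>k<n. f ((T ^^ k) x)) / n < a" by simp
    qed
  qed
qed

text \<open>The averages are nonnegative and their means do not exceed that of the limit, so
  Scheffe's lemma upgrades almost sure convergence to convergence in mean.\<close>

theorem ergodic_average_L1:
  fixes f :: "'a \<Rightarrow> real"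
  assumes f: "integrable M f" and nonneg: "\<And>x. 0 \<le> f x"
  shows "(\<lambda>n. \<integral>x. \<bar>(\<Sum>k<n. f ((T ^^ k) x)) / n - (\<integral>x. f x \<partial>M)\<bar> \<partial>M) \<longlonglongrightarrow> 0"
proof -
  let ?I = "\<integral>x. f x \<partial>M"
  let ?A = "\<lambda>n x. (\<Sum>k<n. f ((T ^^ k) x)) / n"
  have [measurable]: "f \<in> borel_measurable M" using f by auto
  have int1: "integrable M (\<lambda>x. f ((T ^^ k) x))" for k
    by (rule mpt.integrable_comp[OF mpt_funpow f])
  have I1: "(\<integral>x. f ((T ^^ k) x) \<partial>M) = ?I" for k
    by (rule mpt.integral_comp[OF mpt_funpow]) simp
  have int: "integrable M (?A n)" for n using int1 by simp
  have "(\<integral>\<^sup>+ x. norm (?A n x) \<partial>M) \<le> (\<integral>\<^sup>+ x. norm ?I \<partial>M)" for n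
  proof -
    have "(\<integral>\<^sup>+ x. norm (?A n x) \<partial>M) = ennreal (\<integral>x. ?A n x \<partial>M)"
    proof -
      have nn: "0 \<le> ?A n x" for x by (simp add: sum_nonneg nonneg)
      show ?thesis
        using int[of n] by (subst nn_integral_eq_integral[symmetric]) (auto simp: nn abs_of_nonneg[OF nn] simp del: abs_divide)
    qed
    \<comment> \<open>For \<open>n = 0\<close> both sides are 0 by division by zero, which is why
      the comparison with \<open>?I\<close> below is an inequality.\<close>
    also have "(\<integral>x. ?A n x \<partial>M) = n * ?I / n" using int1 I1 by simp
    also have "ennreal \<dots> \<le> ennreal ?I" using nonneg by (cases "n = 0") (auto simp: integral_nonneg)
    finally show ?thesis using nonneg by (simp add: emeasure_space_1 integral_nonneg)
  qed
  then have "(\<lambda>n. \<integral>\<^sup>+ x. norm (?A n x - ?I) \<partial>M) \<longlonglongrightarrow> 0"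
    by (intro Scheffe_lemma2 AE_ergodic_average_tendsto f) auto
  moreover have "(\<integral>\<^sup>+ x. norm (?A n x - ?I) \<partial>M) = ennreal (\<integral>x. \<bar>?A n x - ?I\<bar> \<partial>M)" for n
    using int[of n] by (subst nn_integral_eq_integral) auto
  ultimately show ?thesis by (simp add: ennreal_tendsto_0_iff integral_nonneg)
qed

end

section \<open>Measures invariant under flows and translations\<close>

lemma nn_integral_lborel_translate:
  fixes f :: "'v::euclidean_space \<Rightarrow> ennreal"
  assumes [measurable]: "f \<in> borel_measurable borel"
  shows "(\<integral>\<^sup>+s. f (a + s) \<partial>lborel) = (\<integral>\<^sup>+s. f s \<partial>lborel)"
  by (subst (2) lborel_distr_plus[of a, symmetric]) (simp add: nn_integral_distr)

lemma lborel_distr_uminus_euclidean: "distr lborel borel uminus = (lborel :: 'v::euclidean_space measure)"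
  using lborel_affine[of "-1" "0::'v"] by (simp add: density_1 one_ennreal_def[symmetric])

lemma nn_integral_lborel_reflect:
  fixes f :: "'v::euclidean_space \<Rightarrow> ennreal"
  assumes [measurable]: "f \<in> borel_measurable borel"
  shows "(\<integral>\<^sup>+s. f (a - s) \<partial>lborel) = (\<integral>\<^sup>+s. f s \<partial>lborel)"
proof -
  have "(\<integral>\<^sup>+s. f (a - s) \<partial>lborel) = (\<integral>\<^sup>+s. f (a - s) \<partial>distr lborel borel uminus)"
    by (simp add: lborel_distr_uminus_euclidean)
  also have "\<dots> = (\<integral>\<^sup>+s. f (a + s) \<partial>lborel)" by (simp add: nn_integral_distr)
  finally show ?thesis by (simp add: nn_integral_lborel_translate)
qed

text \<open>
  Averaging over the time \<open>s\<close> at which the orbit of \<open>x\<close> passes the unit box in the coordinate \<open>p\<close>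
  shows that the measure of \<open>{x. u (\<theta> x) x \<in> E}\<close> does not depend on \<open>\<theta>\<close>.
\<close>

lemma emeasure_flow_reparametrized:
  fixes u :: "'v::euclidean_space \<Rightarrow> 'a \<Rightarrow> 'a" and p \<theta> :: "'a \<Rightarrow> 'v"
  assumes "sigma_finite_measure M"
    and u [measurable]: "(\<lambda>(s, x). u s x) \<in> measurable (borel \<Otimes>\<^sub>M M) M"
    and [measurable]: "p \<in> borel_measurable M" "\<theta> \<in> borel_measurable M" "X \<in> sets M" "E \<in> sets M"
    and inv: "\<And>s. distr M M (u s) = M"
    and add: "\<And>s t x. x \<in> X \<Longrightarrow> u s (u t x) = u (s + t) x"
    and zero: "\<And>x. u 0 x = x"
    and p: "\<And>s x. x \<in> X \<Longrightarrow> p (u s x) = p x + s"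
    and \<theta>: "\<And>s x. x \<in> X \<Longrightarrow> \<theta> (u s x) = \<theta> x"
    and X: "\<And>s x. x \<in> space M \<Longrightarrow> u s x \<in> X \<longleftrightarrow> x \<in> X"
  shows "emeasure M {x\<in>X. u (\<theta> x) x \<in> E} = emeasure M (X \<inter> E)"
proof -
  interpret sigma_finite_measure M by fact
  interpret pair_sigma_finite lborel M ..
  let ?Q = "box 0 One :: 'v set"
  \<comment> \<open>The right side does not involve \<open>\<theta>\<close>. Used for the given
    \<open>\<theta>\<close> and for the constant 0, it identifies the two measures.\<close>
  have *: "emeasure M {x\<in>X. u (\<theta> x) x \<in> E} =
      (\<integral>\<^sup>+x. indicator X x * indicator ?Q (p x) * (\<integral>\<^sup>+s. indicator E (u s x) \<partial>lborel) \<partial>M)"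
    if [measurable]: "\<theta> \<in> borel_measurable M"
      and \<theta>: "\<And>s x. x \<in> X \<Longrightarrow> \<theta> (u s x) = \<theta> x" for \<theta>
  proof -
    have Q1: "(\<integral>\<^sup>+s. indicator ?Q (p x + s) \<partial>lborel) = (1::ennreal)" for x
      using nn_integral_lborel_translate[of "indicator ?Q" "p x"] by simp
    have u' [measurable]: "u s \<in> measurable M M" for s
      using measurable_compose_Pair1[OF _ u, of s] by simp
    have X_space: "x \<in> X \<Longrightarrow> x \<in> space M" for x 
      using sets.sets_into_space[OF \<open>X \<in> sets M\<close>] by auto
    have "emeasure M {x\<in>X. u (\<theta> x) x \<in> E} = emeasure M {x\<in>space M. x \<in> X \<and> u (\<theta> x) x \<in> E}"
      using X_space by (intro arg_cong2[where f = emeasure] refl) auto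
    also have "\<dots> = (\<integral>\<^sup>+x. indicator {x\<in>space M. x \<in> X \<and> u (\<theta> x) x \<in> E} x \<partial>M)" by (simp)
    also have "\<dots> = (\<integral>\<^sup>+x. (\<integral>\<^sup>+s. indicator X x * indicator ?Q (p x + s) * indicator E (u (\<theta> x) x) \<partial>lborel) \<partial>M)"
    proof (rule nn_integral_cong)
      fix x assume x: "x \<in> space M"
      have "(\<integral>\<^sup>+s. indicator X x * indicator ?Q (p x + s) * indicator E (u (\<theta> x) x) \<partial>lborel) =
          indicator X x * (indicator E (u (\<theta> x) x) :: ennreal)"
        by (simp add: nn_integral_cmult nn_integral_multc Q1)
      then show "indicator {x\<in>space M. x \<in> X \<and> u (\<theta> x) x \<in> E} x =
          (\<integral>\<^sup>+s. indicator X x * indicator ?Q (p x + s) * indicator E (u (\<theta> x) x) \<partial>lborel)"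
        using x by (simp add: indicator_def)
    qed
    also have "\<dots> = (\<integral>\<^sup>+s. (\<integral>\<^sup>+x. indicator X x * indicator ?Q (p x + s) * indicator E (u (\<theta> x) x) \<partial>M) \<partial>lborel)"
      by (rule Fubini') measurable
    \<comment> \<open>Invariance under \<open>u (- s)\<close> moves the time shift out of the box
      and into the orbit: \<open>p\<close> drops by s while \<open>X\<close> and
      \<open>\<theta>\<close> are unchanged.\<close>
    also have "\<dots> = (\<integral>\<^sup>+s. (\<integral>\<^sup>+x. indicator X x * indicator ?Q (p x) * indicator E (u (\<theta> x - s) x) \<partial>M) \<partial>lborel)"
    proof (rule nn_integral_cong)
      fix s :: 'v
      have "(\<integral>\<^sup>+x. indicator X x * indicator ?Q (p x + s) * indicator E (u (\<theta> x) x) \<partial>M) =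
        (\<integral>\<^sup>+x. indicator X x * indicator ?Q (p x + s) * indicator E (u (\<theta> x) x) \<partial>distr M M (u (- s)))"
        by (simp add: inv)
      also have "\<dots> = (\<integral>\<^sup>+x. indicator X (u (- s) x) * indicator ?Q (p (u (- s) x) + s) * indicator E (u (\<theta> (u (- s) x)) (u (- s) x)) \<partial>M)"
        by (rule nn_integral_distr[OF u']) measurable
      also have "\<dots> = (\<integral>\<^sup>+x. indicator X x * indicator ?Q (p x) * indicator E (u (\<theta> x - s) x) \<partial>M)"
        by (intro nn_integral_cong) (auto simp: indicator_def X p \<theta> add)
      finally show "(\<integral>\<^sup>+x. indicator X x * indicator ?Q (p x + s) * indicator E (u (\<theta> x) x) \<partial>M) = \<dots>" .
    qed
    also have "\<dots> = (\<integral>\<^sup>+x. (\<integral>\<^sup>+s. indicator X x * indicator ?Q (p x) * indicator E (u (\<theta> x - s) x) \<partial>lborel) \<partial>M)"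
      by (rule Fubini'[symmetric]) measurable
    also have "\<dots> = (\<integral>\<^sup>+x. indicator X x * indicator ?Q (p x) * (\<integral>\<^sup>+s. indicator E (u s x) \<partial>lborel) \<partial>M)"
    proof (rule nn_integral_cong)
      fix x assume [simp]: "x \<in> space M"
      have [measurable]: "(\<lambda>s. u s x) \<in> measurable borel M"
        using measurable_compose[OF measurable_Pair2' u, of x] by simp
      have "(\<integral>\<^sup>+s. indicator E (u (\<theta> x - s) x) \<partial>lborel) = (\<integral>\<^sup>+s. (indicator E (u s x) :: ennreal) \<partial>lborel)"
        by (rule nn_integral_lborel_reflect) measurable
      then show "(\<integral>\<^sup>+s. indicator X x * indicator ?Q (p x) * indicator E (u (\<theta> x - s) x) \<partial>lborel) =
          indicator X x * indicator ?Q (p x) * (\<integral>\<^sup>+s. (indicator E (u s x) :: ennreal) \<partial>lborel)"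
        by (subst nn_integral_cmult) measurable
    qed
    finally show ?thesis .
  qed
  have "emeasure M {x\<in>X. u (\<theta> x) x \<in> E} = emeasure M {x\<in>X. u 0 x \<in> E}"
    by (subst (1 2) *) (auto simp: \<theta>)
  also have "{x\<in>X. u 0 x \<in> E} = X \<inter> E" by (auto simp: zero)
  finally show ?thesis .
qed

text \<open>Fubini on time and space: \<open>Z\<close> has the same measure seen from every time s,
  while each orbit meets \<open>Z\<close> at a Lebesgue null set of times. So the infinite length of
  the time axis multiplied by \<open>emeasure M Z\<close> is 0.\<close>

lemma null_set_of_null_orbit_times:
  fixes u :: "real \<Rightarrow> 'a \<Rightarrow> 'a"
  assumes "sigma_finite_measure M"
    and u [measurable]: "(\<lambda>(s, x). u s x) \<in> measurable (borel \<Otimes>\<^sub>M M) M"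
    and [measurable]: "Z \<in> sets M"
    and inv: "\<And>s. distr M M (u s) = M"
    and null: "\<And>x. x \<in> space M \<Longrightarrow> countable {s. u s x \<in> Z}"
  shows "emeasure M Z = 0"
proof -
  interpret sigma_finite_measure M by fact
  interpret pair_sigma_finite lborel M ..
  have u' [measurable]: "u s \<in> measurable M M" for s
    using measurable_compose_Pair1[OF _ u, of s] by simp
  have "(\<integral>\<^sup>+s. emeasure M Z \<partial>(lborel :: real measure)) = (\<integral>\<^sup>+s. (\<integral>\<^sup>+x. indicator Z (u s x) \<partial>M) \<partial>lborel)"
  proof (rule nn_integral_cong)
    fix s :: real
    have "(\<integral>\<^sup>+x. indicator Z (u s x) \<partial>M) = (\<integral>\<^sup>+x. indicator Z x \<partial>distr M M (u s))"
      by (subst nn_integral_distr) auto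
    then show "emeasure M Z = (\<integral>\<^sup>+x. indicator Z (u s x) \<partial>M)" by (simp add: inv)
  qed
  also have "\<dots> = (\<integral>\<^sup>+x. (\<integral>\<^sup>+s. indicator Z (u s x) \<partial>lborel) \<partial>M)"
    by (rule Fubini'[symmetric]) measurable
  also have "\<dots> = (\<integral>\<^sup>+x. 0 \<partial>M)"
  proof (rule nn_integral_cong)
    fix x assume x: "x \<in> space M"
    have "(\<integral>\<^sup>+s. indicator Z (u s x) \<partial>lborel) = (\<integral>\<^sup>+s. indicator {s. u s x \<in> Z} s \<partial>lborel)"
      by (intro nn_integral_cong) (auto simp: indicator_def)
    also have "\<dots> = emeasure lborel {s. u s x \<in> Z}"
      using null[OF x] by (intro nn_integral_indicator) (auto intro: sets.countable)
    also have "\<dots> = 0" using emeasure_lborel_countable[OF null[OF x]] .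
    finally show "(\<integral>\<^sup>+s. indicator Z (u s x) \<partial>lborel) = (0 :: ennreal)" .
  qed
  finally show ?thesis by (simp add: ennreal_mult_eq_top_iff)
qed

lemma basis_translation_invariant_imp_translation_invariant:
  fixes M :: "'v::euclidean_space measure"
  assumes M: "sets M = sets borel"
    and inv: "\<And>b \<tau>. b \<in> Basis \<Longrightarrow> distr M M (\<lambda>x. x + \<tau> *\<^sub>R b) = M"
  shows "distr M M (\<lambda>x. x + a) = M"
proof -
  have [measurable]: "(\<lambda>x. x + v) \<in> measurable M M" for v
    by (simp add: measurable_cong_sets[OF M M])
  have "distr M M (\<lambda>x. x + (\<Sum>b\<in>B. (a \<bullet> b) *\<^sub>R b)) = M" if "finite B" "B \<subseteq> Basis" for B
    using that
  proof (induction B)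
    case (insert b B)
    have "distr M M (\<lambda>x. x + (\<Sum>b\<in>insert b B. (a \<bullet> b) *\<^sub>R b)) =
        distr (distr M M (\<lambda>x. x + (a \<bullet> b) *\<^sub>R b)) M (\<lambda>x. x + (\<Sum>b\<in>B. (a \<bullet> b) *\<^sub>R b))"
      using insert by (subst distr_distr) (auto simp: o_def add.assoc)
    then show ?case using insert inv by simp
  qed (simp add: distr_id2)
  from this[of Basis] show ?thesis by (simp add: euclidean_representation)
qed

text \<open>The usual uniqueness proof for Haar measure. Integrating
  \<open>indicator E x * indicator Q (x - y)\<close> against \<open>M\<close> and Lebesgue measure
  in both orders yields \<open>swap\<close>; then one reference set with finite
  \<open>M\<close>-measure and positive finite Lebesgue measure fixes the constant.\<close>

theorem basis_translation_invariant_measure_eq: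
  fixes M :: "'v::euclidean_space measure"
  assumes "sigma_finite_measure M" and M: "sets M = sets borel"
    and inv: "\<And>b \<tau>. b \<in> Basis \<Longrightarrow> distr M M (\<lambda>x. x + \<tau> *\<^sub>R b) = M"
  shows "\<exists>c::real. 0 \<le> c \<and> M = scale_measure (ennreal c) lborel"
proof -
  interpret sigma_finite_measure M by fact
  interpret pair_sigma_finite lborel M ..
  note [measurable_cong] = M
  note sp [simp] = sets_eq_imp_space_eq[OF M, simplified]
  note trans = basis_translation_invariant_imp_translation_invariant[OF M inv]
  have swap: "emeasure M E * emeasure lborel (uminus ` Q) = emeasure M Q * emeasure lborel E"
    if [measurable]: "E \<in> sets borel" "Q \<in> sets borel" for E Q
  proof -
    have im: "uminus ` Q = uminus -` Q" by (auto intro: rev_image_eqI)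
    have [measurable]: "uminus ` Q \<in> sets borel"
      unfolding im using measurable_sets_borel[of uminus borel Q] by simp
    have "emeasure M E * emeasure lborel (uminus ` Q) =
        (\<integral>\<^sup>+x. indicator E x * (\<integral>\<^sup>+y. indicator Q (- y) \<partial>lborel) \<partial>M)"
    proof -
      have "(\<integral>\<^sup>+y. indicator Q (- y) \<partial>lborel) = (\<integral>\<^sup>+y. indicator (uminus ` Q) y \<partial>lborel)"
        by (intro nn_integral_cong) (auto simp: indicator_def im)
      also have "\<dots> = emeasure lborel (uminus ` Q)" by simp
      finally show ?thesis by (simp add: nn_integral_multc)
    qed
    also have "\<dots> = (\<integral>\<^sup>+x. (\<integral>\<^sup>+y. indicator E x * indicator Q (x - y) \<partial>lborel) \<partial>M)"
    proof (rule nn_integral_cong)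
      fix x
      have "(\<integral>\<^sup>+y. indicator Q (- y) \<partial>lborel) = (\<integral>\<^sup>+y. indicator Q (x - y) \<partial>lborel)"
        using nn_integral_lborel_reflect[of "indicator Q" x] nn_integral_lborel_reflect[of "indicator Q" 0]
        by simp
      then show "indicator E x * (\<integral>\<^sup>+y. indicator Q (- y) \<partial>lborel) = (\<integral>\<^sup>+y. indicator E x * indicator Q (x - y) \<partial>lborel)"
        by (subst nn_integral_cmult) auto
    qed
    also have "\<dots> = (\<integral>\<^sup>+y. (\<integral>\<^sup>+x. indicator E x * indicator Q (x - y) \<partial>M) \<partial>lborel)"
      by (rule Fubini') measurable
    also have "\<dots> = (\<integral>\<^sup>+y. (\<integral>\<^sup>+x. indicator E (x + y) * indicator Q x \<partial>M) \<partial>lborel)"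
    proof (rule nn_integral_cong)
      fix y :: 'v
      have "(\<integral>\<^sup>+x. indicator E x * indicator Q (x - y) \<partial>M) = (\<integral>\<^sup>+x. indicator E x * indicator Q (x - y) \<partial>distr M M (\<lambda>x. x + y))"
        by (simp add: trans)
      also have "\<dots> = (\<integral>\<^sup>+x. indicator E (x + y) * indicator Q x \<partial>M)"
        by (subst nn_integral_distr) auto
      finally show "(\<integral>\<^sup>+x. indicator E x * indicator Q (x - y) \<partial>M) = \<dots>" .
    qed
    also have "\<dots> = (\<integral>\<^sup>+x. (\<integral>\<^sup>+y. indicator E (x + y) * indicator Q x \<partial>lborel) \<partial>M)"
      by (rule Fubini'[symmetric]) measurable
    also have "\<dots> = (\<integral>\<^sup>+x. indicator Q x * emeasure lborel E \<partial>M)"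
    proof (rule nn_integral_cong)
      fix x
      have "(\<integral>\<^sup>+y. indicator E (x + y) \<partial>lborel) = emeasure lborel E"
        using nn_integral_lborel_translate[of "indicator E" x] by simp
      then show "(\<integral>\<^sup>+y. indicator E (x + y) * indicator Q x \<partial>lborel) = indicator Q x * emeasure lborel E"
        by (subst nn_integral_multc) (auto simp: mult.commute)
    qed
    also have "\<dots> = emeasure M Q * emeasure lborel E"
      by (simp add: nn_integral_multc)
    finally show ?thesis .
  qed
  obtain A :: "nat \<Rightarrow> 'v set" where A: "range A \<subseteq> sets M" "(\<Union>i. A i) = space M" "\<And>i. emeasure M (A i) \<noteq> \<infinity>"
    using sigma_finite_measure.sigma_finite[OF assms(1)] by (metis (no_types))
  have "\<exists>i. emeasure lborel (A i) \<noteq> 0"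
  proof (rule ccontr)
    assume "\<not> ?thesis"
    then have "emeasure lborel (\<Union>i. A i) = 0"
      using A(1) M by (intro emeasure_UN_eq_0) auto
    then show False using A(2) by simp
  qed
  then obtain i where i: "emeasure lborel (A i) \<noteq> 0" by blast
  have Ai [measurable]: "A i \<in> sets borel" using A(1) M by auto
  have "\<exists>k. emeasure lborel (A i \<inter> cball 0 (real k)) \<noteq> 0"
  proof (rule ccontr)
    assume "\<not> ?thesis"
    then have "emeasure lborel (\<Union>k. A i \<inter> cball 0 (real k)) = 0"
      by (intro emeasure_UN_eq_0) auto
    moreover have "(\<Union>k. A i \<inter> cball 0 (real k)) = A i"
    proof (intro equalityI subsetI)
      fix x assume "x \<in> A i"
      moreover obtain n :: nat where "norm x \<le> n" using real_arch_simple by blast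
      ultimately show "x \<in> (\<Union>k. A i \<inter> cball 0 (real k))" by auto
    qed auto
    ultimately show False using i by simp
  qed
  then obtain k where k: "emeasure lborel (A i \<inter> cball 0 (real k)) \<noteq> 0" by blast
  \<comment> \<open>\<open>A i\<close> is finite for \<open>M\<close> and not Lebesgue null; the
    ball makes its Lebesgue measure finite.\<close>
  define P where "P = A i \<inter> cball 0 (real k)"
  have [measurable]: "P \<in> sets borel" by (simp add: P_def)
  have P0: "emeasure lborel P \<noteq> 0" using k by (simp add: P_def)
  have "emeasure lborel P \<le> emeasure lborel (cball 0 (real k) :: 'v set)"
    by (rule emeasure_mono) (auto simp: P_def)
  then have P_fin: "emeasure lborel P \<noteq> \<infinity>"
    using emeasure_lborel_cball_finite[of "0::'v" "real k"] by (auto simp: top_unique)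
  have "emeasure M P \<le> emeasure M (A i)"
    using A(1) by (intro emeasure_mono) (auto simp: P_def)
  then have MP: "emeasure M P \<noteq> \<infinity>"
    using A(3)[of i] by (auto simp: top_unique)
  have im: "uminus ` P = uminus -` P" by (auto intro: rev_image_eqI)
  have neg: "emeasure lborel (uminus ` P) = emeasure lborel P"
    unfolding im by (subst (2) lborel_distr_uminus_euclidean[symmetric]) (simp add: emeasure_distr)
  define c where "c = enn2real (emeasure M P / emeasure lborel P)"
  have "emeasure M P / emeasure lborel P \<noteq> \<top>"
    using MP P0 by (simp add: ennreal_divide_eq_top_iff)
  then have c: "ennreal c = emeasure M P / emeasure lborel P"
    unfolding c_def by (intro ennreal_enn2real) (simp add: less_top)
  have "M = scale_measure (ennreal c) lborel"
  proof (rule measure_eqI)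
    fix E assume "E \<in> sets M"
    then have [measurable]: "E \<in> sets borel" using M by simp
    have "emeasure M E * (emeasure lborel P / emeasure lborel P) = (emeasure M P / emeasure lborel P) * emeasure lborel E"
      using swap[of E P] by (simp add: neg ennreal_times_divide ennreal_divide_times)
    moreover have "emeasure lborel P / emeasure lborel P = 1"
      using P0 P_fin by (intro ennreal_divide_self) (auto simp: less_top)
    ultimately have "emeasure M E = ennreal c * emeasure lborel E" using c by simp
    then show "emeasure M E = emeasure (scale_measure (ennreal c) lborel) E" by simp
  qed (simp add: M)
  then show ?thesis by (intro exI[of _ c]) (simp add: c_def)
qed

section \<open>Generation of the special linear group by transvections\<close>

definition transvection :: "'n \<Rightarrow> 'n \<Rightarrow> real \<Rightarrow> real ^ 'n ^ 'n" where
  "transvection i j s = (\<chi> a b. if a = i \<and> b = j then s else of_bool (a = b))"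

definition diag :: "('n \<Rightarrow> real) \<Rightarrow> real ^ 'n ^ 'n" where
  "diag e = (\<chi> a b. if a = b then e a else 0)"

lemma ex_other_index:
  assumes "CARD('n::finite) > 1" shows "\<exists>j::'n. j \<noteq> i"
proof (rule ccontr)
  assume "\<not> ?thesis"
  then have "UNIV = {i}" by auto
  then have "CARD('n) = card {i}" by simp
  then show False using assms by simp
qed

lemma transvection_mult_vec:
  assumes "i \<noteq> j"
  shows "(transvection i j s *v v) $ a = (if a = i then v $ i + s * v $ j else v $ a)"
proof (cases "a = i")
  case True
  have "(transvection i j s *v v) $ a = (\<Sum>b\<in>UNIV. (if b = j then s * v $ j else 0) + (if b = i then v $ i else 0))"
    using assms True unfolding transvection_def matrix_vector_mult_def by (auto intro!: sum.cong)
  then show ?thesis using True by (simp add: sum.distrib)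
next
  case False
  have "(transvection i j s *v v) $ a = (\<Sum>b\<in>UNIV. (if b = a then v $ a else 0))"
    using False unfolding transvection_def matrix_vector_mult_def by (auto intro!: sum.cong)
  then show ?thesis using False by simp
qed

lemma diag_mult_vec [simp]: "(diag e *v v) $ a = e a * v $ a"
  by (simp add: diag_def matrix_vector_mult_def if_distrib if_distribR cong: if_cong)

lemma det_diag: "det (diag e) = prod e UNIV"
  by (subst det_diagonal) (auto simp: diag_def)

lemma diag_one: "diag (\<lambda>_. 1) = mat 1"
  by (simp add: diag_def mat_def)

lemma matrix_eqI:
  fixes A B :: "real ^ 'n ^ 'n"
  assumes "\<And>v a. (A *v v) $ a = (B *v v) $ a" shows "A = B"
  by (simp add: matrix_eq vec_eq_iff assms)

lemma det_transvection:
  assumes "i \<noteq> j" shows "det (transvection i j s) = 1"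
proof -
  have "transvection i j s = (\<chi> k. if k = i then row i (mat 1) + s *s row j (mat 1) else row k (mat 1))"
    using assms by (auto simp: transvection_def vec_eq_iff row_def mat_def)
  then show ?thesis using det_row_operation[OF assms, of "mat 1" s] by (simp only: det_I)
qed

lemma transvection_in_SL: "i \<noteq> j \<Longrightarrow> transvection i j s \<in> SL"
  by (simp add: SL_def det_transvection)

lemma transvection_add:
  assumes "i \<noteq> j"
  shows "transvection i j s ** transvection i j t = transvection i j (s + t)"
  using assms by (intro matrix_eqI)
    (simp add: matrix_vector_mul_assoc[symmetric] transvection_mult_vec algebra_simps)

lemma transvection_0: "i \<noteq> j \<Longrightarrow> transvection i j 0 = mat 1"
  by (intro matrix_eqI) (simp add: transvection_mult_vec)

lemma transvection_conj_diag:
  assumes "i \<noteq> j" "e j \<noteq> 0"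
  shows "diag e ** transvection i j s = transvection i j (e i * s / e j) ** diag e"
  using assms by (intro matrix_eqI)
    (simp add: matrix_vector_mul_assoc[symmetric] transvection_mult_vec algebra_simps)

text \<open>Closure under products is enough to make a group: for distinct indices
  \<open>transvection i j 0\<close> is the identity and \<open>transvection i j (- s)\<close>
  inverts a generator.\<close>

inductive_set transvection_group :: "(real ^ 'n ^ 'n) set" where
  transv: "i \<noteq> j \<Longrightarrow> transvection i j s \<in> transvection_group"
| mult: "A \<in> transvection_group \<Longrightarrow> B \<in> transvection_group \<Longrightarrow> A ** B \<in> transvection_group"

lemma transvection_group_subset_SL: "A \<in> transvection_group \<Longrightarrow> A \<in> SL"
  by (induction rule: transvection_group.induct) (simp_all add: SL_def det_mul det_transvection)

text \<open>Conjugating a transvection by a diagonal matrix only rescales its parameter, so diagonal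
  factors can be pushed to the right end of a product.\<close>

lemma transvection_group_normalized:
  assumes "A \<in> transvection_group" "\<And>a. e a \<noteq> 0"
  shows "\<exists>B\<in>transvection_group. diag e ** A = B ** diag e"
  using assms(1)
proof (induction rule: transvection_group.induct)
  case (transv i j s)
  then show ?case using assms(2) transvection_conj_diag transvection_group.transv by metis
next
  case (mult A B)
  then show ?case by (metis matrix_mul_assoc transvection_group.mult)
qed

text \<open>A representative of the Weyl group element exchanging the coordinates i and j, scaled by
  t.\<close>

lemma weyl_mult_vec:
  assumes "i \<noteq> j" "t \<noteq> 0"
  shows "((transvection i j t ** transvection j i (-1/t) ** transvection i j t) *v v) $ a =
    (if a = i then t * v $ j else if a = j then - v $ i / t else v $ a)"
  using assms assms(1)[symmetric]
  by (simp add: matrix_vector_mul_assoc[symmetric] transvection_mult_vec field_simps)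

text \<open>The standard identity h(t) = w(t) w(-1) in the copy of SL(2) acting on the coordinates i
  and j, with w the product \<open>?w\<close>.\<close>

lemma hyperbolic_in_transvection_group:
  assumes "i \<noteq> j" "t \<noteq> 0"
  shows "diag (\<lambda>a. if a = i then t else if a = j then 1 / t else 1) \<in> transvection_group"
proof -
  let ?w = "\<lambda>t. transvection i j t ** transvection j i (-1/t) ** transvection i j t"
  have "diag (\<lambda>a. if a = i then t else if a = j then 1 / t else 1) = ?w t ** ?w (-1)"
  proof (rule matrix_eqI)
    fix v a
    have "(-1::real) \<noteq> 0" by simp
    then show "(diag (\<lambda>a. if a = i then t else if a = j then 1 / t else 1) *v v) $ a = (?w t ** ?w (-1) *v v) $ a"
      unfolding matrix_vector_mul_assoc[of "?w t" "?w (-1)", symmetric] weyl_mult_vec[OF assms]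
        weyl_mult_vec[OF assms(1) \<open>(-1::real) \<noteq> 0\<close>]
      using assms by auto
  qed
  then show ?thesis using assms by (auto intro!: transvection_group.intros)
qed

text \<open>\<open>F\<close> holds the indices, apart from \<open>i0\<close>, whose entry may differ
  from 1. Each step splits off a hyperbolic factor that makes one of these entries 1 and multiplies
  the entry at \<open>i0\<close>; in the end the determinant forces that entry to be 1 too.\<close>

lemma diag_in_transvection_group:
  assumes "finite F" "i0 \<notin> F" "\<And>a. e a \<noteq> 0" "\<And>a. a \<notin> insert i0 F \<Longrightarrow> e a = 1" "det (diag e) = 1"
    and card: "CARD('n) > 1"
  shows "diag e \<in> (transvection_group :: (real ^ 'n ^ 'n) set)"
  using assms(1-5)
proof (induction F arbitrary: e)
  case empty
  have "prod e UNIV = e i0"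
    using empty(3) by (subst prod.remove[of UNIV i0]) (auto intro!: prod.neutral)
  then have "e a = 1" for a using empty by (cases "a = i0") (auto simp: det_diag)
  then have "e = (\<lambda>_. 1)" by auto
  moreover obtain j where "j \<noteq> i0" using ex_other_index[OF card] by blast
  ultimately show ?case
    using transvection_group.transv[of i0 j 0] transvection_0[of i0 j] by (auto simp: diag_one)
next
  case (insert x F)
  let ?h = "\<lambda>a. if a = x then e x else if a = i0 then 1 / e x else 1"
  let ?e = "\<lambda>a. if a = x then 1 else if a = i0 then e i0 * e x else e a"
  have h: "diag ?h \<in> transvection_group"
    using insert by (intro hyperbolic_in_transvection_group) auto
  have eq: "diag e = diag ?h ** diag ?e"
    using insert by (intro matrix_eqI) (auto simp: matrix_vector_mul_assoc[symmetric])
  moreover have "det (diag ?h) = 1" using transvection_group_subset_SL[OF h] by (simp add: SL_def)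
  ultimately have "det (diag ?e) = 1" using insert.prems(4) by (simp add: det_mul)
  then have "diag ?e \<in> transvection_group" using insert.prems insert.hyps by (intro insert.IH) auto
  then show ?case unfolding eq using h by (rule transvection_group.mult[rotated])
qed

text \<open>Induction over products of elementary matrices. The determinant is a premise inside the
  claim because singular factors occur in the induction; products are rearranged by
  \<open>transvection_group_normalized\<close>.\<close>

lemma nonsingular_transvection_diag:
  fixes A :: "real ^ 'n ^ 'n"
  assumes card: "CARD('n) > 1"
  shows "det A \<noteq> 0 \<longrightarrow> (\<exists>g\<in>transvection_group. \<exists>e. (\<forall>a. e a \<noteq> 0) \<and> A = g ** diag e)"
proof (rule induct_matrix_elementary)
  obtain i0 j0 :: 'n where ij: "i0 \<noteq> j0"
    using ex_other_index[OF card] by metis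
  have one: "mat 1 \<in> (transvection_group :: (real ^ 'n ^ 'n) set)"
    using transvection_group.transv[OF ij, of 0] by (simp add: transvection_0[OF ij])
  {
    fix A B :: "real ^ 'n ^ 'n"
    assume A: "det A \<noteq> 0 \<longrightarrow> (\<exists>g\<in>transvection_group. \<exists>e. (\<forall>a. e a \<noteq> 0) \<and> A = g ** diag e)"
      and B: "det B \<noteq> 0 \<longrightarrow> (\<exists>g\<in>transvection_group. \<exists>e. (\<forall>a. e a \<noteq> 0) \<and> B = g ** diag e)"
    show "det (A ** B) \<noteq> 0 \<longrightarrow> (\<exists>g\<in>transvection_group. \<exists>e. (\<forall>a. e a \<noteq> 0) \<and> A ** B = g ** diag e)"
    proof
      assume "det (A ** B) \<noteq> 0"
      with A B obtain g e h f where g: "g \<in> transvection_group" "\<And>a. e a \<noteq> 0" "A = g ** diag e"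
        and h: "h \<in> transvection_group" "\<And>a. f a \<noteq> 0" "B = h ** diag f"
        by (auto simp: det_mul)
      from transvection_group_normalized[OF h(1), of e] g(2) obtain k
        where k: "k \<in> transvection_group" "diag e ** h = k ** diag e" by blast
      have "diag e ** diag f = diag (\<lambda>a. e a * f a)"
        by (intro matrix_eqI) (simp add: matrix_vector_mul_assoc[symmetric])
      then have "A ** B = (g ** k) ** diag (\<lambda>a. e a * f a)"
        unfolding g(3) h(3) matrix_mul_assoc using k(2) by (simp flip: matrix_mul_assoc)
      moreover have "g ** k \<in> transvection_group" using g(1) k(1) by (rule transvection_group.mult)
      ultimately show "\<exists>g\<in>transvection_group. \<exists>e. (\<forall>a. e a \<noteq> 0) \<and> A ** B = g ** diag e"
        using g(2) h(2) by (intro bexI[of _ "g ** k"] exI[of _ "\<lambda>a. e a * f a"]) auto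
    qed
  next
    fix A :: "real ^ 'n ^ 'n" and i assume "row i A = 0"
    then show "det A \<noteq> 0 \<longrightarrow> (\<exists>g\<in>transvection_group. \<exists>e. (\<forall>a. e a \<noteq> 0) \<and> A = g ** diag e)"
      using det_zero_row(2) by (metis row_def)
  next
    fix A :: "real ^ 'n ^ 'n" assume d: "\<And>i j. i \<noteq> j \<Longrightarrow> A $ i $ j = 0"
    have A: "A = diag (\<lambda>a. A $ a $ a)" using d by (auto simp: diag_def vec_eq_iff)
    show "det A \<noteq> 0 \<longrightarrow> (\<exists>g\<in>transvection_group. \<exists>e. (\<forall>a. e a \<noteq> 0) \<and> A = g ** diag e)"
    proof
      assume "det A \<noteq> 0"
      then have "\<forall>a. A $ a $ a \<noteq> 0" using det_diagonal[of A] d by (simp add: prod_zero_iff)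
      then show "\<exists>g\<in>transvection_group. \<exists>e. (\<forall>a. e a \<noteq> 0) \<and> A = g ** diag e"
        using A by (intro bexI[OF _ one] exI[of _ "\<lambda>a. A $ a $ a"]) auto
    qed
  next
    fix m n :: 'n assume mn: "m \<noteq> n"
    \<comment> \<open>A transposition has determinant -1, so it is a Weyl element only up to the
      sign carried by \<open>?e\<close>.\<close>
    let ?w = "transvection m n 1 ** transvection n m (-1/1) ** transvection m n 1"
    let ?e = "\<lambda>a. if a = m then -1 else 1 :: real"
    let ?S = "(\<chi> i j. mat 1 $ i $ Transposition.transpose m n j) :: real ^ 'n ^ 'n"
    have S: "(?S *v v) $ a = v $ Transposition.transpose m n a" for v a
    proof -
      have "(?S *v v) $ a = (\<Sum>j\<in>UNIV. if j = Transposition.transpose m n a then v $ j else 0)"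
        unfolding matrix_vector_mult_def vec_lambda_beta by (rule sum.cong) (auto simp: mat_def transpose_def)
      then show ?thesis by simp
    qed
    have "?S = ?w ** diag ?e"
      using mn by (intro matrix_eqI, subst matrix_vector_mul_assoc[symmetric], subst weyl_mult_vec)
        (auto simp: S transpose_def)
    moreover have "?w \<in> transvection_group" using mn by (auto intro!: transvection_group.intros)
    ultimately show "det ?S \<noteq> 0 \<longrightarrow> (\<exists>g\<in>transvection_group. \<exists>e. (\<forall>a. e a \<noteq> 0) \<and> ?S = g ** diag e)"
      by (intro impI bexI[of _ ?w] exI[of _ ?e]) auto
  next
    fix m n :: 'n and c :: real assume mn: "m \<noteq> n"
    have "(\<chi> i j. if i = m \<and> j = n then c else of_bool (i = j)) = transvection m n c ** diag (\<lambda>_. 1)"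
      by (simp add: transvection_def diag_one)
    then show "det (\<chi> i j. if i = m \<and> j = n then c else of_bool (i = j)) \<noteq> 0 \<longrightarrow>
      (\<exists>g\<in>transvection_group. \<exists>e. (\<forall>a. e a \<noteq> 0) \<and> (\<chi> i j. if i = m \<and> j = n then c else of_bool (i = j)) = g ** diag e)"
      by (intro impI bexI[OF _ transvection_group.transv[OF mn, of c]] exI[of _ "\<lambda>_. 1"]) auto
  }
qed

theorem SL_eq_transvection_group:
  assumes card: "CARD('n) > 1"
  shows "(SL :: (real ^ 'n ^ 'n) set) = transvection_group"
proof (intro equalityI subsetI)
  fix A :: "real ^ 'n ^ 'n" assume "A \<in> SL"
  then have A: "det A = 1" by (simp add: SL_def)
  from nonsingular_transvection_diag[OF card, of A] A obtain g e
    where g: "g \<in> transvection_group" "\<And>a. e a \<noteq> 0" "A = g ** diag e" by auto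
  have "det (diag e) = 1"
    using A transvection_group_subset_SL[OF g(1)] by (simp add: g(3) det_mul SL_def)
  \<comment> \<open>\<open>undefined\<close> serves as an arbitrary base index.\<close>
  then have "diag e \<in> transvection_group"
    using g(2) card diag_in_transvection_group[of "UNIV - {undefined}" undefined e] by auto
  then show "A \<in> transvection_group" unfolding g(3) using g(1) by (rule transvection_group.mult[rotated])
qed (rule transvection_group_subset_SL)

lemma SL_mult: "A \<in> SL \<Longrightarrow> B \<in> SL \<Longrightarrow> A ** B \<in> SL"
  by (simp add: SL_def det_mul)

lemma SL_inverse:
  assumes "A \<in> SL"
  obtains B where "B \<in> SL" "A ** B = mat 1" "B ** A = mat 1"
proof -
  have "det A \<noteq> 0" using assms by (simp add: SL_def)
  then obtain B where B: "A ** B = mat 1" "B ** A = mat 1"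
    by (metis invertible_def invertible_det_nz)
  then have "det A * det B = 1" by (metis det_I det_mul)
  then show ?thesis using B assms that by (simp add: SL_def)
qed

section \<open>The weak-star topology is second countable\<close>

lemma growth_measuresD:
  fixes \<nu> :: "(real ^ 'n) measure"
  assumes "\<nu> \<in> growth_measures"
  shows sets_growth_measure: "sets \<nu> = sets borel"
    and space_growth_measure: "space \<nu> = UNIV"
    and growth_bound_finite: "growth_bound \<nu> < \<infinity>"
  using assms sets_eq_imp_space_eq[of \<nu> borel] by (auto simp: growth_measures_def)

lemma emeasure_ball_le_growth_bound:
  fixes \<nu> :: "(real ^ 'n) measure"
  assumes "0 < R"
  shows "emeasure \<nu> (ball 0 R) \<le> growth_bound \<nu> * ennreal (R ^ CARD('n))"
proof -
  have "mass_in_ball \<nu> R / ennreal (R ^ CARD('n)) \<le> growth_bound \<nu>"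
    unfolding growth_bound_def using assms by (intro SUP_upper) auto
  then have "mass_in_ball \<nu> R / ennreal (R ^ CARD('n)) * ennreal (R ^ CARD('n)) \<le> growth_bound \<nu> * ennreal (R ^ CARD('n))"
    by (rule mult_right_mono) simp
  moreover have "mass_in_ball \<nu> R / ennreal (R ^ CARD('n)) * ennreal (R ^ CARD('n)) = mass_in_ball \<nu> R"
    using assms by (simp add: ennreal_divide_times ennreal_times_divide[symmetric] ennreal_divide_self)
  ultimately show ?thesis by (simp add: mass_in_ball_def)
qed

lemma growth_measure_bounded_finite:
  fixes \<nu> :: "(real ^ 'n) measure"
  assumes "\<nu> \<in> growth_measures" "bounded E"
  shows "emeasure \<nu> E < \<infinity>"
proof -
  obtain R where R: "0 < R" "E \<subseteq> ball 0 R"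
    using assms(2) by (metis bounded_subset_ballD)
  have "emeasure \<nu> E \<le> emeasure \<nu> (ball 0 R)"
    using R assms by (intro emeasure_mono) (auto simp: growth_measuresD)
  also have "\<dots> < \<infinity>"
    using emeasure_ball_le_growth_bound[OF R(1), of \<nu>] growth_bound_finite[OF assms(1)]
    by (auto simp: ennreal_mult_less_top intro: le_less_trans)
  finally show ?thesis .
qed

lemma growth_measure_sigma_finite:
  fixes \<nu> :: "(real ^ 'n) measure"
  assumes "\<nu> \<in> growth_measures"
  shows "sigma_finite_measure \<nu>"
proof
  have "(\<Union>k::nat. ball 0 (real k)) = (UNIV :: (real ^ 'n) set)"
    by (auto simp: reals_Archimedean2)
  then show "\<exists>A. countable A \<and> A \<subseteq> sets \<nu> \<and> \<Union>A = space \<nu> \<and> (\<forall>a\<in>A. emeasure \<nu> a \<noteq> \<infinity>)"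
    using growth_measure_bounded_finite[OF assms bounded_ball] assms
    by (intro exI[of _ "range (\<lambda>k::nat. ball 0 (real k))"]) (auto simp: growth_measuresD less_top[symmetric])
qed

text \<open>The growth condition also covers small radii, so small balls have mass of the order of
  their volume. This excludes a point mass at the origin, which would be another invariant measure
  besides Lebesgue measure.\<close>

lemma growth_measure_null_origin:
  fixes \<nu> :: "(real ^ 'n) measure"
  assumes "\<nu> \<in> growth_measures"
  shows "emeasure \<nu> {0} = 0"
proof (rule antisym[OF LIMSEQ_le_const])
  let ?f = "\<lambda>k. growth_bound \<nu> * ennreal ((1 / Suc k) ^ CARD('n))"
  have "(\<lambda>k. ennreal ((1 / Suc k) ^ CARD('n))) \<longlonglongrightarrow> ennreal (0 ^ CARD('n))"
    by (intro tendsto_ennrealI tendsto_power lim_1_over_n[THEN LIMSEQ_Suc])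
  then have "?f \<longlonglongrightarrow> growth_bound \<nu> * ennreal (0 ^ CARD('n))"
    using growth_bound_finite[OF assms] by (intro ennreal_tendsto_cmult) auto
  moreover have "ennreal (0 ^ CARD('n)) = 0" by (simp add: zero_power)
  ultimately show "?f \<longlonglongrightarrow> 0" by (simp only: mult_zero_right)
  show "\<exists>N. \<forall>n\<ge>N. emeasure \<nu> {0} \<le> ?f n"
  proof (intro exI allI impI)
    fix n
    have "emeasure \<nu> {0} \<le> emeasure \<nu> (ball 0 (1 / Suc n))"
      using assms by (intro emeasure_mono) (auto simp: growth_measuresD)
    also have "\<dots> \<le> ?f n" by (rule emeasure_ball_le_growth_bound) simp
    finally show "emeasure \<nu> {0} \<le> ?f n" .
  qed
qed simp

section \<open>Continuous functions of compact support and countable approximation\<close>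

lemma Cc_iff: "\<psi> \<in> Cc \<longleftrightarrow> continuous_on UNIV \<psi> \<and> (\<exists>R. \<forall>x. R \<le> norm x \<longrightarrow> \<psi> x = 0)"
proof
  assume "\<psi> \<in> Cc"
  then have c: "continuous_on UNIV \<psi>" and "bounded {x. \<psi> x \<noteq> 0}"
    by (auto simp: Cc_def intro: bounded_subset[OF compact_imp_bounded closure_subset])
  then obtain R where "{x. \<psi> x \<noteq> 0} \<subseteq> ball 0 R"
    by (metis bounded_subset_ballD)
  then have "\<forall>x. R \<le> norm x \<longrightarrow> \<psi> x = 0" by (auto simp: subset_eq)
  with c show "continuous_on UNIV \<psi> \<and> (\<exists>R. \<forall>x. R \<le> norm x \<longrightarrow> \<psi> x = 0)" by blast
next
  assume *: "continuous_on UNIV \<psi> \<and> (\<exists>R. \<forall>x. R \<le> norm x \<longrightarrow> \<psi> x = 0)"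
  then obtain R where "\<And>x. R \<le> norm x \<Longrightarrow> \<psi> x = 0" by blast
  then have "{x. \<psi> x \<noteq> 0} \<subseteq> cball 0 R" by (force simp: not_le)
  then have "compact (closure {x. \<psi> x \<noteq> 0})"
    by (metis bounded_cball bounded_subset compact_closure)
  with * show "\<psi> \<in> Cc" by (simp add: Cc_def)
qed

lemma CcI: "continuous_on UNIV \<psi> \<Longrightarrow> (\<And>x. R \<le> norm x \<Longrightarrow> \<psi> x = 0) \<Longrightarrow> \<psi> \<in> Cc"
  by (auto simp: Cc_iff)

lemma Cc_measurable: "\<psi> \<in> Cc \<Longrightarrow> \<psi> \<in> borel_measurable borel"
  by (auto simp: Cc_def intro: borel_measurable_continuous_onI)

lemma Cc_bound:
  assumes "\<psi> \<in> Cc"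
  obtains B R where "0 < B" "0 < R" "\<And>x. \<bar>\<psi> x\<bar> \<le> B" "\<And>x. R \<le> norm x \<Longrightarrow> \<psi> x = 0"
proof -
  obtain R where R: "\<And>x. R \<le> norm x \<Longrightarrow> \<psi> x = 0" and c: "continuous_on UNIV \<psi>"
    using assms by (auto simp: Cc_iff)
  have "compact (\<psi> ` cball 0 R)"
    by (intro compact_continuous_image continuous_on_subset[OF c]) auto
  then obtain B where B: "\<And>y. y \<in> \<psi> ` cball 0 R \<Longrightarrow> norm y \<le> B" "0 < B"
    by (meson compact_imp_bounded bounded_pos)
  have "\<bar>\<psi> x\<bar> \<le> B" for x
  proof (cases "R \<le> norm x")
    case False
    then show ?thesis using B(1)[of "\<psi> x"] by auto
  qed (use R B in simp)
  then show thesis using that[of B "max 1 R"] R B(2) by auto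
qed

lemma Cc_integrable:
  assumes "\<psi> \<in> Cc" "\<nu> \<in> growth_measures"
  shows "integrable \<nu> \<psi>"
proof -
  obtain B R where BR: "0 < B" "\<And>x. \<bar>\<psi> x\<bar> \<le> B" "\<And>x. R \<le> norm x \<Longrightarrow> \<psi> x = 0"
    by (rule Cc_bound[OF assms(1)]) blast
  note [measurable_cong] = sets_growth_measure[OF assms(2)]
  have [measurable]: "\<psi> \<in> borel_measurable borel" by (rule Cc_measurable) fact
  show ?thesis
  proof (rule Bochner_Integration.integrable_bound)
    show "integrable \<nu> (\<lambda>x. B * indicator (ball 0 R) x)"
      using growth_measure_bounded_finite[OF assms(2) bounded_ball]
      by (intro integrable_mult_right integrable_real_indicator) auto
    show "AE x in \<nu>. norm (\<psi> x) \<le> norm (B * indicator (ball 0 R) x)"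
      using BR by (intro AE_I2) (auto simp: indicator_def)
  qed measurable
qed

lemma Cc_diff: "\<psi> \<in> Cc \<Longrightarrow> \<phi> \<in> Cc \<Longrightarrow> (\<lambda>x. \<psi> x - \<phi> x) \<in> Cc"
proof -
  assume *: "\<psi> \<in> Cc" "\<phi> \<in> Cc"
  then obtain R S where "\<And>x. R \<le> norm x \<Longrightarrow> \<psi> x = 0" "\<And>x. S \<le> norm x \<Longrightarrow> \<phi> x = 0"
    by (auto simp: Cc_iff)
  then show ?thesis
    using * by (intro CcI[of _ "max R S"]) (auto simp: Cc_iff intro!: continuous_on_diff)
qed

lemma Cc_cmult: "\<psi> \<in> Cc \<Longrightarrow> (\<lambda>x. c * \<psi> x) \<in> Cc"
  unfolding Cc_iff by (auto intro!: continuous_intros)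

lemma Cc_max: "\<psi> \<in> Cc \<Longrightarrow> \<phi> \<in> Cc \<Longrightarrow> (\<lambda>x. max (\<psi> x) (\<phi> x)) \<in> Cc"
proof -
  assume *: "\<psi> \<in> Cc" "\<phi> \<in> Cc"
  then obtain R S where "\<And>x. R \<le> norm x \<Longrightarrow> \<psi> x = 0" "\<And>x. S \<le> norm x \<Longrightarrow> \<phi> x = 0"
    by (auto simp: Cc_iff)
  then show ?thesis
    using * by (intro CcI[of _ "max R S"]) (auto simp: Cc_iff intro!: continuous_on_max)
qed

lemma hat_diff:
  assumes "\<psi> \<in> Cc" "\<phi> \<in> Cc" "\<nu> \<in> growth_measures"
  shows "hat (\<lambda>x. \<psi> x - \<phi> x) \<nu> = hat \<psi> \<nu> - hat \<phi> \<nu>"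
  using assms unfolding hat_def by (intro Bochner_Integration.integral_diff Cc_integrable)

definition cutoff :: "nat \<Rightarrow> 'a::real_normed_vector \<Rightarrow> real" where
  "cutoff k x = max 0 (min 1 (1 + real k - norm x))"

lemma cutoff_Cc: "cutoff k \<in> (Cc :: (real ^ 'n \<Rightarrow> real) set)"
  unfolding cutoff_def by (rule CcI[of _ "1 + real k"]) (auto intro!: continuous_intros)

lemma cutoff_nonneg: "0 \<le> cutoff k x" by (simp add: cutoff_def)

lemma cutoff_eq_1: "norm x \<le> real k \<Longrightarrow> cutoff k x = 1" by (simp add: cutoff_def)

text \<open>A triple \<open>(q, z, n)\<close> encodes the cone of height q over the ball of radius
  1/(n+1) about z; rational q and z from a countable dense set give a countable family.\<close>

definition bump :: "real \<times> 'a::real_normed_vector \<times> nat \<Rightarrow> 'a \<Rightarrow> real" where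
  "bump p x = (case p of (q, z, n) \<Rightarrow> q * max 0 (1 - real (Suc n) * dist x z))"

text \<open>The inserted 0 makes the maximum nonnegative and meaningful for empty
  \<open>F\<close>.\<close>

definition bump_max :: "(real \<times> 'a::real_normed_vector \<times> nat) set \<Rightarrow> 'a \<Rightarrow> real" where
  "bump_max F x = Max (insert 0 ((\<lambda>p. bump p x) ` F))"

lemma bump_Cc: "bump p \<in> (Cc :: (real ^ 'n \<Rightarrow> real) set)"
proof -
  obtain q z n where p: "p = (q, z, n)" by (cases p) auto
  show ?thesis
  proof (rule CcI[of _ "norm z + 1"])
    show "continuous_on UNIV (bump p)"
      unfolding bump_def p by (auto intro!: continuous_intros)
    fix x :: "real ^ 'n" assume "norm z + 1 \<le> norm x"
    then have "1 \<le> dist x z" using norm_triangle_ineq2[of x z] by (simp add: dist_norm)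
    then have "1 \<le> real (Suc n) * dist x z" by (metis dual_order.trans mult_1 mult_right_mono zero_le_dist of_nat_1 of_nat_le_iff le_add1 plus_1_eq_Suc)
    then show "bump p x = 0" by (simp add: bump_def p)
  qed
qed

lemma bump_max_Cc:
  assumes "finite F" shows "bump_max F \<in> (Cc :: (real ^ 'n \<Rightarrow> real) set)"
  using assms
proof (induction F)
  case empty
  show ?case by (rule CcI[of _ 0]) (auto simp: bump_max_def)
next
  case (insert p F)
  have "bump_max (insert p F) = (\<lambda>x. max (bump p x) (bump_max F x))"
    using insert by (auto simp: bump_max_def fun_eq_iff insert_commute[of 0])
  then show ?case using Cc_max[OF bump_Cc insert.IH] by simp
qed

text \<open>The height is a rational b between a and \<open>\<psi> x\<close>; n is taken so large
  that a cone centred near x is supported where \<psi> exceeds b.\<close>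

lemma bump_approx:
  fixes \<psi> :: "real ^ 'n \<Rightarrow> real"
  assumes \<psi>: "continuous_on UNIV \<psi>" and nonneg: "\<And>x. 0 \<le> \<psi> x"
    and D: "\<And>U. open U \<Longrightarrow> U \<noteq> {} \<Longrightarrow> \<exists>d\<in>D. d \<in> U"
    and a: "a < \<psi> x" "0 \<le> a"
  shows "\<exists>q z n. q \<in> \<rat> \<and> z \<in> D \<and> (\<forall>y. bump (q, z, n) y \<le> \<psi> y) \<and> a < bump (q, z, n) x"
proof -
  obtain b where b: "b \<in> \<rat>" "a < b" "b < \<psi> x" using Rats_dense_in_real[OF a(1)] by blast
  have "open (\<psi> -` {b<..})" using \<psi> by (simp add: continuous_on_open_vimage)
  then obtain e where e: "0 < e" "ball x e \<subseteq> \<psi> -` {b<..}"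
    using b(3) by (meson open_contains_ball vimageI greaterThan_iff)
  obtain n where n: "1 / real (Suc n) < e / 2" using nat_approx_posE[of "e/2"] e by auto
  \<comment> \<open>If z is within d of x, the cone of height b about z still exceeds a at
    x.\<close>
  define d where "d = (1 - a / b) / real (Suc n)"
  have "a / b < 1" using b a(2) by simp
  then have "0 < d" unfolding d_def by (intro divide_pos_pos) auto
  then have "ball x (min d (e/2)) \<noteq> {}" using e by simp
  then obtain z where z: "z \<in> D" "dist x z < min d (e/2)"
    using D[of "ball x (min d (e/2))"] by (auto simp del: ball_eq_empty)
  have le: "bump (b, z, n) y \<le> \<psi> y" for y
  proof (cases "real (Suc n) * dist y z < 1")
    case True
    then have "dist y z < 1 / real (Suc n)" by (simp add: field_simps)
    then have "dist y z < e / 2" using n by linarith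
    then have "dist x y < e" using z dist_triangle2[of x y z] by linarith
    then have "b < \<psi> y" using e by auto
    moreover have "b * max 0 (1 - real (Suc n) * dist y z) \<le> b * 1"
      using b a(2) by (intro mult_left_mono) auto
    ultimately show ?thesis unfolding bump_def by simp
  next
    case False
    then show ?thesis using nonneg[of y] by (simp add: bump_def)
  qed
  have "real (Suc n) * dist x z < 1 - a / b"
    using z(2) by (simp add: d_def field_simps)
  then have "a / b < 1 - real (Suc n) * dist x z" by simp
  then have "a < b * (1 - real (Suc n) * dist x z)"
    using b a(2) by (simp add: pos_divide_less_eq mult.commute)
  also have "\<dots> \<le> bump (b, z, n) x"
    unfolding bump_def using b a(2) by (auto intro!: mult_left_mono)
  finally show ?thesis using b z le by blast
qed

text \<open>The members of \<open>I\<close> below \<psi> form a nonempty countable set; by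
  \<open>bump_approx\<close> the maxima over longer and longer initial segments of an enumeration
  increase to \<psi>.\<close>

lemma Cc_countable_approx:
  obtains I :: "(real \<times> (real ^ 'n) \<times> nat) set" where "countable I"
    and "\<And>\<psi>. \<psi> \<in> Cc \<Longrightarrow> (\<And>x. 0 \<le> \<psi> x) \<Longrightarrow>
      \<exists>F. (\<forall>n. finite (F n) \<and> F n \<subseteq> I \<and> (\<forall>x. 0 \<le> bump_max (F n) x \<and> bump_max (F n) x \<le> \<psi> x)) \<and>
          (\<forall>x. (\<lambda>n. bump_max (F n) x) \<longlonglongrightarrow> \<psi> x)"
proof -
  obtain D :: "(real ^ 'n) set" where D: "countable D" "\<And>U. open U \<Longrightarrow> U \<noteq> {} \<Longrightarrow> \<exists>d\<in>D. d \<in> U"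
    using countable_dense_setE by blast
  define I where "I = (\<rat> :: real set) \<times> D \<times> (UNIV :: nat set)"
  have "\<exists>F. (\<forall>n. finite (F n) \<and> F n \<subseteq> I \<and> (\<forall>x. 0 \<le> bump_max (F n) x \<and> bump_max (F n) x \<le> \<psi> x)) \<and>
          (\<forall>x. (\<lambda>n. bump_max (F n) x) \<longlonglongrightarrow> \<psi> x)"
    if \<psi>: "\<psi> \<in> Cc" "\<And>x. 0 \<le> \<psi> x" for \<psi> :: "real ^ 'n \<Rightarrow> real"
  proof -
    define J where "J = {p \<in> I. \<forall>x. bump p x \<le> \<psi> x}"
    have "countable J" unfolding J_def I_def using D(1) by (auto intro!: countable_Collect countable_rat)
    obtain d where d: "d \<in> D" using D(2)[of UNIV] by auto
    have "(0, d, 0) \<in> J" using d \<psi>(2) by (simp add: J_def I_def bump_def)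
    then have "J \<noteq> {}" by blast
    define F where "F n = from_nat_into J ` {..n}" for n
    have F: "finite (F n)" "F n \<subseteq> J" for n
      using from_nat_into[OF \<open>J \<noteq> {}\<close>] by (auto simp: F_def)
    have le: "bump_max (F n) x \<le> \<psi> x" for n x
      using F \<psi>(2) unfolding bump_max_def by (subst Max_le_iff) (auto simp: J_def subset_eq)
    have ge0: "0 \<le> bump_max (F n) x" for n x
      using F unfolding bump_max_def by (intro Max_ge) auto
    have "(\<lambda>n. bump_max (F n) x) \<longlonglongrightarrow> \<psi> x" for x
    proof (rule order_tendstoI)
      fix a assume "\<psi> x < a"
      then show "\<forall>\<^sub>F n in sequentially. bump_max (F n) x < a"
        using le_less_trans[OF le] by simp
    next
      fix a assume a: "a < \<psi> x"
      show "\<forall>\<^sub>F n in sequentially. a < bump_max (F n) x"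
      proof (cases "a < 0")
        case True
        then have "a < bump_max (F n) x" for n using ge0[of n x] by linarith
        then show ?thesis by simp
      next
        case False
        then obtain q z n where q: "q \<in> \<rat>" "z \<in> D" "\<forall>y. bump (q, z, n) y \<le> \<psi> y" "a < bump (q, z, n) x"
          using bump_approx[of \<psi> D a x] D(2) \<psi> a by (auto simp: Cc_def)
        then have "(q, z, n) \<in> J" by (auto simp: J_def I_def)
        then obtain m where m: "from_nat_into J m = (q, z, n)"
          using from_nat_into_surj[OF \<open>countable J\<close>] by blast
        show ?thesis
          using eventually_ge_at_top[of m]
        proof eventually_elim
          case (elim k)
          then have "from_nat_into J m \<in> F k" by (simp add: F_def)
          then have "(q, z, n) \<in> F k" by (simp only: m)
          then have "bump (q, z, n) x \<le> bump_max (F k) x"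
            using F(1)[of k] unfolding bump_max_def by (intro Max_ge) auto
          then show ?case using q(4) by simp
        qed
      qed
    qed
    moreover have "F n \<subseteq> I" for n using F(2)[of n] by (auto simp: J_def)
    ultimately show ?thesis using F(1) le ge0 by (intro exI[of _ F]) simp
  qed
  moreover have "countable I" unfolding I_def using D(1) by (auto intro!: countable_rat)
  ultimately show thesis using that by blast
qed

lemma Cc_dominated_convergence:
  assumes "\<nu> \<in> growth_measures" "\<And>n. s n \<in> Cc" "\<phi> \<in> Cc" "\<And>n x. \<bar>s n x\<bar> \<le> \<phi> x" "\<And>x. (\<lambda>n. s n x) \<longlonglongrightarrow> \<psi> x"
    and "\<psi> \<in> Cc"
  shows "(\<lambda>n. hat (s n) \<nu>) \<longlonglongrightarrow> hat \<psi> \<nu>"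
proof -
  note [measurable_cong] = sets_growth_measure[OF assms(1)]
  note [measurable] = Cc_measurable[OF assms(2)] Cc_measurable[OF assms(6)]
  show ?thesis unfolding hat_def
    by (rule integral_dominated_convergence[where w = \<phi>]) (use assms in \<open>auto intro: Cc_integrable\<close>)
qed

lemma hat_mono:
  assumes "\<psi> \<in> Cc" "\<phi> \<in> Cc" "\<nu> \<in> growth_measures" "\<And>x. \<psi> x \<le> \<phi> x"
  shows "hat \<psi> \<nu> \<le> hat \<phi> \<nu>"
  using assms unfolding hat_def by (intro integral_mono Cc_integrable)

text \<open>A lower bound on \<open>hat \<phi>\<close> is witnessed by a member of
  \<open>\<D>\<close> below \<phi>. An upper bound needs countably many functions above \<phi>: take
  an integer multiple h of a cutoff that dominates \<phi> and subtract a member of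
  \<open>\<D>\<close> below \<open>h - \<phi>\<close>.\<close>

lemma weak_star_second_countable:
  obtains \<Phi> :: "(real ^ 'n \<Rightarrow> real) set" where "countable \<Phi>" "\<Phi> \<subseteq> Cc"
    and "\<And>\<phi> \<nu> r. \<phi> \<in> Cc \<Longrightarrow> (\<And>x. 0 \<le> \<phi> x) \<Longrightarrow> \<nu> \<in> growth_measures \<Longrightarrow> r < hat \<phi> \<nu> \<Longrightarrow>
      \<exists>d\<in>\<Phi>. r < hat d \<nu> \<and> (\<forall>\<nu>'\<in>growth_measures. r < hat d \<nu>' \<longrightarrow> r < hat \<phi> \<nu>')"
    and "\<And>\<phi> \<nu> r. \<phi> \<in> Cc \<Longrightarrow> (\<And>x. 0 \<le> \<phi> x) \<Longrightarrow> \<nu> \<in> growth_measures \<Longrightarrow> hat \<phi> \<nu> < r \<Longrightarrow>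
      \<exists>d\<in>\<Phi>. hat d \<nu> < r \<and> (\<forall>\<nu>'\<in>growth_measures. hat d \<nu>' < r \<longrightarrow> hat \<phi> \<nu>' < r)"
proof -
  obtain I :: "(real \<times> (real ^ 'n) \<times> nat) set" where "countable I"
    and I: "\<And>\<psi>. \<psi> \<in> Cc \<Longrightarrow> (\<And>x. 0 \<le> \<psi> x) \<Longrightarrow>
      \<exists>F. (\<forall>n. finite (F n) \<and> F n \<subseteq> I \<and> (\<forall>x. 0 \<le> bump_max (F n) x \<and> bump_max (F n) x \<le> \<psi> x)) \<and>
          (\<forall>x. (\<lambda>n. bump_max (F n) x) \<longlonglongrightarrow> \<psi> x)"
    by (rule Cc_countable_approx) blast
  define \<D> where "\<D> = bump_max ` {F. finite F \<and> F \<subseteq> I}"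
  define \<E> where "\<E> = (\<lambda>(m, k, d) x. real m * cutoff k x - d x) ` ((UNIV :: nat set) \<times> (UNIV :: nat set) \<times> \<D>)"
  have "countable \<D>"
    unfolding \<D>_def using countable_Collect_finite_subset[OF \<open>countable I\<close>] by simp
  moreover then have "countable \<E>" unfolding \<E>_def by (intro countable_image countable_SIGMA) auto
  moreover have D: "\<D> \<subseteq> Cc" unfolding \<D>_def by (auto intro: bump_max_Cc)
  moreover have "\<E> \<subseteq> Cc" unfolding \<E>_def using D by (auto intro!: Cc_diff Cc_cmult cutoff_Cc)
  moreover have lower: "\<exists>d\<in>\<D>. r < hat d \<nu> \<and> (\<forall>x. d x \<le> \<phi> x)"
    if \<phi>: "\<phi> \<in> Cc" "\<And>x. 0 \<le> \<phi> x" and \<nu>: "\<nu> \<in> growth_measures" and r: "r < hat \<phi> \<nu>" for \<phi> \<nu> r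
  proof -
    obtain F where F: "\<And>n. finite (F n)" "\<And>n. F n \<subseteq> I" "\<And>n x. 0 \<le> bump_max (F n) x"
        "\<And>n x. bump_max (F n) x \<le> \<phi> x" "\<And>x. (\<lambda>n. bump_max (F n) x) \<longlonglongrightarrow> \<phi> x"
      using I[OF \<phi>] by blast
    have "(\<lambda>n. hat (bump_max (F n)) \<nu>) \<longlonglongrightarrow> hat \<phi> \<nu>"
      using F by (intro Cc_dominated_convergence[OF \<nu> _ \<phi>(1)] bump_max_Cc \<phi>(1)) auto
    from order_tendstoD(1)[OF this r] obtain n where "r < hat (bump_max (F n)) \<nu>"
      by (auto simp: eventually_sequentially)
    moreover have "bump_max (F n) \<in> \<D>" using F(1,2)[of n] by (auto simp: \<D>_def)
    ultimately show ?thesis using F(4) by blast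
  qed
  moreover have "\<exists>d\<in>\<D> \<union> \<E>. r < hat d \<nu> \<and> (\<forall>\<nu>'\<in>growth_measures. r < hat d \<nu>' \<longrightarrow> r < hat \<phi> \<nu>')"
    if \<phi>: "\<phi> \<in> Cc" "\<And>x. 0 \<le> \<phi> x" and \<nu>: "\<nu> \<in> growth_measures" and r: "r < hat \<phi> \<nu>" for \<phi> \<nu> r
  proof -
    obtain d where d: "d \<in> \<D>" "r < hat d \<nu>" "\<And>x. d x \<le> \<phi> x" using lower[OF \<phi> \<nu> r] by blast
    have "r < hat \<phi> \<nu>'" if "\<nu>' \<in> growth_measures" "r < hat d \<nu>'" for \<nu>'
      using hat_mono[of d \<phi> \<nu>'] d D \<phi>(1) that by (auto intro: less_le_trans)
    with d show ?thesis by blast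
  qed
  moreover have "\<exists>d\<in>\<D> \<union> \<E>. hat d \<nu> < r \<and> (\<forall>\<nu>'\<in>growth_measures. hat d \<nu>' < r \<longrightarrow> hat \<phi> \<nu>' < r)"
    if \<phi>: "\<phi> \<in> Cc" "\<And>x. 0 \<le> \<phi> x" and \<nu>: "\<nu> \<in> growth_measures" and r: "hat \<phi> \<nu> < r" for \<phi> \<nu> r
  proof -
    obtain B R where BR: "\<And>x. \<bar>\<phi> x\<bar> \<le> B" "\<And>x. R \<le> norm x \<Longrightarrow> \<phi> x = 0"
      by (rule Cc_bound[OF \<phi>(1)]) blast
    obtain m :: nat where m: "B \<le> m" using real_arch_simple by blast
    obtain k :: nat where k: "R \<le> k" using real_arch_simple by blast
    define h :: "real ^ 'n \<Rightarrow> real" where "h x = real m * cutoff k x" for x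
    have h: "h \<in> Cc" unfolding h_def by (intro Cc_cmult cutoff_Cc)
    have le: "\<phi> x \<le> h x" for x
    proof (cases "R \<le> norm x")
      case True then show ?thesis using BR by (simp add: h_def cutoff_nonneg)
    next
      case False
      then have "cutoff k x = 1" using k by (intro cutoff_eq_1) simp
      then show ?thesis using BR(1)[of x] m by (simp add: h_def)
    qed
    have "hat h \<nu> - r < hat (\<lambda>x. h x - \<phi> x) \<nu>" using r by (simp add: hat_diff[OF h \<phi>(1) \<nu>])
    then have "\<exists>d\<in>\<D>. hat h \<nu> - r < hat d \<nu> \<and> (\<forall>x. d x \<le> h x - \<phi> x)"
      using le by (intro lower[OF Cc_diff[OF h \<phi>(1)] _ \<nu>]) auto
    then obtain d where d: "d \<in> \<D>" "hat h \<nu> - r < hat d \<nu>" "\<And>x. d x \<le> h x - \<phi> x"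
      by blast
    have dC: "d \<in> Cc" using D d by blast
    have "(\<lambda>x. h x - d x) \<in> \<E>"
      using d(1) by (auto simp: \<E>_def h_def intro!: image_eqI[of _ _ "(m, k, d)"])
    moreover have "hat (\<lambda>x. h x - d x) \<nu> < r" using d(2) by (simp add: hat_diff[OF h dC \<nu>])
    moreover have "hat \<phi> \<nu>' < r" if "\<nu>' \<in> growth_measures" "hat (\<lambda>x. h x - d x) \<nu>' < r" for \<nu>'
    proof -
      have "\<phi> x \<le> h x - d x" for x using d(3)[of x] by linarith
      then have "hat \<phi> \<nu>' \<le> hat (\<lambda>x. h x - d x) \<nu>'"
        by (rule hat_mono[OF \<phi>(1) Cc_diff[OF h dC] that(1)])
      then show ?thesis using that(2) by linarith
    qed
    ultimately show ?thesis by blast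
  qed
  ultimately show thesis by (intro that[of "\<D> \<union> \<E>"]) auto
qed

text \<open>Positive and negative parts reduce an arbitrary \<psi> to nonnegative functions, for
  which countable witnesses exist; rational bounds keep the number of half-lines countable.\<close>

lemma hat_open_near:
  fixes \<nu> :: "(real ^ 'n) measure" and U :: "real set"
  assumes "\<psi> \<in> Cc" "\<nu> \<in> growth_measures" "open U" "hat \<psi> \<nu> \<in> U"
  shows "\<exists>\<phi>1 \<phi>2 a1 b1 a2 b2. \<phi>1 \<in> Cc \<and> \<phi>2 \<in> Cc \<and> (\<forall>x. 0 \<le> \<phi>1 x) \<and> (\<forall>x. 0 \<le> \<phi>2 x) \<and>
    a1 \<in> \<rat> \<and> b1 \<in> \<rat> \<and> a2 \<in> \<rat> \<and> b2 \<in> \<rat> \<and>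
    a1 < hat \<phi>1 \<nu> \<and> hat \<phi>1 \<nu> < b1 \<and> a2 < hat \<phi>2 \<nu> \<and> hat \<phi>2 \<nu> < b2 \<and>
    (\<forall>\<nu>'\<in>growth_measures. a1 < hat \<phi>1 \<nu>' \<and> hat \<phi>1 \<nu>' < b1 \<and> a2 < hat \<phi>2 \<nu>' \<and> hat \<phi>2 \<nu>' < b2 \<longrightarrow> hat \<psi> \<nu>' \<in> U)"
proof -
  define \<phi>1 where "\<phi>1 x = max (\<psi> x) 0" for x
  define \<phi>2 where "\<phi>2 x = max (- \<psi> x) 0" for x
  have zero: "(\<lambda>_. 0) \<in> (Cc :: (real ^ 'n \<Rightarrow> real) set)" by (rule CcI) auto
  have C: "\<phi>1 \<in> Cc" "\<phi>2 \<in> Cc"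
    unfolding \<phi>1_def \<phi>2_def using Cc_max[OF assms(1) zero] Cc_max[OF Cc_cmult[OF assms(1), of "-1"] zero] by auto
  have \<psi>: "\<psi> = (\<lambda>x. \<phi>1 x - \<phi>2 x)" by (auto simp: \<phi>1_def \<phi>2_def)
  have hat: "hat \<psi> \<nu>' = hat \<phi>1 \<nu>' - hat \<phi>2 \<nu>'" if "\<nu>' \<in> growth_measures" for \<nu>'
    by (subst \<psi>) (rule hat_diff[OF C that])
  obtain e where e: "0 < e" "ball (hat \<psi> \<nu>) e \<subseteq> U" using assms(3,4) by (meson open_contains_ball)
  obtain a1 b1 a2 b2 where ab: "a1 \<in> \<rat>" "hat \<phi>1 \<nu> - e/2 < a1" "a1 < hat \<phi>1 \<nu>"
      "b1 \<in> \<rat>" "hat \<phi>1 \<nu> < b1" "b1 < hat \<phi>1 \<nu> + e/2"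
      "a2 \<in> \<rat>" "hat \<phi>2 \<nu> - e/2 < a2" "a2 < hat \<phi>2 \<nu>"
      "b2 \<in> \<rat>" "hat \<phi>2 \<nu> < b2" "b2 < hat \<phi>2 \<nu> + e/2"
    using Rats_dense_in_real[of "hat \<phi>1 \<nu> - e/2" "hat \<phi>1 \<nu>"] Rats_dense_in_real[of "hat \<phi>1 \<nu>" "hat \<phi>1 \<nu> + e/2"]
      Rats_dense_in_real[of "hat \<phi>2 \<nu> - e/2" "hat \<phi>2 \<nu>"] Rats_dense_in_real[of "hat \<phi>2 \<nu>" "hat \<phi>2 \<nu> + e/2"] e(1)
    by auto
  have "hat \<psi> \<nu>' \<in> U" if "\<nu>' \<in> growth_measures" "a1 < hat \<phi>1 \<nu>'" "hat \<phi>1 \<nu>' < b1" "a2 < hat \<phi>2 \<nu>'" "hat \<phi>2 \<nu>' < b2" for \<nu>'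
  proof -
    have "\<bar>hat \<psi> \<nu> - hat \<psi> \<nu>'\<bar> < e"
      unfolding hat[OF assms(2)] hat[OF that(1)] using that ab by linarith
    then show ?thesis using e(2) by (auto simp: dist_real_def)
  qed
  note U = this
  have nonneg: "0 \<le> \<phi>1 x" "0 \<le> \<phi>2 x" for x by (auto simp: \<phi>1_def \<phi>2_def)
  show ?thesis
  proof (rule exI[of _ \<phi>1], rule exI[of _ \<phi>2], rule exI[of _ a1], rule exI[of _ b1], rule exI[of _ a2], rule exI[of _ b2],
      intro conjI ballI impI allI)
    fix \<nu>' :: "(real ^ 'n) measure" assume "\<nu>' \<in> growth_measures"
      and "a1 < hat \<phi>1 \<nu>' \<and> hat \<phi>1 \<nu>' < b1 \<and> a2 < hat \<phi>2 \<nu>' \<and> hat \<phi>2 \<nu>' < b2"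
    then show "hat \<psi> \<nu>' \<in> U" by (elim conjE) (rule U)
  qed (fact C ab nonneg)+
qed

text \<open>An open set is an arbitrary union of finite intersections of subbasic sets, which a
  sigma-algebra need not contain. The countable base \<open>\<B>\<close> makes it a countable union,
  so measurability can be tested on the functions \<open>hat \<psi>\<close>.\<close>

theorem sets_growth_measures_borel:
  "sets growth_measures_borel =
    sigma_sets growth_measures {{\<nu> \<in> growth_measures. hat \<psi> \<nu> \<in> U} | \<psi> U. \<psi> \<in> (Cc :: (real ^ 'n \<Rightarrow> real) set) \<and> open U}"
    (is "_ = sigma_sets ?M ?G")
proof -
  have G_open: "openin weak_star_topology W" if "W \<in> ?G" for W
    unfolding weak_star_topology_def using that by (intro topology_generated_by_Basis)
  obtain \<Phi> :: "(real ^ 'n \<Rightarrow> real) set" where \<Phi>: "countable \<Phi>" "\<Phi> \<subseteq> Cc"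
    and gt: "\<And>\<phi> \<nu> r. \<phi> \<in> Cc \<Longrightarrow> (\<And>x. 0 \<le> \<phi> x) \<Longrightarrow> \<nu> \<in> growth_measures \<Longrightarrow> r < hat \<phi> \<nu> \<Longrightarrow>
      \<exists>d\<in>\<Phi>. r < hat d \<nu> \<and> (\<forall>\<nu>'\<in>growth_measures. r < hat d \<nu>' \<longrightarrow> r < hat \<phi> \<nu>')"
    and lt: "\<And>\<phi> \<nu> r. \<phi> \<in> Cc \<Longrightarrow> (\<And>x. 0 \<le> \<phi> x) \<Longrightarrow> \<nu> \<in> growth_measures \<Longrightarrow> hat \<phi> \<nu> < r \<Longrightarrow>
      \<exists>d\<in>\<Phi>. hat d \<nu> < r \<and> (\<forall>\<nu>'\<in>growth_measures. hat d \<nu>' < r \<longrightarrow> hat \<phi> \<nu>' < r)"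
    by (rule weak_star_second_countable) blast
  define \<S> where "\<S> = (\<lambda>(d, r). {\<nu> \<in> ?M. r < hat d \<nu>}) ` (\<Phi> \<times> (\<rat> :: real set)) \<union>
    (\<lambda>(d, r). {\<nu> \<in> ?M. hat d \<nu> < r}) ` (\<Phi> \<times> (\<rat> :: real set))"
  define \<B> where "\<B> = (\<lambda>F. ?M \<inter> \<Inter>F) ` {F. finite F \<and> F \<subseteq> \<S>}"
  have S: "countable \<S>" unfolding \<S>_def using \<Phi>(1) countable_rat by (intro countable_Un countable_image countable_SIGMA) auto
  then have B: "countable \<B>" unfolding \<B>_def by (intro countable_image countable_Collect_finite_subset)
  have S_G: "\<S> \<subseteq> ?G"
  proof
    fix W assume "W \<in> \<S>"
    then consider d r where "d \<in> \<Phi>" "W = {\<nu> \<in> ?M. hat d \<nu> \<in> {r<..}}" | d r where "d \<in> \<Phi>" "W = {\<nu> \<in> ?M. hat d \<nu> \<in> {..<r}}"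
      by (auto simp: \<S>_def)
    then show "W \<in> ?G"
    proof cases
      case 1
      then show ?thesis using \<Phi>(2) by (intro CollectI exI[of _ d] exI[of _ "{r<..}"]) auto
    next
      case 2
      then show ?thesis using \<Phi>(2) by (intro CollectI exI[of _ d] exI[of _ "{..<r}"]) auto
    qed
  qed
  have G_M: "?G \<subseteq> Pow ?M" by auto
  have B_iff: "W \<in> \<B> \<longleftrightarrow> (\<exists>F. finite F \<and> F \<subseteq> \<S> \<and> W = ?M \<inter> \<Inter>F)" for W
    unfolding \<B>_def image_iff Bex_def mem_Collect_eq by (simp only: conj_assoc)
  have B_sigma: "W \<in> sigma_sets ?M ?G" if W: "W \<in> \<B>" for W
  proof -
    obtain F where "finite F \<and> F \<subseteq> \<S> \<and> W = ?M \<inter> \<Inter>F" using iffD1[OF B_iff W] ..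
    then have F: "finite F" "F \<subseteq> \<S>" "W = ?M \<inter> \<Inter>F" by (simp_all only:)
    interpret sigma_algebra ?M "sigma_sets ?M ?G" by (rule sigma_algebra_sigma_sets[OF G_M])
    have "?M \<inter> \<Inter>F \<in> sigma_sets ?M ?G" using F(1,2)
    proof (induction F)
      case (insert x F)
      have "x \<in> ?G" by (rule subsetD[OF S_G]) (use insert in simp)
      then have "x \<in> sigma_sets ?M ?G" by (rule sigma_sets.Basic)
      moreover have "?M \<inter> \<Inter>F \<in> sigma_sets ?M ?G" by (rule insert.IH) (use insert.prems in simp)
      ultimately have "x \<inter> (?M \<inter> \<Inter>F) \<in> sigma_sets ?M ?G" by (rule Int)
      then show ?case by (simp add: Int_left_commute)
    qed (simp add: top)
    then show ?thesis by (simp add: F(3))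
  qed
  have B_Int: "V \<inter> W \<in> \<B>" if VW: "V \<in> \<B>" "W \<in> \<B>" for V W
  proof -
    obtain F where "finite F \<and> F \<subseteq> \<S> \<and> V = ?M \<inter> \<Inter>F" using iffD1[OF B_iff VW(1)] ..
    moreover obtain F' where "finite F' \<and> F' \<subseteq> \<S> \<and> W = ?M \<inter> \<Inter>F'" using iffD1[OF B_iff VW(2)] ..
    ultimately show ?thesis unfolding B_iff by (intro exI[of _ "F \<union> F'"]) auto
  qed
  have S_B: "\<S> \<subseteq> \<B>"
  proof
    fix W assume W: "W \<in> \<S>"
    then have "W \<subseteq> ?M" using S_G by auto
    with W show "W \<in> \<B>" unfolding B_iff by (intro exI[of _ "{W}"]) auto
  qed
  have near: "\<forall>\<nu>\<in>W. \<exists>V\<in>\<B>. \<nu> \<in> V \<and> V \<subseteq> W" if "generate_topology_on ?G W" for W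
    using that
  proof induction
    case (Int a b)
    show ?case
    proof
      fix \<nu> assume "\<nu> \<in> a \<inter> b"
      then have \<nu>: "\<nu> \<in> a" "\<nu> \<in> b" by simp_all
      obtain V where V: "V \<in> \<B>" "\<nu> \<in> V" "V \<subseteq> a" using bspec[OF Int.IH(1) \<nu>(1)] by (elim bexE conjE)
      obtain V' where V': "V' \<in> \<B>" "\<nu> \<in> V'" "V' \<subseteq> b" using bspec[OF Int.IH(2) \<nu>(2)] by (elim bexE conjE)
      show "\<exists>V\<in>\<B>. \<nu> \<in> V \<and> V \<subseteq> a \<inter> b"
        by (rule bexI[OF _ B_Int[OF V(1) V'(1)]]) (use V V' in auto)
    qed
  next
    case (Basis W)
    then obtain \<psi> U where "W = {\<nu> \<in> ?M. hat \<psi> \<nu> \<in> U} \<and> \<psi> \<in> Cc \<and> open U"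
      unfolding mem_Collect_eq by (elim exE)
    then have W: "\<psi> \<in> Cc" "open U" "W = {\<nu> \<in> ?M. hat \<psi> \<nu> \<in> U}" by simp_all
    show ?case
    proof
      fix \<nu> assume "\<nu> \<in> W"
      then have \<nu>: "\<nu> \<in> ?M" "hat \<psi> \<nu> \<in> U" by (auto simp: W)
      from hat_open_near[OF W(1) \<nu>(1) W(2) \<nu>(2)] obtain \<phi>1 \<phi>2 a1 b1 a2 b2 where
        \<phi>: "\<phi>1 \<in> Cc" "\<phi>2 \<in> Cc" "\<And>x. 0 \<le> \<phi>1 x" "\<And>x. 0 \<le> \<phi>2 x"
        and ab: "a1 \<in> \<rat>" "b1 \<in> \<rat>" "a2 \<in> \<rat>" "b2 \<in> \<rat>"
        and lts: "a1 < hat \<phi>1 \<nu>" "hat \<phi>1 \<nu> < b1" "a2 < hat \<phi>2 \<nu>" "hat \<phi>2 \<nu> < b2"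
        and U: "\<And>\<nu>'. \<nu>' \<in> growth_measures \<Longrightarrow> a1 < hat \<phi>1 \<nu>' \<Longrightarrow> hat \<phi>1 \<nu>' < b1 \<Longrightarrow> a2 < hat \<phi>2 \<nu>' \<Longrightarrow> hat \<phi>2 \<nu>' < b2 \<Longrightarrow> hat \<psi> \<nu>' \<in> U"
        by blast
      from gt[OF \<phi>(1,3) \<nu>(1) lts(1)] obtain d1 where
        d1: "d1 \<in> \<Phi>" "a1 < hat d1 \<nu>" "\<And>\<nu>'. \<nu>' \<in> ?M \<Longrightarrow> a1 < hat d1 \<nu>' \<Longrightarrow> a1 < hat \<phi>1 \<nu>'" by blast
      from lt[OF \<phi>(1,3) \<nu>(1) lts(2)] obtain d2 where
        d2: "d2 \<in> \<Phi>" "hat d2 \<nu> < b1" "\<And>\<nu>'. \<nu>' \<in> ?M \<Longrightarrow> hat d2 \<nu>' < b1 \<Longrightarrow> hat \<phi>1 \<nu>' < b1" by blast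
      from gt[OF \<phi>(2,4) \<nu>(1) lts(3)] obtain d3 where
        d3: "d3 \<in> \<Phi>" "a2 < hat d3 \<nu>" "\<And>\<nu>'. \<nu>' \<in> ?M \<Longrightarrow> a2 < hat d3 \<nu>' \<Longrightarrow> a2 < hat \<phi>2 \<nu>'" by blast
      from lt[OF \<phi>(2,4) \<nu>(1) lts(4)] obtain d4 where
        d4: "d4 \<in> \<Phi>" "hat d4 \<nu> < b2" "\<And>\<nu>'. \<nu>' \<in> ?M \<Longrightarrow> hat d4 \<nu>' < b2 \<Longrightarrow> hat \<phi>2 \<nu>' < b2" by blast
      let ?V1 = "{\<nu> \<in> ?M. a1 < hat d1 \<nu>}" and ?V2 = "{\<nu> \<in> ?M. hat d2 \<nu> < b1}"
      let ?V3 = "{\<nu> \<in> ?M. a2 < hat d3 \<nu>}" and ?V4 = "{\<nu> \<in> ?M. hat d4 \<nu> < b2}"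
      have "?V1 \<in> \<S>" unfolding \<S>_def using d1(1) ab(1) by (intro UnI1 image_eqI[of _ _ "(d1, a1)"]) auto
      moreover have "?V2 \<in> \<S>" unfolding \<S>_def using d2(1) ab(2) by (intro UnI2 image_eqI[of _ _ "(d2, b1)"]) auto
      moreover have "?V3 \<in> \<S>" unfolding \<S>_def using d3(1) ab(3) by (intro UnI1 image_eqI[of _ _ "(d3, a2)"]) auto
      moreover have "?V4 \<in> \<S>" unfolding \<S>_def using d4(1) ab(4) by (intro UnI2 image_eqI[of _ _ "(d4, b2)"]) auto
      ultimately have V: "?V1 \<inter> ?V2 \<inter> (?V3 \<inter> ?V4) \<in> \<B>" by (intro B_Int subsetD[OF S_B])
      have "\<nu> \<in> ?V1 \<inter> ?V2 \<inter> (?V3 \<inter> ?V4)" using \<nu> d1(2) d2(2) d3(2) d4(2) by simp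
      moreover have "?V1 \<inter> ?V2 \<inter> (?V3 \<inter> ?V4) \<subseteq> W"
        unfolding W(3) using d1(3) d2(3) d3(3) d4(3) U by (intro subsetI) simp
      ultimately show "\<exists>V\<in>\<B>. \<nu> \<in> V \<and> V \<subseteq> W" by (intro bexI[OF _ V] conjI)
    qed
  next
    case (UN K)
    show ?case
    proof
      fix \<nu> assume "\<nu> \<in> \<Union>K"
      then obtain k where k: "k \<in> K" "\<nu> \<in> k" ..
      obtain V where V: "V \<in> \<B>" "\<nu> \<in> V" "V \<subseteq> k" using bspec[OF UN.IH[OF k(1)] k(2)] by (elim bexE conjE)
      show "\<exists>V\<in>\<B>. \<nu> \<in> V \<and> V \<subseteq> \<Union>K"
        by (rule bexI[OF _ V(1)]) (use V k in auto)
    qed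
  qed simp
  have open_sigma: "W \<in> sigma_sets ?M ?G" if "openin weak_star_topology W" for W
  proof -
    have "generate_topology_on ?G W"
      using that unfolding weak_star_topology_def by (simp add: openin_topology_generated_by_iff)
    note * = near[OF this]
    have "W = \<Union>{V \<in> \<B>. V \<subseteq> W}"
    proof (intro equalityI subsetI)
      fix \<nu> assume \<nu>: "\<nu> \<in> W"
      obtain V where "V \<in> \<B>" "\<nu> \<in> V" "V \<subseteq> W" using bspec[OF * \<nu>] by (elim bexE conjE)
      then show "\<nu> \<in> \<Union>{V \<in> \<B>. V \<subseteq> W}" by (intro UnionI[of V]) simp_all
    next
      fix \<nu> assume "\<nu> \<in> \<Union>{V \<in> \<B>. V \<subseteq> W}"
      then show "\<nu> \<in> W" by (elim UnionE) (simp, elim conjE subsetD)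
    qed
    moreover have "\<Union>{V \<in> \<B>. V \<subseteq> W} \<in> sigma_sets ?M ?G"
      by (rule sigma_sets_UNION[OF countable_Collect[OF B]]) (simp add: B_sigma)
    ultimately show ?thesis by simp
  qed
  have sub: "{W. openin weak_star_topology W} \<subseteq> Pow ?M"
    using openin_subset by fastforce
  have "sets growth_measures_borel = sigma_sets ?M {W. openin weak_star_topology W}"
    unfolding growth_measures_borel_def by (rule sets_measure_of[OF sub])
  also have "\<dots> = sigma_sets ?M ?G"
  proof (rule sigma_sets_eqI)
    show "a \<in> sigma_sets ?M ?G" if "a \<in> {W. openin weak_star_topology W}" for a
      using that open_sigma by simp
    show "b \<in> sigma_sets ?M {W. openin weak_star_topology W}" if "b \<in> ?G" for b
      using G_open[OF that] by (intro sigma_sets.Basic) simp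
  qed
  finally show ?thesis .
qed

lemma space_growth_measures_borel [simp]: "space growth_measures_borel = growth_measures"
proof -
  have "{W. openin weak_star_topology W} \<subseteq> Pow (growth_measures :: (real ^ 'n) measure set)"
    using openin_subset by fastforce
  then show ?thesis unfolding growth_measures_borel_def by (rule space_measure_of)
qed

lemma hat_measurable [measurable]:
  assumes "\<psi> \<in> Cc" shows "hat \<psi> \<in> borel_measurable growth_measures_borel"
proof (rule borel_measurableI)
  fix U :: "real set" assume U: "open U"
  have "hat \<psi> -` U \<inter> space growth_measures_borel = {\<nu> \<in> growth_measures. hat \<psi> \<nu> \<in> U}" by auto
  also have "\<dots> \<in> sets growth_measures_borel"
    unfolding sets_growth_measures_borel using assms U by (intro sigma_sets.Basic) blast
  finally show "hat \<psi> -` U \<inter> space growth_measures_borel \<in> sets growth_measures_borel" .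
qed

lemma measurable_growth_measures_borelI:
  fixes f :: "'a \<Rightarrow> (real ^ 'n) measure"
  assumes "f \<in> space M \<rightarrow> growth_measures" "\<And>\<psi>. \<psi> \<in> Cc \<Longrightarrow> (\<lambda>x. hat \<psi> (f x)) \<in> borel_measurable M"
  shows "f \<in> measurable M growth_measures_borel"
proof (rule measurable_sigma_sets[OF sets_growth_measures_borel])
  fix W :: "(real ^ 'n) measure set"
  assume "W \<in> {{\<nu> \<in> growth_measures. hat \<psi> \<nu> \<in> U} | \<psi> U. \<psi> \<in> Cc \<and> open U}"
  then obtain \<psi> U where W: "\<psi> \<in> Cc" "open U" "W = {\<nu> \<in> growth_measures. hat \<psi> \<nu> \<in> U}" by auto
  have "f -` W \<inter> space M = (\<lambda>x. hat \<psi> (f x)) -` U \<inter> space M" using assms(1) by (auto simp: W)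
  also have "\<dots> \<in> sets M" using assms(2)[OF W(1)] W(2) by (intro measurable_sets) auto
  finally show "f -` W \<inter> space M \<in> sets M" .
qed (use assms in auto)

section \<open>Measurability of counting functions and of the action\<close>

text \<open>Indicators of bounded open sets are limits of functions in \<open>Cc\<close>. Inside a
  fixed ball all masses are finite, so the induction over complements and disjoint unions may
  subtract; exhausting by balls handles general \<open>E\<close>.\<close>

lemma borel_measurable_emeasure_growth_measures [measurable]:
  fixes E :: "(real ^ 'n) set"
  assumes E: "E \<in> sets borel"
  shows "(\<lambda>\<nu>. emeasure \<nu> E) \<in> borel_measurable growth_measures_borel"
proof -
  have open_bounded: "(\<lambda>\<nu>. emeasure \<nu> U) \<in> borel_measurable growth_measures_borel"
    if U: "open U" "bounded U" for U :: "(real ^ 'n) set"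
  proof -
    define f where "f n x = min 1 (real n * infdist x (- U))" for n x
    have "U \<noteq> UNIV" using U(2) not_bounded_UNIV by blast
    then have ne: "- U \<noteq> {}" by blast
    obtain R where R: "U \<subseteq> ball 0 R" using U(2) by (metis bounded_subset_ballD)
    have zero: "f n x = 0" if "x \<notin> U" for n x using that by (simp add: f_def)
    have C: "f n \<in> Cc" for n
    proof (rule CcI[of _ R])
      show "continuous_on UNIV (f n)" unfolding f_def by (intro continuous_intros)
      show "R \<le> norm x \<Longrightarrow> f n x = 0" for x using R by (intro zero) (auto simp: subset_eq)
    qed
    have lim: "(\<lambda>n. f n x) \<longlonglongrightarrow> indicator U x" for x
    proof (cases "x \<in> U")
      case True
      have "closed (- U)" using U(1) by (simp add: closed_Compl)
      then have "infdist x (- U) \<noteq> 0" using True ne by (metis ComplD in_closed_iff_infdist_zero)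
      then have pos: "0 < infdist x (- U)" using infdist_nonneg[of x "- U"] by linarith
      obtain N :: nat where N: "1 / infdist x (- U) < N" using reals_Archimedean2 by blast
      have "\<forall>\<^sub>F n in sequentially. f n x = 1"
        using eventually_ge_at_top[of N]
      proof eventually_elim
        case (elim n)
        then have "1 / infdist x (- U) < real n" using N by linarith
        then have "1 \<le> real n * infdist x (- U)" using pos by (simp add: field_simps)
        then show ?case by (simp add: f_def)
      qed
      then show ?thesis using True by (simp add: tendsto_eventually)
    qed (simp add: zero)
    have "(\<lambda>\<nu>. measure \<nu> U) \<in> borel_measurable growth_measures_borel"
    proof (rule borel_measurable_LIMSEQ_real)
      show "hat (f n) \<in> borel_measurable growth_measures_borel" for n by (rule hat_measurable[OF C])
      fix \<nu> assume "\<nu> \<in> space (growth_measures_borel :: (real ^ 'n) measure measure)"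
      then have \<nu>: "\<nu> \<in> growth_measures" by simp
      note [measurable_cong] = sets_growth_measure[OF \<nu>]
      note [measurable] = Cc_measurable[OF C]
      have [measurable]: "U \<in> sets borel" using U by simp
      have int: "integrable \<nu> (indicator U :: _ \<Rightarrow> real)"
        using growth_measure_bounded_finite[OF \<nu> U(2)] by (intro integrable_real_indicator) auto
      have "(\<lambda>n. hat (f n) \<nu>) \<longlonglongrightarrow> (\<integral>x. indicator U x \<partial>\<nu>)"
        unfolding hat_def
      proof (rule integral_dominated_convergence[where w = "indicator U"])
        show "AE x in \<nu>. norm (f n x) \<le> indicator U x" for n
          using zero by (intro AE_I2) (auto simp: f_def indicator_def infdist_nonneg)
      qed (use int lim in auto)
      then show "(\<lambda>n. hat (f n) \<nu>) \<longlonglongrightarrow> measure \<nu> U"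
        by (simp add: space_growth_measure[OF \<nu>])
    qed
    then have "(\<lambda>\<nu>. ennreal (measure \<nu> U)) \<in> borel_measurable growth_measures_borel" by measurable
    then show ?thesis
      using growth_measure_bounded_finite[OF _ U(2)]
      by (subst measurable_cong[where g = "\<lambda>\<nu>. ennreal (measure \<nu> U)"]) (auto simp: emeasure_eq_ennreal_measure less_top)
  qed
  have trunc: "(\<lambda>\<nu>. emeasure \<nu> (E \<inter> ball 0 (real k))) \<in> borel_measurable growth_measures_borel" for k :: nat
  proof -
    have "E \<in> sigma_sets UNIV {S. open S}" using E by (simp add: borel_def)
    have istab: "Int_stable {S :: (real ^ 'n) set. open S}" by (auto simp: Int_stable_def)
    have closed: "{S :: (real ^ 'n) set. open S} \<subseteq> Pow UNIV" by simp
    from \<open>E \<in> sigma_sets UNIV {S. open S}\<close> have "E \<in> sets borel \<and> (\<lambda>\<nu>. emeasure \<nu> (E \<inter> ball 0 (real k))) \<in> borel_measurable growth_measures_borel"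
    proof (induction rule: sigma_sets_induct_disjoint[OF istab closed, consumes 1, case_names basic empty compl union])
      case (basic A)
      then show ?case using open_bounded[of "A \<inter> ball 0 (real k)"] by auto
    next
      case (compl A)
      have fin: "emeasure \<nu> (A \<inter> ball 0 (real k)) \<noteq> \<infinity>" if "\<nu> \<in> growth_measures" for \<nu>
        using growth_measure_bounded_finite[OF that, of "A \<inter> ball 0 (real k)"]
        by (simp add: bounded_Int less_top[symmetric])
      have eq: "emeasure \<nu> ((UNIV - A) \<inter> ball 0 (real k)) = emeasure \<nu> (ball 0 (real k)) - emeasure \<nu> (A \<inter> ball 0 (real k))"
        if "\<nu> \<in> growth_measures" for \<nu>
      proof -
        have "(UNIV - A) \<inter> ball 0 (real k) = ball 0 (real k) - (A \<inter> ball 0 (real k))" by auto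
        then show ?thesis
          using compl fin[OF that] that by (simp only:) (intro emeasure_Diff, auto simp: sets_growth_measure)
      qed
      have "(\<lambda>\<nu>. emeasure \<nu> (ball 0 (real k)) - emeasure \<nu> (A \<inter> ball 0 (real k))) \<in> borel_measurable growth_measures_borel"
        using compl open_bounded[of "ball 0 (real k)"] by (intro borel_measurable_minus_ennreal) auto
      then have "(\<lambda>\<nu>. emeasure \<nu> ((UNIV - A) \<inter> ball 0 (real k))) \<in> borel_measurable growth_measures_borel"
        by (rule measurable_cong[THEN iffD1, rotated]) (simp add: eq)
      moreover have "UNIV - A \<in> sets borel" using compl sets.compl_sets[of A borel] by simp
      ultimately show ?case by simp
    next
      case (union A)
      have eq: "emeasure \<nu> ((\<Union>i. A i) \<inter> ball 0 (real k)) = (\<Sum>i. emeasure \<nu> (A i \<inter> ball 0 (real k)))"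
        if "\<nu> \<in> growth_measures" for \<nu>
      proof -
        have "(\<Sum>i. emeasure \<nu> (A i \<inter> ball 0 (real k))) = emeasure \<nu> (\<Union>i. A i \<inter> ball 0 (real k))"
          using union that by (intro suminf_emeasure) (auto simp: sets_growth_measure disjoint_family_on_def)
        then show ?thesis by simp
      qed
      have "(\<lambda>\<nu>. \<Sum>i. emeasure \<nu> (A i \<inter> ball 0 (real k))) \<in> borel_measurable growth_measures_borel"
        using union(3) by (intro borel_measurable_suminf_order) simp
      then have "(\<lambda>\<nu>. emeasure \<nu> ((\<Union>i. A i) \<inter> ball 0 (real k))) \<in> borel_measurable growth_measures_borel"
        by (rule measurable_cong[THEN iffD1, rotated]) (simp add: eq)
      then show ?case using union by auto
    qed simp
    then show ?thesis by simp
  qed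
  have "(\<lambda>\<nu>. SUP k. emeasure \<nu> (E \<inter> ball 0 (real k))) \<in> borel_measurable growth_measures_borel"
    using trunc by (intro borel_measurable_SUP) auto
  then show ?thesis
  proof (rule measurable_cong[THEN iffD1, rotated])
    fix \<nu> assume "\<nu> \<in> space (growth_measures_borel :: (real ^ 'n) measure measure)"
    then have \<nu>: "\<nu> \<in> growth_measures" by simp
    have "(SUP k. emeasure \<nu> (E \<inter> ball 0 (real k))) = emeasure \<nu> (\<Union>k. E \<inter> ball 0 (real k))"
    proof (rule SUP_emeasure_incseq)
      show "incseq (\<lambda>k. E \<inter> ball 0 (real k))"
        by (auto simp: incseq_def intro: less_le_trans)
    qed (use E in \<open>auto simp: sets_growth_measure[OF \<nu>]\<close>)
    also have "(\<Union>k. E \<inter> ball 0 (real k)) = E" by (auto simp: reals_Archimedean2)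
    finally show "(SUP k. emeasure \<nu> (E \<inter> ball 0 (real k))) = emeasure \<nu> E" .
  qed
qed

text \<open>
  The Giry monad only covers subprobability kernels, so the growth measure is cut off to a ball
  and normalized by a constant depending measurably on it.
\<close>

lemma measurable_growth_kernel_nn_integral:
  fixes K :: "'a \<Rightarrow> (real ^ 'n) measure"
  assumes K [measurable]: "K \<in> measurable M growth_measures_borel"
    and F [measurable]: "(\<lambda>(x, v). F x v) \<in> borel_measurable (M \<Otimes>\<^sub>M borel)"
  shows "(\<lambda>x. \<integral>\<^sup>+v. F x v \<partial>K x) \<in> borel_measurable M"
proof -
  have K_growth: "K x \<in> growth_measures" if "x \<in> space M" for x
    using measurable_space[OF K that] by simp
  \<comment> \<open>The summand 1 keeps the divisor positive when the ball carries no mass.\<close>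
  define c where "c k x = 1 + emeasure (K x) (ball 0 (real k))" for k :: nat and x
  have c_meas [measurable]: "c k \<in> borel_measurable M" for k
    unfolding c_def using measurable_compose[OF K borel_measurable_emeasure_growth_measures[of "ball 0 (real k)"]]
    by simp
  have c: "c k x \<noteq> 0" "c k x < \<top>" if "x \<in> space M" for k x
    using growth_measure_bounded_finite[OF K_growth[OF that] bounded_ball, of 0 "real k"] by (auto simp: c_def)
  define L where "L k x = density (K x) (\<lambda>v. indicator (ball 0 (real k)) v * inverse (c k x))" for k :: nat and x
  have L_sets: "sets (L k x) = sets borel" if "x \<in> space M" for k x
    using sets_growth_measure[OF K_growth[OF that]] by (simp add: L_def)
  have L_int: "(\<integral>\<^sup>+v. g v \<partial>L k x) = (\<integral>\<^sup>+v. g v * indicator (ball 0 (real k)) v \<partial>K x) / c k x"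
    if "x \<in> space M" and [measurable]: "g \<in> borel_measurable borel" for k x g
  proof -
    note [measurable_cong] = sets_growth_measure[OF K_growth[OF that(1)]]
    have "(\<integral>\<^sup>+v. g v \<partial>L k x) = (\<integral>\<^sup>+v. indicator (ball 0 (real k)) v * inverse (c k x) * g v \<partial>K x)"
      unfolding L_def
    proof (rule nn_integral_density)
      have mc: "measurable (K x) borel = measurable borel (borel :: ennreal measure)"
        by (rule measurable_cong_sets[OF sets_growth_measure[OF K_growth[OF that(1)]] refl])
      show "(\<lambda>v. indicator (ball 0 (real k)) v * inverse (c k x)) \<in> borel_measurable (K x)"
        unfolding mc by (intro borel_measurable_times_ennreal borel_measurable_indicator borel_measurable_const) simp
      show "g \<in> borel_measurable (K x)" unfolding mc by fact
    qed
    also have "\<dots> = (\<integral>\<^sup>+v. (g v * indicator (ball 0 (real k)) v) * inverse (c k x) \<partial>K x)"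
      by (intro nn_integral_cong) (simp add: ac_simps)
    also have "\<dots> = (\<integral>\<^sup>+v. g v * indicator (ball 0 (real k)) v \<partial>K x) / c k x"
      unfolding divide_ennreal_def
    proof (rule nn_integral_multc)
      have mc: "measurable (K x) borel = measurable borel (borel :: ennreal measure)"
        by (rule measurable_cong_sets[OF sets_growth_measure[OF K_growth[OF that(1)]] refl])
      show "(\<lambda>v. g v * indicator (ball 0 (real k)) v) \<in> borel_measurable (K x)"
        unfolding mc using that(2) by (intro borel_measurable_times_ennreal borel_measurable_indicator borel_open open_ball)
    qed
    finally show ?thesis .
  qed
  have L_emeasure: "emeasure (L k x) A = emeasure (K x) (A \<inter> ball 0 (real k)) / c k x"
    if "x \<in> space M" "A \<in> sets borel" for k x A
  proof -
    have "emeasure (L k x) A = (\<integral>\<^sup>+v. indicator A v \<partial>L k x)"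
      using that L_sets[OF that(1)] by simp
    also have "\<dots> = (\<integral>\<^sup>+v. indicator (A \<inter> ball 0 (real k)) v \<partial>K x) / c k x"
      using that by (subst L_int) (auto simp: indicator_inter_arith[symmetric])
    also have "\<dots> = emeasure (K x) (A \<inter> ball 0 (real k)) / c k x"
      using that sets_growth_measure[OF K_growth[OF that(1)]] by (subst nn_integral_indicator) auto
    finally show ?thesis .
  qed
  have L_kernel: "L k \<in> measurable M (subprob_algebra borel)" for k
  proof (rule measurable_subprob_algebra)
    fix x assume x: "x \<in> space M"
    show "subprob_space (L k x)"
    proof
      have sp: "space (L k x) = UNIV" using sets_eq_imp_space_eq[OF L_sets[OF x, of k]] by simp
      have "emeasure (L k x) UNIV = emeasure (K x) (ball 0 (real k)) / c k x"
        using L_emeasure[OF x, of UNIV k] by simp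
      also have "\<dots> \<le> c k x / c k x" by (intro divide_right_mono_ennreal) (simp add: c_def)
      also have "\<dots> = 1" using c[OF x, of k] by (intro ennreal_divide_self) auto
      finally show "emeasure (L k x) (space (L k x)) \<le> 1" by (simp add: sp)
      show "space (L k x) \<noteq> {}" by (simp add: sp)
    qed
    show "sets (L k x) = sets borel" by (rule L_sets[OF x])
  next
    fix A :: "(real ^ 'n) set" assume A [measurable]: "A \<in> sets borel"
    have [measurable]: "(\<lambda>x. emeasure (K x) (A \<inter> ball 0 (real k))) \<in> borel_measurable M"
      using measurable_compose[OF K borel_measurable_emeasure_growth_measures[of "A \<inter> ball 0 (real k)"]] by simp
    have "(\<lambda>x. emeasure (K x) (A \<inter> ball 0 (real k)) / c k x) \<in> borel_measurable M" by measurable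
    then show "(\<lambda>x. emeasure (L k x) A) \<in> borel_measurable M"
      by (rule measurable_cong[THEN iffD1, rotated]) (simp add: L_emeasure)
  qed
  \<comment> \<open>Multiplying by \<open>c k x\<close> undoes the normalization, and the supremum
    lets the ball grow.\<close>
  have "(\<lambda>x. SUP k. c k x * (\<integral>\<^sup>+v. F x v \<partial>L k x)) \<in> borel_measurable M"
    using nn_integral_measurable_subprob_algebra2[OF F L_kernel]
    by (intro borel_measurable_SUP borel_measurable_times_ennreal) auto
  then show ?thesis
  proof (rule measurable_cong[THEN iffD1, rotated])
    fix x assume x: "x \<in> space M"
    note [measurable_cong] = sets_growth_measure[OF K_growth[OF x]]
    have [measurable]: "F x \<in> borel_measurable borel"
      using measurable_compose_Pair1[OF x F] by simp
    have "c k x * (\<integral>\<^sup>+v. F x v \<partial>L k x) = (\<integral>\<^sup>+v. F x v * indicator (ball 0 (real k)) v \<partial>K x)" for k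
    proof -
      have "c k x * (\<integral>\<^sup>+v. F x v \<partial>L k x) = (\<integral>\<^sup>+v. F x v * indicator (ball 0 (real k)) v \<partial>K x) * c k x / c k x"
        by (simp add: L_int[OF x] ennreal_times_divide mult.commute)
      also have "\<dots> = (\<integral>\<^sup>+v. F x v * indicator (ball 0 (real k)) v \<partial>K x)"
        using c[OF x, of k] by (intro ennreal_mult_divide_eq) auto
      finally show ?thesis .
    qed
    then have "(SUP k. c k x * (\<integral>\<^sup>+v. F x v \<partial>L k x)) = (SUP k. \<integral>\<^sup>+v. F x v * indicator (ball 0 (real k)) v \<partial>K x)"
      by simp
    also have "\<dots> = (\<integral>\<^sup>+v. (SUP k. F x v * indicator (ball 0 (real k)) v) \<partial>K x)"
      by (rule nn_integral_monotone_convergence_SUP[symmetric])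
        (auto simp: incseq_def le_fun_def indicator_def)
    also have "\<dots> = (\<integral>\<^sup>+v. F x v \<partial>K x)"
    proof (intro nn_integral_cong antisym)
      fix v
      show "(SUP k. F x v * indicator (ball 0 (real k)) v) \<le> F x v"
        by (intro SUP_least) (auto simp: indicator_def)
      obtain k :: nat where "norm v < k" using reals_Archimedean2 by blast
      then show "F x v \<le> (SUP k. F x v * indicator (ball 0 (real k)) v)"
        by (intro SUP_upper2[of k]) auto
    qed
    finally show "(SUP k. c k x * (\<integral>\<^sup>+v. F x v \<partial>L k x)) = (\<integral>\<^sup>+v. F x v \<partial>K x)" .
  qed
qed

lemma nn_hat_measurable [measurable]:
  assumes [measurable]: "\<psi> \<in> borel_measurable borel"
  shows "nn_hat \<psi> \<in> borel_measurable growth_measures_borel"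
  unfolding nn_hat_def by (rule measurable_growth_kernel_nn_integral) measurable

section \<open>The linear action on growth measures\<close>

lemma borel_measurable_matrix_mult_vec [measurable]: "(\<lambda>x. A *v x :: real ^ 'n) \<in> borel_measurable borel"
  by (intro borel_measurable_continuous_onI linear_continuous_on matrix_vector_mul_bounded_linear)

lemma sets_act [simp]: "sets (act A \<nu>) = sets borel"
  by (simp add: act_def)

lemma hat_act:
  assumes "sets \<nu> = sets borel" "\<psi> \<in> borel_measurable borel"
  shows "hat \<psi> (act A \<nu>) = hat (\<lambda>x. \<psi> (A *v x)) \<nu>"
  using assms unfolding hat_def act_def
  by (intro integral_distr) (simp_all add: measurable_cong_sets[OF assms(1) refl])

lemma emeasure_act:
  assumes "sets \<nu> = sets borel" "E \<in> sets borel"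
  shows "emeasure (act A \<nu>) E = emeasure \<nu> {x. A *v x \<in> E}"
  using assms sets_eq_imp_space_eq[OF assms(1)] unfolding act_def
  by (subst emeasure_distr) (auto simp: measurable_cong_sets[OF assms(1) refl] vimage_def)

lemma act_act:
  assumes "sets \<nu> = sets borel"
  shows "act A (act B \<nu>) = act (A ** B) \<nu>"
  unfolding act_def
  by (subst distr_distr) (simp_all add: measurable_cong_sets[OF assms refl] o_def matrix_vector_mul_assoc)

lemma act_one:
  assumes "sets \<nu> = sets borel" shows "act (mat 1) \<nu> = \<nu>"
  using assms by (simp add: act_def distr_id2)

lemma norm_matrix_mult_vec_le: "\<exists>K>0. \<forall>x. norm (A *v x :: real ^ 'n) \<le> K * norm (x :: real ^ 'n)"
  using bounded_linear.pos_bounded[OF matrix_vector_mul_bounded_linear[of A]] by (auto simp: mult.commute)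

text \<open>The preimage of a ball of radius R lies in the ball of radius K R, where K bounds the
  inverse matrix, so the growth bound grows at most by the factor
  \<open>K ^ CARD('n)\<close>.\<close>

lemma act_growth_measures:
  fixes \<nu> :: "(real ^ 'n) measure"
  assumes "A \<in> SL" "\<nu> \<in> growth_measures"
  shows "act A \<nu> \<in> growth_measures"
proof -
  obtain B where B: "B ** A = mat 1" by (rule SL_inverse[OF assms(1)])
  obtain K where K: "0 < K" "\<And>x. norm (B *v x) \<le> K * norm x" using norm_matrix_mult_vec_le[of B] by blast
  have "mass_in_ball (act A \<nu>) R / ennreal (R ^ CARD('n)) \<le> growth_bound \<nu> * ennreal (K ^ CARD('n))" if R: "0 < R" for R
  proof -
    have "mass_in_ball (act A \<nu>) R = emeasure \<nu> {x. A *v x \<in> ball 0 R}"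
      unfolding mass_in_ball_def using sets_growth_measure[OF assms(2)] by (intro emeasure_act) auto
    also have "\<dots> \<le> emeasure \<nu> (ball 0 (K * R))"
    proof (rule emeasure_mono)
      show "{x. A *v x \<in> ball 0 R} \<subseteq> ball 0 (K * R)"
      proof
        fix x assume "x \<in> {x. A *v x \<in> ball 0 R}"
        then have "norm (A *v x) < R" by simp
        have "norm x = norm (B *v (A *v x))" by (simp add: matrix_vector_mul_assoc B)
        also have "\<dots> \<le> K * norm (A *v x)" by (rule K)
        also have "\<dots> < K * R" using K(1) \<open>norm (A *v x) < R\<close> by simp
        finally show "x \<in> ball 0 (K * R)" by simp
      qed
    qed (simp add: sets_growth_measure[OF assms(2)])
    also have "\<dots> \<le> growth_bound \<nu> * ennreal ((K * R) ^ CARD('n))"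
      using K R by (intro emeasure_ball_le_growth_bound) simp
    also have "\<dots> = growth_bound \<nu> * ennreal (K ^ CARD('n)) * ennreal (R ^ CARD('n))"
      using K R by (simp add: power_mult_distrib ennreal_mult mult.assoc)
    finally have "mass_in_ball (act A \<nu>) R / ennreal (R ^ CARD('n)) \<le>
        growth_bound \<nu> * ennreal (K ^ CARD('n)) * ennreal (R ^ CARD('n)) / ennreal (R ^ CARD('n))"
      by (rule divide_right_mono_ennreal)
    also have "\<dots> = growth_bound \<nu> * ennreal (K ^ CARD('n))"
      using R by (intro ennreal_mult_divide_eq) auto
    finally show ?thesis .
  qed
  then have "growth_bound (act A \<nu>) \<le> growth_bound \<nu> * ennreal (K ^ CARD('n))"
    unfolding growth_bound_def by (intro SUP_least) auto
  also have "\<dots> < \<infinity>"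
    using growth_bound_finite[OF assms(2)] by (simp add: ennreal_mult_less_top)
  finally show ?thesis by (simp add: growth_measures_def)
qed

lemma Cc_compose_matrix:
  fixes A :: "real ^ 'n ^ 'n"
  assumes "\<psi> \<in> Cc" "A \<in> SL" shows "(\<lambda>x. \<psi> (A *v x)) \<in> Cc"
proof -
  obtain B where B: "B ** A = mat 1" by (rule SL_inverse[OF assms(2)])
  obtain K where K: "0 < K" "\<And>x. norm (B *v x) \<le> K * norm x" using norm_matrix_mult_vec_le[of B] by blast
  obtain R where R: "\<And>x. R \<le> norm x \<Longrightarrow> \<psi> x = 0" and c: "continuous_on UNIV \<psi>"
    using assms(1) by (auto simp: Cc_iff)
  show ?thesis
  proof (rule CcI[of _ "K * R"])
    show "continuous_on UNIV (\<lambda>x. \<psi> (A *v x))"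
      by (rule continuous_on_compose2[OF c]) (auto intro: linear_continuous_on matrix_vector_mul_bounded_linear)
    fix x :: "real ^ 'n" assume "K * R \<le> norm x"
    also have "norm x = norm (B *v (A *v x))" by (simp add: matrix_vector_mul_assoc B)
    also have "\<dots> \<le> K * norm (A *v x)" by (rule K)
    finally show "\<psi> (A *v x) = 0" using K(1) by (intro R) simp
  qed
qed

lemma act_measurable:
  fixes A :: "real ^ 'n ^ 'n"
  assumes "A \<in> SL" shows "act A \<in> measurable growth_measures_borel growth_measures_borel"
proof (rule measurable_growth_measures_borelI)
  fix \<psi> assume \<psi>: "\<psi> \<in> (Cc :: (real ^ 'n \<Rightarrow> real) set)"
  have "hat (\<lambda>x. \<psi> (A *v x)) \<in> borel_measurable growth_measures_borel"
    by (intro hat_measurable Cc_compose_matrix \<psi> assms)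
  then show "(\<lambda>\<nu>. hat \<psi> (act A \<nu>)) \<in> borel_measurable growth_measures_borel"
    by (rule measurable_cong[THEN iffD1, rotated])
      (simp add: hat_act[OF sets_growth_measure Cc_measurable[OF \<psi>]])
qed (use assms act_growth_measures in auto)

section \<open>Ergodicity of a transvection\<close>

locale siegel =
  fixes \<mu> :: "(real ^ 'n) measure measure"
  assumes card: "CARD('n) > 1" and siegel: "Siegel_measure \<mu>"
begin

lemma sets_mu [measurable_cong, simp]: "sets \<mu> = sets growth_measures_borel"
  using siegel by (simp add: Siegel_measure_def)

lemma space_mu [simp]: "space \<mu> = growth_measures"
  using sets_eq_imp_space_eq[OF sets_mu] by simp

sublocale prob_space \<mu>
  using siegel by (simp add: Siegel_measure_def)

lemma act_measurable_mu: "A \<in> SL \<Longrightarrow> act A \<in> measurable \<mu> \<mu>"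
  using act_measurable by (simp add: measurable_cong_sets[OF sets_mu sets_mu])

lemma act_preserves: "A \<in> SL \<Longrightarrow> distr \<mu> \<mu> (act A) = \<mu>"
  using siegel distr_cong[OF refl sets_mu refl, of \<mu> "act A"]
  by (simp add: Siegel_measure_def SL_invariant_def)

lemma mpt_act: "A \<in> SL \<Longrightarrow> mpt \<mu> (act A)"
  by unfold_locales (simp_all add: act_measurable_mu act_preserves)

section \<open>Almost invariant sets\<close>

definition pre :: "real ^ 'n ^ 'n \<Rightarrow> (real ^ 'n) measure set \<Rightarrow> (real ^ 'n) measure set" where
  "pre A E = {\<nu> \<in> growth_measures. act A \<nu> \<in> E}"

lemma pre_sets: "A \<in> SL \<Longrightarrow> E \<in> sets \<mu> \<Longrightarrow> pre A E \<in> sets \<mu>"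
  using measurable_sets[OF act_measurable_mu, of A E] by (simp add: pre_def vimage_def Int_def conj_commute)

lemma prob_pre: "A \<in> SL \<Longrightarrow> E \<in> sets \<mu> \<Longrightarrow> prob (pre A E) = prob E"
  using measure_distr[OF act_measurable_mu, of A E]
  by (simp add: act_preserves pre_def vimage_def Int_def conj_commute)

lemma sets_subset_growth: "E \<in> sets \<mu> \<Longrightarrow> E \<subseteq> growth_measures"
  using sets.sets_into_space[of E \<mu>] by simp

lemma pre_mult: "B \<in> SL \<Longrightarrow> pre (A ** B) E = pre B (pre A E)"
  by (auto simp: pre_def act_act sets_growth_measure act_growth_measures)

lemma pre_one: "E \<in> sets \<mu> \<Longrightarrow> pre (mat 1) E = E"
  using sets_subset_growth[of E] by (auto simp: pre_def act_one sets_growth_measure)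

text \<open>For A in \<open>SL\<close> both one-sided differences of \<open>E\<close> and
  \<open>pre A E\<close> have the same measure, so this is half the measure of the symmetric
  difference. It is subadditive in A and vanishes on a subgroup.\<close>

definition defect :: "(real ^ 'n) measure set \<Rightarrow> real ^ 'n ^ 'n \<Rightarrow> real" where
  "defect E A = prob (E - pre A E)"

lemma defect_nonneg: "0 \<le> defect E A"
  by (simp add: defect_def)

lemma prob_Diff_symmetric:
  assumes "E \<in> sets \<mu>" "F \<in> sets \<mu>" "prob E = prob F"
  shows "prob (E - F) = prob (F - E)"
  using assms finite_measure_Diff'[of E F] finite_measure_Diff'[of F E] by (simp add: Int_commute)

lemma defect_swap:
  assumes "A \<in> SL" "E \<in> sets \<mu>"
  shows "prob (pre A E - E) = defect E A"
  unfolding defect_def using assms by (intro prob_Diff_symmetric pre_sets) (simp_all add: prob_pre)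

lemma defect_mult:
  assumes "A \<in> SL" "B \<in> SL" "E \<in> sets \<mu>"
  shows "defect E (A ** B) \<le> defect E A + defect E B"
proof -
  have "E - pre (A ** B) E \<subseteq> (E - pre B E) \<union> pre B (E - pre A E)"
    unfolding pre_mult[OF assms(2)] using sets_subset_growth[OF assms(3)] by (auto simp: pre_def)
  then have "defect E (A ** B) \<le> prob ((E - pre B E) \<union> pre B (E - pre A E))"
    unfolding defect_def using assms by (intro finite_measure_mono sets.Un sets.Diff pre_sets)
  also have "\<dots> \<le> prob (E - pre B E) + prob (pre B (E - pre A E))"
    using assms by (intro measure_Un_le sets.Diff pre_sets)
  also have "prob (pre B (E - pre A E)) = defect E A"
    unfolding defect_def using assms by (intro prob_pre sets.Diff pre_sets)
  finally show ?thesis by (simp add: defect_def)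
qed

lemma defect_inverse:
  assumes "A \<in> SL" "B \<in> SL" "A ** B = mat 1" "E \<in> sets \<mu>"
  shows "defect E B = defect E A"
proof -
  have "act A (act B \<nu>) = \<nu>" if "\<nu> \<in> growth_measures" for \<nu>
    using that assms(3) by (simp add: act_act act_one sets_growth_measure)
  then have "pre B (pre A E - E) = E - pre B E"
    using assms sets_subset_growth[OF assms(4)] by (auto simp: pre_def act_growth_measures)
  then have "defect E B = prob (pre B (pre A E - E))" by (simp add: defect_def)
  also have "\<dots> = prob (pre A E - E)" using assms by (intro prob_pre sets.Diff pre_sets)
  finally show ?thesis using assms by (simp add: defect_swap)
qed

lemma norm_transvection_le:
  assumes "i \<noteq> j"
  shows "norm (transvection i j s *v v) \<le> (1 + \<bar>s\<bar>) * norm v"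
proof -
  have "transvection i j s *v v = v + (s * v $ j) *\<^sub>R axis i 1"
    using assms by (auto simp: vec_eq_iff transvection_mult_vec axis_def)
  then have "norm (transvection i j s *v v) \<le> norm v + \<bar>s * v $ j\<bar>"
    using norm_triangle_ineq[of v "(s * v $ j) *\<^sub>R axis i 1"] by (simp add: norm_axis_1)
  also have "\<bar>s * v $ j\<bar> \<le> \<bar>s\<bar> * norm v"
    by (simp add: abs_mult mult_left_mono component_le_norm_cart)
  finally show ?thesis by (simp add: algebra_simps)
qed

text \<open>Dominated convergence: for bounded parameters the composed functions vanish outside one
  common ball, because the inverse of a transvection stretches norms by at most 1 + S.\<close>

lemma hat_transvection_tendsto:
  assumes ij: "i \<noteq> j" and s: "s \<longlonglongrightarrow> 0" and \<psi>: "\<psi> \<in> Cc" and \<nu>: "\<nu> \<in> growth_measures"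
  shows "(\<lambda>n. hat \<psi> (act (transvection i j (s n)) \<nu>)) \<longlonglongrightarrow> hat \<psi> \<nu>"
proof -
  obtain B R where BR: "0 < B" "0 < R" "\<And>x. \<bar>\<psi> x\<bar> \<le> B" "\<And>x. R \<le> norm x \<Longrightarrow> \<psi> x = 0"
    by (rule Cc_bound[OF \<psi>]) blast
  obtain S where S: "0 < S" "\<And>n. \<bar>s n\<bar> \<le> S"
    using convergent_imp_Bseq[OF convergentI[OF s]] by (auto simp: Bseq_def)
  note mc = measurable_cong_sets[OF sets_growth_measure[OF \<nu>] refl]
  have \<psi>_meas [measurable]: "\<psi> \<in> borel_measurable borel" by (rule Cc_measurable[OF \<psi>])
  have zero: "\<psi> (transvection i j (s n) *v v) = 0" if "(1 + S) * R \<le> norm v" for n v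
  proof (rule BR)
    have "v = transvection i j (- s n) *v (transvection i j (s n) *v v)"
      by (simp add: matrix_vector_mul_assoc transvection_add[OF ij] transvection_0[OF ij])
    then have "norm v \<le> (1 + \<bar>s n\<bar>) * norm (transvection i j (s n) *v v)"
      using norm_transvection_le[OF ij, of "- s n" "transvection i j (s n) *v v"] by simp
    also have "\<dots> \<le> (1 + S) * norm (transvection i j (s n) *v v)"
      using S(2)[of n] by (intro mult_right_mono) auto
    finally have "(1 + S) * R \<le> (1 + S) * norm (transvection i j (s n) *v v)" using that by linarith
    then show "R \<le> norm (transvection i j (s n) *v v)" using S(1) by simp
  qed
  have "(\<lambda>n. \<integral>v. \<psi> (transvection i j (s n) *v v) \<partial>\<nu>) \<longlonglongrightarrow> (\<integral>v. \<psi> v \<partial>\<nu>)"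
  proof (rule integral_dominated_convergence[where w = "\<lambda>v. B * indicator (ball 0 ((1 + S) * R)) v"])
    show "\<psi> \<in> borel_measurable \<nu>" "(\<lambda>v. \<psi> (transvection i j (s n) *v v)) \<in> borel_measurable \<nu>" for n
      unfolding mc by measurable
    show "integrable \<nu> (\<lambda>v. B * indicator (ball 0 ((1 + S) * R)) v)"
      using growth_measure_bounded_finite[OF \<nu> bounded_ball] sets_growth_measure[OF \<nu>]
      by (intro integrable_mult_right integrable_real_indicator) auto
    show "AE v in \<nu>. norm (\<psi> (transvection i j (s n) *v v)) \<le> B * indicator (ball 0 ((1 + S) * R)) v" for n
      using zero[of _ n] BR(1,3) by (intro AE_I2) (auto simp: indicator_def not_less)
    show "AE v in \<nu>. (\<lambda>n. \<psi> (transvection i j (s n) *v v)) \<longlonglongrightarrow> \<psi> v"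
    proof (intro AE_I2)
      fix v
      have "(\<lambda>n. transvection i j (s n) *v v) \<longlonglongrightarrow> v"
      proof (rule vec_tendstoI)
        fix a
        have "(\<lambda>n. v $ i + s n * v $ j) \<longlonglongrightarrow> v $ i + 0 * v $ j" by (intro tendsto_intros s)
        then show "(\<lambda>n. (transvection i j (s n) *v v) $ a) \<longlonglongrightarrow> v $ a"
          by (cases "a = i") (simp_all add: transvection_mult_vec[OF ij])
      qed
      moreover have "isCont \<psi> v" using \<psi> by (auto simp: Cc_def continuous_on_eq_continuous_at)
      ultimately show "(\<lambda>n. \<psi> (transvection i j (s n) *v v)) \<longlonglongrightarrow> \<psi> v" by (metis isCont_tendsto_compose)
    qed
  qed
  moreover have "hat \<psi> (act A \<nu>) = (\<integral>v. \<psi> (A *v v) \<partial>\<nu>)" for A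
    using hat_act[OF sets_growth_measure[OF \<nu>] \<psi>_meas, of A] by (simp only: hat_def)
  ultimately show ?thesis by (simp only: hat_def[of \<psi> \<nu>])
qed

text \<open>Continuity of the action in measure, by induction over the generated sigma-algebra. For
  a subbasic \<open>E\<close> the one-sided difference is what helps: a point of \<open>E\<close> is
  eventually carried into \<open>E\<close> again, as its defining condition is open. Complements use
  the symmetry of the defect; countable unions are cut off at a finite stage.\<close>

lemma defect_transvection_tendsto:
  assumes ij: "i \<noteq> j" and E: "E \<in> sets \<mu>" and s: "s \<longlonglongrightarrow> 0"
  shows "(\<lambda>n. defect E (transvection i j (s n))) \<longlonglongrightarrow> 0"
proof -
  let ?T = "\<lambda>n. transvection i j (s n)"
  note SL = transvection_in_SL[OF ij]
  have "E \<in> sigma_sets growth_measures {{\<nu> \<in> growth_measures. hat \<psi> \<nu> \<in> U} | \<psi> U. \<psi> \<in> (Cc :: (real ^ 'n \<Rightarrow> real) set) \<and> open U}"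
    using E by (simp add: sets_growth_measures_borel)
  then show ?thesis
  proof induction
    case (Basic E)
    then obtain \<psi> U where "E = {\<nu> \<in> growth_measures. hat \<psi> \<nu> \<in> U} \<and> \<psi> \<in> Cc \<and> open U"
      unfolding mem_Collect_eq by (elim exE)
    then have E: "E = {\<nu> \<in> growth_measures. hat \<psi> \<nu> \<in> U}" "\<psi> \<in> Cc" "open U" by simp_all
    have Em: "E \<in> sets \<mu>" unfolding E(1) sets_mu sets_growth_measures_borel
      using E(2,3) by (intro sigma_sets.Basic) blast
    have "(\<lambda>n. \<integral>\<nu>. (indicator (E - pre (?T n) E) \<nu> :: real) \<partial>\<mu>) \<longlonglongrightarrow> (\<integral>\<nu>. 0 \<partial>\<mu>)"
    proof (rule integral_dominated_convergence[where w = "\<lambda>_. 1"])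
      show "(\<lambda>\<nu>. indicator (E - pre (?T n) E) \<nu> :: real) \<in> borel_measurable \<mu>" for n
        using Em by (intro borel_measurable_indicator sets.Diff pre_sets SL)
      show "AE \<nu> in \<mu>. (\<lambda>n. indicator (E - pre (?T n) E) \<nu>) \<longlonglongrightarrow> (0 :: real)"
      proof (intro AE_I2)
        fix \<nu> assume "\<nu> \<in> space \<mu>"
        then have \<nu>: "\<nu> \<in> growth_measures" by simp
        show "(\<lambda>n. indicator (E - pre (?T n) E) \<nu>) \<longlonglongrightarrow> (0 :: real)"
        proof (cases "\<nu> \<in> E")
          case True
          then have "hat \<psi> \<nu> \<in> U" by (simp add: E)
          from topological_tendstoD[OF hat_transvection_tendsto[OF ij s E(2) \<nu>] E(3) this]
          have "\<forall>\<^sub>F n in sequentially. indicator (E - pre (?T n) E) \<nu> = (0 :: real)"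
            by eventually_elim (use \<nu> in \<open>simp add: pre_def E indicator_def act_growth_measures SL\<close>)
          then show ?thesis by (rule tendsto_eventually)
        qed simp
      qed
    qed (auto simp: indicator_def)
    moreover have "(E - pre (?T n) E) \<inter> growth_measures = E - pre (?T n) E" for n
      using sets_subset_growth[OF Em] by auto
    ultimately show ?case by (simp add: defect_def)
  next
    case Empty
    show ?case by (simp add: defect_def)
  next
    case (Compl E)
    then have E: "E \<in> sets \<mu>" by (simp add: sets_growth_measures_borel)
    have "(growth_measures - E) - pre (?T n) (growth_measures - E) = pre (?T n) E - E" for n
      by (auto simp: pre_def act_growth_measures SL)
    then show ?case using Compl.IH by (simp add: defect_def[of "_ - _"] defect_swap[OF SL E])
  next
    case (Union F)
    then have F: "F i \<in> sets \<mu>" for i by (simp add: sets_growth_measures_borel)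
    let ?E = "\<Union>i. F i" and ?P = "\<lambda>k. \<Union>i<k. F i"
    have P: "?P k \<in> sets \<mu>" for k using F by (intro sets.finite_UN) auto
    have "(\<lambda>k. prob (?E - ?P k)) \<longlonglongrightarrow> prob (\<Inter>k. ?E - ?P k)"
      using F P by (intro finite_Lim_measure_decseq) (force simp: decseq_def)+
    moreover have "(\<Inter>k. ?E - ?P k) = {}"
    proof (rule equals0I)
      fix x assume x: "x \<in> (\<Inter>k. ?E - ?P k)"
      then obtain i where i: "x \<in> F i" by auto
      have "x \<notin> ?P (Suc i)" using x by blast
      with i show False by auto
    qed
    ultimately have lim: "(\<lambda>k. prob (?E - ?P k)) \<longlonglongrightarrow> 0" by (simp only: measure_empty)
    show ?case
    proof (rule order_tendstoI)
      show "\<forall>\<^sub>F n in sequentially. a < defect ?E (?T n)" if "a < 0" for a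
        using that less_le_trans[OF _ defect_nonneg] by simp
      fix e :: real assume e: "0 < e"
      obtain k where k: "prob (?E - ?P k) < e / 2"
        using order_tendstoD(2)[OF lim, of "e / 2"] e by (auto simp: eventually_sequentially)
      have "(\<lambda>n. \<Sum>i<k. defect (F i) (?T n)) \<longlonglongrightarrow> (\<Sum>i<k. 0)"
        using Union.IH by (intro tendsto_sum)
      then have "\<forall>\<^sub>F n in sequentially. (\<Sum>i<k. defect (F i) (?T n)) < e / 2"
        using e by (intro order_tendstoD(2)) auto
      then show "\<forall>\<^sub>F n in sequentially. defect ?E (?T n) < e"
      proof eventually_elim
        case (elim n)
        have sub: "?E - pre (?T n) ?E \<subseteq> (?E - ?P k) \<union> (\<Union>i<k. F i - pre (?T n) (F i))"
          by (auto simp: pre_def)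
        have m: "F i - pre (?T n) (F i) \<in> sets \<mu>" for i using F by (intro sets.Diff pre_sets SL)
        have m': "(\<Union>i<k. F i - pre (?T n) (F i)) \<in> sets \<mu>" by (rule sets.finite_UN) (simp, rule m)
        have EP: "?E - ?P k \<in> sets \<mu>" using F P by (intro sets.Diff sets.countable_UN) auto
        have "defect ?E (?T n) \<le> prob ((?E - ?P k) \<union> (\<Union>i<k. F i - pre (?T n) (F i)))"
          unfolding defect_def by (rule finite_measure_mono[OF sub sets.Un[OF EP m']])
        also have "\<dots> \<le> prob (?E - ?P k) + prob (\<Union>i<k. F i - pre (?T n) (F i))"
          by (rule measure_Un_le[OF EP m'])
        also have "prob (\<Union>i<k. F i - pre (?T n) (F i)) \<le> (\<Sum>i<k. defect (F i) (?T n))"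
          unfolding defect_def by (rule measure_UNION_le) (simp, rule m)
        finally show ?case using k elim by linarith
      qed
    qed
  qed
qed

lemma defect_eq_0_mult:
  "A \<in> SL \<Longrightarrow> B \<in> SL \<Longrightarrow> E \<in> sets \<mu> \<Longrightarrow> defect E A = 0 \<Longrightarrow> defect E B = 0 \<Longrightarrow> defect E (A ** B) = 0"
  using defect_mult[of A B E] defect_nonneg[of E "A ** B"] by simp

lemma defect_transvection_uminus:
  assumes "i \<noteq> j" "E \<in> sets \<mu>"
  shows "defect E (transvection i j (- s)) = defect E (transvection i j s)"
  using assms by (intro defect_inverse) (simp_all add: transvection_in_SL transvection_add transvection_0)

lemma defect_transvection_of_nat:
  assumes "i \<noteq> j" "E \<in> sets \<mu>" "defect E (transvection i j 1) = 0"
  shows "defect E (transvection i j (real n)) = 0"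
proof (induction n)
  case 0
  show ?case using assms by (simp add: transvection_0 defect_def pre_one)
next
  case (Suc n)
  have "transvection i j (real (Suc n)) = transvection i j 1 ** transvection i j (real n)"
    using assms(1) by (simp add: transvection_add)
  then show ?case using Suc assms by (simp add: defect_eq_0_mult transvection_in_SL)
qed

definition hyp :: "'n \<Rightarrow> 'n \<Rightarrow> real \<Rightarrow> 'n \<Rightarrow> real" where
  "hyp i j t a = (if a = i then t else if a = j then 1 / t else 1)"

lemma hyp_in_SL: "i \<noteq> j \<Longrightarrow> t \<noteq> 0 \<Longrightarrow> diag (hyp i j t) \<in> SL"
  using transvection_group_subset_SL[OF hyperbolic_in_transvection_group, of i j t]
  by (simp add: hyp_def[abs_def])

text \<open>
  A Mautner argument for a single unipotent element: the product below is fixed up to the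
  two lower transvections, which tend to the identity.
\<close>

lemma hyp_2_decomposition:
  assumes "i \<noteq> j" "0 < k"
  shows "diag (hyp i j 2) = (transvection i j (2 * k) ** transvection j i (1 / (2 * k))) **
    (transvection i j (- k) ** transvection j i (- (1 / k)))"
  using assms assms(1)[symmetric]
  by (intro matrix_eqI) (simp add: matrix_vector_mul_assoc[symmetric] transvection_mult_vec hyp_def field_simps)

text \<open>The parameters 2k and -k must be integers, since \<open>u\<close> only controls the
  integer powers of one transvection. The lower transvections tend to the identity, and their
  defects to 0.\<close>

lemma defect_hyp_2:
  assumes ij: "i \<noteq> j" and E: "E \<in> sets \<mu>" and u: "defect E (transvection i j 1) = 0"
  shows "defect E (diag (hyp i j 2)) = 0"
proof (rule antisym[OF LIMSEQ_le_const defect_nonneg])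
  note SL = transvection_in_SL[OF ij] transvection_in_SL[OF ij[symmetric]]
  have s1: "(\<lambda>k. 1 / (2 * real (Suc k))) \<longlonglongrightarrow> 0" and s2: "(\<lambda>k. - (1 / real (Suc k))) \<longlonglongrightarrow> 0"
    by real_asymp+
  have "(\<lambda>k. defect E (transvection j i (1 / (2 * real (Suc k)))) + defect E (transvection j i (- (1 / real (Suc k))))) \<longlonglongrightarrow> 0 + 0"
    by (intro tendsto_add defect_transvection_tendsto E s1 s2 ij[symmetric])
  then show "(\<lambda>k. defect E (transvection j i (1 / (2 * real (Suc k)))) + defect E (transvection j i (- (1 / real (Suc k))))) \<longlonglongrightarrow> 0"
    by simp
  show "\<exists>N. \<forall>k\<ge>N. defect E (diag (hyp i j 2)) \<le>
      defect E (transvection j i (1 / (2 * real (Suc k)))) + defect E (transvection j i (- (1 / real (Suc k))))"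
  proof (intro exI allI impI)
    fix k
    let ?k = "real (Suc k)"
    have u1: "defect E (transvection i j (2 * ?k)) = 0"
      using defect_transvection_of_nat[OF ij E u, of "2 * Suc k"] by simp
    have u2: "defect E (transvection i j (- ?k)) = 0"
      using defect_transvection_of_nat[OF ij E u, of "Suc k"] by (simp only: defect_transvection_uminus[OF ij E])
    have "defect E (diag (hyp i j 2)) \<le>
        (defect E (transvection i j (2 * ?k)) + defect E (transvection j i (1 / (2 * ?k)))) +
        (defect E (transvection i j (- ?k)) + defect E (transvection j i (- (1 / ?k))))"
      unfolding hyp_2_decomposition[OF ij, of ?k, simplified of_nat_0_less_iff, OF zero_less_Suc]
      by (intro order_trans[OF defect_mult] add_mono defect_mult SL SL_mult E)
    then show "defect E (diag (hyp i j 2)) \<le>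
      defect E (transvection j i (1 / (2 * ?k))) + defect E (transvection j i (- (1 / ?k)))"
      unfolding u1 u2 by simp
  qed
qed

text \<open>The contraction step of the Mautner phenomenon. Conjugation by \<open>diag e\<close>
  costs no defect and replaces s by \<open>s * ?r\<close> with \<open>?r < 1\<close>; iterating
  drives the parameter, and with it the defect, to 0.\<close>

lemma defect_contracted_transvection:
  assumes pq: "p \<noteq> q" and E: "E \<in> sets \<mu>" and e: "diag e \<in> SL" "\<And>a. 0 < e a" "defect E (diag e) = 0" and lt: "e q < e p"
  shows "defect E (transvection p q s) = 0"
proof -
  note SL = transvection_in_SL[OF pq]
  let ?r = "e q / e p"
  obtain B where B: "B \<in> SL" "diag e ** B = mat 1" "B ** diag e = mat 1" by (rule SL_inverse[OF e(1)])
  have dB: "defect E B = 0" using defect_inverse[OF e(1) B(1,2) E] e(3) by simp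
  have step: "defect E (transvection p q s) \<le> defect E (transvection p q (s * ?r))" for s
  proof -
    have ne: "e a \<noteq> 0" for a using e(2)[of a] by simp
    have "diag e ** transvection p q (s * ?r) = transvection p q s ** diag e"
      using transvection_conj_diag[of p q e "s * ?r"] pq ne by simp
    then have "(diag e ** transvection p q (s * ?r)) ** B = transvection p q s"
      by (metis B(2) matrix_mul_assoc matrix_mul_rid)
    then have "defect E (transvection p q s) \<le> defect E (diag e ** transvection p q (s * ?r)) + defect E B"
      using defect_mult[OF SL_mult[OF e(1) SL] B(1) E] by metis
    also have "\<dots> \<le> defect E (diag e) + defect E (transvection p q (s * ?r)) + defect E B"
      using defect_mult[OF e(1) SL E] by simp
    finally show ?thesis by (simp add: dB e(3))
  qed
  have "defect E (transvection p q s) \<le> defect E (transvection p q (s * ?r ^ n))" for n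
  proof (induction n)
    case (Suc n)
    then show ?case using step[of "s * ?r ^ n"] by (simp add: mult.assoc mult.commute[of ?r] power_Suc2 del: power_Suc)
  qed simp
  moreover have "0 < ?r" "?r < 1" using e(2) lt by auto
  then have "(\<lambda>n. s * ?r ^ n) \<longlonglongrightarrow> s * 0" by (intro tendsto_mult_left LIMSEQ_power_zero) auto
  then have "(\<lambda>n. defect E (transvection p q (s * ?r ^ n))) \<longlonglongrightarrow> 0"
    by (intro defect_transvection_tendsto[OF pq E]) simp
  ultimately have "defect E (transvection p q s) \<le> 0" by (intro LIMSEQ_le_const) auto
  then show ?thesis using defect_nonneg[of E "transvection p q s"] by simp
qed

text \<open>The Steinberg commutator relation. It reaches the transvections that commute with
  \<open>diag (hyp i j 2)\<close> because both their indices avoid i and j.\<close>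

lemma commutator_transvection:
  assumes "p \<noteq> i" "i \<noteq> q" "p \<noteq> q"
  shows "transvection p q s = (transvection p i s ** transvection i q 1) ** (transvection p i (- s) ** transvection i q (- 1))"
  using assms assms[symmetric]
  by (intro matrix_eqI) (simp add: matrix_vector_mul_assoc[symmetric] transvection_mult_vec algebra_simps)

text \<open>If p or q lies in {i, j}, the entries of \<open>hyp i j 2\<close> at p and q differ, so
  this matrix or its inverse contracts the transvection. Commutators give the remaining
  transvections, and all together generate \<open>SL\<close>.\<close>

lemma defect_SL_eq_0:
  assumes ij: "i \<noteq> j" and E: "E \<in> sets \<mu>" and u: "defect E (transvection i j 1) = 0" and A: "A \<in> SL"
  shows "defect E A = 0"
proof -
  have h2: "defect E (diag (hyp i j 2)) = 0" by (rule defect_hyp_2[OF ij E u])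
  have inv: "diag (hyp i j 2) ** diag (hyp i j (1/2)) = mat 1"
    by (intro matrix_eqI) (simp add: matrix_vector_mul_assoc[symmetric] hyp_def)
  have h12: "defect E (diag (hyp i j (1/2))) = 0"
    using defect_inverse[OF hyp_in_SL hyp_in_SL inv E] ij h2 by simp
  have edge: "defect E (transvection p q s) = 0" if pq: "p \<noteq> q" "p \<in> {i, j} \<or> q \<in> {i, j}" for p q s
  proof (cases "hyp i j 2 q < hyp i j 2 p")
    case True
    then show ?thesis
      using pq ij E h2 by (intro defect_contracted_transvection[of p q E "hyp i j 2"] hyp_in_SL) (auto simp: hyp_def)
  next
    case False
    then have "hyp i j (1/2) q < hyp i j (1/2) p" using pq ij by (auto simp: hyp_def split: if_splits)
    then show ?thesis
      using pq ij E h12 by (intro defect_contracted_transvection[of p q E "hyp i j (1/2)"] hyp_in_SL) (auto simp: hyp_def)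
  qed
  have transv: "defect E (transvection p q s) = 0" if pq: "p \<noteq> q" for p q s
  proof (cases "p \<in> {i, j} \<or> q \<in> {i, j}")
    case False
    then have "p \<noteq> i" "i \<noteq> q" by auto
    then show ?thesis
      unfolding commutator_transvection[OF \<open>p \<noteq> i\<close> \<open>i \<noteq> q\<close> pq]
      by (intro defect_eq_0_mult edge SL_mult transvection_in_SL E) auto
  qed (use edge pq in blast)
  have "A \<in> transvection_group" using A SL_eq_transvection_group[OF card] by simp
  then show ?thesis
  proof induction
    case (mult A B)
    then show ?case by (intro defect_eq_0_mult E) (simp_all add: transvection_group_subset_SL)
  qed (rule transv)
qed

end

text \<open>
  Lebesgue measure on the matrices of positive determinant, normalized to determinant one, plays
  the role of Haar measure on the special linear group: its null sets are invariant under right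
  multiplication.
\<close>

definition normalize_det :: "real ^ 'n ^ 'n \<Rightarrow> real ^ 'n ^ 'n" where
  "normalize_det A = (if 0 < det A then diag (\<lambda>_. 1 / root CARD('n) (det A)) ** A else mat 1)"

lemma normalize_det_SL: "normalize_det (A :: real ^ 'n ^ 'n) \<in> SL"
proof (cases "0 < det A")
  case True
  have "(1 / root CARD('n) (det A)) ^ CARD('n) * det A = 1"
    using True by (simp add: power_divide real_root_pow_pos2)
  then show ?thesis using True by (simp add: normalize_det_def SL_def det_mul det_diag)
qed (simp add: normalize_det_def SL_def)

lemma normalize_det_mult: "h \<in> SL \<Longrightarrow> 0 < det A \<Longrightarrow> normalize_det (A ** h) = normalize_det A ** h"
  by (simp add: normalize_det_def SL_def det_mul matrix_mul_assoc)

lemma continuous_on_det [continuous_intros]: 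
  "continuous_on S f \<Longrightarrow> continuous_on S (\<lambda>x. det (f x :: real ^ 'n ^ 'n))"
  unfolding det_def by (intro continuous_intros) 

lemma borel_measurable_det [measurable]: "(det :: real ^ 'n ^ 'n \<Rightarrow> real) \<in> borel_measurable borel"
  by (intro borel_measurable_continuous_onI continuous_on_det continuous_on_id)

lemma borel_measurable_matrix_mult_vec_pair [measurable]:
  "(\<lambda>(A, v). A *v v :: real ^ 'n) \<in> borel_measurable ((borel :: (real ^ 'm ^ 'n) measure) \<Otimes>\<^sub>M borel)"
proof -
  have "continuous_on UNIV (\<lambda>p. fst p *v snd p :: real ^ 'n) "
    unfolding matrix_vector_mult_def by (intro continuous_intros continuous_on_vec_lambda)
  then have "(\<lambda>p. fst p *v snd p :: real ^ 'n) \<in> borel_measurable (borel :: ((real ^ 'm ^ 'n) \<times> (real ^ 'm)) measure)"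
    by (rule borel_measurable_continuous_onI)
  then show ?thesis by (simp add: borel_prod split_beta')
qed

lemma normalize_det_mult_vec:
  "normalize_det A *v (v :: real ^ 'n) =
    (if 0 < det A then (1 / root CARD('n) (det A)) *\<^sub>R (A *v v) else v)"
  by (auto simp: vec_eq_iff normalize_det_def matrix_vector_mul_assoc[symmetric])

lemma borel_measurable_normalize_det_mult_vec [measurable]:
  "(\<lambda>(A, v). normalize_det A *v v :: real ^ 'n) \<in> borel_measurable (borel \<Otimes>\<^sub>M borel)"
proof -
  have [measurable]: "root CARD('n) \<in> borel_measurable borel"
    by (intro borel_measurable_continuous_onI continuous_intros) 
  show ?thesis unfolding normalize_det_mult_vec by measurable
qed

lemma negligible_right_mult:
  fixes h :: "real ^ 'n ^ 'n"
  assumes "negligible S" shows "negligible ((\<lambda>A. A ** h) ` S)"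
proof (rule negligible_differentiable_image_negligible[OF order_refl assms])
  have "linear (\<lambda>A. A ** h)"
    by (intro linearI) (simp_all add: vec_eq_iff matrix_matrix_mult_def sum.distrib algebra_simps sum_distrib_left)
  then show "(\<lambda>A. A ** h) differentiable_on S"
    by (rule linear_imp_differentiable_on)
qed

context siegel
begin

text \<open>Joint measurability in matrix and measure, as Fubini demands below. Positive and
  negative parts of \<psi> are treated apart because the kernel lemma concerns nonnegative
  integrands.\<close>

lemma act_normalize_det_measurable:
  "(\<lambda>(A, \<nu>). act (normalize_det A) \<nu>) \<in> measurable (borel \<Otimes>\<^sub>M \<mu>) growth_measures_borel"
proof (rule measurable_growth_measures_borelI)
  show "(\<lambda>(A, \<nu>). act (normalize_det A) \<nu>) \<in> space (borel \<Otimes>\<^sub>M \<mu>) \<rightarrow> growth_measures"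
    by (auto simp: space_pair_measure intro: act_growth_measures normalize_det_SL)
  fix \<psi> :: "real ^ 'n \<Rightarrow> real" assume \<psi>: "\<psi> \<in> Cc"
  have [measurable]: "\<psi> \<in> borel_measurable borel" by (rule Cc_measurable[OF \<psi>])
  let ?f = "\<lambda>\<sigma> x. \<integral>\<^sup>+v. ennreal (\<sigma> * \<psi> (normalize_det (fst x) *v v)) \<partial>(snd x)"
  have meas: "?f \<sigma> \<in> borel_measurable (borel \<Otimes>\<^sub>M \<mu>)" for \<sigma> :: real
  proof (rule measurable_growth_kernel_nn_integral)
    show "snd \<in> measurable (borel \<Otimes>\<^sub>M \<mu>) growth_measures_borel"
      using measurable_snd[of borel \<mu>] by (simp add: measurable_cong_sets[OF refl sets_mu])
  qed measurable
  have "(\<lambda>x. enn2real (?f 1 x) - enn2real (?f (-1) x)) \<in> borel_measurable (borel \<Otimes>\<^sub>M \<mu>)"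
    using meas[of 1] meas[of "-1"] by measurable
  then show "(\<lambda>x. hat \<psi> (case x of (A, \<nu>) \<Rightarrow> act (normalize_det A) \<nu>)) \<in> borel_measurable (borel \<Otimes>\<^sub>M \<mu>)"
  proof (rule measurable_cong[THEN iffD1, rotated])
    fix x :: "(real ^ 'n ^ 'n) \<times> (real ^ 'n) measure" assume "x \<in> space (borel \<Otimes>\<^sub>M \<mu>)"
    then obtain A \<nu> where x: "x = (A, \<nu>)" and \<nu>: "\<nu> \<in> growth_measures"
      by (auto simp: space_pair_measure)
    have "hat \<psi> (act (normalize_det A) \<nu>) = (\<integral>v. \<psi> (normalize_det A *v v) \<partial>\<nu>)"
      using hat_act[OF sets_growth_measure[OF \<nu>] Cc_measurable[OF \<psi>]] by (simp add: hat_def)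
    also have "\<dots> = enn2real (?f 1 x) - enn2real (?f (-1) x)"
      using Cc_integrable[OF Cc_compose_matrix[OF \<psi> normalize_det_SL] \<nu>]
      by (subst real_lebesgue_integral_def) (auto simp: x)
    finally show "enn2real (?f 1 x) - enn2real (?f (-1) x) = hat \<psi> (case x of (A, \<nu>) \<Rightarrow> act (normalize_det A) \<nu>)"
      by (simp add: x)
  qed
qed

text \<open>The null set on which invariance fails may depend on A, whereas
  \<open>SL_ergodic\<close> concerns strictly invariant sets. \<open>E'\<close> collects the \<nu>
  that almost every normalized matrix sends into \<open>E\<close>; it is strictly invariant because
  right multiplication preserves null sets, and Fubini shows that it agrees with \<open>E\<close>
  almost surely.\<close>

theorem prob_almost_invariant:
  assumes E: "E \<in> sets \<mu>" and inv: "\<And>A. A \<in> SL \<Longrightarrow> defect E A = 0"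
  shows "prob E = 0 \<or> prob E = 1"
proof -
  interpret P: pair_sigma_finite "lborel :: (real ^ 'n ^ 'n) measure" \<mu> ..
  note [measurable] = E
  define Z where "Z \<nu> = {A :: real ^ 'n ^ 'n. 0 < det A \<and> act (normalize_det A) \<nu> \<notin> E}" for \<nu>
  define E' where "E' = {\<nu> \<in> growth_measures. emeasure lborel (Z \<nu>) = 0}"
  have g [measurable]: "(\<lambda>(A, \<nu>). act (normalize_det A) \<nu>) \<in> measurable (lborel \<Otimes>\<^sub>M \<mu>) \<mu>"
    using act_normalize_det_measurable
    by (simp add: measurable_cong_sets[OF sets_pair_measure_cong[OF sets_lborel refl] sets_mu])
  define Q where "Q = {x \<in> space (lborel \<Otimes>\<^sub>M \<mu>). 0 < det (fst x) \<and> act (normalize_det (fst x)) (snd x) \<notin> E}"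
  have g' [measurable]: "(\<lambda>x. act (normalize_det (fst x)) (snd x)) \<in> measurable (lborel \<Otimes>\<^sub>M \<mu>) \<mu>"
    using g by (simp add: split_beta')
  have Q [measurable]: "Q \<in> sets (lborel \<Otimes>\<^sub>M \<mu>)" unfolding Q_def by measurable
  have Q_Z: "(\<lambda>A. (A, \<nu>)) -` Q = Z \<nu>" if "\<nu> \<in> growth_measures" for \<nu>
    using that by (auto simp: Q_def Z_def space_pair_measure)
  have Z_sets: "Z \<nu> \<in> sets borel" if "\<nu> \<in> growth_measures" for \<nu>
    using sets_Pair2[OF Q, of \<nu>] Q_Z[OF that] by simp
  have "(\<lambda>\<nu>. emeasure lborel ((\<lambda>A. (A, \<nu>)) -` Q)) \<in> borel_measurable \<mu>"
    by (rule P.measurable_emeasure_Pair2[OF Q])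
  then have "{\<nu> \<in> space \<mu>. emeasure lborel ((\<lambda>A. (A, \<nu>)) -` Q) = 0} \<in> sets \<mu>"
    by measurable
  also have "{\<nu> \<in> space \<mu>. emeasure lborel ((\<lambda>A. (A, \<nu>)) -` Q) = 0} = E'"
    by (auto simp: E'_def Q_Z)
  finally have E' [measurable]: "E' \<in> sets \<mu>" .
  have null_iff: "emeasure lborel (Z \<nu>) = 0 \<longleftrightarrow> negligible (Z \<nu>)" if "\<nu> \<in> growth_measures" for \<nu>
  proof -
    have "Z \<nu> \<in> null_sets lborel \<longleftrightarrow> Z \<nu> \<in> null_sets (completion lborel)"
      using Z_sets[OF that] null_sets_completion_iff[of "Z \<nu>" lborel] by simp
    then show ?thesis using Z_sets[OF that] by (simp add: negligible_iff_null_sets null_sets_def[of lborel])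
  qed
  have one_side: "act h \<nu> \<in> E'" if h: "h \<in> SL" and \<nu>: "\<nu> \<in> E'" for h \<nu>
  proof -
    obtain k where k: "k \<in> SL" "h ** k = mat 1" "k ** h = mat 1" by (rule SL_inverse[OF h])
    have \<nu>g: "\<nu> \<in> growth_measures" "act h \<nu> \<in> growth_measures"
      using \<nu> h by (auto simp: E'_def act_growth_measures)
    \<comment> \<open>A matrix that is bad for \<open>act h \<nu>\<close> becomes bad for \<nu>
      after right multiplication by h.\<close>
    have "Z (act h \<nu>) \<subseteq> (\<lambda>A. A ** k) ` Z \<nu>"
    proof
      fix A assume A: "A \<in> Z (act h \<nu>)"
      then have "0 < det A" by (simp add: Z_def)
      then have "A ** h \<in> Z \<nu>"
        using A h sets_growth_measure[OF \<nu>g(1)]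
        by (simp add: Z_def act_act normalize_det_mult) (simp add: det_mul SL_def)
      moreover have "A = (A ** h) ** k" by (simp add: matrix_mul_assoc[symmetric] k)
      ultimately show "A \<in> (\<lambda>A. A ** k) ` Z \<nu>" by blast
    qed
    moreover have "negligible ((\<lambda>A. A ** k) ` Z \<nu>)"
      using \<nu> null_iff[OF \<nu>g(1)] by (intro negligible_right_mult) (simp add: E'_def)
    ultimately have "negligible (Z (act h \<nu>))" by (rule negligible_subset[rotated])
    then show ?thesis using \<nu>g(2) null_iff by (simp add: E'_def)
  qed
  have "act h ` E' = E'" if h: "h \<in> SL" for h
  proof -
    obtain k where k: "k \<in> SL" "h ** k = mat 1" "k ** h = mat 1" by (rule SL_inverse[OF h])
    have "act h (act k \<nu>) = \<nu>" if "\<nu> \<in> E'" for \<nu>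
      using that k by (simp add: E'_def act_act act_one sets_growth_measure)
    then have "\<nu> \<in> act h ` E'" if "\<nu> \<in> E'" for \<nu>
      using that one_side[OF k(1) that] by (metis imageI)
    with one_side[OF h] show ?thesis by blast
  qed
  then have E'_01: "emeasure \<mu> E' = 0 \<or> emeasure \<mu> E' = 1"
    using siegel E' by (auto simp: Siegel_measure_def SL_ergodic_def)
  \<comment> \<open>The pairs at which moving \<nu> changes membership in \<open>E\<close>: null
    over each A by assumption, hence null over almost every \<nu>.\<close>
  define W where "W = {x \<in> space (lborel \<Otimes>\<^sub>M \<mu>). act (normalize_det (fst x)) (snd x) \<in> E \<longleftrightarrow> snd x \<notin> E}"
  have W [measurable]: "W \<in> sets (lborel \<Otimes>\<^sub>M \<mu>)" unfolding W_def by measurable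
  have "emeasure \<mu> (Pair A -` W) = 0" for A
  proof -
    let ?B = "normalize_det A"
    have "Pair A -` W = (E - pre ?B E) \<union> (pre ?B E - E)"
      using sets_subset_growth[OF E] by (auto simp: W_def pre_def space_pair_measure)
    also have "emeasure \<mu> \<dots> \<le> emeasure \<mu> (E - pre ?B E) + emeasure \<mu> (pre ?B E - E)"
      using E by (intro emeasure_subadditive sets.Diff pre_sets normalize_det_SL)
    also have "\<dots> = 0"
      using inv[OF normalize_det_SL, of A] defect_swap[OF normalize_det_SL E, of A]
      by (simp add: emeasure_eq_measure defect_def)
    finally show ?thesis by simp
  qed
  then have "emeasure (lborel \<Otimes>\<^sub>M \<mu>) W = 0"
    by (subst emeasure_pair_measure_alt[OF W]) simp
  then have "W \<in> null_sets (lborel \<Otimes>\<^sub>M \<mu>)" using W by (simp add: null_sets_def)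
  moreover have "emeasure (lborel \<Otimes>\<^sub>M \<mu>) W = (\<integral>\<^sup>+\<nu>. emeasure lborel ((\<lambda>A. (A, \<nu>)) -` W) \<partial>\<mu>)"
    by (rule P.emeasure_pair_measure_alt2) measurable
  ultimately have "(\<integral>\<^sup>+\<nu>. emeasure lborel ((\<lambda>A. (A, \<nu>)) -` W) \<partial>\<mu>) = 0" by (simp add: null_sets_def)
  then have AE_W: "AE \<nu> in \<mu>. emeasure lborel ((\<lambda>A. (A, \<nu>)) -` W) = 0"
    using P.measurable_emeasure_Pair2[OF W] by (simp add: nn_integral_0_iff_AE)
  \<comment> \<open>Without this, a \<nu> outside \<open>E\<close> could belong to \<open>E'\<close>
    vacuously.\<close>
  have pos: "emeasure lborel {A :: real ^ 'n ^ 'n. 0 < det A} \<noteq> 0"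
  proof -
    have "open {A :: real ^ 'n ^ 'n. 0 < det A}"
      by (intro open_Collect_less continuous_intros continuous_on_id)
    moreover have "mat 1 \<in> {A :: real ^ 'n ^ 'n. 0 < det A}" by simp
    ultimately have "\<not> negligible {A :: real ^ 'n ^ 'n. 0 < det A}"
      using open_not_negligible by blast
    then show ?thesis
      using \<open>open _\<close> null_sets_completion_iff[of "{A :: real ^ 'n ^ 'n. 0 < det A}" lborel]
      by (auto simp: negligible_iff_null_sets null_sets_def[of lborel])
  qed
  have "AE \<nu> in \<mu>. \<nu> \<in> E \<longleftrightarrow> \<nu> \<in> E'"
    using AE_W AE_space
  proof eventually_elim
    case (elim \<nu>)
    then have \<nu>: "\<nu> \<in> growth_measures" by simp
    have Wm: "(\<lambda>A. (A, \<nu>)) -` W \<in> sets lborel" using sets_Pair2[OF W] by simp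
    show ?case
    proof
      assume "\<nu> \<in> E"
      then have "Z \<nu> \<subseteq> (\<lambda>A. (A, \<nu>)) -` W" using \<nu> by (auto simp: Z_def W_def space_pair_measure)
      then have "emeasure lborel (Z \<nu>) \<le> 0" using emeasure_mono[OF _ Wm, of "Z \<nu>"] elim(1) by simp
      then show "\<nu> \<in> E'" using \<nu> by (simp add: E'_def)
    next
      assume *: "\<nu> \<in> E'"
      show "\<nu> \<in> E"
      proof (rule ccontr)
        assume "\<nu> \<notin> E"
        then have "{A. 0 < det A} \<subseteq> Z \<nu> \<union> (\<lambda>A. (A, \<nu>)) -` W"
          using \<nu> by (auto simp: Z_def W_def space_pair_measure)
        then have "emeasure lborel {A :: real ^ 'n ^ 'n. 0 < det A} \<le> emeasure lborel (Z \<nu> \<union> (\<lambda>A. (A, \<nu>)) -` W)"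
          using Z_sets[OF \<nu>] Wm by (intro emeasure_mono) auto
        also have "\<dots> \<le> emeasure lborel (Z \<nu>) + emeasure lborel ((\<lambda>A. (A, \<nu>)) -` W)"
          using Z_sets[OF \<nu>] Wm by (intro emeasure_subadditive) auto
        also have "\<dots> = 0" using elim(1) * by (simp add: E'_def)
        finally show False using pos by simp
      qed
    qed
  qed
  then have "emeasure \<mu> E = emeasure \<mu> E'" using E E' by (intro emeasure_eq_AE) auto
  then show ?thesis using E'_01 by (auto simp: emeasure_eq_measure)
qed

theorem ergodic_transvection:
  assumes ij: "i \<noteq> j" shows "ergodic_mpt \<mu> (act (transvection i j 1))"
proof -
  interpret mpt \<mu> "act (transvection i j 1)" by (rule mpt_act[OF transvection_in_SL[OF ij]])
  show ?thesis
  proof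
    fix E assume E: "E \<in> sets \<mu>" and inv: "act (transvection i j 1) -` E \<inter> space \<mu> = E"
    have "pre (transvection i j 1) E = E"
      using inv by (simp add: pre_def vimage_def Int_def conj_commute)
    then have "defect E (transvection i j 1) = 0" by (simp add: defect_def)
    then show "prob E = 0 \<or> prob E = 1"
      using defect_SL_eq_0[OF ij E] by (intro prob_almost_invariant[OF E]) auto
  qed
qed

end

section \<open>Invariant measures on Euclidean space\<close>

lemma borel_measurable_transvection_mult_vec [measurable]:
  fixes i j :: "'n::finite"
  assumes "i \<noteq> j"
  shows "(\<lambda>(s, x). transvection i j s *v x) \<in> borel_measurable (borel \<Otimes>\<^sub>M borel)"
proof -
  have eq: "transvection i j s *v x = x + (s * x $ j) *\<^sub>R axis i 1" for s and x :: "real ^ 'n"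
    using assms by (auto simp: vec_eq_iff transvection_mult_vec axis_def)
  have "continuous_on UNIV (\<lambda>p :: real \<times> (real ^ 'n). snd p + (fst p * snd p $ j) *\<^sub>R axis i 1 :: real ^ 'n)"
    by (intro continuous_intros)
  then have "(\<lambda>p :: real \<times> (real ^ 'n). snd p + (fst p * snd p $ j) *\<^sub>R axis i 1 :: real ^ 'n) \<in> borel_measurable borel"
    by (rule borel_measurable_continuous_onI)
  then show ?thesis unfolding eq by (simp add: borel_prod split_beta')
qed

lemma borel_measurable_component [measurable]: "(\<lambda>x :: real ^ 'n. x $ i) \<in> borel_measurable borel"
  by (intro borel_measurable_continuous_onI continuous_intros)

text \<open>
  Where \<open>x $ j \<noteq> 0\<close>, the transvections move the coordinate \<open>x $ i\<close> along lines; reparametrizing them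
  by \<open>\<tau> / x $ j\<close> turns the flow into a translation.
\<close>

theorem SL_invariant_measure_eq:
  fixes m :: "(real ^ 'n) measure"
  assumes card: "CARD('n) > 1" and sets_m: "sets m = sets borel" and sf: "sigma_finite_measure m"
    and inv: "\<And>A. A \<in> SL \<Longrightarrow> distr m borel ((*v) A) = m"
    and zero: "emeasure m {0} = 0"
  shows "\<exists>c::real. 0 \<le> c \<and> m = scale_measure (ennreal c) lborel"
proof (rule basis_translation_invariant_measure_eq[OF sf sets_m])
  note [measurable_cong] = sets_m
  have sp [simp]: "space m = UNIV" using sets_eq_imp_space_eq[OF sets_m] by simp
  have u_meas: "(\<lambda>(s, x). transvection i j s *v x) \<in> measurable (borel \<Otimes>\<^sub>M m) m" if "i \<noteq> j" for i j
    using borel_measurable_transvection_mult_vec[OF that]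
    by (simp add: measurable_cong_sets[OF sets_pair_measure_cong[OF refl sets_m] sets_m])
  have u_inv: "distr m m ((*v) (transvection i j s)) = m" if "i \<noteq> j" for i j s
    using inv[OF transvection_in_SL[OF that], of s] distr_cong[OF refl sets_m refl, of m "(*v) (transvection i j s)"] by simp
  \<comment> \<open>A point with \<open>x $ j \<noteq> 0\<close> moves along its orbit at constant
    nonzero speed in coordinate i and meets the hyperplane at one time only.\<close>
  have null1: "emeasure m {x. x $ i = 0 \<and> x $ j \<noteq> 0} = 0" if ij: "i \<noteq> j" for i j
  proof (rule null_set_of_null_orbit_times[OF sf u_meas[OF ij] _ u_inv[OF ij]])
    show "{x. x $ i = 0 \<and> x $ j \<noteq> 0} \<in> sets m" by measurable
    fix x :: "real ^ 'n"
    have "{s. transvection i j s *v x \<in> {x. x $ i = 0 \<and> x $ j \<noteq> 0}} \<subseteq> {- (x $ i) / x $ j}"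
      using ij by (auto simp: transvection_mult_vec field_simps)
    then show "countable {s. transvection i j s *v x \<in> {x. x $ i = 0 \<and> x $ j \<noteq> 0}}"
      by (rule countable_subset) simp
  qed
  have null: "AE x in m. x $ j \<noteq> 0" for j
  proof -
    \<comment> \<open>The hyperplane splits into the origin, null by hypothesis, and pieces where
      some other coordinate drives a flow across it.\<close>
    have "{x :: real ^ 'n. x $ j = 0} = {0} \<union> (\<Union>k\<in>UNIV - {j}. {x. x $ j = 0 \<and> x $ k \<noteq> 0})"
      by (auto simp: vec_eq_iff) (metis DiffI UNIV_I singletonD)
    moreover have "{0} \<in> null_sets m" using zero by (simp add: null_sets_def sets_m)
    then have "{0} \<union> (\<Union>k\<in>UNIV - {j}. {x. x $ j = 0 \<and> x $ k \<noteq> 0}) \<in> null_sets m"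
    proof (rule null_sets.Un)
      show "(\<Union>k\<in>UNIV - {j}. {x. x $ j = 0 \<and> x $ k \<noteq> 0}) \<in> null_sets m"
      proof (rule null_sets_UN')
        fix k assume "k \<in> UNIV - {j}"
        then show "{x. x $ j = 0 \<and> x $ k \<noteq> 0} \<in> null_sets m"
          using null1[of j k] by (auto simp: null_sets_def)
      qed (simp add: countable_finite)
    qed
    ultimately have "{x. x $ j = 0} \<in> null_sets m" by (simp only:)
    then show ?thesis by (rule AE_I') auto
  qed
  fix b :: "real ^ 'n" and \<tau> :: real assume "b \<in> Basis"
  then obtain i where b: "b = axis i 1" by (auto simp: Basis_vec_def)
  obtain j where "j \<noteq> i" using ex_other_index[OF card] by blast
  then have ij: "i \<noteq> j" by simp
  show "distr m m (\<lambda>x. x + \<tau> *\<^sub>R b) = m"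
  proof (rule measure_eqI)
    fix E assume "E \<in> sets (distr m m (\<lambda>x. x + \<tau> *\<^sub>R b))"
    then have E [measurable]: "E \<in> sets borel" by (simp add: sets_m)
    let ?X = "{x :: real ^ 'n. x $ j \<noteq> 0}"
    have tr: "transvection i j (\<tau> / x $ j) *v x = x + \<tau> *\<^sub>R b" if "x \<in> ?X" for x
      using that ij by (auto simp: vec_eq_iff transvection_mult_vec b axis_def)
    have "emeasure (distr m m (\<lambda>x. x + \<tau> *\<^sub>R b)) E = emeasure m {x. x + \<tau> *\<^sub>R b \<in> E}"
      by (subst emeasure_distr) (auto simp: sets_m vimage_def)
    also have "\<dots> = emeasure m {x\<in>?X. transvection i j (\<tau> / x $ j) *v x \<in> E}"
    proof (rule emeasure_eq_AE)
      have "{x\<in>?X. transvection i j (\<tau> / x $ j) *v x \<in> E} = {x. x $ j \<noteq> 0 \<and> x + \<tau> *\<^sub>R b \<in> E}"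
        by (intro Collect_cong conj_cong) (auto simp: tr)
      also have "\<dots> \<in> sets m" by measurable
      finally show "{x\<in>?X. transvection i j (\<tau> / x $ j) *v x \<in> E} \<in> sets m" .
      show "{x. x + \<tau> *\<^sub>R b \<in> E} \<in> sets m" by measurable
      show "AE x in m. (x \<in> {x. x + \<tau> *\<^sub>R b \<in> E}) = (x \<in> {x\<in>?X. transvection i j (\<tau> / x $ j) *v x \<in> E})"
        using null[of j] by eventually_elim (simp add: tr)
    qed
    also have "\<dots> = emeasure m (?X \<inter> E)"
    \<comment> \<open>The slope \<open>x $ i / x $ j\<close> advances at unit speed along the flow,
      and the time \<open>\<tau> / x $ j\<close> is constant on each orbit.\<close>
    proof (rule emeasure_flow_reparametrized[where p = "\<lambda>x. x $ i / x $ j", OF sf u_meas[OF ij]])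
      show "(\<lambda>x. x $ i / x $ j) \<in> borel_measurable m" "(\<lambda>x. \<tau> / x $ j) \<in> borel_measurable m"
        by measurable
      show "?X \<in> sets m" by measurable
      show "E \<in> sets m" by (simp add: sets_m)
    qed (use ij u_inv in \<open>auto simp: transvection_mult_vec transvection_0 transvection_add matrix_vector_mul_assoc add_divide_distrib\<close>)
    also have "\<dots> = emeasure m E"
    proof (rule emeasure_eq_AE)
      show "AE x in m. (x \<in> ?X \<inter> E) = (x \<in> E)" using null[of j] by eventually_elim simp
      show "?X \<inter> E \<in> sets m" "E \<in> sets m" by measurable
    qed
    finally show "emeasure (distr m m (\<lambda>x. x + \<tau> *\<^sub>R b)) E = emeasure m E" .
  qed simp
qed

section \<open>Mixtures of measures\<close>

text \<open>The components may have infinite mass, so the mixture is built from its set function;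
  \<open>emeasure_mixture\<close> verifies countable additivity.\<close>

definition mixture :: "'a measure \<Rightarrow> ('a \<Rightarrow> 'b measure) \<Rightarrow> 'b measure \<Rightarrow> 'b measure" where
  "mixture M K N = measure_of (space N) (sets N) (\<lambda>E. \<integral>\<^sup>+x. emeasure (K x) E \<partial>M)"

lemma sets_mixture [simp]: "sets (mixture M K N) = sets N"
  by (simp add: mixture_def sets.sigma_sets_eq)

lemma space_mixture [simp]: "space (mixture M K N) = space N"
  by (simp add: mixture_def)

lemma borel_measurable_mixture [simp]: "borel_measurable (mixture M K N) = borel_measurable N"
  by (rule measurable_cong_sets) simp_all

locale measure_mixture =
  fixes M :: "'a measure" and K :: "'a \<Rightarrow> 'b measure" and N :: "'b measure"
  assumes sets_K: "\<And>x. x \<in> space M \<Longrightarrow> sets (K x) = sets N"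
    and meas_K: "\<And>E. E \<in> sets N \<Longrightarrow> (\<lambda>x. emeasure (K x) E) \<in> borel_measurable M"
begin

lemma emeasure_mixture:
  assumes E: "E \<in> sets N"
  shows "emeasure (mixture M K N) E = (\<integral>\<^sup>+x. emeasure (K x) E \<partial>M)"
proof (rule emeasure_measure_of[OF mixture_def])
  show "sets N \<subseteq> Pow (space N)" by (rule sets.space_closed)
  show "E \<in> sets (mixture M K N)" using E by simp
  show "positive (sets (mixture M K N)) (\<lambda>E. \<integral>\<^sup>+x. emeasure (K x) E \<partial>M)"
    by (simp add: positive_def)
  show "countably_additive (sets (mixture M K N)) (\<lambda>E. \<integral>\<^sup>+x. emeasure (K x) E \<partial>M)"
  proof (rule countably_additiveI)
    fix A :: "nat \<Rightarrow> 'b set"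
    assume A: "range A \<subseteq> sets (mixture M K N)" "disjoint_family A"
    have "(\<Sum>i. \<integral>\<^sup>+x. emeasure (K x) (A i) \<partial>M) = (\<integral>\<^sup>+x. (\<Sum>i. emeasure (K x) (A i)) \<partial>M)"
      using A(1) by (intro nn_integral_suminf[symmetric] meas_K) auto
    also have "\<dots> = (\<integral>\<^sup>+x. emeasure (K x) (\<Union>i. A i) \<partial>M)"
    proof (rule nn_integral_cong)
      fix x assume "x \<in> space M"
      then show "(\<Sum>i. emeasure (K x) (A i)) = emeasure (K x) (\<Union>i. A i)"
        using A sets_K[of x] by (intro suminf_emeasure) auto
    qed
    finally show "(\<Sum>i. \<integral>\<^sup>+x. emeasure (K x) (A i) \<partial>M) = (\<integral>\<^sup>+x. emeasure (K x) (\<Union>i. A i) \<partial>M)" .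
  qed
qed

text \<open>Measurability is proved together with the formula, since the induction over
  \<open>f\<close> uses it at multiples, sums and monotone limits.\<close>

lemma nn_integral_mixture_measurable:
  assumes "f \<in> borel_measurable N"
  shows "(\<integral>\<^sup>+y. f y \<partial>mixture M K N) = (\<integral>\<^sup>+x. (\<integral>\<^sup>+y. f y \<partial>K x) \<partial>M) \<and>
    (\<lambda>x. \<integral>\<^sup>+y. f y \<partial>K x) \<in> borel_measurable M"
  using assms
proof (induction f rule: borel_measurable_induct)
  case (cong f g)
  have eq: "(\<integral>\<^sup>+y. f y \<partial>K x) = (\<integral>\<^sup>+y. g y \<partial>K x)" if "x \<in> space M" for x
    using cong(3) sets_eq_imp_space_eq[OF sets_K[OF that]] by (intro nn_integral_cong) simp
  have "(\<integral>\<^sup>+y. f y \<partial>mixture M K N) = (\<integral>\<^sup>+y. g y \<partial>mixture M K N)"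
    using cong(3) by (intro nn_integral_cong) simp
  moreover have "(\<integral>\<^sup>+x. (\<integral>\<^sup>+y. f y \<partial>K x) \<partial>M) = (\<integral>\<^sup>+x. (\<integral>\<^sup>+y. g y \<partial>K x) \<partial>M)"
    by (intro nn_integral_cong eq)
  moreover have "(\<lambda>x. \<integral>\<^sup>+y. g y \<partial>K x) \<in> borel_measurable M \<longleftrightarrow> (\<lambda>x. \<integral>\<^sup>+y. f y \<partial>K x) \<in> borel_measurable M"
    by (intro measurable_cong) (simp add: eq)
  ultimately show ?case using cong(4) by simp
next
  case (set A)
  have "(\<integral>\<^sup>+y. indicator A y \<partial>K x) = emeasure (K x) A" if "x \<in> space M" for x
    using set sets_K[OF that] by simp
  then show ?case using set meas_K[OF set]
    by (simp add: emeasure_mixture cong: nn_integral_cong measurable_cong)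
next
  case (mult f c)
  have "(\<integral>\<^sup>+y. c * f y \<partial>K x) = c * (\<integral>\<^sup>+y. f y \<partial>K x)" if "x \<in> space M" for x
    using mult(2) sets_K[OF that] by (intro nn_integral_cmult) (simp cong: measurable_cong_sets)
  moreover have "(\<integral>\<^sup>+y. c * f y \<partial>mixture M K N) = c * (\<integral>\<^sup>+y. f y \<partial>mixture M K N)"
    using mult(2) by (intro nn_integral_cmult) simp
  moreover have "(\<integral>\<^sup>+x. c * (\<integral>\<^sup>+y. f y \<partial>K x) \<partial>M) = c * (\<integral>\<^sup>+x. (\<integral>\<^sup>+y. f y \<partial>K x) \<partial>M)"
    using mult(4) by (intro nn_integral_cmult) simp
  moreover have "(\<lambda>x. c * (\<integral>\<^sup>+y. f y \<partial>K x)) \<in> borel_measurable M"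
    using mult(4) by (intro borel_measurable_times_ennreal) simp_all
  ultimately show ?case using mult(4) by (simp cong: nn_integral_cong measurable_cong)
next
  case (add f g)
  have "(\<integral>\<^sup>+y. f y + g y \<partial>K x) = (\<integral>\<^sup>+y. f y \<partial>K x) + (\<integral>\<^sup>+y. g y \<partial>K x)" if "x \<in> space M" for x
    using add sets_K[OF that] by (intro nn_integral_add) (simp_all cong: measurable_cong_sets)
  moreover have "(\<integral>\<^sup>+y. f y + g y \<partial>mixture M K N) = (\<integral>\<^sup>+y. f y \<partial>mixture M K N) + (\<integral>\<^sup>+y. g y \<partial>mixture M K N)"
    using add by (intro nn_integral_add) simp_all
  moreover have "(\<integral>\<^sup>+x. (\<integral>\<^sup>+y. f y \<partial>K x) + (\<integral>\<^sup>+y. g y \<partial>K x) \<partial>M) =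
      (\<integral>\<^sup>+x. (\<integral>\<^sup>+y. f y \<partial>K x) \<partial>M) + (\<integral>\<^sup>+x. (\<integral>\<^sup>+y. g y \<partial>K x) \<partial>M)"
    using add by (intro nn_integral_add) simp_all
  moreover have "(\<lambda>x. (\<integral>\<^sup>+y. f y \<partial>K x) + (\<integral>\<^sup>+y. g y \<partial>K x)) \<in> borel_measurable M"
    using add by (intro borel_measurable_add) simp_all
  ultimately show ?case using add by (simp add: add.commute[of "g _"] cong: nn_integral_cong measurable_cong)
next
  case (seq U)
  have mix: "(\<integral>\<^sup>+y. (SUP i. U i y) \<partial>mixture M K N) = (SUP i. \<integral>\<^sup>+y. U i y \<partial>mixture M K N)"
    using seq by (intro nn_integral_monotone_convergence_SUP) (simp_all cong: measurable_cong_sets)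
  have eq: "(\<integral>\<^sup>+y. (SUP i. U i y) \<partial>K x) = (SUP i. \<integral>\<^sup>+y. U i y \<partial>K x)" if "x \<in> space M" for x
    using seq sets_K[OF that] by (intro nn_integral_monotone_convergence_SUP) (simp_all cong: measurable_cong_sets)
  have inc: "incseq (\<lambda>i x. \<integral>\<^sup>+y. U i y \<partial>K x)"
    using \<open>incseq U\<close> by (auto simp: incseq_def le_fun_def intro!: nn_integral_mono)
  have "(\<integral>\<^sup>+x. (SUP i. \<integral>\<^sup>+y. U i y \<partial>K x) \<partial>M) = (SUP i. \<integral>\<^sup>+x. (\<integral>\<^sup>+y. U i y \<partial>K x) \<partial>M)"
    using seq inc by (intro nn_integral_monotone_convergence_SUP) simp_all
  moreover have "(\<lambda>x. SUP i. \<integral>\<^sup>+y. U i y \<partial>K x) \<in> borel_measurable M"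
    using seq by (intro borel_measurable_SUP) simp_all
  ultimately show ?case using seq mix eq
    by (simp add: SUP_apply[abs_def] image_comp o_def cong: nn_integral_cong measurable_cong)
qed

lemma nn_integral_mixture:
  "f \<in> borel_measurable N \<Longrightarrow> (\<integral>\<^sup>+y. f y \<partial>mixture M K N) = (\<integral>\<^sup>+x. (\<integral>\<^sup>+y. f y \<partial>K x) \<partial>M)"
  using nn_integral_mixture_measurable by blast

end

section \<open>Integrability of counting functions\<close>

text \<open>The slope range is half open so that consecutive sectors tile. For bounded
  \<open>P\<close>, the slope and the coordinates other than i control the whole vector.\<close>

definition sector :: "'n \<Rightarrow> 'n \<Rightarrow> real \<Rightarrow> real \<Rightarrow> ('n \<Rightarrow> real set) \<Rightarrow> (real ^ 'n) set" where
  "sector i j a b P = {x. x $ j \<noteq> 0 \<and> a \<le> x $ i / x $ j \<and> x $ i / x $ j < b \<and> (\<forall>l. l \<noteq> i \<longrightarrow> x $ l \<in> P l)}"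

lemma sector_borel:
  assumes [measurable]: "\<And>l. P l \<in> sets borel"
  shows "sector i j a b P \<in> sets (borel :: (real ^ 'n) measure)"
proof -
  have "sector i j a b P = {x \<in> space borel. x $ j \<noteq> 0 \<and> a \<le> x $ i / x $ j \<and> x $ i / x $ j < b \<and> (\<forall>l. l \<noteq> i \<longrightarrow> x $ l \<in> P l)}"
    by (simp add: sector_def)
  also have "\<dots> \<in> sets borel" by measurable
  finally show ?thesis .
qed

lemma sector_transvection:
  "i \<noteq> j \<Longrightarrow> transvection i j s *v x \<in> sector i j a b P \<longleftrightarrow> x \<in> sector i j (a - s) (b - s) P"
  by (auto simp: sector_def transvection_mult_vec add_divide_distrib split: if_splits)

lemma sector_bounded:
  fixes P :: "'n::finite \<Rightarrow> real set"
  assumes ij: "i \<noteq> j" and "\<And>l. bounded (P l)" shows "bounded (sector i j a b P)"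
proof -
  have "\<exists>f. \<forall>l. 0 \<le> f l \<and> (\<forall>y\<in>P l. \<bar>y\<bar> \<le> f l)"
  proof (rule choice, rule allI)
    fix l show "\<exists>B. 0 \<le> B \<and> (\<forall>y\<in>P l. \<bar>y\<bar> \<le> B)"
      using assms(2)[of l] unfolding bounded_pos by (auto intro: less_imp_le)
  qed
  then obtain f where f: "\<And>l. 0 \<le> f l" "\<And>l y. y \<in> P l \<Longrightarrow> \<bar>y\<bar> \<le> f l" by blast
  have "norm x \<le> (\<Sum>l\<in>UNIV. f l) + (\<bar>a\<bar> + \<bar>b\<bar>) * f j" if x: "x \<in> sector i j a b P" for x
  proof -
    have xl: "\<bar>x $ l\<bar> \<le> f l" if "l \<noteq> i" for l using x f(2) that by (auto simp: sector_def)
    have "x $ j \<noteq> 0" "\<bar>x $ i / x $ j\<bar> \<le> \<bar>a\<bar> + \<bar>b\<bar>" using x by (auto simp: sector_def)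
    then have "\<bar>x $ i\<bar> \<le> (\<bar>a\<bar> + \<bar>b\<bar>) * \<bar>x $ j\<bar>" by (simp add: pos_divide_le_eq)
    also have "\<dots> \<le> (\<bar>a\<bar> + \<bar>b\<bar>) * f j" using xl[of j] ij by (intro mult_left_mono) auto
    finally have xi: "\<bar>x $ i\<bar> \<le> (\<bar>a\<bar> + \<bar>b\<bar>) * f j" .
    have "norm x \<le> (\<Sum>l\<in>UNIV. \<bar>x $ l\<bar>)" by (rule norm_le_l1_cart)
    also have "\<dots> \<le> (\<Sum>l\<in>UNIV. f l + (if l = i then (\<bar>a\<bar> + \<bar>b\<bar>) * f j else 0))"
      using xl xi f(1)[of i] by (intro sum_mono) auto
    finally show ?thesis by (simp add: sum.distrib)
  qed
  then show ?thesis unfolding bounded_iff by blast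
qed

lemma sector_split: "a \<le> b \<Longrightarrow> b \<le> c \<Longrightarrow> sector i j a c P = sector i j a b P \<union> sector i j b c P"
  by (auto simp: sector_def)

lemma sector_disjoint: "sector i j a b P \<inter> sector i j b c P = {}"
  by (auto simp: sector_def)

text \<open>The slope ranges [-k, 1-k) for k < n tile [1-n, 1).\<close>

lemma sum_emeasure_sector:
  assumes "sets \<nu> = sets borel" "\<And>l. P l \<in> sets borel"
  shows "(\<Sum>k<n. emeasure \<nu> (sector i j (- real k) (1 - real k) P)) = emeasure \<nu> (sector i j (1 - real n) 1 P)"
proof (induction n)
  case 0
  have "sector i j 1 1 P = {}" by (auto simp: sector_def)
  then show ?case by simp
next
  case (Suc n)
  have "emeasure \<nu> (sector i j (1 - real (Suc n)) 1 P) =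
      emeasure \<nu> (sector i j (- real n) (1 - real n) P) + emeasure \<nu> (sector i j (1 - real n) 1 P)"
    using sector_borel[OF assms(2)] assms(1)
    by (subst sector_split[of _ "1 - real n"]) (auto intro!: plus_emeasure[symmetric] sector_disjoint simp: sector_disjoint)
  then show ?case using Suc by (simp add: add.commute)
qed

text \<open>For positive R this is division by R followed by multiplication of coordinate i by
  \<open>R ^ CARD('n)\<close>: the determinant is 1, and slopes grow by that power.\<close>

definition stretch :: "'n::finite \<Rightarrow> real \<Rightarrow> 'n \<Rightarrow> real" where
  "stretch i R l = (if l = i then R ^ (CARD('n) - 1) else 1 / R)"

lemma stretch_SL:
  assumes "0 < R" shows "diag (stretch i R) \<in> SL"
proof -
  have "prod (stretch i R) UNIV = R ^ (CARD('a) - 1) * (\<Prod>l\<in>UNIV - {i}. 1 / R)"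
    by (subst prod.remove[of UNIV i]) (auto simp: stretch_def)
  also have "\<dots> = 1" using assms by (simp add: card_Diff_singleton power_divide)
  finally show ?thesis by (simp add: SL_def det_diag)
qed

text \<open>
  The stretched sector is the dilate by \<open>R\<close> of a fixed sector: this turns averages along a
  unipotent orbit into counts over dilates.
\<close>

lemma sector_stretch:
  fixes i j :: "'n::finite"
  assumes "i \<noteq> j" "0 < R"
  shows "diag (stretch i R) *v x \<in> sector i j (R ^ CARD('n) * a) (R ^ CARD('n) * b) P \<longleftrightarrow> x /\<^sub>R R \<in> sector i j a b P"
proof -
  let ?y = "diag (stretch i R) *v x" and ?z = "x /\<^sub>R R"
  have T: "R ^ CARD('n) = R ^ (CARD('n) - 1) * R" "0 < R ^ CARD('n)"
    using power_minus_mult[of "CARD('n)" R] assms(2) by simp_all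
  have y: "?y $ l = ?z $ l" if "l \<noteq> i" for l
    using that by (simp add: stretch_def divide_inverse_commute)
  have z: "?z $ i / ?z $ j = x $ i / x $ j" using assms(2) by simp
  have "?y $ i / ?y $ j = R ^ CARD('n) * (?z $ i / ?z $ j)"
    unfolding z T(1) using assms by (simp add: stretch_def)
  moreover have "?y $ j = ?z $ j" using y assms(1) by metis
  moreover have "(\<forall>l. l \<noteq> i \<longrightarrow> ?y $ l \<in> P l) \<longleftrightarrow> (\<forall>l. l \<noteq> i \<longrightarrow> ?z $ l \<in> P l)" using y by metis
  ultimately show ?thesis
    unfolding sector_def mem_Collect_eq
    by (simp only: mult_le_cancel_left_pos[OF T(2)] mult_less_cancel_left_pos[OF T(2)])
qed

context siegel
begin

lemma measurable_measure_mu [measurable]: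
  "E \<in> sets borel \<Longrightarrow> (\<lambda>\<nu>. measure \<nu> E) \<in> borel_measurable \<mu>"
  using borel_measurable_emeasure_growth_measures[of E] unfolding measure_def by simp

lemma funpow_act:
  fixes \<nu> :: "(real ^ 'n) measure"
  assumes "i \<noteq> j" "\<nu> \<in> growth_measures"
  shows "(act (transvection i j 1) ^^ k) \<nu> = act (transvection i j (real k)) \<nu>"
proof (induction k)
  case (Suc k)
  show ?case using assms Suc
    by (simp add: act_act sets_growth_measure transvection_add)
qed (use assms in \<open>simp add: transvection_0 act_one sets_growth_measure\<close>)

lemma measure_act:
  fixes \<nu> :: "(real ^ 'n) measure"
  assumes "\<nu> \<in> growth_measures" "E \<in> sets borel"
  shows "measure (act A \<nu>) E = measure \<nu> {x. A *v x \<in> E}"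
  using assms by (simp add: measure_def emeasure_act sets_growth_measure)

lemma sum_measure_orbit_sector:
  fixes \<nu> :: "(real ^ 'n) measure"
  assumes ij: "i \<noteq> j" and \<nu>: "\<nu> \<in> growth_measures" and P: "\<And>l. P l \<in> sets borel" "\<And>l. bounded (P l)"
  shows "(\<Sum>k<n. measure ((act (transvection i j 1) ^^ k) \<nu>) (sector i j 0 1 P)) = measure \<nu> (sector i j (1 - real n) 1 P)"
proof -
  have fin: "emeasure \<nu> (sector i j a b P) = ennreal (measure \<nu> (sector i j a b P))" for a b
    using growth_measure_bounded_finite[OF \<nu> sector_bounded[OF ij P(2)]]
    by (intro emeasure_eq_ennreal_measure) (simp add: less_top)
  have "(\<Sum>k<n. measure ((act (transvection i j 1) ^^ k) \<nu>) (sector i j 0 1 P)) =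
      (\<Sum>k<n. measure \<nu> (sector i j (- real k) (1 - real k) P))"
    by (intro sum.cong refl)
      (simp add: funpow_act[OF ij \<nu>] measure_act[OF \<nu> sector_borel[OF P(1)]] sector_transvection[OF ij])
  moreover have "ennreal (\<Sum>k<n. measure \<nu> (sector i j (- real k) (1 - real k) P)) = ennreal (measure \<nu> (sector i j (1 - real n) 1 P))"
    using sum_emeasure_sector[where P = P and n = n and i = i and j = j, OF sets_growth_measure[OF \<nu>] P(1)]
    by (subst sum_ennreal[symmetric]) (auto simp: fin)
  ultimately show ?thesis by (simp add: sum_nonneg)
qed

text \<open>With \<open>R ^ CARD('n) = n\<close>, the sector of n unit slopes is pulled back into
  the R-dilate of the fixed sector with slopes in [-1, 1), hence into a ball of radius R K. The
  volume factor \<open>R ^ CARD('n)\<close> then cancels the divisor n.\<close>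

lemma orbit_sector_le_growth_bound:
  fixes \<nu> :: "(real ^ 'n) measure"
  assumes ij: "i \<noteq> j" and \<nu>: "\<nu> \<in> growth_measures" and P: "\<And>l. P l \<in> sets borel" "\<And>l. bounded (P l)"
    and K: "0 < K" "sector i j (- 1) 1 P \<subseteq> ball 0 K"
  defines "g \<equiv> \<lambda>n. diag (stretch i (root CARD('n) (real n)))"
  assumes n: "0 < n"
  shows "measure (act (g n) \<nu>) (sector i j (1 - real n) 1 P) / n \<le> K ^ CARD('n) * enn2real (growth_bound \<nu>)"
proof -
  let ?R = "root CARD('n) (real n)"
  have R: "0 < ?R" "?R ^ CARD('n) = n" using n by (simp_all add: real_root_pow_pos2)
  have "1 \<le> real n" using n by simp
  have "measure (act (g n) \<nu>) (sector i j (1 - real n) 1 P) =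
      measure \<nu> {x. g n *v x \<in> sector i j (1 - real n) 1 P}"
    by (rule measure_act[OF \<nu> sector_borel[OF P(1)]])
  also have "\<dots> \<le> measure \<nu> (ball 0 (?R * K))"
  proof (rule measure_mono_fmeasurable)
    show "{x. g n *v x \<in> sector i j (1 - real n) 1 P} \<subseteq> ball 0 (?R * K)"
    proof
      fix x assume "x \<in> {x. g n *v x \<in> sector i j (1 - real n) 1 P}"
      then have "g n *v x \<in> sector i j (?R ^ CARD('n) * - 1) (?R ^ CARD('n) * 1) P"
        using \<open>1 \<le> real n\<close> unfolding sector_def R(2) mem_Collect_eq
        by (elim conjE, intro conjI) (assumption | linarith)+
      then have "x /\<^sub>R ?R \<in> sector i j (- 1) 1 P"
        unfolding g_def by (rule iffD1[OF sector_stretch[OF ij R(1)]])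
      then have "norm (x /\<^sub>R ?R) < K" using K(2) by auto
      then show "x \<in> ball 0 (?R * K)" using R(1) by (simp add: field_simps)
    qed
    have "{x \<in> space borel. g n *v x \<in> sector i j (1 - real n) 1 P} \<in> sets borel"
      using sector_borel[OF P(1)] by measurable
    then show "{x. g n *v x \<in> sector i j (1 - real n) 1 P} \<in> sets \<nu>"
      by (simp add: sets_growth_measure[OF \<nu>])
    show "ball 0 (?R * K) \<in> fmeasurable \<nu>"
      using growth_measure_bounded_finite[OF \<nu> bounded_ball] by (intro fmeasurableI) (auto simp: sets_growth_measure[OF \<nu>])
  qed
  also have "\<dots> \<le> enn2real (growth_bound \<nu> * ennreal ((?R * K) ^ CARD('n)))"
    unfolding measure_def using growth_bound_finite[OF \<nu>] R(1) K(1)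
    by (intro enn2real_mono emeasure_ball_le_growth_bound) (auto simp: ennreal_mult_less_top)
  also have "\<dots> = n * (K ^ CARD('n) * enn2real (growth_bound \<nu>))"
    using R K(1) by (simp add: enn2real_mult power_mult_distrib)
  finally show ?thesis using n by (simp add: pos_divide_le_eq mult.commute)
qed

text \<open>Truncations of \<open>f\<close> are integrable, so their orbit averages converge to
  their means. Moved by \<open>g n\<close>, these averages are dominated by counts in a ball of
  comparable volume, hence by a constant times the growth bound. So the truncated means are bounded,
  and monotone convergence removes the truncation.\<close>

lemma sector_intensity_finite:
  assumes ij: "i \<noteq> j" and P: "\<And>l. P l \<in> sets borel" "\<And>l. bounded (P l)"
  shows "(\<integral>\<^sup>+\<nu>. emeasure \<nu> (sector i j 0 1 P) \<partial>\<mu>) < \<infinity>"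
proof -
  let ?T = "act (transvection i j 1)"
  interpret T: ergodic_mpt \<mu> ?T by (rule ergodic_transvection[OF ij])
  define f where "f \<nu> = measure \<nu> (sector i j 0 1 P)" for \<nu>
  have [measurable]: "f \<in> borel_measurable \<mu>"
    unfolding f_def using sector_borel[OF P(1)] by measurable
  obtain K where K: "0 < K" "sector i j (- 1) 1 P \<subseteq> ball 0 K"
    using bounded_subset_ballD[OF sector_bounded[OF ij, of P "- 1" 1], of 0] P(2) by blast
  define g where "g n = diag (stretch i (root CARD('n) (real n)))" for n :: nat
  have g: "g (Suc n) \<in> SL" for n unfolding g_def by (intro stretch_SL) simp
  have bound: "AE \<nu> in \<mu>. (\<integral>\<nu>. min (f \<nu>) (real m) \<partial>\<mu>) \<le> K ^ CARD('n) * enn2real (growth_bound \<nu>)" for m :: nat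
  proof -
    define h where "h \<nu> = min (f \<nu>) (real m)" for \<nu>
    have h_int: "integrable \<mu> h"
      unfolding h_def
    proof (rule integrable_const_bound[where B = "real m"])
      show "AE \<nu> in \<mu>. norm (min (f \<nu>) (real m)) \<le> real m" by (simp add: f_def)
    qed measurable
    have h0: "0 \<le> h \<nu>" for \<nu> by (simp add: h_def f_def)
    let ?I = "\<integral>\<nu>. h \<nu> \<partial>\<mu>"
    let ?U = "\<lambda>n \<nu>. (\<Sum>k<n. h ((?T ^^ k) \<nu>)) / n - ?I"
    have U_int: "integrable \<mu> (?U n)" for n
      using mpt.integrable_comp[OF T.mpt_funpow h_int] by simp
    have "(\<lambda>n. \<integral>\<nu>. \<bar>?U (Suc n) \<nu>\<bar> \<partial>\<mu>) \<longlonglongrightarrow> 0"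
      using LIMSEQ_Suc[OF T.ergodic_average_L1[OF h_int h0]] by simp
    \<comment> \<open>Precomposition with \<open>act (g (Suc n))\<close> keeps the L1 norm although
      the matrix changes with n; an almost sure statement would not survive this.\<close>
    moreover have "(\<integral>\<nu>. \<bar>?U (Suc n) \<nu>\<bar> \<partial>\<mu>) = (\<integral>\<nu>. \<bar>?U (Suc n) (act (g (Suc n)) \<nu>)\<bar> \<partial>\<mu>)" for n
      using U_int[of "Suc n"] by (intro mpt.integral_comp[OF mpt_act[OF g], symmetric]) auto
    ultimately have "(\<lambda>n. \<integral>\<nu>. norm (?U (Suc n) (act (g (Suc n)) \<nu>)) \<partial>\<mu>) \<longlonglongrightarrow> 0"
      by simp
    then obtain r :: "nat \<Rightarrow> nat" where r: "strict_mono r"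
      and AE: "AE \<nu> in \<mu>. (\<lambda>n. ?U (Suc (r n)) (act (g (Suc (r n))) \<nu>)) \<longlonglongrightarrow> 0"
      using tendsto_L1_AE_subseq[of \<mu> "\<lambda>n \<nu>. ?U (Suc n) (act (g (Suc n)) \<nu>)"]
        mpt.integrable_comp[OF mpt_act[OF g] U_int] by blast
    from AE AE_space have "AE \<nu> in \<mu>. ?I \<le> K ^ CARD('n) * enn2real (growth_bound \<nu>)"
    proof eventually_elim
      case (elim \<nu>)
      then have \<nu>: "\<nu> \<in> growth_measures" by simp
      have le: "?U (Suc n) (act (g (Suc n)) \<nu>) + ?I \<le> K ^ CARD('n) * enn2real (growth_bound \<nu>)" for n
      proof -
        have "(\<Sum>k<Suc n. h ((?T ^^ k) (act (g (Suc n)) \<nu>))) \<le> (\<Sum>k<Suc n. f ((?T ^^ k) (act (g (Suc n)) \<nu>)))"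
          by (intro sum_mono) (simp add: h_def)
        also have "\<dots> = measure (act (g (Suc n)) \<nu>) (sector i j (1 - real (Suc n)) 1 P)"
          unfolding f_def by (rule sum_measure_orbit_sector[OF ij act_growth_measures[OF g \<nu>] P])
        finally have "?U (Suc n) (act (g (Suc n)) \<nu>) + ?I \<le> measure (act (g (Suc n)) \<nu>) (sector i j (1 - real (Suc n)) 1 P) / Suc n"
          by (simp add: divide_right_mono del: sum.lessThan_Suc of_nat_Suc)
        also have "\<dots> \<le> K ^ CARD('n) * enn2real (growth_bound \<nu>)"
          using orbit_sector_le_growth_bound[OF ij \<nu> P K, of "Suc n"] by (simp add: g_def)
        finally show ?thesis .
      qed
      have "(\<lambda>n. ?U (Suc (r n)) (act (g (Suc (r n))) \<nu>) + ?I) \<longlonglongrightarrow> 0 + ?I"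
        by (intro tendsto_add elim(1) tendsto_const)
      then have "(\<lambda>n. ?U (Suc (r n)) (act (g (Suc (r n))) \<nu>) + ?I) \<longlonglongrightarrow> ?I" by simp
      then show ?case using le by (intro LIMSEQ_le_const2) blast+
    qed
    then show ?thesis by (simp add: h_def)
  qed
  \<comment> \<open>Any \<nu> outside countably many null sets bounds all truncated means at once,
    and such a \<nu> exists because \<mu> has mass 1.\<close>
  have "AE \<nu> in \<mu>. \<forall>m::nat. (\<integral>\<nu>. min (f \<nu>) (real m) \<partial>\<mu>) \<le> K ^ CARD('n) * enn2real (growth_bound \<nu>)"
    unfolding AE_all_countable using bound by blast
  then have "\<exists>\<nu> :: (real ^ 'n) measure. \<forall>m::nat. (\<integral>\<nu>. min (f \<nu>) (real m) \<partial>\<mu>) \<le> K ^ CARD('n) * enn2real (growth_bound \<nu>)"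
  proof (rule contrapos_pp)
    assume no: "\<not> ?thesis"
    show "\<not> (AE \<nu> in \<mu>. \<forall>m::nat. (\<integral>\<nu>. min (f \<nu>) (real m) \<partial>\<mu>) \<le> K ^ CARD('n) * enn2real (growth_bound \<nu>))"
    proof
      assume "AE \<nu> in \<mu>. \<forall>m::nat. (\<integral>\<nu>. min (f \<nu>) (real m) \<partial>\<mu>) \<le> K ^ CARD('n) * enn2real (growth_bound \<nu>)"
      then have "AE \<nu> in \<mu>. False" by (rule eventually_mono) (use no in blast)
      then show False by (simp only: AE_False)
    qed
  qed
  then obtain C where C: "\<And>m::nat. (\<integral>\<nu>. min (f \<nu>) (real m) \<partial>\<mu>) \<le> C" by blast
  have "(\<integral>\<^sup>+\<nu>. emeasure \<nu> (sector i j 0 1 P) \<partial>\<mu>) = (\<integral>\<^sup>+\<nu>. (SUP m::nat. ennreal (min (f \<nu>) (real m))) \<partial>\<mu>)"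
  proof (rule nn_integral_cong)
    fix \<nu> assume "\<nu> \<in> space \<mu>"
    then have "emeasure \<nu> (sector i j 0 1 P) = ennreal (f \<nu>)"
      using growth_measure_bounded_finite[OF _ sector_bounded[OF ij P(2)], of \<nu> 0 1]
      unfolding f_def by (intro emeasure_eq_ennreal_measure) (simp add: less_top)
    also have "\<dots> = (SUP m::nat. ennreal (min (f \<nu>) (real m)))"
    proof (rule antisym)
      obtain m :: nat where "f \<nu> \<le> m" using real_arch_simple by blast
      then show "ennreal (f \<nu>) \<le> (SUP m::nat. ennreal (min (f \<nu>) (real m)))"
        by (intro SUP_upper2[of m]) auto
    qed (auto intro!: SUP_least ennreal_leI)
    finally show "emeasure \<nu> (sector i j 0 1 P) = (SUP m::nat. ennreal (min (f \<nu>) (real m)))" .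
  qed
  also have "\<dots> = (SUP m::nat. \<integral>\<^sup>+\<nu>. ennreal (min (f \<nu>) (real m)) \<partial>\<mu>)"
    by (rule nn_integral_monotone_convergence_SUP) (auto simp: incseq_def le_fun_def intro!: ennreal_leI)
  also have "\<dots> \<le> ennreal C"
  proof (rule SUP_least)
    fix m :: nat
    have "(\<integral>\<^sup>+\<nu>. ennreal (min (f \<nu>) (real m)) \<partial>\<mu>) = ennreal (\<integral>\<nu>. min (f \<nu>) (real m) \<partial>\<mu>)"
    proof (rule nn_integral_eq_integral[OF integrable_const_bound[where B = "real m"]])
      show "AE \<nu> in \<mu>. norm (min (f \<nu>) (real m)) \<le> real m" by (simp add: f_def)
      show "AE \<nu> in \<mu>. 0 \<le> min (f \<nu>) (real m)" by (simp add: f_def)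
    qed measurable
    then show "(\<integral>\<^sup>+\<nu>. ennreal (min (f \<nu>) (real m)) \<partial>\<mu>) \<le> ennreal C" using C[of m] by (simp add: ennreal_leI)
  qed
  also have "\<dots> < \<infinity>" by simp
  finally show ?thesis .
qed

subsection \<open>The mean value formula\<close>

definition intensity :: "(real ^ 'n) measure" where
  "intensity = mixture \<mu> (\<lambda>\<nu>. \<nu>) borel"

sublocale intensity: measure_mixture \<mu> "\<lambda>\<nu>. \<nu>" borel
  by unfold_locales (simp_all add: sets_growth_measure)

lemma sets_intensity [simp]: "sets intensity = sets borel"
  by (simp add: intensity_def)

lemma space_intensity [simp]: "space intensity = UNIV"
  by (simp add: intensity_def)

lemma emeasure_intensity: "E \<in> sets borel \<Longrightarrow> emeasure intensity E = (\<integral>\<^sup>+\<nu>. emeasure \<nu> E \<partial>\<mu>)"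
  unfolding intensity_def by (rule intensity.emeasure_mixture)

lemma intensity_invariant:
  assumes A: "A \<in> SL" shows "distr intensity borel ((*v) A) = intensity"
proof (rule measure_eqI)
  fix E assume "E \<in> sets (distr intensity borel ((*v) A))"
  then have E [measurable]: "E \<in> sets borel" by simp
  have A_meas [measurable]: "(*v) A \<in> measurable borel (borel :: (real ^ 'n) measure)" by simp
  have sets: "{x. A *v x \<in> E} \<in> sets borel"
    using measurable_sets_borel[OF A_meas E] by (simp add: vimage_def)
  have "emeasure (distr intensity borel ((*v) A)) E = emeasure intensity {x. A *v x \<in> E}"
    by (subst emeasure_distr) (simp_all add: measurable_cong_sets[OF sets_intensity refl] vimage_def)
  also have "\<dots> = (\<integral>\<^sup>+\<nu>. emeasure (act A \<nu>) E \<partial>\<mu>)"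
    unfolding emeasure_intensity[OF sets] by (intro nn_integral_cong) (simp add: emeasure_act sets_growth_measure)
  also have "\<dots> = (\<integral>\<^sup>+\<nu>. emeasure \<nu> E \<partial>distr \<mu> \<mu> (act A))"
    using act_measurable_mu[OF A] by (intro nn_integral_distr[symmetric]) simp_all
  finally show "emeasure (distr intensity borel ((*v) A)) E = emeasure intensity E"
    by (simp add: act_preserves[OF A] emeasure_intensity)
qed simp

lemma intensity_origin: "emeasure intensity {0} = 0"
proof -
  have "(\<integral>\<^sup>+\<nu>. emeasure \<nu> {0 :: real ^ 'n} \<partial>\<mu>) = (\<integral>\<^sup>+\<nu>. 0 \<partial>\<mu>)"
    by (rule nn_integral_cong) (simp add: growth_measure_null_origin)
  then show ?thesis by (simp add: emeasure_intensity)
qed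

text \<open>Off the origin, sectors with unit slope ranges at integers and coordinates in integer
  boxes form a countable cover; a transvection moves each to slopes [0, 1), where the intensity is
  finite.\<close>

lemma intensity_sigma_finite: "sigma_finite_measure intensity"
proof
  define o' where "o' j = (SOME i :: 'n. i \<noteq> j)" for j
  have o': "o' j \<noteq> j" for j unfolding o'_def using ex_other_index[OF card, of j] by (rule someI_ex)
  define P where "P k = (\<lambda>l::'n. {- real k .. real k})" for k :: nat
  have P: "P k l \<in> sets borel" "bounded (P k l)" for k l by (simp_all add: P_def)
  have sb: "sector (o' j) j a b (P k) \<in> sets borel" for j a b k
    by (rule sector_borel) (rule P)
  have unit: "emeasure intensity (sector (o' j) j a (a + 1) (P k)) < \<infinity>" for j a k
  proof -
    have "emeasure intensity (sector (o' j) j a (a + 1) (P k)) =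
        emeasure (distr intensity borel ((*v) (transvection (o' j) j (- a)))) (sector (o' j) j 0 1 (P k))"
      using sb sector_transvection[OF o', of j "- a" _ 0 1 "P k"]
      by (subst emeasure_distr) (simp_all add: measurable_cong_sets[OF sets_intensity refl] vimage_def add.commute)
    also have "\<dots> = emeasure intensity (sector (o' j) j 0 1 (P k))"
      by (simp add: intensity_invariant[OF transvection_in_SL[OF o']])
    also have "\<dots> < \<infinity>"
      using sector_intensity_finite[OF o' P] by (simp add: emeasure_intensity sb)
    finally show ?thesis .
  qed
  let ?A = "(\<lambda>(j, z, k). sector (o' j) j (of_int z) (of_int z + 1) (P k)) ` (UNIV :: ('n \<times> int \<times> nat) set)"
  have "x \<in> \<Union>(?A \<union> {{0}})" for x :: "real ^ 'n"
  proof (cases "x = 0")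
    case False
    then obtain j where j: "x $ j \<noteq> 0" by (auto simp: vec_eq_iff)
    obtain k :: nat where k: "norm x \<le> k" using real_arch_simple by blast
    have "- real k \<le> x $ l" "x $ l \<le> real k" for l
      using component_le_norm_cart[of x l] k by linarith+
    then have "x \<in> sector (o' j) j (of_int \<lfloor>x $ o' j / x $ j\<rfloor>) (of_int \<lfloor>x $ o' j / x $ j\<rfloor> + 1) (P k)"
      using j by (auto simp: sector_def P_def)
    then show ?thesis by blast
  qed simp
  then have cover: "\<Union>(?A \<union> {{0}}) = space intensity" by (auto simp: intensity_def)
  show "\<exists>A. countable A \<and> A \<subseteq> sets intensity \<and> \<Union>A = space intensity \<and> (\<forall>a\<in>A. emeasure intensity a \<noteq> \<infinity>)"
    using unit cover sb intensity_origin
    by (intro exI[of _ "?A \<union> {{0}}"]) (auto simp: less_top[symmetric])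
qed

definition mean_density :: real where
  "mean_density = (SOME c. 0 \<le> c \<and> intensity = scale_measure (ennreal c) lborel)"

lemma mean_density: "0 \<le> mean_density" "intensity = scale_measure (ennreal mean_density) lborel"
proof -
  from someI_ex[OF SL_invariant_measure_eq[OF card sets_intensity intensity_sigma_finite intensity_invariant intensity_origin]]
  show "0 \<le> mean_density" "intensity = scale_measure (ennreal mean_density) lborel"
    by (auto simp: mean_density_def)
qed

theorem mean_value:
  assumes "\<psi> \<in> borel_measurable borel"
  shows "(\<integral>\<^sup>+\<nu>. nn_hat \<psi> \<nu> \<partial>\<mu>) = ennreal mean_density * (\<integral>\<^sup>+u. \<psi> u \<partial>lborel)"
proof -
  have "(\<integral>\<^sup>+\<nu>. nn_hat \<psi> \<nu> \<partial>\<mu>) = (\<integral>\<^sup>+u. \<psi> u \<partial>intensity)"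
    unfolding nn_hat_def intensity_def by (rule intensity.nn_integral_mixture[OF assms, symmetric])
  then show ?thesis using assms by (simp add: mean_density(2) nn_integral_scale_measure)
qed

end

section \<open>Mean convergence\<close>

lemma dilation_lborel:
  fixes \<phi> :: "'v::euclidean_space \<Rightarrow> real"
  assumes \<phi>: "integrable lborel \<phi>" and R: "0 < R"
  shows "integrable lborel (\<lambda>x. \<phi> (x /\<^sub>R R))"
    and "(\<integral>x. \<phi> (x /\<^sub>R R) \<partial>lborel) = R ^ DIM('v) * (\<integral>x. \<phi> x \<partial>lborel)"
proof -
  have [measurable]: "\<phi> \<in> borel_measurable borel" using \<phi> by simp
  have lb: "lborel = density (distr lborel borel (\<lambda>x::'v. R *\<^sub>R x)) (\<lambda>_. ennreal (R ^ DIM('v)))"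
    using lborel_affine[of R "0::'v"] R by simp
  have "integrable lborel (\<lambda>x. \<phi> (x /\<^sub>R R)) \<longleftrightarrow>
      integrable (distr lborel borel (\<lambda>x::'v. R *\<^sub>R x)) (\<lambda>x. R ^ DIM('v) *\<^sub>R \<phi> (x /\<^sub>R R))"
    by (subst lb, subst integrable_density) (use R in auto)
  also have "\<dots> \<longleftrightarrow> integrable lborel (\<lambda>x. R ^ DIM('v) *\<^sub>R \<phi> ((R *\<^sub>R x) /\<^sub>R R))"
    by (rule integrable_distr_eq) measurable
  finally show "integrable lborel (\<lambda>x. \<phi> (x /\<^sub>R R))" using \<phi> R by simp
  have "(\<integral>x. \<phi> (x /\<^sub>R R) \<partial>lborel) = (\<integral>x. R ^ DIM('v) *\<^sub>R \<phi> (x /\<^sub>R R) \<partial>distr lborel borel (\<lambda>x::'v. R *\<^sub>R x))"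
    by (subst lb, subst integral_density) (use R in auto)
  also have "\<dots> = (\<integral>x. R ^ DIM('v) *\<^sub>R \<phi> ((R *\<^sub>R x) /\<^sub>R R) \<partial>lborel)"
    by (rule integral_distr) measurable
  finally show "(\<integral>x. \<phi> (x /\<^sub>R R) \<partial>lborel) = R ^ DIM('v) * (\<integral>x. \<phi> x \<partial>lborel)"
    using R by simp
qed

lemma hyperplane_lborel_null:
  fixes a :: "'v::euclidean_space"
  assumes "a \<noteq> 0" shows "{x. a \<bullet> x = b} \<in> null_sets lborel"
proof -
  have "{x. a \<bullet> x = b} \<in> sets borel" by (simp add: closed_hyperplane)
  then show ?thesis
    using negligible_hyperplane[of a b] assms null_sets_completion_iff[of "{x. a \<bullet> x = b}" lborel]
    by (simp add: negligible_iff_null_sets)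
qed

text \<open>For positive R the normalization makes the Lebesgue integral independent of R; the
  \<open>hat\<close> of this function is the rescaled integral of the theorem.\<close>

definition dilate :: "real \<Rightarrow> (real ^ 'n \<Rightarrow> real) \<Rightarrow> real ^ 'n \<Rightarrow> real" where
  "dilate R \<phi> v = \<phi> (v /\<^sub>R R) / R ^ CARD('n)"

lemma hat_dilate:
  fixes \<phi> :: "real ^ 'n \<Rightarrow> real"
  shows "hat (dilate R \<phi>) \<nu> = (\<integral>v. \<phi> (v /\<^sub>R R) \<partial>\<nu>) / R ^ CARD('n)"
  unfolding hat_def dilate_def by simp

lemma dilate_measurable [measurable]:
  fixes \<phi> :: "real ^ 'n \<Rightarrow> real"
  assumes [measurable]: "\<phi> \<in> borel_measurable borel"
  shows "dilate R \<phi> \<in> borel_measurable borel"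
  unfolding dilate_def[abs_def] by measurable

lemma dilate_integrable:
  fixes \<phi> :: "real ^ 'n \<Rightarrow> real"
  assumes "integrable lborel \<phi>" "0 < R"
  shows "integrable lborel (dilate R \<phi>)" "(\<integral>u. dilate R \<phi> u \<partial>lborel) = (\<integral>u. \<phi> u \<partial>lborel)"
    "(\<integral>u. \<bar>dilate R \<phi> u\<bar> \<partial>lborel) = (\<integral>u. \<bar>\<phi> u\<bar> \<partial>lborel)"
proof -
  show "integrable lborel (dilate R \<phi>)" "(\<integral>u. dilate R \<phi> u \<partial>lborel) = (\<integral>u. \<phi> u \<partial>lborel)"
    unfolding dilate_def[abs_def] using dilation_lborel[OF assms] assms(2) by simp_all
  have "\<bar>dilate R \<phi> u\<bar> = dilate R (\<lambda>u. \<bar>\<phi> u\<bar>) u" for u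
    using assms(2) by (simp add: dilate_def abs_div)
  then show "(\<integral>u. \<bar>dilate R \<phi> u\<bar> \<partial>lborel) = (\<integral>u. \<bar>\<phi> u\<bar> \<partial>lborel)"
    using dilation_lborel(2)[OF integrable_abs[OF assms(1)] assms(2)] assms(2) by (simp add: dilate_def)
qed

context siegel
begin

lemma AE_integrable_hat:
  fixes \<phi> :: "real ^ 'n \<Rightarrow> real"
  assumes \<phi>: "integrable lborel \<phi>" shows "AE \<nu> in \<mu>. integrable \<nu> \<phi>"
proof -
  have [measurable]: "\<phi> \<in> borel_measurable borel" using \<phi> by simp
  have "(\<integral>\<^sup>+\<nu>. nn_hat (\<lambda>u. ennreal \<bar>\<phi> u\<bar>) \<nu> \<partial>\<mu>) = ennreal mean_density * (\<integral>\<^sup>+u. ennreal \<bar>\<phi> u\<bar> \<partial>lborel)"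
    by (rule mean_value) measurable
  also have "\<dots> < \<infinity>"
    using \<phi> by (simp add: integrable_iff_bounded ennreal_mult_less_top)
  finally have "AE \<nu> in \<mu>. nn_hat (\<lambda>u. ennreal \<bar>\<phi> u\<bar>) \<nu> \<noteq> \<infinity>"
    by (intro nn_integral_PInf_AE) (simp_all add: measurable_cong_sets[OF sets_mu refl])
  with AE_space show ?thesis
  proof eventually_elim
    case (elim \<nu>)
    then have \<nu>: "\<nu> \<in> growth_measures" by simp
    then show ?case
      using elim(2) by (simp add: integrable_iff_bounded nn_hat_def measurable_cong_sets[OF sets_growth_measure[OF \<nu>] refl] less_top)
  qed
qed

lemma hat_borel_measurable [measurable]:
  fixes \<phi> :: "real ^ 'n \<Rightarrow> real"
  assumes [measurable]: "\<phi> \<in> borel_measurable borel"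
  shows "hat \<phi> \<in> borel_measurable \<mu>"
proof -
  have m: "nn_hat (\<lambda>u. ennreal (\<sigma> * \<phi> u)) \<in> borel_measurable \<mu>" for \<sigma> :: real
    by (simp add: measurable_cong_sets[OF sets_mu refl])
  have m': "nn_hat (\<lambda>u. ennreal \<bar>\<phi> u\<bar>) \<in> borel_measurable \<mu>"
    by (simp add: measurable_cong_sets[OF sets_mu refl])
  \<comment> \<open>The \<open>else\<close> branch matches the convention that the integral of a
    nonintegrable function is 0.\<close>
  have "(\<lambda>\<nu>. if nn_hat (\<lambda>u. ennreal \<bar>\<phi> u\<bar>) \<nu> < \<infinity>
      then enn2real (nn_hat (\<lambda>u. ennreal (1 * \<phi> u)) \<nu>) - enn2real (nn_hat (\<lambda>u. ennreal (- 1 * \<phi> u)) \<nu>) else 0) \<in> borel_measurable \<mu>"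
    using m[of 1] m[of "-1"] m' by measurable
  then show ?thesis
  proof (rule measurable_cong[THEN iffD1, rotated])
    fix \<nu> assume "\<nu> \<in> space \<mu>"
    then have \<nu>: "\<nu> \<in> growth_measures" by simp
    have iff: "integrable \<nu> \<phi> \<longleftrightarrow> nn_hat (\<lambda>u. ennreal \<bar>\<phi> u\<bar>) \<nu> < \<infinity>"
      by (simp add: integrable_iff_bounded nn_hat_def measurable_cong_sets[OF sets_growth_measure[OF \<nu>] refl])
    show "(if nn_hat (\<lambda>u. ennreal \<bar>\<phi> u\<bar>) \<nu> < \<infinity>
      then enn2real (nn_hat (\<lambda>u. ennreal (1 * \<phi> u)) \<nu>) - enn2real (nn_hat (\<lambda>u. ennreal (- 1 * \<phi> u)) \<nu>) else 0) = hat \<phi> \<nu>"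
      unfolding iff[symmetric]
      by (simp add: hat_def nn_hat_def real_lebesgue_integral_def not_integrable_integral_eq)
  qed
qed

lemma hat_integrable:
  fixes \<phi> :: "real ^ 'n \<Rightarrow> real"
  assumes \<phi>: "integrable lborel \<phi>"
  shows "integrable \<mu> (hat \<phi>)" "(\<integral>\<nu>. \<bar>hat \<phi> \<nu>\<bar> \<partial>\<mu>) \<le> mean_density * (\<integral>u. \<bar>\<phi> u\<bar> \<partial>lborel)"
proof -
  have [measurable]: "\<phi> \<in> borel_measurable borel" using \<phi> by simp
  have "(\<integral>\<^sup>+\<nu>. ennreal \<bar>hat \<phi> \<nu>\<bar> \<partial>\<mu>) \<le> (\<integral>\<^sup>+\<nu>. nn_hat (\<lambda>u. ennreal \<bar>\<phi> u\<bar>) \<nu> \<partial>\<mu>)"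
  proof (rule nn_integral_mono_AE)
    show "AE \<nu> in \<mu>. ennreal \<bar>hat \<phi> \<nu>\<bar> \<le> nn_hat (\<lambda>u. ennreal \<bar>\<phi> u\<bar>) \<nu>"
      using AE_integrable_hat[OF \<phi>]
    proof eventually_elim
      case (elim \<nu>)
      then show ?case
        using integral_norm_bound_ennreal[OF elim] by (simp add: hat_def nn_hat_def)
    qed
  qed
  also have "\<dots> = ennreal mean_density * (\<integral>\<^sup>+u. ennreal \<bar>\<phi> u\<bar> \<partial>lborel)"
    by (rule mean_value) measurable
  also have "\<dots> = ennreal (mean_density * (\<integral>u. \<bar>\<phi> u\<bar> \<partial>lborel))"
    using \<phi> mean_density(1) by (simp add: nn_integral_eq_integral ennreal_mult)
  finally have le: "(\<integral>\<^sup>+\<nu>. ennreal \<bar>hat \<phi> \<nu>\<bar> \<partial>\<mu>) \<le> ennreal (mean_density * (\<integral>u. \<bar>\<phi> u\<bar> \<partial>lborel))" .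
  show int: "integrable \<mu> (hat \<phi>)"
    using le by (auto simp: integrable_iff_bounded intro: le_less_trans)
  then have "ennreal (\<integral>\<nu>. \<bar>hat \<phi> \<nu>\<bar> \<partial>\<mu>) \<le> ennreal (mean_density * (\<integral>u. \<bar>\<phi> u\<bar> \<partial>lborel))"
    using le by (subst nn_integral_eq_integral[symmetric]) auto
  then show "(\<integral>\<nu>. \<bar>hat \<phi> \<nu>\<bar> \<partial>\<mu>) \<le> mean_density * (\<integral>u. \<bar>\<phi> u\<bar> \<partial>lborel)"
    using mean_density(1) by (subst (asm) ennreal_le_iff) auto
qed

lemma hat_integral_nonneg:
  fixes \<phi> :: "real ^ 'n \<Rightarrow> real"
  assumes \<phi>: "integrable lborel \<phi>" and nonneg: "\<And>u. 0 \<le> \<phi> u"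
  shows "(\<integral>\<nu>. hat \<phi> \<nu> \<partial>\<mu>) = mean_density * (\<integral>u. \<phi> u \<partial>lborel)"
proof -
  have [measurable]: "\<phi> \<in> borel_measurable borel" using \<phi> by simp
  have h0: "0 \<le> hat \<phi> \<nu>" for \<nu> by (simp add: hat_def nonneg)
  have "ennreal (\<integral>\<nu>. hat \<phi> \<nu> \<partial>\<mu>) = (\<integral>\<^sup>+\<nu>. ennreal (hat \<phi> \<nu>) \<partial>\<mu>)"
    using hat_integrable(1)[OF \<phi>] h0 by (intro nn_integral_eq_integral[symmetric]) auto
  also have "\<dots> = (\<integral>\<^sup>+\<nu>. nn_hat (\<lambda>u. ennreal (\<phi> u)) \<nu> \<partial>\<mu>)"
  proof (rule nn_integral_cong_AE)
    show "AE \<nu> in \<mu>. ennreal (hat \<phi> \<nu>) = nn_hat (\<lambda>u. ennreal (\<phi> u)) \<nu>"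
      using AE_integrable_hat[OF \<phi>]
      by eventually_elim (simp add: hat_def nn_hat_def nn_integral_eq_integral nonneg)
  qed
  also have "\<dots> = ennreal mean_density * (\<integral>\<^sup>+u. ennreal (\<phi> u) \<partial>lborel)"
    by (rule mean_value) measurable
  also have "\<dots> = ennreal (mean_density * (\<integral>u. \<phi> u \<partial>lborel))"
    using \<phi> nonneg mean_density(1) by (simp add: nn_integral_eq_integral ennreal_mult)
  finally show ?thesis
    using nonneg h0 mean_density(1) by (subst (asm) ennreal_inj) auto
qed

definition deviation :: "real \<Rightarrow> (real ^ 'n \<Rightarrow> real) \<Rightarrow> real" where
  "deviation R \<phi> = (\<integral>\<nu>. \<bar>hat (dilate R \<phi>) \<nu> - mean_density * (\<integral>u. \<phi> u \<partial>lborel)\<bar> \<partial>\<mu>)"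

definition equidistributes :: "(real ^ 'n \<Rightarrow> real) \<Rightarrow> bool" where
  "equidistributes \<phi> \<longleftrightarrow> integrable lborel \<phi> \<and> ((\<lambda>R. deviation R \<phi>) \<longlongrightarrow> 0) at_top"

lemma prob_growth_measures [simp]: "prob growth_measures = 1"
  using prob_space by simp

lemma hat_dilate_measurable [measurable]:
  fixes \<phi> :: "real ^ 'n \<Rightarrow> real"
  assumes "\<phi> \<in> borel_measurable borel" shows "hat (dilate R \<phi>) \<in> borel_measurable \<mu>"
  by (intro hat_borel_measurable dilate_measurable assms)

lemma deviation_nonneg: "0 \<le> deviation R \<phi>"
  by (simp add: deviation_def)

text \<open>The mean value formula turns Lebesgue L1 distance into an L1(\<mu>) bound on the
  difference of the hats, uniformly in R. The factor 2 counts this distance once for the hats and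
  once for the limiting constants.\<close>

lemma deviation_le:
  fixes \<phi> \<phi>' :: "real ^ 'n \<Rightarrow> real"
  assumes \<phi>: "integrable lborel \<phi>" and \<phi>': "integrable lborel \<phi>'" and R: "0 < R"
  shows "deviation R \<phi> \<le> deviation R \<phi>' + 2 * mean_density * (\<integral>u. \<bar>\<phi> u - \<phi>' u\<bar> \<partial>lborel)"
proof -
  let ?\<delta> = "\<lambda>u. \<phi> u - \<phi>' u" and ?c = mean_density
  let ?I = "\<lambda>\<phi> :: real ^ 'n \<Rightarrow> real. \<integral>u. \<phi> u \<partial>lborel"
  have \<delta>: "integrable lborel ?\<delta>" using \<phi> \<phi>' by simp
  note int = hat_integrable(1)[OF dilate_integrable(1)[OF _ R]]
  have I\<delta>: "\<bar>?I \<phi>' - ?I \<phi>\<bar> \<le> (\<integral>u. \<bar>?\<delta> u\<bar> \<partial>lborel)"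
  proof -
    have "\<bar>?I \<phi>' - ?I \<phi>\<bar> = \<bar>?I ?\<delta>\<bar>" using \<phi> \<phi>' by simp
    also have "\<dots> \<le> (\<integral>u. \<bar>?\<delta> u\<bar> \<partial>lborel)" by (rule integral_abs_bound)
    finally show ?thesis .
  qed
  have "deviation R \<phi> \<le> (\<integral>\<nu>. \<bar>hat (dilate R \<phi>') \<nu> - ?c * ?I \<phi>'\<bar> + \<bar>hat (dilate R ?\<delta>) \<nu>\<bar> + ?c * \<bar>?I \<phi>' - ?I \<phi>\<bar> \<partial>\<mu>)"
    unfolding deviation_def
  proof (rule integral_mono_AE)
    show "AE \<nu> in \<mu>. \<bar>hat (dilate R \<phi>) \<nu> - ?c * ?I \<phi>\<bar> \<le>
        \<bar>hat (dilate R \<phi>') \<nu> - ?c * ?I \<phi>'\<bar> + \<bar>hat (dilate R ?\<delta>) \<nu>\<bar> + ?c * \<bar>?I \<phi>' - ?I \<phi>\<bar>"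
      using AE_integrable_hat[OF dilate_integrable(1)[OF \<phi> R]] AE_integrable_hat[OF dilate_integrable(1)[OF \<phi>' R]]
    proof eventually_elim
      case (elim \<nu>)
      have "hat (dilate R ?\<delta>) \<nu> = (\<integral>v. dilate R \<phi> v - dilate R \<phi>' v \<partial>\<nu>)"
        by (simp add: hat_def dilate_def diff_divide_distrib)
      also have "\<dots> = hat (dilate R \<phi>) \<nu> - hat (dilate R \<phi>') \<nu>"
        unfolding hat_def using elim by (rule Bochner_Integration.integral_diff)
      finally have "hat (dilate R \<phi>) \<nu> = hat (dilate R \<phi>') \<nu> + hat (dilate R ?\<delta>) \<nu>" by simp
      moreover have "?c * ?I \<phi> = ?c * ?I \<phi>' - ?c * (?I \<phi>' - ?I \<phi>)" by (simp add: algebra_simps)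
      moreover have "\<bar>?c * (?I \<phi>' - ?I \<phi>)\<bar> = ?c * \<bar>?I \<phi>' - ?I \<phi>\<bar>"
        using mean_density(1) by (simp add: abs_mult)
      ultimately show ?case by linarith
    qed
  qed (use int[OF \<phi>] int[OF \<phi>'] int[OF \<delta>] in \<open>auto intro!: Bochner_Integration.integrable_add integrable_abs Bochner_Integration.integrable_diff\<close>)
  also have "\<dots> = deviation R \<phi>' + (\<integral>\<nu>. \<bar>hat (dilate R ?\<delta>) \<nu>\<bar> \<partial>\<mu>) + ?c * \<bar>?I \<phi>' - ?I \<phi>\<bar>"
    unfolding deviation_def using int[OF \<phi>'] int[OF \<delta>] by (simp add: prob_space)
  also have "\<dots> \<le> deviation R \<phi>' + ?c * (\<integral>u. \<bar>?\<delta> u\<bar> \<partial>lborel) + ?c * (\<integral>u. \<bar>?\<delta> u\<bar> \<partial>lborel)"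
    using hat_integrable(2)[OF dilate_integrable(1)[OF \<delta> R]] dilate_integrable(3)[OF \<delta> R] I\<delta> mean_density(1)
    by (intro add_mono mult_left_mono) auto
  finally show ?thesis by simp
qed

lemma equidistributes_closed:
  fixes \<phi> :: "real ^ 'n \<Rightarrow> real"
  assumes \<phi>: "integrable lborel \<phi>"
    and approx: "\<And>e. 0 < e \<Longrightarrow> \<exists>\<phi>'. equidistributes \<phi>' \<and> (\<integral>u. \<bar>\<phi> u - \<phi>' u\<bar> \<partial>lborel) < e"
  shows "equidistributes \<phi>"
  unfolding equidistributes_def
proof (intro conjI \<phi> order_tendstoI)
  show "\<forall>\<^sub>F R in at_top. a < deviation R \<phi>" if "a < 0" for a
    using less_le_trans[OF that deviation_nonneg] by simp
  fix e :: real assume e: "0 < e"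
  \<comment> \<open>The summand 1 guards against mean density 0.\<close>
  define d where "d = e / (2 * (2 * mean_density + 1))"
  have d: "0 < d" "2 * mean_density * d \<le> e / 2"
    using e mean_density(1) by (auto simp: d_def field_simps)
  obtain \<phi>' where \<phi>': "equidistributes \<phi>'" "(\<integral>u. \<bar>\<phi> u - \<phi>' u\<bar> \<partial>lborel) < d" using approx[OF d(1)] by blast
  have int': "integrable lborel \<phi>'" and lim: "((\<lambda>R. deviation R \<phi>') \<longlongrightarrow> 0) at_top"
    using \<phi>'(1) by (auto simp: equidistributes_def)
  have "\<forall>\<^sub>F R in at_top. deviation R \<phi>' < e / 2"
    using order_tendstoD(2)[OF lim, of "e / 2"] e by simp
  then show "\<forall>\<^sub>F R in at_top. deviation R \<phi> < e"
    using eventually_gt_at_top[of 0]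
  proof eventually_elim
    case (elim R)
    have "2 * mean_density * (\<integral>u. \<bar>\<phi> u - \<phi>' u\<bar> \<partial>lborel) \<le> 2 * mean_density * d"
      using \<phi>'(2) mean_density(1) by (intro mult_left_mono) auto
    then show ?case using deviation_le[OF \<phi> int' elim(2)] elim(1) d(2) by linarith
  qed
qed

text \<open>The two functions have L1 distance 0. By the mean value formula almost no \<nu> charges
  a given Lebesgue null set, so boundary hyperplanes may be ignored.\<close>

lemma equidistributes_cong_AE:
  fixes \<phi> :: "real ^ 'n \<Rightarrow> real"
  assumes "equidistributes \<phi>'" "AE u in lborel. \<phi> u = \<phi>' u" "\<phi> \<in> borel_measurable borel"
  shows "equidistributes \<phi>"
proof (rule equidistributes_closed)
  have int': "integrable lborel \<phi>'" using assms(1) by (simp add: equidistributes_def)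
  then show int: "integrable lborel \<phi>"
    using assms(2,3) by (subst integrable_cong_AE[where g = \<phi>']) auto
  have "(\<integral>u. \<bar>\<phi> u - \<phi>' u\<bar> \<partial>lborel) = (\<integral>u. 0 \<partial>(lborel :: (real ^ 'n) measure))"
    using int int' assms(2) by (intro integral_cong_AE) auto
  then show "\<exists>\<phi>'. equidistributes \<phi>' \<and> (\<integral>u. \<bar>\<phi> u - \<phi>' u\<bar> \<partial>lborel) < e" if "0 < e" for e
    using assms(1) that by (intro exI[of _ \<phi>']) simp
qed

lemma equidistributes_lim:
  fixes \<phi> :: "real ^ 'n \<Rightarrow> real"
  assumes f: "\<And>n. equidistributes (f n)" and lim: "\<And>u. (\<lambda>n. f n u) \<longlonglongrightarrow> \<phi> u"
    and w: "integrable lborel w" "\<And>n u. \<bar>f n u\<bar> \<le> w u" and \<phi>: "\<phi> \<in> borel_measurable borel"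
  shows "equidistributes \<phi>"
proof (rule equidistributes_closed)
  have fi: "integrable lborel (f n)" for n using f by (simp add: equidistributes_def)
  have \<phi>w: "\<bar>\<phi> u\<bar> \<le> w u" for u
    by (rule LIMSEQ_le_const2[OF tendsto_rabs[OF lim]]) (use w in auto)
  show int: "integrable lborel \<phi>"
    using \<phi> \<phi>w by (intro Bochner_Integration.integrable_bound[OF w(1)]) (auto intro: order_trans[OF _ abs_ge_self])
  have "(\<lambda>n. \<integral>u. \<bar>\<phi> u - f n u\<bar> \<partial>lborel) \<longlonglongrightarrow> (\<integral>u. 0 \<partial>(lborel :: (real ^ 'n) measure))"
  proof (rule integral_dominated_convergence[where w = "\<lambda>u. 2 * w u"])
    show "AE u in lborel. (\<lambda>n. \<bar>\<phi> u - f n u\<bar>) \<longlonglongrightarrow> 0"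
    proof (intro AE_I2)
      fix u
      have "(\<lambda>n. \<bar>\<phi> u - f n u\<bar>) \<longlonglongrightarrow> \<bar>\<phi> u - \<phi> u\<bar>" by (intro tendsto_intros lim)
      then show "(\<lambda>n. \<bar>\<phi> u - f n u\<bar>) \<longlonglongrightarrow> 0" by simp
    qed
    show "AE u in lborel. norm \<bar>\<phi> u - f n u\<bar> \<le> 2 * w u" for n
    proof (intro AE_I2)
      fix u show "norm \<bar>\<phi> u - f n u\<bar> \<le> 2 * w u" using \<phi>w[of u] w(2)[of n u] by simp
    qed
  qed (use int fi w in auto)
  then have lim0: "(\<lambda>n. \<integral>u. \<bar>\<phi> u - f n u\<bar> \<partial>lborel) \<longlonglongrightarrow> 0" by simp
  fix e :: real assume "0 < e"
  from order_tendstoD(2)[OF lim0 this] obtain n where "(\<integral>u. \<bar>\<phi> u - f n u\<bar> \<partial>lborel) < e"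
    by (auto simp: eventually_sequentially)
  then show "\<exists>\<phi>'. equidistributes \<phi>' \<and> (\<integral>u. \<bar>\<phi> u - \<phi>' u\<bar> \<partial>lborel) < e" using f by blast
qed

lemma equidistributes_linear:
  fixes \<phi> \<phi>' :: "real ^ 'n \<Rightarrow> real"
  assumes "equidistributes \<phi>" "equidistributes \<phi>'"
  shows "equidistributes (\<lambda>u. \<phi> u + a * \<phi>' u)"
proof -
  have \<phi>: "integrable lborel \<phi>" "integrable lborel \<phi>'" using assms by (auto simp: equidistributes_def)
  let ?I = "\<lambda>\<phi> :: real ^ 'n \<Rightarrow> real. \<integral>u. \<phi> u \<partial>lborel"
  have le: "deviation R (\<lambda>u. \<phi> u + a * \<phi>' u) \<le> deviation R \<phi> + \<bar>a\<bar> * deviation R \<phi>'" if R: "0 < R" for R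
  proof -
    note int = hat_integrable(1)[OF dilate_integrable(1)[OF _ R]]
    have sum_int: "integrable lborel (\<lambda>u. \<phi> u + a * \<phi>' u)" using \<phi> by simp
    have "deviation R (\<lambda>u. \<phi> u + a * \<phi>' u) \<le> (\<integral>\<nu>. \<bar>hat (dilate R \<phi>) \<nu> - mean_density * ?I \<phi>\<bar> +
        \<bar>a\<bar> * \<bar>hat (dilate R \<phi>') \<nu> - mean_density * ?I \<phi>'\<bar> \<partial>\<mu>)"
      unfolding deviation_def
    proof (rule integral_mono_AE)
      show "AE \<nu> in \<mu>. \<bar>hat (dilate R (\<lambda>u. \<phi> u + a * \<phi>' u)) \<nu> - mean_density * ?I (\<lambda>u. \<phi> u + a * \<phi>' u)\<bar> \<le>
          \<bar>hat (dilate R \<phi>) \<nu> - mean_density * ?I \<phi>\<bar> + \<bar>a\<bar> * \<bar>hat (dilate R \<phi>') \<nu> - mean_density * ?I \<phi>'\<bar>"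
        using AE_integrable_hat[OF dilate_integrable(1)[OF \<phi>(1) R]] AE_integrable_hat[OF dilate_integrable(1)[OF \<phi>(2) R]]
      proof eventually_elim
        case (elim \<nu>)
        have "hat (dilate R (\<lambda>u. \<phi> u + a * \<phi>' u)) \<nu> = (\<integral>v. dilate R \<phi> v + a * dilate R \<phi>' v \<partial>\<nu>)"
          by (simp add: hat_def dilate_def add_divide_distrib)
        also have "\<dots> = hat (dilate R \<phi>) \<nu> + a * hat (dilate R \<phi>') \<nu>"
          unfolding hat_def using elim by simp
        finally have h: "hat (dilate R (\<lambda>u. \<phi> u + a * \<phi>' u)) \<nu> = hat (dilate R \<phi>) \<nu> + a * hat (dilate R \<phi>') \<nu>" .
        have "?I (\<lambda>u. \<phi> u + a * \<phi>' u) = ?I \<phi> + a * ?I \<phi>'" using \<phi> by simp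
        then have "hat (dilate R (\<lambda>u. \<phi> u + a * \<phi>' u)) \<nu> - mean_density * ?I (\<lambda>u. \<phi> u + a * \<phi>' u) =
            (hat (dilate R \<phi>) \<nu> - mean_density * ?I \<phi>) + a * (hat (dilate R \<phi>') \<nu> - mean_density * ?I \<phi>')"
          unfolding h by (simp only: algebra_simps)
        then show ?case
          by (simp only: abs_mult[symmetric] abs_triangle_ineq)
      qed
    qed (use int[OF \<phi>(1)] int[OF \<phi>(2)] int[OF sum_int] in
      \<open>auto intro!: Bochner_Integration.integrable_add integrable_mult_right integrable_abs Bochner_Integration.integrable_diff\<close>)
    also have "\<dots> = deviation R \<phi> + \<bar>a\<bar> * deviation R \<phi>'"
      unfolding deviation_def using int[OF \<phi>(1)] int[OF \<phi>(2)] by simp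
    finally show ?thesis .
  qed
  have "((\<lambda>R. deviation R \<phi> + \<bar>a\<bar> * deviation R \<phi>') \<longlongrightarrow> 0 + \<bar>a\<bar> * 0) at_top"
    using assms by (intro tendsto_intros) (auto simp: equidistributes_def)
  then have lim: "((\<lambda>R. deviation R \<phi> + \<bar>a\<bar> * deviation R \<phi>') \<longlongrightarrow> 0) at_top" by simp
  have "((\<lambda>R. deviation R (\<lambda>u. \<phi> u + a * \<phi>' u)) \<longlongrightarrow> 0) at_top"
  proof (rule tendsto_sandwich[OF _ _ tendsto_const lim])
    show "\<forall>\<^sub>F R in at_top. 0 \<le> deviation R (\<lambda>u. \<phi> u + a * \<phi>' u)" by (simp add: deviation_nonneg)
    show "\<forall>\<^sub>F R in at_top. deviation R (\<lambda>u. \<phi> u + a * \<phi>' u) \<le> deviation R \<phi> + \<bar>a\<bar> * deviation R \<phi>'"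
      using eventually_gt_at_top[of 0] by eventually_elim (rule le)
  qed
  then show ?thesis using \<phi> by (simp add: equidistributes_def)
qed

lemma equidistributes_zero: "equidistributes (\<lambda>_. 0)"
  by (simp add: equidistributes_def deviation_def hat_def dilate_def[abs_def])

text \<open>The constant in the limit is determined by the mean value formula.\<close>

lemma equidistributesI:
  fixes \<phi> :: "real ^ 'n \<Rightarrow> real"
  assumes \<phi>: "integrable lborel \<phi>" "\<And>u. 0 \<le> \<phi> u"
    and lim: "((\<lambda>R. \<integral>\<nu>. \<bar>hat (dilate R \<phi>) \<nu> - \<kappa>\<bar> \<partial>\<mu>) \<longlongrightarrow> 0) at_top"
  shows "equidistributes \<phi>"
proof -
  let ?m = "mean_density * (\<integral>u. \<phi> u \<partial>lborel)"
  have le: "\<bar>?m - \<kappa>\<bar> \<le> (\<integral>\<nu>. \<bar>hat (dilate R \<phi>) \<nu> - \<kappa>\<bar> \<partial>\<mu>)" if R: "0 < R" for R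
  proof -
    note d = dilate_integrable[OF \<phi>(1) R]
    have "(\<integral>\<nu>. hat (dilate R \<phi>) \<nu> \<partial>\<mu>) = ?m"
      using \<phi>(2) R by (subst hat_integral_nonneg[OF d(1)]) (auto simp: d(2) dilate_def)
    then have "?m - \<kappa> = (\<integral>\<nu>. hat (dilate R \<phi>) \<nu> - \<kappa> \<partial>\<mu>)"
      using hat_integrable(1)[OF d(1)] by (simp add: prob_space)
    then show ?thesis using integral_abs_bound[of \<mu> "\<lambda>\<nu>. hat (dilate R \<phi>) \<nu> - \<kappa>"] by simp
  qed
  have "\<bar>?m - \<kappa>\<bar> \<le> 0"
    by (rule tendsto_lowerbound[OF lim]) (use le in \<open>auto intro!: eventually_mono[OF eventually_gt_at_top[of 0]]\<close>)
  then have "\<kappa> = ?m" by simp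
  with lim \<phi>(1) show ?thesis by (simp add: equidistributes_def deviation_def)
qed

end

section \<open>Equidistribution of sectors and of Borel sets\<close>

lemma borel_measurable_vec_lambda:
  fixes f :: "'a \<Rightarrow> 'n::finite \<Rightarrow> real"
  assumes [measurable]: "\<And>i. (\<lambda>x. f x i) \<in> borel_measurable M"
  shows "(\<lambda>x. \<chi> i. f x i) \<in> borel_measurable M"
proof -
  have "(\<chi> i. f x i) = (\<Sum>i\<in>UNIV. f x i *\<^sub>R axis i 1)" for x
    by (simp add: vec_eq_iff axis_def if_distrib cong: if_cong)
  then show ?thesis by simp
qed

lemma mass_indicator:
  fixes \<nu> :: "(real ^ 'n) measure"
  assumes "sets \<nu> = sets borel" "E \<in> sets borel"
  shows "hat (indicator E) \<nu> = measure \<nu> E"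
  using assms sets_eq_imp_space_eq[OF assms(1)] by (simp add: hat_def)

context siegel
begin

text \<open>\<open>stretch i R\<close> maps the dilated sector to one of slope length
  \<open>L R\<close>, a transvection places its right end at 1, and all but less than one unit of
  slope is then an orbit sum of \<open>n R\<close> terms. The leftover piece and the rounding of
  \<open>L R\<close> each cost at most \<open>F / R ^ CARD('n)\<close> in mean.\<close>

lemma equidistributes_sector:
  assumes ij: "i \<noteq> j" and P: "\<And>l. P l \<in> sets borel" "\<And>l. bounded (P l)" and ab: "a < b"
  shows "equidistributes (indicator (sector i j a b P))"
proof -
  let ?T = "act (transvection i j 1)"
  interpret T: ergodic_mpt \<mu> ?T by (rule ergodic_transvection[OF ij])
  note sb = sector_borel[where P = P and i = i and j = j, OF P(1)]
  note bnd = sector_bounded[where P = P, OF ij P(2)]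
  have lint: "integrable lborel (indicator (sector i j a b P) :: _ \<Rightarrow> real)" for a b
    using sb bnd emeasure_bounded_finite[OF bnd] by (intro integrable_real_indicator) auto
  define f where "f \<nu> = measure \<nu> (sector i j 0 1 P)" for \<nu>
  define F where "F = (\<integral>\<nu>. f \<nu> \<partial>\<mu>)"
  have m_int: "integrable \<mu> (\<lambda>\<nu>. measure \<nu> (sector i j a b P))" for a b
  proof -
    have "integrable \<mu> (hat (indicator (sector i j a b P)))" by (rule hat_integrable[OF lint])
    then show ?thesis
      by (rule Bochner_Integration.integrable_cong[OF refl, THEN iffD1, rotated]) (simp add: mass_indicator sets_growth_measure sb)
  qed
  have g_meas: "(\<lambda>\<nu>. \<bar>measure \<nu> (sector i j a b P) / X - \<kappa>\<bar>) \<in> borel_measurable \<mu>" for a b X \<kappa>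
    using m_int[of a b] by (intro borel_measurable_integrable) simp
  have f_int: "integrable \<mu> f" unfolding f_def by (rule m_int)
  have f0: "0 \<le> f \<nu>" for \<nu> by (simp add: f_def)
  have F0: "0 \<le> F" unfolding F_def by (simp add: f0)
  have shift: "measure (act (transvection i j s) \<nu>) (sector i j a b P) = measure \<nu> (sector i j (a - s) (b - s) P)"
    if "\<nu> \<in> growth_measures" for s a b \<nu>
    using measure_act[OF that sb] by (simp add: sector_transvection[OF ij])
  have F_shift: "(\<integral>\<nu>. measure \<nu> (sector i j (- s) (1 - s) P) \<partial>\<mu>) = F" for s
  proof -
    have "F = (\<integral>\<nu>. f (act (transvection i j s) \<nu>) \<partial>\<mu>)"
      unfolding F_def using f_int by (intro mpt.integral_comp[OF mpt_act[OF transvection_in_SL[OF ij]], symmetric]) auto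
    also have "\<dots> = (\<integral>\<nu>. measure \<nu> (sector i j (- s) (1 - s) P) \<partial>\<mu>)"
      by (intro Bochner_Integration.integral_cong refl) (simp add: f_def shift)
    finally show ?thesis by simp
  qed
  let ?N = "CARD('n)"
  define e where "e n = (\<integral>\<nu>. \<bar>(\<Sum>k<n. f ((?T ^^ k) \<nu>)) / n - F\<bar> \<partial>\<mu>)" for n :: nat
  have e_lim: "e \<longlonglongrightarrow> 0" unfolding e_def F_def by (rule T.ergodic_average_L1[OF f_int f0])
  define L where "L R = R ^ ?N * (b - a)" for R :: real
  define n where "n R = nat \<lfloor>L R\<rfloor>" for R :: real
  have bound: "(\<integral>\<nu>. \<bar>hat (dilate R (indicator (sector i j a b P))) \<nu> - (b - a) * F\<bar> \<partial>\<mu>) \<le>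
      2 * F / R ^ ?N + (b - a) * e (n R)" if R: "0 < R" for R
  proof -
    let ?X = "R ^ ?N"
    have X: "0 < ?X" using R by simp
    \<comment> \<open>Chosen so that the shift by s carries the slopes [?X a, ?X b) to [1 - L R,
      1).\<close>
    define s where "s = 1 - ?X * b"
    have nL: "real (n R) \<le> L R" "L R < real (n R) + 1"
    proof -
      have "0 \<le> L R" using X ab by (simp add: L_def)
      then have "real (n R) = of_int \<lfloor>L R\<rfloor>" by (simp add: n_def)
      then show "real (n R) \<le> L R" "L R < real (n R) + 1" using floor_correct[of "L R"] by simp_all
    qed
    have hd: "hat (dilate R (indicator (sector i j a b P))) \<nu> = measure (act (diag (stretch i R)) \<nu>) (sector i j (?X * a) (?X * b) P) / ?X"
      if \<nu>: "\<nu> \<in> growth_measures" for \<nu>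
    proof -
      have "{x \<in> space borel. diag (stretch i R) *v x \<in> sector i j (?X * a) (?X * b) P} \<in> sets borel"
        using sb by measurable
      then have "hat (indicator {x. diag (stretch i R) *v x \<in> sector i j (?X * a) (?X * b) P}) \<nu> =
          measure \<nu> {x. diag (stretch i R) *v x \<in> sector i j (?X * a) (?X * b) P}"
        by (intro mass_indicator sets_growth_measure \<nu>) simp
      also have "{x. diag (stretch i R) *v x \<in> sector i j (?X * a) (?X * b) P} = {x. x /\<^sub>R R \<in> sector i j a b P}"
        using sector_stretch[OF ij R] by auto
      finally have "hat (indicator {x. x /\<^sub>R R \<in> sector i j a b P}) \<nu> = measure \<nu> {x. diag (stretch i R) *v x \<in> sector i j (?X * a) (?X * b) P}"
        using sector_stretch[OF ij R] by simp
      moreover have "(\<lambda>v. indicator (sector i j a b P) (v /\<^sub>R R)) = (indicator {x. x /\<^sub>R R \<in> sector i j a b P} :: _ \<Rightarrow> real)"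
        by (auto simp: indicator_def fun_eq_iff)
      ultimately show ?thesis by (simp add: hat_dilate hat_def[symmetric] measure_act[OF \<nu> sb])
    qed
    have "(\<integral>\<nu>. \<bar>hat (dilate R (indicator (sector i j a b P))) \<nu> - (b - a) * F\<bar> \<partial>\<mu>) =
        (\<integral>\<nu>. \<bar>measure (act (diag (stretch i R)) \<nu>) (sector i j (?X * a) (?X * b) P) / ?X - (b - a) * F\<bar> \<partial>\<mu>)"
      by (intro Bochner_Integration.integral_cong refl) (simp add: hd)
    also have "\<dots> = (\<integral>\<nu>. \<bar>measure \<nu> (sector i j (?X * a) (?X * b) P) / ?X - (b - a) * F\<bar> \<partial>\<mu>)"
      by (rule mpt.integral_comp[OF mpt_act[OF stretch_SL[OF R]] g_meas])
    also have "\<dots> = (\<integral>\<nu>. \<bar>measure (act (transvection i j (- s)) \<nu>) (sector i j (?X * a) (?X * b) P) / ?X - (b - a) * F\<bar> \<partial>\<mu>)"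
      by (rule mpt.integral_comp[OF mpt_act[OF transvection_in_SL[OF ij]] g_meas, symmetric])
    also have "\<dots> = (\<integral>\<nu>. \<bar>measure \<nu> (sector i j (1 - L R) 1 P) / ?X - (b - a) * F\<bar> \<partial>\<mu>)"
    proof (intro Bochner_Integration.integral_cong refl)
      fix \<nu> assume "\<nu> \<in> space \<mu>"
      moreover have "?X * a - - s = 1 - L R" "?X * b - - s = 1" by (simp_all add: s_def L_def algebra_simps)
      ultimately show "\<bar>measure (act (transvection i j (- s)) \<nu>) (sector i j (?X * a) (?X * b) P) / ?X - (b - a) * F\<bar> =
          \<bar>measure \<nu> (sector i j (1 - L R) 1 P) / ?X - (b - a) * F\<bar>"
        by (simp only: shift space_mu)
    qed
    also have "\<dots> \<le> (\<integral>\<nu>. measure \<nu> (sector i j (- real (n R)) (1 - real (n R)) P) / ?X +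
        (b - a) * \<bar>(\<Sum>k<n R. f ((?T ^^ k) \<nu>)) / n R - F\<bar> + F / ?X \<partial>\<mu>)"
    proof (rule integral_mono)
      fix \<nu> assume "\<nu> \<in> space \<mu>"
      then have \<nu>: "\<nu> \<in> growth_measures" by simp
      let ?m = "\<lambda>a b. measure \<nu> (sector i j a b P)"
      have S: "(\<Sum>k<n R. f ((?T ^^ k) \<nu>)) = ?m (1 - real (n R)) 1"
        unfolding f_def by (rule sum_measure_orbit_sector[OF ij \<nu> P])
      have fm: "sector i j a b P \<in> fmeasurable \<nu>" for a b
        using growth_measure_bounded_finite[OF \<nu> bnd] sb by (intro fmeasurableI) (auto simp: sets_growth_measure[OF \<nu>])
      have "sector i j (1 - L R) 1 P \<subseteq> sector i j (- real (n R)) (1 - real (n R)) P \<union> sector i j (1 - real (n R)) 1 P"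
        using nL by (auto simp: sector_def)
      then have "?m (1 - L R) 1 \<le> measure \<nu> (sector i j (- real (n R)) (1 - real (n R)) P \<union> sector i j (1 - real (n R)) 1 P)"
        using fm by (intro measure_mono_fmeasurable fmeasurable.Un) (auto simp: fmeasurableD)
      also have "\<dots> \<le> ?m (- real (n R)) (1 - real (n R)) + ?m (1 - real (n R)) 1"
        using fm by (intro measure_Un_le) (auto simp: fmeasurableD)
      finally have up: "?m (1 - L R) 1 \<le> ?m (- real (n R)) (1 - real (n R)) + ?m (1 - real (n R)) 1" .
      have "sector i j (1 - real (n R)) 1 P \<subseteq> sector i j (1 - L R) 1 P" using nL by (auto simp: sector_def)
      then have lo: "?m (1 - real (n R)) 1 \<le> ?m (1 - L R) 1"
        using fm by (intro measure_mono_fmeasurable) (auto simp: fmeasurableD)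
      let ?A = "?m (1 - real (n R)) 1" and ?D = "?m (- real (n R)) (1 - real (n R))"
      have d1: "\<bar>?m (1 - L R) 1 / ?X - ?A / ?X\<bar> \<le> ?D / ?X"
        using up lo X by (simp add: diff_divide_distrib[symmetric] divide_right_mono abs_of_nonneg)
      have d2: "\<bar>?A / ?X - (b - a) * F\<bar> \<le> (b - a) * \<bar>?A / n R - F\<bar> + F / ?X"
      proof -
        have q: "real (n R) / ?X \<le> b - a" "b - a \<le> (real (n R) + 1) / ?X"
          using nL X by (auto simp: L_def pos_divide_le_eq pos_le_divide_eq mult.commute)
        \<comment> \<open>For \<open>n R = 0\<close> both sides vanish, since the slope range [1, 1)
          is empty.\<close>
        have "?A / ?X = (real (n R) / ?X) * (?A / n R)"
        proof (cases "n R = 0")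
          case True
          have "sector i j 1 1 P = {}" by (auto simp: sector_def)
          then show ?thesis using True by simp
        qed simp
        then have "?A / ?X - (b - a) * F = (real (n R) / ?X) * (?A / n R - F) + (real (n R) / ?X - (b - a)) * F"
          by (simp add: algebra_simps)
        then have "\<bar>?A / ?X - (b - a) * F\<bar> \<le> \<bar>(real (n R) / ?X) * (?A / n R - F)\<bar> + \<bar>(real (n R) / ?X - (b - a)) * F\<bar>"
          by (simp only: abs_triangle_ineq)
        also have "\<dots> = (real (n R) / ?X) * \<bar>?A / n R - F\<bar> + \<bar>real (n R) / ?X - (b - a)\<bar> * F"
          using X F0 by (simp add: abs_mult)
        also have "\<dots> \<le> (b - a) * \<bar>?A / n R - F\<bar> + 1 / ?X * F"
          using q F0 by (intro add_mono mult_right_mono) (auto simp: add_divide_distrib)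
        finally show ?thesis by simp
      qed
      show "\<bar>?m (1 - L R) 1 / ?X - (b - a) * F\<bar> \<le> ?D / ?X + (b - a) * \<bar>(\<Sum>k<n R. f ((?T ^^ k) \<nu>)) / n R - F\<bar> + F / ?X"
        unfolding S using d1 d2 by linarith
    next
      have "integrable \<mu> (\<lambda>\<nu>. f ((?T ^^ k) \<nu>))" for k by (rule mpt.integrable_comp[OF T.mpt_funpow f_int])
      then show "integrable \<mu> (\<lambda>\<nu>. measure \<nu> (sector i j (- real (n R)) (1 - real (n R)) P) / ?X +
          (b - a) * \<bar>(\<Sum>k<n R. f ((?T ^^ k) \<nu>)) / n R - F\<bar> + F / ?X)"
        using m_int by (intro Bochner_Integration.integrable_add integrable_mult_right integrable_abs Bochner_Integration.integrable_diff
            Bochner_Integration.integrable_divide_zero Bochner_Integration.integrable_sum integrable_const) auto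
      show "integrable \<mu> (\<lambda>\<nu>. \<bar>measure \<nu> (sector i j (1 - L R) 1 P) / ?X - (b - a) * F\<bar>)"
        using m_int by simp
    qed
    also have "\<dots> = F / ?X + (b - a) * e (n R) + F / ?X"
    proof -
      have "integrable \<mu> (\<lambda>\<nu>. f ((?T ^^ k) \<nu>))" for k by (rule mpt.integrable_comp[OF T.mpt_funpow f_int])
      then have "integrable \<mu> (\<lambda>\<nu>. \<bar>(\<Sum>k<n R. f ((?T ^^ k) \<nu>)) / n R - F\<bar>)" by simp
      then show ?thesis using m_int F_shift[of "real (n R)"] by (simp add: e_def)
    qed
    finally show ?thesis by simp
  qed
  show ?thesis
  proof (rule equidistributesI[OF lint])
    have X_lim: "filterlim (\<lambda>R::real. R ^ ?N) at_top at_top"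
      by (intro filterlim_pow_at_top filterlim_ident) simp
    have "filterlim (\<lambda>R. (b - a) * R ^ ?N) at_top at_top"
      by (rule filterlim_tendsto_pos_mult_at_top[OF tendsto_const _ X_lim]) (use ab in simp)
    then have "filterlim L at_top at_top" by (simp add: L_def[abs_def] mult.commute)
    then have "filterlim n sequentially at_top"
      unfolding n_def by (intro filterlim_compose[OF filterlim_nat_sequentially] filterlim_compose[OF filterlim_floor_sequentially])
    then have e_lim': "((\<lambda>R. e (n R)) \<longlongrightarrow> 0) at_top" by (rule filterlim_compose[OF e_lim])
    have "((\<lambda>R. 2 * F / R ^ ?N) \<longlongrightarrow> 0) at_top"
      by (intro tendsto_divide_0[OF tendsto_const] filterlim_at_top_imp_at_infinity X_lim)
    then have "((\<lambda>R. 2 * F / R ^ ?N + (b - a) * e (n R)) \<longlongrightarrow> 0 + (b - a) * 0) at_top"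
      by (intro tendsto_intros e_lim')
    then have lim: "((\<lambda>R. 2 * F / R ^ ?N + (b - a) * e (n R)) \<longlongrightarrow> 0) at_top" by simp
    show "((\<lambda>R. \<integral>\<nu>. \<bar>hat (dilate R (indicator (sector i j a b P))) \<nu> - (b - a) * F\<bar> \<partial>\<mu>) \<longlongrightarrow> 0) at_top"
      by (rule tendsto_sandwich[OF _ _ tendsto_const lim])
        (auto intro!: eventually_mono[OF eventually_gt_at_top[of 0]] bound)
  qed simp
qed

text \<open>
  In the coordinates \<open>x $ i / x $ j\<close> and \<open>x $ l\<close> for \<open>l \<noteq> i\<close> the sectors are boxes, so they generate
  the Borel sets.
\<close>

definition to_sector_coords :: "'n \<Rightarrow> 'n \<Rightarrow> real ^ 'n \<Rightarrow> real ^ 'n" where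
  "to_sector_coords i j x = (\<chi> l. if l = i then x $ i / x $ j else x $ l)"

lemma to_sector_coords_measurable [measurable]: "to_sector_coords i j \<in> borel_measurable borel"
  unfolding to_sector_coords_def[abs_def] by (intro borel_measurable_vec_lambda) measurable

definition sector_piece :: "'n \<Rightarrow> 'n \<Rightarrow> (real ^ 'n) set \<Rightarrow> (real ^ 'n) set" where
  "sector_piece i j D = {x. x $ j \<noteq> 0 \<and> to_sector_coords i j x \<in> D}"

lemma sector_piece_borel: "D \<in> sets borel \<Longrightarrow> sector_piece i j D \<in> sets borel"
proof -
  assume [measurable]: "D \<in> sets borel"
  have "{x \<in> space borel. x $ j \<noteq> 0 \<and> to_sector_coords i j x \<in> D} \<in> sets borel" by measurable
  then show ?thesis by (simp add: sector_piece_def)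
qed

lemma equidistributes_empty: "equidistributes (indicator {})"
proof -
  have "(indicator {} :: real ^ 'n \<Rightarrow> real) = (\<lambda>_. 0)" by (simp add: fun_eq_iff)
  then show ?thesis by (simp only: equidistributes_zero)
qed

text \<open>The box is open at the lower slope where the sector is closed; the difference lies in
  the hyperplane of slope \<open>u $ i\<close>, a Lebesgue null set.\<close>

lemma equidistributes_box:
  assumes ij: "i \<noteq> j" shows "equidistributes (indicator (sector_piece i j (box u v)))"
proof (cases "u $ i < v $ i")
  case True
  let ?P = "\<lambda>l. {u $ l <..< v $ l}"
  let ?S = "sector i j (u $ i) (v $ i) ?P"
  have S: "equidistributes (indicator ?S)"
    by (rule equidistributes_sector[OF ij _ _ True]) auto
  show ?thesis
  proof (rule equidistributes_cong_AE[OF S])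
    let ?a = "axis i 1 - (u $ i) *\<^sub>R axis j 1 :: real ^ 'n"
    have "?a $ i = 1" using ij by (simp add: axis_def)
    then have "?a \<noteq> 0" by (metis zero_index zero_neq_one)
    from hyperplane_lborel_null[OF this, of 0]
    have "AE x in lborel. \<not> ?a \<bullet> x = 0" by (rule AE_I') auto
    then have "AE x in lborel. x $ i \<noteq> u $ i * x $ j"
      by eventually_elim (simp add: inner_diff_left inner_axis' )
    then show "AE x in lborel. indicator (sector_piece i j (box u v)) x = (indicator ?S x :: real)"
    proof eventually_elim
      case (elim x)
      have "x \<in> sector_piece i j (box u v) \<longleftrightarrow> x \<in> ?S"
      proof (cases "x $ j = 0")
        case False
        then have "x $ i / x $ j \<noteq> u $ i" using elim by (auto simp: field_simps)
        then have "u $ i < x $ i / x $ j \<longleftrightarrow> u $ i \<le> x $ i / x $ j" by auto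
        then show ?thesis
          using False unfolding sector_piece_def sector_def mem_box_cart to_sector_coords_def
          by (auto split: if_splits)
      qed (simp add: sector_piece_def sector_def)
      then show ?case by (simp add: indicator_def)
    qed
    show "indicator (sector_piece i j (box u v)) \<in> borel_measurable borel"
      by (intro borel_measurable_indicator sector_piece_borel) simp
  qed
next
  case False
  then have "sector_piece i j (box u v) = {}"
    by (auto simp: sector_piece_def mem_box_cart) (meson order.strict_trans)
  then show ?thesis by (simp only: equidistributes_empty)
qed

text \<open>Intersecting with a fixed box provides one integrable majorant for the disjoint unions
  of the induction and makes complements relative to that box.\<close>

lemma equidistributes_sector_piece:
  assumes ij: "i \<noteq> j" and D: "D \<in> sets borel"
  shows "equidistributes (indicator (sector_piece i j (D \<inter> box u v)))"
proof -
  let ?C = "\<lambda>D. sector_piece i j (D \<inter> box u v)"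
  have gen: "sets (borel :: (real ^ 'n) measure) = sigma_sets UNIV (range (\<lambda>(a, b). box a b))"
    by (subst borel_eq_box) (simp add: sets_measure_of)
  have Bint: "integrable lborel (indicator (?C UNIV) :: _ \<Rightarrow> real)"
    using equidistributes_box[OF ij, of u v] by (simp add: equidistributes_def)
  have box_Int: "\<exists>a' b'. box a b \<inter> box c d = box a' b'" for a b c d :: "real ^ 'n"
    by (rule exI[of _ "\<chi> l. max (a $ l) (c $ l)"], rule exI[of _ "\<chi> l. min (b $ l) (d $ l)"])
      (auto simp: mem_box_cart)
  have istab: "Int_stable (range (\<lambda>(a, b). box a b :: (real ^ 'n) set))"
  proof (rule Int_stableI)
    fix A B :: "(real ^ 'n) set" assume "A \<in> range (\<lambda>(a, b). box a b)" "B \<in> range (\<lambda>(a, b). box a b)"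
    then obtain a b c d where "A = box a b" "B = box c d" by auto
    then show "A \<inter> B \<in> range (\<lambda>(a, b). box a b)" using box_Int[of a b c d] by auto
  qed
  have closed: "range (\<lambda>(a, b). box a b :: (real ^ 'n) set) \<subseteq> Pow UNIV" by simp
  from D have "D \<in> sigma_sets UNIV (range (\<lambda>(a, b). box a b))" by (simp only: gen)
  then show ?thesis
  proof (induction rule: sigma_sets_induct_disjoint[OF istab closed, consumes 1, case_names basic empty compl union])
    case (basic A)
    then obtain a b where "A = box a b" by auto
    then obtain a' b' where "A \<inter> box u v = box a' b'" using box_Int by metis
    then show ?case using equidistributes_box[OF ij] by simp
  next
    case empty
    have "sector_piece i j ({} \<inter> box u v) = {}" by (simp add: sector_piece_def)
    then show ?case by (simp only: equidistributes_empty)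
  next
    case (compl A)
    have "indicator (?C (UNIV - A)) = (\<lambda>x. indicator (sector_piece i j (box u v)) x + (- 1) * indicator (?C A) x :: real)"
      by (auto simp: fun_eq_iff indicator_def sector_piece_def)
    then show ?case
      using equidistributes_linear[OF equidistributes_box[OF ij, of u v] compl.IH, of "- 1"] by (simp only:)
  next
    case (union A)
    let ?f = "\<lambda>n x. \<Sum>k<n. indicator (?C (A k)) x :: real"
    have disj: "disjoint_family (\<lambda>k. ?C (A k))"
      using union(1) by (auto simp: disjoint_family_on_def sector_piece_def)
    have f_eq: "?f n x = indicator (\<Union>k<n. ?C (A k)) x" for n x
    proof (induction n)
      case (Suc n)
      have "x \<notin> ?C (A n)" if "x \<in> ?C (A k)" "k < n" for k
        using disjoint_family_onD[OF disj UNIV_I UNIV_I, of k n] that by blast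
      then have "(indicator (\<Union>k<Suc n. ?C (A k)) x :: real) = indicator (\<Union>k<n. ?C (A k)) x + indicator (?C (A n)) x"
        by (auto simp: indicator_def less_Suc_eq)
      then show ?case by (simp only: sum.lessThan_Suc Suc)
    qed simp
    have f: "equidistributes (?f n)" for n
    proof (induction n)
      case (Suc n)
      then show ?case using equidistributes_linear[OF Suc union.IH, of 1 n] by simp
    qed (simp add: equidistributes_zero)
    show ?case
    proof (rule equidistributes_lim[OF f _ Bint])
      fix x
      have "(\<lambda>n. indicator (\<Union>k<n. ?C (A k)) x :: real) \<longlonglongrightarrow> indicator (\<Union>k. ?C (A k)) x"
        by (rule LIMSEQ_indicator_UN)
      moreover have "(\<Union>k. ?C (A k)) = ?C (\<Union>k. A k)" by (auto simp: sector_piece_def)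
      ultimately show "(\<lambda>n. ?f n x) \<longlonglongrightarrow> indicator (?C (\<Union>k. A k)) x" by (simp only: f_eq)
    next
      show "\<bar>?f n x\<bar> \<le> indicator (?C UNIV) x" for n x
        unfolding f_eq by (auto simp: indicator_def sector_piece_def)
      have "A k \<in> sets borel" for k using union(2) gen by auto
      then show "indicator (?C (\<Union>k. A k)) \<in> borel_measurable borel"
        by (intro borel_measurable_indicator sector_piece_borel) auto
    qed
  qed
qed

text \<open>\<open>\<Psi>\<close> inverts \<open>to_sector_coords\<close> off the null hyperplane
  \<open>x $ j = 0\<close>. There \<open>E\<close> is the increasing limit of sector pieces, with
  its own indicator as majorant.\<close>

lemma equidistributes_indicator:
  fixes E :: "(real ^ 'n) set"
  assumes E: "E \<in> sets borel" and fin: "emeasure lborel E < \<infinity>"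
  shows "equidistributes (indicator E)"
proof -
  obtain i j :: 'n where ij: "i \<noteq> j" using ex_other_index[OF card] by metis
  define \<Psi> where "\<Psi> y = (\<chi> l. if l = i then y $ i * y $ j else y $ l)" for y :: "real ^ 'n"
  have [measurable]: "\<Psi> \<in> borel_measurable borel"
    unfolding \<Psi>_def by (intro borel_measurable_vec_lambda) measurable
  have inverse: "\<Psi> (to_sector_coords i j x) = x" if "x $ j \<noteq> 0" for x
    using that ij by (auto simp: \<Psi>_def to_sector_coords_def vec_eq_iff)
  have D: "\<Psi> -` E \<in> sets borel" using measurable_sets_borel[OF _ E, of \<Psi>] by simp
  let ?B = "\<lambda>k. box (- (\<chi> l. real k)) (\<chi> l. real k) :: (real ^ 'n) set"
  let ?C = "\<lambda>k. sector_piece i j (\<Psi> -` E \<inter> ?B k)"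
  let ?E = "E \<inter> {x. x $ j \<noteq> 0}"
  have lim: "(\<lambda>k. indicator (?C k) x :: real) \<longlonglongrightarrow> indicator ?E x" for x
  proof -
    obtain K :: nat where K: "norm (to_sector_coords i j x) < K" using reals_Archimedean2 by blast
    have "\<forall>\<^sub>F k in sequentially. (indicator (?C k) x :: real) = indicator ?E x"
      using eventually_ge_at_top[of K]
    proof eventually_elim
      case (elim k)
      have "\<bar>to_sector_coords i j x $ l\<bar> < real k" for l
        using component_le_norm_cart[of "to_sector_coords i j x" l] K elim by linarith
      then have "to_sector_coords i j x \<in> ?B k" by (auto simp: mem_box_cart abs_less_iff minus_less_iff)
      then show ?case using inverse[of x] by (auto simp: indicator_def sector_piece_def)
    qed
    then show ?thesis by (rule tendsto_eventually)
  qed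
  have mE: "{x \<in> space borel. x \<in> E \<and> x $ j \<noteq> 0} \<in> sets borel" using E by measurable
  have "equidistributes (indicator ?E)"
  proof (rule equidistributes_lim[OF equidistributes_sector_piece[OF ij D] lim])
    show "integrable lborel (indicator E :: _ \<Rightarrow> real)" using E fin by (intro integrable_real_indicator) auto
    show "\<bar>indicator (?C k) x\<bar> \<le> (indicator E x :: real)" for k x
      using inverse[of x] by (auto simp: indicator_def sector_piece_def)
    show "indicator ?E \<in> borel_measurable borel"
      using mE by (intro borel_measurable_indicator) (simp add: Int_def)
  qed
  then show ?thesis
  proof (rule equidistributes_cong_AE)
    have "(axis j 1 :: real ^ 'n) \<noteq> 0" by (simp add: axis_eq_0_iff)
    from hyperplane_lborel_null[OF this, of 0]
    have "AE x in lborel. \<not> (axis j 1 :: real ^ 'n) \<bullet> x = 0" by (rule AE_I') auto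
    then show "AE x in lborel. indicator E x = (indicator ?E x :: real)"
      by eventually_elim (simp add: inner_axis' indicator_def)
  qed (use E in simp)
qed

theorem equidistributes_integrable:
  fixes \<phi> :: "real ^ 'n \<Rightarrow> real"
  assumes "integrable lborel \<phi>" shows "equidistributes \<phi>"
  using assms
proof (induction rule: integrable_induct)
  case (base A c)
  have "equidistributes (\<lambda>x. 0 + c * indicator A x)"
    using base by (intro equidistributes_linear equidistributes_zero equidistributes_indicator) auto
  then show ?case by (simp add: mult.commute)
next
  case (add f g)
  then show ?case using equidistributes_linear[of f g 1] by simp
next
  case (lim f s)
  show ?case
    by (rule equidistributes_lim[where f = s and w = "\<lambda>x. 2 * norm (f x)"]) (use lim in \<open>auto simp: space_borel\<close>)
qed

end

section \<open>Invariant measures on pairs of vectors\<close>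

definition pair_act :: "real ^ 'n ^ 'n \<Rightarrow> (real ^ 'n) \<times> (real ^ 'n) \<Rightarrow> (real ^ 'n) \<times> (real ^ 'n)" where
  "pair_act A p = (A *v fst p, A *v snd p)"

text \<open>The 2 by 2 minors of the matrix whose columns are the two vectors (Pluecker
  coordinates); all of them vanish exactly for dependent pairs.\<close>

definition minor :: "'n \<Rightarrow> 'n \<Rightarrow> (real ^ 'n) \<times> (real ^ 'n) \<Rightarrow> real" where
  "minor j k p = fst p $ j * snd p $ k - fst p $ k * snd p $ j"

lemma minor_measurable [measurable]: "minor j k \<in> borel_measurable borel"
  unfolding minor_def[abs_def] by (intro borel_measurable_continuous_onI continuous_intros)

lemma minor_swap: "minor k j p = - minor j k p"
  by (simp add: minor_def)

lemma minor_same [simp]: "minor j j p = 0"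
  by (simp add: minor_def)

lemma pair_act_measurable [measurable]: "pair_act A \<in> borel_measurable borel"
  unfolding pair_act_def[abs_def]
  by (intro borel_measurable_continuous_onI continuous_on_Pair continuous_on_compose2[OF matrix_vector_mult_linear_continuous_on[of UNIV]])
    (auto intro!: continuous_intros)

lemma minor_transvection:
  assumes "k \<noteq> l" "j \<noteq> k"
  shows "minor j k (pair_act (transvection k l s) p) = minor j k p + s * minor j l p"
  using assms by (simp add: minor_def pair_act_def transvection_mult_vec algebra_simps)

lemma minor_transvection_other:
  assumes "k \<noteq> l" "j \<noteq> k" "i \<noteq> k"
  shows "minor j i (pair_act (transvection k l s) p) = minor j i p"
  using assms by (simp add: minor_def pair_act_def transvection_mult_vec)

lemma pair_transvection_measurable:
  assumes "k \<noteq> l"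
  shows "(\<lambda>(s, p). pair_act (transvection k l s) p) \<in> borel_measurable (borel \<Otimes>\<^sub>M borel)"
proof -
  have eq: "transvection k l s *v x = x + (s * x $ l) *\<^sub>R axis k 1" for s and x :: "real ^ 'a"
    using assms by (auto simp: vec_eq_iff transvection_mult_vec axis_def)
  have "continuous_on UNIV (\<lambda>q :: real \<times> (real ^ 'a) \<times> (real ^ 'a). (fst (snd q) + (fst q * fst (snd q) $ l) *\<^sub>R axis k 1 :: real ^ 'a,
      snd (snd q) + (fst q * snd (snd q) $ l) *\<^sub>R axis k 1 :: real ^ 'a))"
    by (intro continuous_intros)
  then have "(\<lambda>q :: real \<times> (real ^ 'a) \<times> (real ^ 'a). (fst (snd q) + (fst q * fst (snd q) $ l) *\<^sub>R axis k 1 :: real ^ 'a,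
      snd (snd q) + (fst q * snd (snd q) $ l) *\<^sub>R axis k 1 :: real ^ 'a)) \<in> borel_measurable borel"
    by (rule borel_measurable_continuous_onI)
  then show ?thesis unfolding pair_act_def eq by (simp add: borel_prod split_beta')
qed

text \<open>Written out rather than as a matrix product so that joint continuity in s and p is
  visible; \<open>double_shear_eq\<close> gives the matrix when i differs from j and k.\<close>

definition double_shear :: "'n \<Rightarrow> 'n \<Rightarrow> 'n \<Rightarrow> real \<times> real \<Rightarrow> (real ^ 'n) \<times> (real ^ 'n) \<Rightarrow> (real ^ 'n) \<times> (real ^ 'n)" where
  "double_shear i j k s p = (fst p + (fst s * fst p $ j + snd s * fst p $ k) *\<^sub>R axis i 1,
    snd p + (fst s * snd p $ j + snd s * snd p $ k) *\<^sub>R axis i 1)"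

lemma double_shear_eq:
  assumes "i \<noteq> j" "i \<noteq> k"
  shows "double_shear i j k s p = pair_act (transvection i j (fst s) ** transvection i k (snd s)) p"
  using assms by (auto simp: double_shear_def pair_act_def vec_eq_iff transvection_mult_vec axis_def
      matrix_vector_mul_assoc[symmetric])

lemma double_shear_measurable:
  "(\<lambda>(s, p). double_shear i j k s p) \<in> borel_measurable (borel \<Otimes>\<^sub>M borel)"
proof -
  have "continuous_on UNIV (\<lambda>q. double_shear i j k (fst q) (snd q))"
    unfolding double_shear_def by (intro continuous_intros)
  then have "(\<lambda>q. double_shear i j k (fst q) (snd q)) \<in> borel_measurable borel"
    by (rule borel_measurable_continuous_onI)
  then show ?thesis by (simp add: borel_prod split_beta')
qed

text \<open>Cramer's rule: the multiples of coordinates j and k that add c to coordinate i of the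
  first vector and d to that of the second.\<close>

definition shear_time :: "'n \<Rightarrow> 'n \<Rightarrow> real \<Rightarrow> real \<Rightarrow> (real ^ 'n) \<times> (real ^ 'n) \<Rightarrow> real \<times> real" where
  "shear_time j k c d p = ((c * snd p $ k - fst p $ k * d) / minor j k p, (fst p $ j * d - c * snd p $ j) / minor j k p)"

lemma shear_time_solves:
  assumes "minor j k p \<noteq> 0"
  shows "fst (shear_time j k c d p) * fst p $ j + snd (shear_time j k c d p) * fst p $ k = c"
    "fst (shear_time j k c d p) * snd p $ j + snd (shear_time j k c d p) * snd p $ k = d"
proof -
  let ?\<Delta> = "minor j k p"
  have n: "(c * snd p $ k - fst p $ k * d) * fst p $ j + (fst p $ j * d - c * snd p $ j) * fst p $ k = c * ?\<Delta>"
    "(c * snd p $ k - fst p $ k * d) * snd p $ j + (fst p $ j * d - c * snd p $ j) * snd p $ k = d * ?\<Delta>"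
    by (simp_all add: minor_def algebra_simps)
  have "fst (shear_time j k c d p) * fst p $ j + snd (shear_time j k c d p) * fst p $ k = c * ?\<Delta> / ?\<Delta>"
    unfolding shear_time_def fst_conv snd_conv times_divide_eq_left add_divide_distrib[symmetric] n ..
  moreover have "fst (shear_time j k c d p) * snd p $ j + snd (shear_time j k c d p) * snd p $ k = d * ?\<Delta> / ?\<Delta>"
    unfolding shear_time_def fst_conv snd_conv times_divide_eq_left add_divide_distrib[symmetric] n ..
  ultimately show "fst (shear_time j k c d p) * fst p $ j + snd (shear_time j k c d p) * fst p $ k = c"
    "fst (shear_time j k c d p) * snd p $ j + snd (shear_time j k c d p) * snd p $ k = d"
    using assms by simp_all
qed

lemma shear_time_unique:
  assumes "minor j k p \<noteq> 0" "a * fst p $ j + b * fst p $ k = c" "a * snd p $ j + b * snd p $ k = d"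
  shows "shear_time j k c d p = (a, b)"
proof -
  have "c * snd p $ k - fst p $ k * d = a * minor j k p" "fst p $ j * d - c * snd p $ j = b * minor j k p"
    unfolding assms(2,3)[symmetric] by (simp_all add: minor_def algebra_simps)
  then show ?thesis using assms(1) by (simp add: shear_time_def)
qed

text \<open>
  For \<open>N \<ge> 3\<close> a third coordinate of a pair of independent vectors can be translated arbitrarily by
  shears that add multiples of two others.
\<close>

theorem SL_invariant_pair_measure_eq:
  fixes m :: "((real ^ 'n) \<times> (real ^ 'n)) measure"
  assumes card: "CARD('n) > 2" and sets_m: "sets m = sets borel" and sf: "sigma_finite_measure m"
    and inv: "\<And>A. A \<in> SL \<Longrightarrow> distr m borel (pair_act A) = m"
    and indep: "AE p in m. \<exists>j k. minor j k p \<noteq> 0"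
  shows "\<exists>c::real. 0 \<le> c \<and> m = scale_measure (ennreal c) lborel"
proof (rule basis_translation_invariant_measure_eq[OF sf sets_m])
  note [measurable_cong] = sets_m
  have sp [simp]: "space m = UNIV" using sets_eq_imp_space_eq[OF sets_m] by simp
  have inv': "distr m m (pair_act A) = m" if "A \<in> SL" for A
    using inv[OF that] distr_cong[OF refl sets_m refl, of m "pair_act A"] by simp
  \<comment> \<open>Adding multiples of coordinate l to coordinate k changes
    \<open>minor j k\<close> at speed \<open>minor j l\<close>, so an orbit with nonzero speed meets
    the zero set once.\<close>
  have null1: "AE p in m. minor j l p \<noteq> 0 \<longrightarrow> minor j k p \<noteq> 0" if d: "j \<noteq> k" "k \<noteq> l" for j k l
  proof -
    let ?Z = "{p. minor j l p \<noteq> 0 \<and> minor j k p = 0}"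
    have Z: "?Z \<in> sets m" by measurable
    have "emeasure m ?Z = 0"
    proof (cases "j = l")
      case False
      show ?thesis
      proof (rule null_set_of_null_orbit_times[OF sf _ Z inv'])
        show "(\<lambda>(s, p). pair_act (transvection k l s) p) \<in> measurable (borel \<Otimes>\<^sub>M m) m"
          using pair_transvection_measurable[OF d(2)]
          by (simp add: measurable_cong_sets[OF sets_pair_measure_cong[OF refl sets_m] sets_m])
        show "transvection k l s \<in> SL" for s by (rule transvection_in_SL[OF d(2)])
        fix p
        have "{s. pair_act (transvection k l s) p \<in> ?Z} \<subseteq> {- minor j k p / minor j l p}"
          using d False by (auto simp: minor_transvection minor_transvection_other field_simps)
        then show "countable {s. pair_act (transvection k l s) p \<in> ?Z}" by (rule countable_subset) simp
      qed
    qed simp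
    then have "?Z \<in> null_sets m" using Z by (simp add: null_sets_def)
    then show ?thesis by (rule AE_I') auto
  qed
  have "AE p in m. \<forall>j k l. j \<noteq> k \<and> k \<noteq> l \<longrightarrow> minor j l p \<noteq> 0 \<longrightarrow> minor j k p \<noteq> 0"
    unfolding AE_all_countable
  proof (intro allI)
    fix j k l show "AE p in m. j \<noteq> k \<and> k \<noteq> l \<longrightarrow> minor j l p \<noteq> 0 \<longrightarrow> minor j k p \<noteq> 0"
      using null1[of j k l] by (cases "j \<noteq> k \<and> k \<noteq> l") auto
  qed
  \<comment> \<open>One nonzero minor spreads to all: exchange its second index, swap the two
    indices, then exchange the other one.\<close>
  with indep have null: "AE p in m. \<forall>j k. j \<noteq> k \<longrightarrow> minor j k p \<noteq> 0"
  proof eventually_elim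
    case (elim p)
    then obtain a b where ab: "minor a b p \<noteq> 0" by blast
    have step: "minor j k p \<noteq> 0" if "minor j l p \<noteq> 0" "j \<noteq> k" for j k l
      using elim(2) that by (cases "k = l") auto
    have swap: "minor k j p \<noteq> 0" if "minor j k p \<noteq> 0" for j k
      using that by (simp add: minor_swap[of k j])
    show ?case
    proof (intro allI impI)
      fix j k :: 'n assume jk: "j \<noteq> k"
      show "minor j k p \<noteq> 0"
      proof (cases "j = a")
        case True then show ?thesis using step[OF ab] jk by simp
      next
        case False
        then show ?thesis using step[OF swap[OF step[OF ab, of j]], of k] jk by simp
      qed
    qed
  qed
  have trans: "distr m m (\<lambda>p. p + (c *\<^sub>R axis i 1, d *\<^sub>R axis i 1)) = m" for i :: 'n and c d
  proof -
    obtain j where j: "j \<noteq> i" using ex_other_index[of i] card by auto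
    have "\<exists>k. k \<notin> {i, j}"
    proof (rule ccontr)
      assume "\<not> ?thesis"
      then have "UNIV = {i, j}" by auto
      then have "CARD('n) = card {i, j}" by (rule arg_cong)
      then show False using card j by simp
    qed
    then obtain k where k: "k \<noteq> i" "k \<noteq> j" by auto
    show ?thesis
    proof (rule measure_eqI)
      fix E assume "E \<in> sets (distr m m (\<lambda>p. p + (c *\<^sub>R axis i 1, d *\<^sub>R axis i 1)))"
      then have E [measurable]: "E \<in> sets borel" by (simp add: sets_m)
      let ?X = "{p :: (real ^ 'n) \<times> (real ^ 'n). minor j k p \<noteq> 0}"
      let ?\<theta> = "shear_time j k c d" and ?p = "\<lambda>p. shear_time j k (fst p $ i) (snd p $ i) p"
      have tr: "double_shear i j k (?\<theta> p) p = p + (c *\<^sub>R axis i 1, d *\<^sub>R axis i 1)" if "p \<in> ?X" for p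
        using shear_time_solves[of j k p c d] that by (cases p) (simp add: double_shear_def)
      have row: "fst (double_shear i j k s p) $ l = fst p $ l" "snd (double_shear i j k s p) $ l = snd p $ l" if "l \<noteq> i" for s p l
        using that by (simp_all add: double_shear_def axis_def)
      have row_i: "fst (double_shear i j k s p) $ i = fst p $ i + (fst s * fst p $ j + snd s * fst p $ k)"
        "snd (double_shear i j k s p) $ i = snd p $ i + (fst s * snd p $ j + snd s * snd p $ k)" for s p
        by (simp_all add: double_shear_def axis_def)
      have minor_shear: "minor j k (double_shear i j k s p) = minor j k p" for s p
        using j k by (simp add: minor_def row)
      have \<theta>_meas: "shear_time j k (f p) (g p) p \<in> UNIV" for f g :: "(real ^ 'n) \<times> (real ^ 'n) \<Rightarrow> real" and p by simp
      have comp [measurable]: "(\<lambda>p. fst p $ l) \<in> borel_measurable (borel :: ((real ^ 'n) \<times> (real ^ 'n)) measure)"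
        "(\<lambda>p. snd p $ l) \<in> borel_measurable (borel :: ((real ^ 'n) \<times> (real ^ 'n)) measure)" for l
        by (intro borel_measurable_continuous_onI continuous_intros)+
      have "emeasure (distr m m (\<lambda>p. p + (c *\<^sub>R axis i 1, d *\<^sub>R axis i 1))) E = emeasure m {p. p + (c *\<^sub>R axis i 1, d *\<^sub>R axis i 1) \<in> E}"
        by (subst emeasure_distr) (auto simp: sets_m vimage_def)
      also have "\<dots> = emeasure m {p\<in>?X. double_shear i j k (?\<theta> p) p \<in> E}"
      proof (rule emeasure_eq_AE)
        have "{p\<in>?X. double_shear i j k (?\<theta> p) p \<in> E} = {p. minor j k p \<noteq> 0 \<and> p + (c *\<^sub>R axis i 1, d *\<^sub>R axis i 1) \<in> E}"
          by (intro Collect_cong conj_cong) (auto simp: tr)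
        also have "\<dots> \<in> sets m" by measurable
        finally show "{p\<in>?X. double_shear i j k (?\<theta> p) p \<in> E} \<in> sets m" .
        show "{p. p + (c *\<^sub>R axis i 1, d *\<^sub>R axis i 1) \<in> E} \<in> sets m" by measurable
        show "AE p in m. (p \<in> {p. p + (c *\<^sub>R axis i 1, d *\<^sub>R axis i 1) \<in> E}) = (p \<in> {p\<in>?X. double_shear i j k (?\<theta> p) p \<in> E})"
          using null by eventually_elim (use k in \<open>simp add: tr\<close>)
      qed
      also have "\<dots> = emeasure m (?X \<inter> E)"
      \<comment> \<open>\<open>?p\<close> expresses coordinate i of the pair through coordinates j
        and k, so it advances by s; \<open>?\<theta>\<close> sees only coordinates j and k, which
        the shear fixes.\<close>
      proof (rule emeasure_flow_reparametrized[where p = ?p, OF sf])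
        show "(\<lambda>(s, p). double_shear i j k s p) \<in> measurable (borel \<Otimes>\<^sub>M m) m"
          using double_shear_measurable[of i j k]
          by (simp add: measurable_cong_sets[OF sets_pair_measure_cong[OF refl sets_m] sets_m])
        show "?p \<in> borel_measurable m" unfolding shear_time_def by (intro borel_measurable_Pair) measurable
        show "?\<theta> \<in> borel_measurable m" unfolding shear_time_def by (intro borel_measurable_Pair) measurable
        show "?X \<in> sets m" by measurable
        show "E \<in> sets m" by (simp add: sets_m)
        show "distr m m (double_shear i j k s) = m" for s
        proof -
          have "double_shear i j k s = pair_act (transvection i j (fst s) ** transvection i k (snd s))"
            using j k by (auto simp: double_shear_eq fun_eq_iff)
          then show ?thesis using j k by (simp add: inv' SL_mult transvection_in_SL)
        qed
        show "double_shear i j k s (double_shear i j k t p) = double_shear i j k (s + t) p" for s t p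
          using j k by (simp add: double_shear_def prod_eq_iff vec_eq_iff axis_def algebra_simps)
        show "double_shear i j k 0 p = p" for p
          by (simp add: double_shear_def)
        show "double_shear i j k s p \<in> ?X \<longleftrightarrow> p \<in> ?X" for s p
          by (simp add: minor_shear)
        show "?\<theta> (double_shear i j k s p) = ?\<theta> p" for s p
          using j k by (simp add: shear_time_def minor_shear row)
        fix s p assume p: "p \<in> ?X"
        have "?p (double_shear i j k s p) = (fst (?p p + s), snd (?p p + s))"
        proof (rule shear_time_unique)
          show "minor j k (double_shear i j k s p) \<noteq> 0" using p by (simp add: minor_shear)
          show "fst (?p p + s) * fst (double_shear i j k s p) $ j + snd (?p p + s) * fst (double_shear i j k s p) $ k =
              fst (double_shear i j k s p) $ i"
            using shear_time_solves(1)[of j k p "fst p $ i" "snd p $ i"] p j k by (simp add: row row_i algebra_simps)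
          show "fst (?p p + s) * snd (double_shear i j k s p) $ j + snd (?p p + s) * snd (double_shear i j k s p) $ k =
              snd (double_shear i j k s p) $ i"
            using shear_time_solves(2)[of j k p "fst p $ i" "snd p $ i"] p j k by (simp add: row row_i algebra_simps)
        qed
        then show "?p (double_shear i j k s p) = ?p p + s" by (simp add: prod_eq_iff)
      qed
      also have "\<dots> = emeasure m E"
      proof (rule emeasure_eq_AE)
        show "AE p in m. (p \<in> ?X \<inter> E) = (p \<in> E)" using null by eventually_elim (use k in simp)
        show "?X \<inter> E \<in> sets m" "E \<in> sets m" by measurable
      qed
      finally show "emeasure (distr m m (\<lambda>p. p + (c *\<^sub>R axis i 1, d *\<^sub>R axis i 1))) E = emeasure m E" .
    qed simp
  qed
  fix b :: "(real ^ 'n) \<times> (real ^ 'n)" and \<tau> :: real assume "b \<in> Basis"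
  then consider i where "b = (axis i 1, 0)" | i where "b = (0, axis i 1)"
    by (auto simp: Basis_prod_def Basis_vec_def)
  then show "distr m m (\<lambda>p. p + \<tau> *\<^sub>R b) = m"
  proof cases
    case 1
    then show ?thesis using trans[of \<tau> i 0] by simp
  next
    case 2
    then show ?thesis using trans[of 0 i \<tau>] by simp
  qed
qed

lemma dependent_iff:
  fixes x y :: "real ^ 'n"
  shows "(\<forall>j k. minor j k (x, y) = 0) \<longleftrightarrow> x = 0 \<or> (\<exists>t. y = t *\<^sub>R x)"
proof
  assume m: "\<forall>j k. minor j k (x, y) = 0"
  show "x = 0 \<or> (\<exists>t. y = t *\<^sub>R x)"
  proof (cases "x = 0")
    case False
    then obtain j where j: "x $ j \<noteq> 0" by (auto simp: vec_eq_iff)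
    have y: "y $ k = (y $ j / x $ j) * x $ k" for k
      using m[rule_format, of j k] j by (simp add: minor_def field_simps)
    have "y = (y $ j / x $ j) *\<^sub>R x"
      unfolding vec_eq_iff vector_scaleR_component real_scaleR_def by (rule allI) (rule y)
    then show ?thesis by blast
  qed simp
qed (auto simp: minor_def)

lemma dependent_pair_act:
  assumes "A \<in> SL"
  shows "(\<forall>j k. minor j k (pair_act A p) = 0) \<longleftrightarrow> (\<forall>j k. minor j k p = 0)"
proof -
  obtain B where B: "B ** A = mat 1" by (rule SL_inverse[OF assms])
  have one: "\<forall>j k. minor j k (pair_act A p) = 0" if "\<forall>j k. minor j k p = 0" for A and p :: "(real ^ 'a) \<times> (real ^ 'a)"
  proof -
    have "fst p = 0 \<or> (\<exists>t. snd p = t *\<^sub>R fst p)" using that dependent_iff[of "fst p" "snd p"] by simp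
    then have "A *v fst p = 0 \<or> (\<exists>t. A *v snd p = t *\<^sub>R (A *v fst p))"
      by (auto simp: matrix_vector_mult_scaleR)
    then show ?thesis unfolding pair_act_def dependent_iff .
  qed
  have "pair_act B (pair_act A p) = p" by (simp add: pair_act_def matrix_vector_mul_assoc B)
  then show ?thesis using one[of p A] one[of "pair_act A p" B] by auto
qed

section \<open>Second moments\<close>

text \<open>
  On pairs of independent vectors the second moment measure is a multiple of Lebesgue measure, so
  only the dependent pairs contribute to the variance.
\<close>

locale siegel_L2 = siegel \<mu> for \<mu> :: "(real ^ 'n) measure measure" +
  assumes card3: "CARD('n) > 2"
    and square_integrable: "\<And>\<psi>. \<psi> \<in> Cc \<Longrightarrow> integrable \<mu> (\<lambda>\<nu>. (hat \<psi> \<nu>)\<^sup>2)"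
begin

definition moment2 :: "((real ^ 'n) \<times> (real ^ 'n)) measure" where
  "moment2 = mixture \<mu> (\<lambda>\<nu>. \<nu> \<Otimes>\<^sub>M \<nu>) borel"

lemma borel_pair: "(borel :: ((real ^ 'n) \<times> (real ^ 'n)) measure) = borel \<Otimes>\<^sub>M borel"
  by (rule borel_prod[symmetric])

lemma sets_pair_growth: "\<nu> \<in> growth_measures \<Longrightarrow> sets (\<nu> \<Otimes>\<^sub>M \<nu>) = sets (borel :: ((real ^ 'n) \<times> (real ^ 'n)) measure)"
  unfolding borel_pair by (intro sets_pair_measure_cong sets_growth_measure)

lemma emeasure_pair_growth:
  assumes \<nu>: "\<nu> \<in> growth_measures" and E: "E \<in> sets (borel :: ((real ^ 'n) \<times> (real ^ 'n)) measure)"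
  shows "emeasure (\<nu> \<Otimes>\<^sub>M \<nu>) E = (\<integral>\<^sup>+x. \<integral>\<^sup>+y. indicator E (x, y) \<partial>\<nu> \<partial>\<nu>)"
  using E sets_pair_growth[OF \<nu>]
  by (intro sigma_finite_measure.emeasure_pair_measure growth_measure_sigma_finite[OF \<nu>]) simp

lemma id_measurable_mu: "(\<lambda>\<nu>. \<nu>) \<in> measurable \<mu> growth_measures_borel"
  using measurable_ident_sets[OF sets_mu] by simp

sublocale moment2: measure_mixture \<mu> "\<lambda>\<nu>. \<nu> \<Otimes>\<^sub>M \<nu>" "borel :: ((real ^ 'n) \<times> (real ^ 'n)) measure"
proof
  fix \<nu> assume "\<nu> \<in> space \<mu>"
  then show "sets (\<nu> \<Otimes>\<^sub>M \<nu>) = sets (borel :: ((real ^ 'n) \<times> (real ^ 'n)) measure)"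
    by (simp add: sets_pair_growth)
next
  fix E assume E: "E \<in> sets (borel :: ((real ^ 'n) \<times> (real ^ 'n)) measure)"
  then have [measurable]: "E \<in> sets (borel \<Otimes>\<^sub>M borel)" unfolding borel_pair .
  have fst_meas: "fst \<in> measurable (\<mu> \<Otimes>\<^sub>M borel) growth_measures_borel"
    by (rule measurable_compose[OF measurable_fst id_measurable_mu])
  have "(\<lambda>q. \<integral>\<^sup>+y. indicator E (snd q, y) \<partial>fst q) \<in> borel_measurable (\<mu> \<Otimes>\<^sub>M (borel :: (real ^ 'n) measure))"
    by (rule measurable_growth_kernel_nn_integral[OF fst_meas]) measurable
  then have "(\<lambda>(\<nu>, x). \<integral>\<^sup>+y. indicator E (x, y) \<partial>\<nu>) \<in> borel_measurable (\<mu> \<Otimes>\<^sub>M (borel :: (real ^ 'n) measure))"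
    by (simp add: split_beta')
  then have "(\<lambda>\<nu>. \<integral>\<^sup>+x. \<integral>\<^sup>+y. indicator E (x, y) \<partial>\<nu> \<partial>\<nu>) \<in> borel_measurable \<mu>"
    by (rule measurable_growth_kernel_nn_integral[OF id_measurable_mu])
  then show "(\<lambda>\<nu>. emeasure (\<nu> \<Otimes>\<^sub>M \<nu>) E) \<in> borel_measurable \<mu>"
    by (rule measurable_cong[THEN iffD1, rotated]) (simp add: emeasure_pair_growth[OF _ E])
qed

lemma sets_moment2 [simp]: "sets moment2 = sets borel"
  by (simp add: moment2_def)

lemma space_moment2 [simp]: "space moment2 = UNIV"
  by (simp add: moment2_def)

lemma borel_measurable_moment2 [simp]: "borel_measurable moment2 = borel_measurable borel"
  by (rule measurable_cong_sets) simp_all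

lemma emeasure_moment2: "E \<in> sets borel \<Longrightarrow> emeasure moment2 E = (\<integral>\<^sup>+\<nu>. emeasure (\<nu> \<Otimes>\<^sub>M \<nu>) E \<partial>\<mu>)"
  unfolding moment2_def by (rule moment2.emeasure_mixture)

lemma pair_act_sets: "E \<in> sets borel \<Longrightarrow> {p. pair_act A p \<in> E} \<in> sets borel"
  using measurable_sets_borel[OF pair_act_measurable[of A], of E] by (simp add: vimage_def)

lemma emeasure_moment2_pair_act:
  assumes A: "A \<in> SL" and E: "E \<in> sets borel"
  shows "emeasure moment2 {p. pair_act A p \<in> E} = emeasure moment2 E"
proof -
  have [measurable]: "E \<in> sets (borel \<Otimes>\<^sub>M borel)" using E unfolding borel_pair .
  have "emeasure moment2 {p. pair_act A p \<in> E} = (\<integral>\<^sup>+\<nu>. emeasure (\<nu> \<Otimes>\<^sub>M \<nu>) {p. pair_act A p \<in> E} \<partial>\<mu>)"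
    by (rule emeasure_moment2[OF pair_act_sets[OF E]])
  also have "\<dots> = (\<integral>\<^sup>+\<nu>. emeasure (act A \<nu> \<Otimes>\<^sub>M act A \<nu>) E \<partial>\<mu>)"
  proof (rule nn_integral_cong)
    fix \<nu> assume "\<nu> \<in> space \<mu>"
    then have \<nu>: "\<nu> \<in> growth_measures" by simp
    note mc = measurable_cong_sets[OF sets_growth_measure[OF \<nu>] refl]
    interpret a: sigma_finite_measure "act A \<nu>"
      by (rule growth_measure_sigma_finite[OF act_growth_measures[OF A \<nu>]])
    have A_meas: "(*v) A \<in> measurable \<nu> borel" unfolding mc by simp
    have in1: "(\<lambda>x. \<integral>\<^sup>+y. indicator E (x, y) \<partial>act A \<nu>) \<in> borel_measurable borel"
    proof -
      have "(\<lambda>x. \<integral>\<^sup>+y. indicator E (x, y) \<partial>act A \<nu>) \<in> borel_measurable (borel :: (real ^ 'n) measure)"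
        by (intro a.borel_measurable_nn_integral)
          (simp add: split_beta' measurable_cong_sets[OF sets_pair_measure_cong[OF refl sets_act] refl], measurable)
      then show ?thesis .
    qed
    have "emeasure (act A \<nu> \<Otimes>\<^sub>M act A \<nu>) E = (\<integral>\<^sup>+x. \<integral>\<^sup>+y. indicator E (x, y) \<partial>act A \<nu> \<partial>act A \<nu>)"
      by (rule emeasure_pair_growth[OF act_growth_measures[OF A \<nu>] E])
    also have "\<dots> = (\<integral>\<^sup>+x. \<integral>\<^sup>+y. indicator E (A *v x, y) \<partial>act A \<nu> \<partial>\<nu>)"
      unfolding act_def[of A \<nu>] by (rule nn_integral_distr[OF A_meas]) (use in1 in \<open>simp add: act_def\<close>)
    also have "\<dots> = (\<integral>\<^sup>+x. \<integral>\<^sup>+y. indicator E (A *v x, A *v y) \<partial>\<nu> \<partial>\<nu>)"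
      unfolding act_def[of A \<nu>] by (intro nn_integral_cong nn_integral_distr[OF A_meas]) measurable
    also have "\<dots> = (\<integral>\<^sup>+x. \<integral>\<^sup>+y. indicator {p. pair_act A p \<in> E} (x, y) \<partial>\<nu> \<partial>\<nu>)"
      by (intro nn_integral_cong) (simp add: indicator_def pair_act_def)
    also have "\<dots> = emeasure (\<nu> \<Otimes>\<^sub>M \<nu>) {p. pair_act A p \<in> E}"
      by (rule emeasure_pair_growth[OF \<nu> pair_act_sets[OF E], symmetric])
    finally show "emeasure (\<nu> \<Otimes>\<^sub>M \<nu>) {p. pair_act A p \<in> E} = emeasure (act A \<nu> \<Otimes>\<^sub>M act A \<nu>) E" by simp
  qed
  also have "\<dots> = (\<integral>\<^sup>+\<nu>. emeasure (\<nu> \<Otimes>\<^sub>M \<nu>) E \<partial>distr \<mu> \<mu> (act A))"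
    using act_measurable_mu[OF A] moment2.meas_K[OF E] by (intro nn_integral_distr[symmetric]) simp_all
  finally show ?thesis by (simp add: act_preserves[OF A] emeasure_moment2[OF E])
qed

text \<open>Square integrability is assumed on \<open>Cc\<close> only, so the indicator of the ball
  is dominated by a cutoff.\<close>

lemma moment2_ball_finite: "emeasure moment2 (ball 0 (real k) \<times> ball 0 (real k)) < \<infinity>"
proof -
  have "emeasure moment2 (ball 0 (real k) \<times> ball 0 (real k)) =
      (\<integral>\<^sup>+\<nu>. emeasure (\<nu> \<Otimes>\<^sub>M \<nu>) (ball 0 (real k) \<times> ball 0 (real k)) \<partial>\<mu>)"
    by (rule emeasure_moment2) (simp add: borel_Times)
  also have "\<dots> \<le> (\<integral>\<^sup>+\<nu>. ennreal ((hat (cutoff k) \<nu>)\<^sup>2) \<partial>\<mu>)"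
  proof (rule nn_integral_mono)
    fix \<nu> assume "\<nu> \<in> space \<mu>"
    then have \<nu>: "\<nu> \<in> growth_measures" by simp
    note [measurable_cong] = sets_growth_measure[OF \<nu>]
    interpret sigma_finite_measure \<nu> by (rule growth_measure_sigma_finite[OF \<nu>])
    have "emeasure \<nu> (ball 0 (real k)) = (\<integral>\<^sup>+x. indicator (ball 0 (real k)) x \<partial>\<nu>)" by simp
    also have "\<dots> \<le> (\<integral>\<^sup>+x. ennreal (cutoff k x) \<partial>\<nu>)"
      by (intro nn_integral_mono) (auto simp: indicator_def cutoff_eq_1)
    also have "\<dots> = ennreal (hat (cutoff k) \<nu>)"
      unfolding hat_def by (intro nn_integral_eq_integral Cc_integrable[OF cutoff_Cc \<nu>]) (simp add: cutoff_nonneg)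
    finally have le: "emeasure \<nu> (ball 0 (real k)) \<le> ennreal (hat (cutoff k) \<nu>)" .
    have "emeasure (\<nu> \<Otimes>\<^sub>M \<nu>) (ball 0 (real k) \<times> ball 0 (real k)) = emeasure \<nu> (ball 0 (real k)) * emeasure \<nu> (ball 0 (real k))"
      by (rule emeasure_pair_measure_Times) (simp_all add: sets_growth_measure[OF \<nu>])
    also have "\<dots> \<le> ennreal (hat (cutoff k) \<nu>) * ennreal (hat (cutoff k) \<nu>)" using le by (intro mult_mono) auto
    also have "\<dots> = ennreal ((hat (cutoff k) \<nu>)\<^sup>2)"
      by (simp add: ennreal_mult'[symmetric] power2_eq_square hat_def cutoff_nonneg)
    finally show "emeasure (\<nu> \<Otimes>\<^sub>M \<nu>) (ball 0 (real k) \<times> ball 0 (real k)) \<le> ennreal ((hat (cutoff k) \<nu>)\<^sup>2)" .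
  qed
  also have "\<dots> < \<infinity>"
    using square_integrable[OF cutoff_Cc, of k] by (subst nn_integral_eq_integral) auto
  finally show ?thesis .
qed

definition dependent_pairs :: "((real ^ 'n) \<times> (real ^ 'n)) set" where
  "dependent_pairs = {p. \<forall>j k. minor j k p = 0}"

lemma dependent_pairs_borel [measurable]: "dependent_pairs \<in> sets borel"
proof -
  have "{p \<in> space borel. \<forall>j k. minor j k (p :: (real ^ 'n) \<times> (real ^ 'n)) = 0} \<in> sets borel" by measurable
  then show ?thesis by (simp add: dependent_pairs_def)
qed

lemma UN_balls: "(\<Union>k. ball 0 (real k)) = (UNIV :: 'a::real_normed_vector set)"
  by (auto simp: reals_Archimedean2)

text \<open>Deleting the dependent pairs leaves an invariant measure, because invertible linear maps
  respect dependence; products of balls make it sigma-finite.\<close>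

lemma moment2_independent:
  obtains c :: real where "0 \<le> c"
    "density moment2 (indicator (- dependent_pairs)) = scale_measure (ennreal c) lborel"
proof -
  let ?m = "density moment2 (indicator (- dependent_pairs))"
  have I: "- dependent_pairs \<in> sets borel" using borel_comp[OF dependent_pairs_borel] .
  have em: "emeasure ?m E = emeasure moment2 (E - dependent_pairs)" if "E \<in> sets borel" for E
  proof -
    have "emeasure ?m E = (\<integral>\<^sup>+p. indicator (- dependent_pairs) p * indicator E p \<partial>moment2)"
      using that I by (subst emeasure_density) auto
    also have "\<dots> = (\<integral>\<^sup>+p. indicator (E - dependent_pairs) p \<partial>moment2)"
      by (intro nn_integral_cong) (auto simp: indicator_def)
    also have "\<dots> = emeasure moment2 (E - dependent_pairs)"
      using that by (subst nn_integral_indicator) auto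
    finally show ?thesis .
  qed
  have "\<exists>c::real. 0 \<le> c \<and> ?m = scale_measure (ennreal c) lborel"
  proof (rule SL_invariant_pair_measure_eq[OF card3])
    show "sets ?m = sets borel" by simp
    show "sigma_finite_measure ?m"
    proof
      let ?A = "range (\<lambda>k::nat. ball 0 (real k) \<times> ball 0 (real k)) :: ((real ^ 'n) \<times> (real ^ 'n)) set set"
      have "p \<in> \<Union>?A" for p
      proof -
        obtain k :: nat where "max (norm (fst p)) (norm (snd p)) < k" using reals_Archimedean2 by blast
        then show ?thesis by (intro UnionI[of "ball 0 (real k) \<times> ball 0 (real k)"]) (auto simp: mem_Times_iff)
      qed
      moreover have "emeasure ?m (ball 0 (real k) \<times> ball 0 (real k)) \<noteq> \<infinity>" for k
      proof -
        have "emeasure ?m (ball 0 (real k) \<times> ball 0 (real k)) \<le> emeasure moment2 (ball 0 (real k) \<times> ball 0 (real k))"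
          unfolding em[OF borel_Times[OF borel_open[OF open_ball] borel_open[OF open_ball]]]
          by (intro emeasure_mono) (auto simp: borel_Times)
        then show ?thesis using moment2_ball_finite[of k] by (auto simp: top_unique)
      qed
      ultimately show "\<exists>A. countable A \<and> A \<subseteq> sets ?m \<and> \<Union>A = space ?m \<and> (\<forall>a\<in>A. emeasure ?m a \<noteq> \<infinity>)"
        by (intro exI[of _ ?A]) (auto simp: borel_Times)
    qed
    show "distr ?m borel (pair_act A) = ?m" if A: "A \<in> SL" for A
    proof (rule measure_eqI)
      fix E assume "E \<in> sets (distr ?m borel (pair_act A))"
      then have E: "E \<in> sets borel" by simp
      have "emeasure (distr ?m borel (pair_act A)) E = emeasure ?m {p. pair_act A p \<in> E}"
        using E by (subst emeasure_distr) (auto simp: vimage_def measurable_cong_sets[of ?m borel])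
      also have "\<dots> = emeasure moment2 {p. pair_act A p \<in> E - dependent_pairs}"
      proof -
        have "{p. pair_act A p \<in> E} - dependent_pairs = {p. pair_act A p \<in> E - dependent_pairs}"
          using dependent_pair_act[OF A] by (auto simp: dependent_pairs_def)
        then show ?thesis using em[OF pair_act_sets[OF E]] by simp
      qed
      also have "\<dots> = emeasure moment2 (E - dependent_pairs)"
        using E by (intro emeasure_moment2_pair_act[OF A]) auto
      finally show "emeasure (distr ?m borel (pair_act A)) E = emeasure ?m E" by (simp add: em[OF E])
    qed simp
    show "AE p in ?m. \<exists>j k. minor j k p \<noteq> 0"
      using I by (subst AE_density) (auto simp: dependent_pairs_def indicator_def)
  qed
  then show thesis using that by blast
qed

text \<open>
  A family of dependent pairs in which one vector dominates the other projects to an invariant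
  measure on the space of single vectors.
\<close>

lemma moment2_marginal:
  assumes S: "S \<in> sets borel" and \<pi>: "\<pi> \<in> borel_measurable borel"
    and S_inv: "\<And>A p. A \<in> SL \<Longrightarrow> pair_act A p \<in> S \<longleftrightarrow> p \<in> S"
    and \<pi>_act: "\<And>A p. \<pi> (pair_act A p) = A *v \<pi> p"
    and dom: "\<And>p. p \<in> S \<Longrightarrow> norm (fst p) \<le> norm (\<pi> p) \<and> norm (snd p) \<le> norm (\<pi> p)"
  shows "\<exists>\<rho>::real. 0 \<le> \<rho> \<and> (\<forall>E\<in>sets borel. emeasure moment2 {p \<in> S. \<pi> p \<in> E} = ennreal \<rho> * emeasure lborel (E :: (real ^ 'n) set))"
proof -
  let ?D = "density moment2 (indicator S)"
  let ?m = "distr ?D borel \<pi>"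
  have sets_S: "{p \<in> S. \<pi> p \<in> E} \<in> sets borel" if "E \<in> sets borel" for E
  proof -
    have "{p \<in> space borel. p \<in> S \<and> \<pi> p \<in> E} \<in> sets borel" using S \<pi> that by measurable
    then show ?thesis by simp
  qed
  have em: "emeasure ?m E = emeasure moment2 {p \<in> S. \<pi> p \<in> E}" if E: "E \<in> sets borel" for E
  proof -
    have pre: "\<pi> -` E \<in> sets borel" using measurable_sets_borel[OF \<pi> E] by simp
    have "emeasure ?m E = emeasure ?D (\<pi> -` E)"
      using E \<pi> by (subst emeasure_distr) (auto simp: measurable_cong_sets[of ?D borel])
    also have "\<dots> = (\<integral>\<^sup>+p. indicator S p * indicator (\<pi> -` E) p \<partial>moment2)"
      using S pre by (subst emeasure_density) auto
    also have "\<dots> = (\<integral>\<^sup>+p. indicator {p \<in> S. \<pi> p \<in> E} p \<partial>moment2)"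
      by (intro nn_integral_cong) (auto simp: indicator_def)
    also have "\<dots> = emeasure moment2 {p \<in> S. \<pi> p \<in> E}"
      using sets_S[OF E] by (subst nn_integral_indicator) auto
    finally show ?thesis .
  qed
  have "\<exists>\<rho>::real. 0 \<le> \<rho> \<and> ?m = scale_measure (ennreal \<rho>) lborel"
  proof (rule SL_invariant_measure_eq[OF card])
    show "sets ?m = sets borel" by simp
    show "sigma_finite_measure ?m"
    proof
      let ?A = "range (\<lambda>k::nat. ball 0 (real k)) :: (real ^ 'n) set set"
      \<comment> \<open>Domination by \<open>\<pi> p\<close> puts both vectors into the ball, where
        the second moment is finite.\<close>
      have "emeasure ?m (ball 0 (real k)) \<noteq> \<infinity>" for k
      proof -
        have "emeasure ?m (ball 0 (real k)) \<le> emeasure moment2 (ball 0 (real k) \<times> ball 0 (real k))"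
          unfolding em[OF borel_open[OF open_ball]]
        proof (rule emeasure_mono)
          show "{p \<in> S. \<pi> p \<in> ball 0 (real k)} \<subseteq> ball 0 (real k) \<times> ball 0 (real k)"
          proof
            fix p assume "p \<in> {p \<in> S. \<pi> p \<in> ball 0 (real k)}"
            then show "p \<in> ball 0 (real k) \<times> ball 0 (real k)"
              using dom[of p] by (auto simp: mem_Times_iff)
          qed
        qed (simp add: borel_Times)
        then show ?thesis using moment2_ball_finite[of k] by (auto simp: top_unique)
      qed
      then show "\<exists>A. countable A \<and> A \<subseteq> sets ?m \<and> \<Union>A = space ?m \<and> (\<forall>a\<in>A. emeasure ?m a \<noteq> \<infinity>)"
        using UN_balls by (intro exI[of _ ?A]) auto
    qed
    show "distr ?m borel ((*v) A) = ?m" if A: "A \<in> SL" for A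
    proof (rule measure_eqI)
      fix E assume "E \<in> sets (distr ?m borel ((*v) A))"
      then have E: "E \<in> sets borel" by simp
      have AE: "{x. A *v x \<in> E} \<in> sets borel"
        using measurable_sets_borel[OF borel_measurable_matrix_mult_vec[of A] E] by (simp add: vimage_def)
      have "emeasure (distr ?m borel ((*v) A)) E = emeasure ?m {x. A *v x \<in> E}"
        using E by (subst emeasure_distr) (auto simp: vimage_def measurable_cong_sets[of ?m borel])
      also have "\<dots> = emeasure moment2 {p. pair_act A p \<in> {p \<in> S. \<pi> p \<in> E}}"
        unfolding em[OF AE] by (simp add: S_inv[OF A] \<pi>_act)
      also have "\<dots> = emeasure moment2 {p \<in> S. \<pi> p \<in> E}"
        by (rule emeasure_moment2_pair_act[OF A sets_S[OF E]])
      finally show "emeasure (distr ?m borel ((*v) A)) E = emeasure ?m E" by (simp only: em[OF E])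
    qed simp
    \<comment> \<open>By domination only the pair of zero vectors lies over the origin, and growth
      measures have no mass at 0.\<close>
    have "emeasure ?m {0} \<le> emeasure moment2 {0}"
    proof -
      have "{p \<in> S. \<pi> p \<in> {0}} \<subseteq> {0}" using dom by (force simp: prod_eq_iff)
      then show ?thesis unfolding em[OF borel_singleton[OF sets.empty_sets]] by (intro emeasure_mono) auto
    qed
    also have "emeasure moment2 {0} = (\<integral>\<^sup>+\<nu>. 0 \<partial>\<mu>)"
      unfolding emeasure_moment2[OF borel_singleton[OF sets.empty_sets]]
    proof (rule nn_integral_cong)
      fix \<nu> assume "\<nu> \<in> space \<mu>"
      then have \<nu>: "\<nu> \<in> growth_measures" by simp
      interpret sigma_finite_measure \<nu> by (rule growth_measure_sigma_finite[OF \<nu>])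
      have "emeasure (\<nu> \<Otimes>\<^sub>M \<nu>) ({0} \<times> {0}) = emeasure \<nu> {0} * emeasure \<nu> {0}"
        by (rule emeasure_pair_measure_Times) (simp_all add: sets_growth_measure[OF \<nu>])
      moreover have "{0} \<times> {0} = {0 :: (real ^ 'n) \<times> (real ^ 'n)}" by (auto simp: prod_eq_iff)
      ultimately show "emeasure (\<nu> \<Otimes>\<^sub>M \<nu>) {0} = 0"
        by (simp add: growth_measure_null_origin[OF \<nu>])
    qed
    finally show "emeasure ?m {0} = 0" by simp
  qed
  then obtain \<rho> :: real where \<rho>: "0 \<le> \<rho>" "?m = scale_measure (ennreal \<rho>) lborel" by blast
  then show ?thesis using em by (intro exI[of _ \<rho>]) auto
qed

text \<open>Dependent pairs are split by which vector is longer and projected to that one. Each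
  projection is an invariant measure on single vectors, hence a multiple of Lebesgue
  measure.\<close>

lemma moment2_dependent:
  obtains \<rho> :: real where "0 \<le> \<rho>"
    "\<And>E F. E \<in> sets borel \<Longrightarrow> F \<in> sets borel \<Longrightarrow>
      emeasure moment2 (E \<times> F \<inter> dependent_pairs) \<le> ennreal \<rho> * (emeasure lborel E + emeasure lborel F)"
proof -
  \<comment> \<open>Linear maps do not preserve norms, but they preserve the ratio t: this form
    shows invariance, while \<open>S1_eq\<close> provides measurability and domination.\<close>
  define S1 where "S1 = {p :: (real ^ 'n) \<times> (real ^ 'n). \<exists>t. \<bar>t\<bar> \<le> 1 \<and> snd p = t *\<^sub>R fst p}"
  define S2 where "S2 = {p :: (real ^ 'n) \<times> (real ^ 'n). \<exists>t. \<bar>t\<bar> \<le> 1 \<and> fst p = t *\<^sub>R snd p}"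
  have S1_eq: "S1 = {p \<in> dependent_pairs. norm (snd p) \<le> norm (fst p)}"
  proof (intro equalityI subsetI)
    fix p assume "p \<in> S1"
    then obtain t where "\<bar>t\<bar> \<le> 1" "snd p = t *\<^sub>R fst p" by (auto simp: S1_def)
    then show "p \<in> {p \<in> dependent_pairs. norm (snd p) \<le> norm (fst p)}"
      by (auto simp: dependent_pairs_def minor_def mult_left_le_one_le)
  next
    fix p assume p: "p \<in> {p \<in> dependent_pairs. norm (snd p) \<le> norm (fst p)}"
    then have "fst p = 0 \<or> (\<exists>t. snd p = t *\<^sub>R fst p)"
      using dependent_iff[of "fst p" "snd p"] by (simp add: dependent_pairs_def)
    then show "p \<in> S1"
    proof
      assume "fst p = 0"
      then show ?thesis using p by (auto simp: S1_def intro: exI[of _ 0])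
    next
      assume "\<exists>t. snd p = t *\<^sub>R fst p"
      then obtain t where t: "snd p = t *\<^sub>R fst p" by blast
      show ?thesis
      proof (cases "fst p = 0")
        case True
        then show ?thesis using t by (auto simp: S1_def intro: exI[of _ 0])
      next
        case False
        then have "\<bar>t\<bar> \<le> 1" using p by (simp add: t mult_le_cancel_right1)
        then show ?thesis using t by (auto simp: S1_def)
      qed
    qed
  qed
  have minor_flip: "minor j k (snd p, fst p) = - minor j k p" for j k and p :: "(real ^ 'n) \<times> (real ^ 'n)"
    by (simp add: minor_def algebra_simps)
  have S2_flip: "p \<in> S2 \<longleftrightarrow> (snd p, fst p) \<in> S1" for p by (simp add: S1_def S2_def)
  have S2_eq: "S2 = {p \<in> dependent_pairs. norm (fst p) \<le> norm (snd p)}"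
    unfolding set_eq_iff S2_flip S1_eq dependent_pairs_def mem_Collect_eq minor_flip by simp
  have [measurable]: "fst \<in> borel_measurable (borel :: ((real ^ 'n) \<times> (real ^ 'n)) measure)"
    "snd \<in> borel_measurable (borel :: ((real ^ 'n) \<times> (real ^ 'n)) measure)"
    by (intro borel_measurable_continuous_onI continuous_intros)+
  have "{p \<in> space borel. p \<in> dependent_pairs \<and> norm (snd p) \<le> norm (fst p)} \<in> sets borel"
    "{p \<in> space borel. p \<in> dependent_pairs \<and> norm (fst p) \<le> norm (snd p)} \<in> sets borel"
    by measurable
  then have S_borel: "S1 \<in> sets borel" "S2 \<in> sets borel" by (simp_all add: S1_eq S2_eq)
  have one: "pair_act A p \<in> S1" if "p \<in> S1" for A p
    using that by (auto simp: S1_def pair_act_def matrix_vector_mult_scaleR)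
  have S1_inv: "pair_act A p \<in> S1 \<longleftrightarrow> p \<in> S1" if A: "A \<in> SL" for A p
  proof -
    obtain B where B: "B ** A = mat 1" by (rule SL_inverse[OF A])
    have "pair_act B (pair_act A p) = p" by (simp add: pair_act_def matrix_vector_mul_assoc B)
    then show ?thesis using one[of p A] one[of "pair_act A p" B] by auto
  qed
  have S2_inv: "pair_act A p \<in> S2 \<longleftrightarrow> p \<in> S2" if "A \<in> SL" for A p
    using S1_inv[OF that, of "(snd p, fst p)"] by (simp add: S2_flip pair_act_def)
  obtain \<rho>1 :: real where \<rho>1: "0 \<le> \<rho>1" "\<And>E. E \<in> sets borel \<Longrightarrow> emeasure moment2 {p \<in> S1. fst p \<in> E} = ennreal \<rho>1 * emeasure lborel E"
    using moment2_marginal[OF S_borel(1) _ S1_inv, of fst] by (auto simp: S1_eq pair_act_def)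
  obtain \<rho>2 :: real where \<rho>2: "0 \<le> \<rho>2" "\<And>E. E \<in> sets borel \<Longrightarrow> emeasure moment2 {p \<in> S2. snd p \<in> E} = ennreal \<rho>2 * emeasure lborel E"
    using moment2_marginal[OF S_borel(2) _ S2_inv, of snd] by (auto simp: S2_eq pair_act_def)
  have "emeasure moment2 (E \<times> F \<inter> dependent_pairs) \<le> ennreal (\<rho>1 + \<rho>2) * (emeasure lborel E + emeasure lborel F)"
    if E: "E \<in> sets borel" and F: "F \<in> sets borel" for E F
  proof -
    have m: "{p \<in> S1. fst p \<in> E} \<in> sets borel" "{p \<in> S2. snd p \<in> F} \<in> sets borel"
    proof -
      have "{p \<in> space borel. p \<in> S1 \<and> fst p \<in> E} \<in> sets borel" "{p \<in> space borel. p \<in> S2 \<and> snd p \<in> F} \<in> sets borel"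
        using S_borel E F by measurable
      then show "{p \<in> S1. fst p \<in> E} \<in> sets borel" "{p \<in> S2. snd p \<in> F} \<in> sets borel" by simp_all
    qed
    have "emeasure moment2 (E \<times> F \<inter> dependent_pairs) \<le> emeasure moment2 ({p \<in> S1. fst p \<in> E} \<union> {p \<in> S2. snd p \<in> F})"
    proof (rule emeasure_mono)
      show "E \<times> F \<inter> dependent_pairs \<subseteq> {p \<in> S1. fst p \<in> E} \<union> {p \<in> S2. snd p \<in> F}"
        unfolding S1_eq S2_eq using linear[of "norm (fst _ :: real ^ 'n)" "norm (snd _ :: real ^ 'n)"]
        by (clarsimp simp: mem_Times_iff)
    qed (use m in auto)
    also have "\<dots> \<le> emeasure moment2 {p \<in> S1. fst p \<in> E} + emeasure moment2 {p \<in> S2. snd p \<in> F}"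
      using m by (intro emeasure_subadditive) simp_all
    also have "\<dots> = ennreal \<rho>1 * emeasure lborel E + ennreal \<rho>2 * emeasure lborel F"
      by (simp add: \<rho>1(2)[OF E] \<rho>2(2)[OF F])
    also have "\<dots> \<le> ennreal (\<rho>1 + \<rho>2) * emeasure lborel E + ennreal (\<rho>1 + \<rho>2) * emeasure lborel F"
      using \<rho>1(1) \<rho>2(1) by (intro add_mono mult_right_mono ennreal_leI) auto
    finally show ?thesis by (simp add: distrib_left)
  qed
  then show thesis using \<rho>1(1) \<rho>2(1) by (intro that[of "\<rho>1 + \<rho>2"]) auto
qed

end

text \<open>The negative part stands on the left so that the identity can be integrated over \<mu>
  without subtracting infinities.\<close>

lemma product_square:
  fixes h :: "'a \<Rightarrow> real"
  assumes "sigma_finite_measure M" and h: "integrable M h"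
  shows "ennreal ((\<integral>x. h x \<partial>M)\<^sup>2) + (\<integral>\<^sup>+p. ennreal (- (h (fst p) * h (snd p))) \<partial>(M \<Otimes>\<^sub>M M)) =
      (\<integral>\<^sup>+p. ennreal (h (fst p) * h (snd p)) \<partial>(M \<Otimes>\<^sub>M M))" (is "?sq + ?N = ?P")
    and "(\<integral>\<^sup>+p. ennreal (- (h (fst p) * h (snd p))) \<partial>(M \<Otimes>\<^sub>M M)) < \<infinity>"
proof -
  interpret sigma_finite_measure M by fact
  interpret pair_sigma_finite M M ..
  have [measurable]: "h \<in> borel_measurable M" using h by auto
  let ?H = "\<lambda>p. h (fst p) * h (snd p)"
  have int: "integrable (M \<Otimes>\<^sub>M M) ?H"
  proof (rule Fubini_integrable)
    show "integrable M (\<lambda>x. \<integral>y. norm (h (fst (x, y)) * h (snd (x, y))) \<partial>M)"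
      using h by (simp add: abs_mult)
    show "AE x in M. integrable M (\<lambda>y. h (fst (x, y)) * h (snd (x, y)))" using h by simp
  qed measurable
  have "integral\<^sup>L (M \<Otimes>\<^sub>M M) ?H = (\<integral>x. \<integral>y. h x * h y \<partial>M \<partial>M)"
    using integral_fst'[OF int] by simp
  also have "\<dots> = (\<integral>x. h x \<partial>M)\<^sup>2" using h by (simp add: power2_eq_square)
  finally have I: "integral\<^sup>L (M \<Otimes>\<^sub>M M) ?H = (\<integral>x. h x \<partial>M)\<^sup>2" .
  have fin: "?P < \<top>" "?N < \<top>"
    using int unfolding real_integrable_def by (auto simp: less_top)
  then show "?N < \<infinity>" by simp
  have "(\<integral>x. h x \<partial>M)\<^sup>2 + enn2real ?N = enn2real ?P"
    using I by (subst (asm) real_lebesgue_integral_def[OF int]) simp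
  then have "ennreal ((\<integral>x. h x \<partial>M)\<^sup>2 + enn2real ?N) = ennreal (enn2real ?P)" by simp
  then show "?sq + ?N = ?P"
    using fin by (simp add: ennreal_plus[symmetric] del: ennreal_plus) (simp add: ennreal_plus)
qed

context siegel_L2
begin

text \<open>Independent pairs contribute a multiple of the squared Lebesgue integral of
  \<open>h\<close>, which is 0. What remains is bounded by absolute values over the dependent
  pairs.\<close>

lemma second_moment_le_dependent:
  fixes h :: "real ^ 'n \<Rightarrow> real"
  assumes h_meas [measurable]: "h \<in> borel_measurable borel" and B: "\<And>u. \<bar>h u\<bar> \<le> C" "\<And>u. real k \<le> norm u \<Longrightarrow> h u = 0"
    and zero: "(\<integral>u. h u \<partial>lborel) = 0"
  shows "(\<integral>\<^sup>+\<nu>. ennreal ((hat h \<nu>)\<^sup>2) \<partial>\<mu>) \<le>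
    (\<integral>\<^sup>+p. ennreal \<bar>h (fst p)\<bar> * ennreal \<bar>h (snd p)\<bar> * indicator dependent_pairs p \<partial>moment2)"
proof -
  define P where "P p = ennreal (h (fst p) * h (snd p))" for p
  define N where "N p = ennreal (- (h (fst p) * h (snd p)))" for p
  have [measurable]: "fst \<in> borel_measurable (borel :: ((real ^ 'n) \<times> (real ^ 'n)) measure)"
    "snd \<in> borel_measurable (borel :: ((real ^ 'n) \<times> (real ^ 'n)) measure)"
    by (intro borel_measurable_continuous_onI continuous_intros)+
  have PN [measurable]: "P \<in> borel_measurable borel" "N \<in> borel_measurable borel"
    unfolding P_def N_def by measurable
  have C: "0 \<le> C" using B(1)[of 0] by linarith
  have h_int: "integrable M h" if M: "sets M = sets borel" and fin: "emeasure M (ball 0 (real k)) < \<infinity>" for M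
  proof (rule Bochner_Integration.integrable_bound)
    show "integrable M (\<lambda>u. C * indicator (ball 0 (real k)) u)"
      using M fin by (intro integrable_mult_right integrable_real_indicator) auto
    show "AE u in M. norm (h u) \<le> norm (C * indicator (ball 0 (real k)) u)"
      using B C by (intro AE_I2) (auto simp: indicator_def)
    show "h \<in> borel_measurable M" by (simp add: measurable_cong_sets[OF M refl])
  qed
  have fiber: "ennreal ((hat h \<nu>)\<^sup>2) + (\<integral>\<^sup>+p. N p \<partial>(\<nu> \<Otimes>\<^sub>M \<nu>)) = (\<integral>\<^sup>+p. P p \<partial>(\<nu> \<Otimes>\<^sub>M \<nu>))" if \<nu>: "\<nu> \<in> growth_measures" for \<nu>
    unfolding hat_def P_def N_def
    by (intro product_square(1) growth_measure_sigma_finite[OF \<nu>] h_int sets_growth_measure[OF \<nu>]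
        growth_measure_bounded_finite[OF \<nu> bounded_ball])
  have mix: "(\<integral>\<^sup>+\<nu>. ennreal ((hat h \<nu>)\<^sup>2) \<partial>\<mu>) + (\<integral>\<^sup>+p. N p \<partial>moment2) = (\<integral>\<^sup>+p. P p \<partial>moment2)"
  proof -
    have "(\<integral>\<^sup>+p. P p \<partial>moment2) = (\<integral>\<^sup>+\<nu>. ennreal ((hat h \<nu>)\<^sup>2) + (\<integral>\<^sup>+p. N p \<partial>(\<nu> \<Otimes>\<^sub>M \<nu>)) \<partial>\<mu>)"
      unfolding moment2_def moment2.nn_integral_mixture[OF PN(1)] by (intro nn_integral_cong) (simp add: fiber)
    also have "\<dots> = (\<integral>\<^sup>+\<nu>. ennreal ((hat h \<nu>)\<^sup>2) \<partial>\<mu>) + (\<integral>\<^sup>+\<nu>. (\<integral>\<^sup>+p. N p \<partial>(\<nu> \<Otimes>\<^sub>M \<nu>)) \<partial>\<mu>)"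
    proof (rule nn_integral_add)
      show "(\<lambda>\<nu>. ennreal ((hat h \<nu>)\<^sup>2)) \<in> borel_measurable \<mu>"
        using hat_borel_measurable[OF h_meas] by measurable
      show "(\<lambda>\<nu>. \<integral>\<^sup>+p. N p \<partial>(\<nu> \<Otimes>\<^sub>M \<nu>)) \<in> borel_measurable \<mu>"
        using moment2.nn_integral_mixture_measurable[OF PN(2)] by simp
    qed
    finally show ?thesis unfolding moment2_def moment2.nn_integral_mixture[OF PN(2)] by simp
  qed
  obtain c :: real where c: "0 \<le> c" "density moment2 (indicator (- dependent_pairs)) = scale_measure (ennreal c) lborel"
    by (rule moment2_independent)
  have split: "(\<integral>\<^sup>+p. F p \<partial>moment2) = ennreal c * (\<integral>\<^sup>+p. F p \<partial>lborel) + (\<integral>\<^sup>+p. F p * indicator dependent_pairs p \<partial>moment2)"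
    if [measurable]: "F \<in> borel_measurable borel" for F
  proof -
    have I: "- dependent_pairs \<in> sets borel" using borel_comp[OF dependent_pairs_borel] .
    have "(\<integral>\<^sup>+p. F p \<partial>moment2) = (\<integral>\<^sup>+p. indicator (- dependent_pairs) p * F p + F p * indicator dependent_pairs p \<partial>moment2)"
      by (intro nn_integral_cong) (auto simp: indicator_def)
    also have "\<dots> = (\<integral>\<^sup>+p. indicator (- dependent_pairs) p * F p \<partial>moment2) + (\<integral>\<^sup>+p. F p * indicator dependent_pairs p \<partial>moment2)"
      using I by (intro nn_integral_add) auto
    also have "(\<integral>\<^sup>+p. indicator (- dependent_pairs) p * F p \<partial>moment2) = (\<integral>\<^sup>+p. F p \<partial>density moment2 (indicator (- dependent_pairs)))"
      using I by (intro nn_integral_density[symmetric]) auto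
    also have "\<dots> = ennreal c * (\<integral>\<^sup>+p. F p \<partial>lborel)"
      unfolding c(2) by (rule nn_integral_scale_measure) simp
    finally show ?thesis .
  qed
  have lb: "(\<integral>\<^sup>+p. N p \<partial>lborel) = (\<integral>\<^sup>+p. P p \<partial>lborel)" "(\<integral>\<^sup>+p. N p \<partial>lborel) < \<infinity>"
    using product_square[OF lborel.sigma_finite_measure_axioms h_int[of lborel]] emeasure_lborel_ball_finite[of "0 :: real ^ 'n" "real k"]
    by (simp_all add: lborel_prod zero P_def N_def)
  have "ennreal c * (\<integral>\<^sup>+p. N p \<partial>lborel) + ((\<integral>\<^sup>+\<nu>. ennreal ((hat h \<nu>)\<^sup>2) \<partial>\<mu>) + (\<integral>\<^sup>+p. N p * indicator dependent_pairs p \<partial>moment2)) =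
      ennreal c * (\<integral>\<^sup>+p. N p \<partial>lborel) + (\<integral>\<^sup>+p. P p * indicator dependent_pairs p \<partial>moment2)"
    using mix unfolding split[OF PN(1)] split[OF PN(2)] lb(1) by (simp add: ac_simps)
  \<comment> \<open>Finiteness permits cancelling the common Lebesgue term; it comes from the
    bounded support of \<open>h\<close>.\<close>
  moreover have "ennreal c * (\<integral>\<^sup>+p. N p \<partial>lborel) \<noteq> \<top>"
    using lb(2) by (simp add: ennreal_mult_eq_top_iff less_top)
  ultimately have eq: "(\<integral>\<^sup>+\<nu>. ennreal ((hat h \<nu>)\<^sup>2) \<partial>\<mu>) + (\<integral>\<^sup>+p. N p * indicator dependent_pairs p \<partial>moment2) =
      (\<integral>\<^sup>+p. P p * indicator dependent_pairs p \<partial>moment2)"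
    by (simp add: ennreal_add_left_cancel)
  have "(\<integral>\<^sup>+\<nu>. ennreal ((hat h \<nu>)\<^sup>2) \<partial>\<mu>) \<le> (\<integral>\<^sup>+p. P p * indicator dependent_pairs p \<partial>moment2)"
    unfolding eq[symmetric] by (rule add_increasing2) simp_all
  also have "\<dots> \<le> (\<integral>\<^sup>+p. ennreal \<bar>h (fst p)\<bar> * ennreal \<bar>h (snd p)\<bar> * indicator dependent_pairs p \<partial>moment2)"
    unfolding P_def
    by (intro nn_integral_mono mult_right_mono) (auto simp: ennreal_mult'[symmetric] abs_mult[symmetric] intro!: ennreal_leI)
  finally show ?thesis .
qed

text \<open>Expanding the product gives four rectangles, each bounded by
  \<open>moment2_dependent\<close>. The bounds add up to 2 \<rho> (a + b) (a |E| + b |F|), which the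
  stated factor 4 covers.\<close>

lemma dependent_two_sets_le:
  obtains \<rho> :: real where "0 \<le> \<rho>"
    "\<And>(a::real) b E F (h :: real ^ 'n \<Rightarrow> real). 0 \<le> a \<Longrightarrow> 0 \<le> b \<Longrightarrow> E \<in> sets borel \<Longrightarrow> F \<in> sets borel \<Longrightarrow>
      (\<And>u. \<bar>h u\<bar> \<le> a * indicator E u + b * indicator F u) \<Longrightarrow>
      (\<integral>\<^sup>+p. ennreal \<bar>h (fst p)\<bar> * ennreal \<bar>h (snd p)\<bar> * indicator dependent_pairs p \<partial>moment2) \<le>
      4 * ennreal \<rho> * (ennreal (a + b) * (ennreal a * emeasure lborel E + ennreal b * emeasure lborel F))"
proof -
  obtain \<rho> :: real where \<rho>: "0 \<le> \<rho>" "\<And>E F. E \<in> sets borel \<Longrightarrow> F \<in> sets borel \<Longrightarrow>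
      emeasure moment2 (E \<times> F \<inter> dependent_pairs) \<le> ennreal \<rho> * (emeasure lborel E + emeasure lborel F)"
    by (rule moment2_dependent) blast
  have "(\<integral>\<^sup>+p. ennreal \<bar>h (fst p)\<bar> * ennreal \<bar>h (snd p)\<bar> * indicator dependent_pairs p \<partial>moment2) \<le>
      4 * ennreal \<rho> * (ennreal (a + b) * (ennreal a * emeasure lborel E + ennreal b * emeasure lborel F))"
    if ab: "0 \<le> a" "0 \<le> b" and E: "E \<in> sets borel" and F: "F \<in> sets borel"
      and h: "\<And>u. \<bar>h u\<bar> \<le> a * indicator E u + b * indicator F u" for a b E F and h :: "real ^ 'n \<Rightarrow> real"
  proof -
    let ?D = dependent_pairs
    let ?a = "ennreal a" and ?b = "ennreal b" and ?e = "emeasure lborel E" and ?f = "emeasure lborel F"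
    have [measurable]: "S \<times> T \<inter> ?D \<in> sets borel" if "S \<in> sets borel" "T \<in> sets borel" for S T
      using that by (intro sets.Int borel_Times) auto
    have hb: "ennreal \<bar>h u\<bar> \<le> ?a * indicator E u + ?b * indicator F u" for u
    proof -
      have "ennreal \<bar>h u\<bar> \<le> ennreal (a * indicator E u + b * indicator F u)" by (rule ennreal_leI[OF h])
      also have "\<dots> = ?a * indicator E u + ?b * indicator F u" using ab by (simp add: indicator_def)
      finally show ?thesis .
    qed
    have "(\<integral>\<^sup>+p. ennreal \<bar>h (fst p)\<bar> * ennreal \<bar>h (snd p)\<bar> * indicator ?D p \<partial>moment2) \<le>
        (\<integral>\<^sup>+p. ?a * ?a * indicator (E \<times> E \<inter> ?D) p + ?a * ?b * indicator (E \<times> F \<inter> ?D) p +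
          (?b * ?a * indicator (F \<times> E \<inter> ?D) p + ?b * ?b * indicator (F \<times> F \<inter> ?D) p) \<partial>moment2)"
    proof (rule nn_integral_mono)
      fix p :: "(real ^ 'n) \<times> (real ^ 'n)"
      have "ennreal \<bar>h (fst p)\<bar> * ennreal \<bar>h (snd p)\<bar> * indicator ?D p \<le>
          (?a * indicator E (fst p) + ?b * indicator F (fst p)) * (?a * indicator E (snd p) + ?b * indicator F (snd p)) * indicator ?D p"
        by (intro mult_mono hb) auto
      also have "\<dots> = ?a * ?a * indicator (E \<times> E \<inter> ?D) p + ?a * ?b * indicator (E \<times> F \<inter> ?D) p +
          (?b * ?a * indicator (F \<times> E \<inter> ?D) p + ?b * ?b * indicator (F \<times> F \<inter> ?D) p)"
        by (cases p) (auto simp: indicator_def distrib_left distrib_right ac_simps)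
      finally show "ennreal \<bar>h (fst p)\<bar> * ennreal \<bar>h (snd p)\<bar> * indicator ?D p \<le> \<dots>" .
    qed
    also have "\<dots> = ?a * ?a * emeasure moment2 (E \<times> E \<inter> ?D) + ?a * ?b * emeasure moment2 (E \<times> F \<inter> ?D) +
          (?b * ?a * emeasure moment2 (F \<times> E \<inter> ?D) + ?b * ?b * emeasure moment2 (F \<times> F \<inter> ?D))"
      using E F by (simp add: nn_integral_add nn_integral_cmult)
    also have "\<dots> \<le> ?a * ?a * (ennreal \<rho> * (?e + ?e)) + ?a * ?b * (ennreal \<rho> * (?e + ?f)) +
          (?b * ?a * (ennreal \<rho> * (?f + ?e)) + ?b * ?b * (ennreal \<rho> * (?f + ?f)))"
      using E F by (intro add_mono mult_left_mono \<rho>(2)) auto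
    also have "\<dots> = 2 * ennreal \<rho> * ((?a + ?b) * (?a * ?e + ?b * ?f))"
      unfolding mult_2 by (simp add: distrib_left distrib_right) (simp add: ac_simps)
    also have "\<dots> \<le> 4 * ennreal \<rho> * ((?a + ?b) * (?a * ?e + ?b * ?f))"
      by (intro mult_right_mono) auto
    finally show ?thesis using ab by (simp add: ennreal_plus)
  qed
  with \<rho>(1) show thesis by (rule that)
qed

end

section \<open>Variance of dilated test functions\<close>

lemma Cc_dilate:
  fixes \<psi> :: "real ^ 'n \<Rightarrow> real"
  assumes "\<psi> \<in> Cc" "0 < R" shows "dilate R \<psi> \<in> Cc"
proof -
  obtain r where r: "\<And>x. r \<le> norm x \<Longrightarrow> \<psi> x = 0" and c: "continuous_on UNIV \<psi>"
    using assms(1) by (auto simp: Cc_iff)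
  show ?thesis
  proof (rule CcI[of _ "R * r"])
    show "continuous_on UNIV (dilate R \<psi>)"
      unfolding dilate_def[abs_def] using assms(2)
      by (intro continuous_intros continuous_on_compose2[OF c]) auto
    fix x :: "real ^ 'n" assume "R * r \<le> norm x"
    then have "r \<le> norm (x /\<^sub>R R)" using assms(2) by (simp add: field_simps)
    then show "dilate R \<psi> x = 0" by (simp add: dilate_def r)
  qed
qed

lemma Cc_lborel_integrable:
  fixes \<psi> :: "real ^ 'n \<Rightarrow> real"
  assumes "\<psi> \<in> Cc" shows "integrable lborel \<psi>"
proof -
  obtain B R where BR: "0 < B" "\<And>x. \<bar>\<psi> x\<bar> \<le> B" "\<And>x. R \<le> norm x \<Longrightarrow> \<psi> x = 0"
    by (rule Cc_bound[OF assms]) blast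
  show ?thesis
  proof (rule Bochner_Integration.integrable_bound)
    show "integrable lborel (\<lambda>x. B * indicator (ball 0 R) x)"
      using emeasure_lborel_ball_finite[of 0 R] by (intro integrable_mult_right integrable_real_indicator) auto
    show "AE x in lborel. norm (\<psi> x) \<le> norm (B * indicator (ball 0 R) x)"
      using BR by (intro AE_I2) (auto simp: indicator_def)
  qed (use Cc_measurable[OF assms] in simp)
qed

context siegel_L2
begin

text \<open>Both dilates have the same Lebesgue integral, so their difference has integral zero. It
  lies below two plateaus for which height times volume is the constant \<open>v\<close>, so what is
  left in the bound is the sum of the heights, of order R^-N + S^-N.\<close>

lemma hat_dilate_increment_bound:
  fixes \<psi> :: "real ^ 'n \<Rightarrow> real"
  assumes \<psi>: "\<psi> \<in> Cc"
  obtains K :: real where "0 \<le> K" "\<And>R S. 0 < R \<Longrightarrow> 0 < S \<Longrightarrow>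
    (\<integral>\<^sup>+\<nu>. ennreal ((hat (dilate R \<psi>) \<nu> - hat (dilate S \<psi>) \<nu>)\<^sup>2) \<partial>\<mu>) \<le> ennreal (K * (1 / R ^ CARD('n) + 1 / S ^ CARD('n)))"
proof -
  let ?N = "CARD('n)"
  obtain C r where C: "0 < C" "0 < r" "\<And>x. \<bar>\<psi> x\<bar> \<le> C" "\<And>x. r \<le> norm x \<Longrightarrow> \<psi> x = 0"
    by (rule Cc_bound[OF \<psi>]) blast
  obtain \<rho> :: real where \<rho>: "0 \<le> \<rho>"
    "\<And>(a::real) b E F (h :: real ^ 'n \<Rightarrow> real). 0 \<le> a \<Longrightarrow> 0 \<le> b \<Longrightarrow> E \<in> sets borel \<Longrightarrow> F \<in> sets borel \<Longrightarrow>
      (\<And>u. \<bar>h u\<bar> \<le> a * indicator E u + b * indicator F u) \<Longrightarrow>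
      (\<integral>\<^sup>+p. ennreal \<bar>h (fst p)\<bar> * ennreal \<bar>h (snd p)\<bar> * indicator dependent_pairs p \<partial>moment2) \<le>
      4 * ennreal \<rho> * (ennreal (a + b) * (ennreal a * emeasure lborel E + ennreal b * emeasure lborel F))"
    by (rule dependent_two_sets_le) blast
  define v where "v = C * unit_ball_vol (real ?N) * r ^ ?N"
  have v: "0 \<le> v" using C by (simp add: v_def)
  \<comment> \<open>The factor 4 \<rho> comes from the two-set bound, C from the heights, and 2 v
    from the two plateaus.\<close>
  define K where "K = 8 * \<rho> * C * v"
  have "(\<integral>\<^sup>+\<nu>. ennreal ((hat (dilate R \<psi>) \<nu> - hat (dilate S \<psi>) \<nu>)\<^sup>2) \<partial>\<mu>) \<le> ennreal (K * (1 / R ^ ?N + 1 / S ^ ?N))"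
    if R: "0 < R" and S: "0 < S" for R S
  proof -
    define h where "h u = dilate R \<psi> u - dilate S \<psi> u" for u
    let ?a = "C / R ^ ?N" and ?b = "C / S ^ ?N"
    let ?E = "ball 0 (R * r) :: (real ^ 'n) set" and ?F = "ball 0 (S * r) :: (real ^ 'n) set"
    have dil: "\<bar>dilate T \<psi> u\<bar> \<le> C / T ^ ?N * indicator (ball 0 (T * r)) u" if T: "0 < T" for T u
    proof (cases "norm u < T * r")
      case True
      then show ?thesis using C(3)[of "u /\<^sub>R T"] T by (simp add: dilate_def divide_right_mono)
    next
      case False
      then have "r \<le> norm (u /\<^sub>R T)" using T by (simp add: field_simps)
      then show ?thesis using False by (simp add: dilate_def C(4))
    qed
    have h_le: "\<bar>h u\<bar> \<le> ?a * indicator ?E u + ?b * indicator ?F u" for u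
      using abs_triangle_ineq4[of "dilate R \<psi> u" "dilate S \<psi> u"] dil[OF R, of u] dil[OF S, of u]
      unfolding h_def by linarith
    have hC: "h \<in> Cc" unfolding h_def by (intro Cc_diff Cc_dilate \<psi> R S)
    obtain B r' where B: "\<And>x. \<bar>h x\<bar> \<le> B" "\<And>x. r' \<le> norm x \<Longrightarrow> h x = 0" by (rule Cc_bound[OF hC]) blast
    obtain k :: nat where k: "r' \<le> k" using real_arch_simple by blast
    have "(\<integral>u. h u \<partial>lborel) = 0"
      unfolding h_def
      using dilate_integrable(1,2)[OF Cc_lborel_integrable[OF \<psi>] R] dilate_integrable(1,2)[OF Cc_lborel_integrable[OF \<psi>] S]
      by simp
    then have le1: "(\<integral>\<^sup>+\<nu>. ennreal ((hat h \<nu>)\<^sup>2) \<partial>\<mu>) \<le>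
        (\<integral>\<^sup>+p. ennreal \<bar>h (fst p)\<bar> * ennreal \<bar>h (snd p)\<bar> * indicator dependent_pairs p \<partial>moment2)"
      using B k by (intro second_moment_le_dependent[of h B k] Cc_measurable hC) auto
    have vol: "ennreal (C / T ^ ?N) * emeasure lborel (ball 0 (T * r) :: (real ^ 'n) set) = ennreal v" if T: "0 < T" for T
    proof -
      have "emeasure lborel (ball 0 (T * r) :: (real ^ 'n) set) = ennreal (unit_ball_vol (real ?N) * (T * r) ^ ?N)"
        using emeasure_ball[of "T * r" "0 :: real ^ 'n"] T C(2) by simp
      then show ?thesis
        using T C by (simp add: ennreal_mult'[symmetric] v_def power_mult_distrib)
    qed
    have "(\<integral>\<^sup>+\<nu>. ennreal ((hat (dilate R \<psi>) \<nu> - hat (dilate S \<psi>) \<nu>)\<^sup>2) \<partial>\<mu>) = (\<integral>\<^sup>+\<nu>. ennreal ((hat h \<nu>)\<^sup>2) \<partial>\<mu>)"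
      unfolding h_def by (intro nn_integral_cong) (simp add: hat_diff[OF Cc_dilate[OF \<psi> R] Cc_dilate[OF \<psi> S]])
    also note le1
    also have "(\<integral>\<^sup>+p. ennreal \<bar>h (fst p)\<bar> * ennreal \<bar>h (snd p)\<bar> * indicator dependent_pairs p \<partial>moment2) \<le>
        4 * ennreal \<rho> * (ennreal (?a + ?b) * (ennreal ?a * emeasure lborel ?E + ennreal ?b * emeasure lborel ?F))"
      using C R S by (intro \<rho>(2) h_le) auto
    also have "\<dots> = 4 * ennreal \<rho> * (ennreal (?a + ?b) * (ennreal v + ennreal v))"
      by (simp only: vol[OF R] vol[OF S])
    also have "\<dots> = ennreal (4 * \<rho> * ((?a + ?b) * (v + v)))"
    proof -
      have nonneg: "0 \<le> ?a + ?b" "0 \<le> v + v" "0 \<le> 4 * \<rho>" using C R S v \<rho>(1) by auto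
      have "(4 :: ennreal) = ennreal 4" by simp
      then show ?thesis
        using nonneg \<rho>(1)
        by (simp only: ennreal_plus[OF v v, symmetric] ennreal_mult'[symmetric] zero_le_numeral)
    qed
    also have "4 * \<rho> * ((?a + ?b) * (v + v)) = K * (1 / R ^ ?N + 1 / S ^ ?N)"
      by (simp add: K_def algebra_simps)
    finally show ?thesis .
  qed
  moreover have "0 \<le> K" using \<rho>(1) C v by (simp add: K_def)
  ultimately show thesis using that by blast
qed

text \<open>Let S tend to infinity in the increment bound: convergence in mean gives a subsequence
  along which the second dilate tends almost surely to the constant, and Fatou's lemma passes the
  bound to the limit.\<close>

lemma hat_dilate_variance_bound:
  fixes \<psi> :: "real ^ 'n \<Rightarrow> real"
  assumes \<psi>: "\<psi> \<in> Cc"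
  obtains K :: real where "0 \<le> K" "\<And>R. 0 < R \<Longrightarrow>
    (\<integral>\<^sup>+\<nu>. ennreal ((hat (dilate R \<psi>) \<nu> - mean_density * (\<integral>u. \<psi> u \<partial>lborel))\<^sup>2) \<partial>\<mu>) \<le> ennreal (K / R ^ CARD('n))"
proof -
  let ?\<kappa> = "mean_density * (\<integral>u. \<psi> u \<partial>lborel)" and ?N = "CARD('n)"
  obtain K :: real where K: "0 \<le> K" "\<And>R S. 0 < R \<Longrightarrow> 0 < S \<Longrightarrow>
    (\<integral>\<^sup>+\<nu>. ennreal ((hat (dilate R \<psi>) \<nu> - hat (dilate S \<psi>) \<nu>)\<^sup>2) \<partial>\<mu>) \<le> ennreal (K * (1 / R ^ ?N + 1 / S ^ ?N))"
    by (rule hat_dilate_increment_bound[OF \<psi>]) blast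
  note \<psi>_int = Cc_lborel_integrable[OF \<psi>]
  let ?X = "\<lambda>n. hat (dilate (real (Suc n)) \<psi>)"
  have X_int: "integrable \<mu> (?X n)" for n
    by (intro hat_integrable dilate_integrable \<psi>_int) simp
  have "((\<lambda>R. deviation R \<psi>) \<longlongrightarrow> 0) at_top"
    using equidistributes_integrable[OF \<psi>_int] by (simp add: equidistributes_def)
  from filterlim_compose[OF this filterlim_compose[OF filterlim_real_sequentially filterlim_Suc]]
  have "(\<lambda>n. deviation (real (Suc n)) \<psi>) \<longlonglongrightarrow> 0" .
  then have "(\<lambda>n. \<integral>\<nu>. norm (?X n \<nu> - ?\<kappa>) \<partial>\<mu>) \<longlonglongrightarrow> 0" by (simp add: deviation_def)
  then obtain s :: "nat \<Rightarrow> nat" where s: "strict_mono s" and AE: "AE \<nu> in \<mu>. (\<lambda>n. ?X (s n) \<nu> - ?\<kappa>) \<longlonglongrightarrow> 0"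
    using tendsto_L1_AE_subseq[of \<mu> "\<lambda>n \<nu>. ?X n \<nu> - ?\<kappa>"] X_int by auto
  have "(\<integral>\<^sup>+\<nu>. ennreal ((hat (dilate R \<psi>) \<nu> - ?\<kappa>)\<^sup>2) \<partial>\<mu>) \<le> ennreal (K / R ^ ?N)" if R: "0 < R" for R
  proof -
    let ?u = "\<lambda>n \<nu>. ennreal ((hat (dilate R \<psi>) \<nu> - ?X (s n) \<nu>)\<^sup>2)"
    have u_meas: "?u n \<in> borel_measurable \<mu>" for n
      using hat_dilate_measurable[OF Cc_measurable[OF \<psi>]] by measurable
    have "(\<integral>\<^sup>+\<nu>. ennreal ((hat (dilate R \<psi>) \<nu> - ?\<kappa>)\<^sup>2) \<partial>\<mu>) = (\<integral>\<^sup>+\<nu>. liminf (\<lambda>n. ?u n \<nu>) \<partial>\<mu>)"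
    proof (rule nn_integral_cong_AE)
      show "AE \<nu> in \<mu>. ennreal ((hat (dilate R \<psi>) \<nu> - ?\<kappa>)\<^sup>2) = liminf (\<lambda>n. ?u n \<nu>)"
        using AE
      proof eventually_elim
        case (elim \<nu>)
        then have "(\<lambda>n. ?X (s n) \<nu>) \<longlonglongrightarrow> ?\<kappa>" by (simp add: LIM_zero_iff)
        then have "(\<lambda>n. ?u n \<nu>) \<longlonglongrightarrow> ennreal ((hat (dilate R \<psi>) \<nu> - ?\<kappa>)\<^sup>2)"
          by (intro tendsto_intros)
        then show ?case by (intro lim_imp_Liminf[symmetric]) auto
      qed
    qed
    also have "\<dots> \<le> liminf (\<lambda>n. \<integral>\<^sup>+\<nu>. ?u n \<nu> \<partial>\<mu>)" by (rule nn_integral_liminf[OF u_meas])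
    also have "\<dots> \<le> liminf (\<lambda>n. ennreal (K * (1 / R ^ ?N + 1 / real (Suc (s n)) ^ ?N)))"
      by (intro Liminf_mono always_eventually allI K(2) R) simp
    also have "\<dots> = ennreal (K * (1 / R ^ ?N + 0))"
    proof (rule lim_imp_Liminf)
      have "filterlim (\<lambda>n. real (Suc (s n))) at_top sequentially"
        by (intro filterlim_compose[OF filterlim_real_sequentially] filterlim_compose[OF filterlim_Suc] filterlim_subseq s)
      then have "(\<lambda>n. 1 / real (Suc (s n)) ^ ?N) \<longlonglongrightarrow> 0"
        by (intro tendsto_divide_0[OF tendsto_const] filterlim_at_top_imp_at_infinity filterlim_pow_at_top) auto
      then show "(\<lambda>n. ennreal (K * (1 / R ^ ?N + 1 / real (Suc (s n)) ^ ?N))) \<longlonglongrightarrow> ennreal (K * (1 / R ^ ?N + 0))"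
        by (intro tendsto_intros)
    qed simp
    finally show ?thesis by simp
  qed
  with K(1) show thesis by (rule that)
qed

text \<open>The bounds on the variances along \<open>q ^ k\<close> form a convergent geometric
  series, so the squared deviations are almost surely summable and tend to 0.\<close>

lemma hat_dilate_geometric:
  fixes \<psi> :: "real ^ 'n \<Rightarrow> real"
  assumes \<psi>: "\<psi> \<in> Cc" and q: "1 < q"
  shows "AE \<nu> in \<mu>. (\<lambda>k. hat (dilate (q ^ k) \<psi>) \<nu>) \<longlonglongrightarrow> mean_density * (\<integral>u. \<psi> u \<partial>lborel)"
proof -
  let ?\<kappa> = "mean_density * (\<integral>u. \<psi> u \<partial>lborel)" and ?N = "CARD('n)"
  obtain K :: real where K: "0 \<le> K" "\<And>R. 0 < R \<Longrightarrow>
    (\<integral>\<^sup>+\<nu>. ennreal ((hat (dilate R \<psi>) \<nu> - ?\<kappa>)\<^sup>2) \<partial>\<mu>) \<le> ennreal (K / R ^ ?N)"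
    by (rule hat_dilate_variance_bound[OF \<psi>]) blast
  let ?f = "\<lambda>k \<nu>. (hat (dilate (q ^ k) \<psi>) \<nu> - ?\<kappa>)\<^sup>2"
  have f_meas: "(\<lambda>\<nu>. ennreal (?f k \<nu>)) \<in> borel_measurable \<mu>" for k
    using hat_dilate_measurable[OF Cc_measurable[OF \<psi>]] by measurable
  let ?x = "1 / q ^ ?N"
  have x: "0 \<le> ?x" "?x < 1" using q by (auto simp: one_less_power)
  have "(\<integral>\<^sup>+\<nu>. (\<Sum>k. ennreal (?f k \<nu>)) \<partial>\<mu>) = (\<Sum>k. \<integral>\<^sup>+\<nu>. ennreal (?f k \<nu>) \<partial>\<mu>)"
    by (rule nn_integral_suminf[OF f_meas])
  also have "\<dots> \<le> (\<Sum>k. ennreal (K * ?x ^ k))"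
  proof (rule suminf_le)
    fix k
    have "K / (q ^ k) ^ ?N = K * ?x ^ k"
      by (simp add: power_one_over power_mult[symmetric] mult.commute)
    then show "(\<integral>\<^sup>+\<nu>. ennreal (?f k \<nu>) \<partial>\<mu>) \<le> ennreal (K * ?x ^ k)" using K(2)[of "q ^ k"] q by simp
  qed auto
  also have "\<dots> = ennreal (\<Sum>k. K * ?x ^ k)"
    using K(1) x by (intro suminf_ennreal_eq summable_sums summable_mult summable_geometric) auto
  also have "\<dots> < \<infinity>" by simp
  finally have "AE \<nu> in \<mu>. (\<Sum>k. ennreal (?f k \<nu>)) \<noteq> \<infinity>"
    using f_meas by (intro nn_integral_PInf_AE borel_measurable_suminf_order) auto
  then show ?thesis
  proof eventually_elim
    case (elim \<nu>)
    then have "summable (\<lambda>k. ?f k \<nu>)" by (intro summable_suminf_not_top) auto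
    then have "(\<lambda>k. ?f k \<nu>) \<longlonglongrightarrow> 0" by (rule summable_LIMSEQ_zero)
    then have "(\<lambda>k. hat (dilate (q ^ k) \<psi>) \<nu> - ?\<kappa>) \<longlonglongrightarrow> 0" by (subst (asm) power_tendsto_0_iff) auto
    then show ?case by (simp add: LIM_zero_iff)
  qed
qed

end

section \<open>Interpolation between geometric radii\<close>

lemma geometric_bracket:
  fixes q R :: real
  assumes "1 < q" "q ^ m \<le> R"
  obtains k where "m \<le> k" "q ^ k \<le> R" "R < q ^ Suc k"
proof -
  have ex: "\<exists>n. R < q ^ (m + Suc n)"
  proof -
    obtain n where "R < q ^ n" using real_arch_pow[OF assms(1)] by blast
    also have "\<dots> \<le> q ^ (m + Suc n)" using assms(1) by (intro power_increasing) auto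
    finally show ?thesis by blast
  qed
  define n where "n = (LEAST n. R < q ^ (m + Suc n))"
  have "R < q ^ (m + Suc n)" unfolding n_def by (rule LeastI_ex[OF ex])
  moreover have "q ^ (m + n) \<le> R"
  proof (cases n)
    case (Suc l)
    then have "\<not> R < q ^ (m + Suc l)" using not_less_Least[of l "\<lambda>n. R < q ^ (m + Suc n)"] by (simp add: n_def)
    then show ?thesis by (simp add: Suc)
  qed (use assms(2) in simp)
  ultimately show thesis using that[of "m + n"] by simp
qed

text \<open>The factor \<open>(S / R) ^ CARD('n)\<close> aligns the two normalizations. What is left
  is the difference of \<psi> at v/R and v/S, small on a ball whose mass the growth bound
  controls.\<close>

lemma hat_dilate_compare:
  fixes \<psi> :: "real ^ 'n \<Rightarrow> real"
  assumes \<psi>: "\<psi> \<in> Cc" and \<nu>: "\<nu> \<in> growth_measures" and RS: "0 < S" "S \<le> R" and r: "0 < r" and \<omega>: "0 \<le> \<omega>"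
    and near: "\<And>v. \<bar>\<psi> (v /\<^sub>R R) - \<psi> (v /\<^sub>R S)\<bar> \<le> \<omega> * indicator (ball 0 (R * r)) v"
  shows "\<bar>hat (dilate R \<psi>) \<nu> - (S / R) ^ CARD('n) * hat (dilate S \<psi>) \<nu>\<bar> \<le> \<omega> * (r ^ CARD('n) * enn2real (growth_bound \<nu>))"
proof -
  let ?N = "CARD('n)"
  have R: "0 < R" using RS by simp
  let ?B = "ball 0 (R * r) :: (real ^ 'n) set"
  define h where "h v = dilate R \<psi> v - (S / R) ^ ?N * dilate S \<psi> v" for v
  have hC: "h \<in> Cc" unfolding h_def by (intro Cc_diff Cc_cmult Cc_dilate \<psi> R RS)
  have h_le: "\<bar>h v\<bar> \<le> \<omega> / R ^ ?N * indicator ?B v" for v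
  proof -
    have "h v = (\<psi> (v /\<^sub>R R) - \<psi> (v /\<^sub>R S)) / R ^ ?N"
      using RS R by (simp add: h_def dilate_def power_divide diff_divide_distrib)
    then have "\<bar>h v\<bar> = \<bar>\<psi> (v /\<^sub>R R) - \<psi> (v /\<^sub>R S)\<bar> / R ^ ?N" using R by (simp add: abs_div)
    also have "\<dots> \<le> \<omega> * indicator ?B v / R ^ ?N" using near R by (intro divide_right_mono) auto
    finally show ?thesis by simp
  qed
  have fin: "emeasure \<nu> ?B < \<infinity>" by (rule growth_measure_bounded_finite[OF \<nu> bounded_ball])
  have B: "?B \<in> sets \<nu>" using sets_growth_measure[OF \<nu>] by simp
  have Bint: "integrable \<nu> (\<lambda>v. \<omega> / R ^ ?N * indicator ?B v)"
    using fin B by (intro integrable_mult_right integrable_real_indicator) auto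
  have "measure \<nu> ?B \<le> enn2real (growth_bound \<nu> * ennreal ((R * r) ^ ?N))"
    unfolding measure_def using growth_bound_finite[OF \<nu>] R r
    by (intro enn2real_mono emeasure_ball_le_growth_bound) (auto simp: ennreal_mult_less_top)
  also have "\<dots> = enn2real (growth_bound \<nu>) * (R * r) ^ ?N"
    using R r by (simp add: enn2real_mult)
  finally have mB: "measure \<nu> ?B \<le> enn2real (growth_bound \<nu>) * (R * r) ^ ?N" .
  have "hat (dilate R \<psi>) \<nu> - (S / R) ^ ?N * hat (dilate S \<psi>) \<nu> = hat h \<nu>"
    unfolding h_def hat_def
    by (subst Bochner_Integration.integral_diff) (auto intro!: Cc_integrable Cc_dilate Cc_cmult \<psi> \<nu> R RS)
  also have "\<bar>\<dots>\<bar> \<le> (\<integral>v. \<bar>h v\<bar> \<partial>\<nu>)" unfolding hat_def by (rule integral_abs_bound)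
  also have "\<dots> \<le> (\<integral>v. \<omega> / R ^ ?N * indicator ?B v \<partial>\<nu>)"
    by (intro integral_mono integrable_abs Cc_integrable hC \<nu> Bint h_le)
  also have "\<dots> = \<omega> / R ^ ?N * measure \<nu> ?B" using B sets.Int_space_eq2[OF B] by simp
  also have "\<dots> \<le> \<omega> / R ^ ?N * (enn2real (growth_bound \<nu>) * (R * r) ^ ?N)"
    using \<omega> R by (intro mult_left_mono mB) auto
  also have "\<dots> = \<omega> * (r ^ ?N * enn2real (growth_bound \<nu>))" using R by (simp add: power_mult_distrib)
  finally show ?thesis .
qed

text \<open>R lies between consecutive powers of a ratio q near 1. Uniform continuity and the growth
  bound compare R with the lower power S, and \<open>(S / R) ^ CARD('n)\<close> is close to 1. As q
  depends on \<open>e\<close>, convergence is assumed for a sequence of ratios tending to 1.\<close>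

lemma tendsto_hat_dilate_geometric:
  fixes \<psi> :: "real ^ 'n \<Rightarrow> real"
  assumes \<psi>: "\<psi> \<in> Cc" and \<nu>: "\<nu> \<in> growth_measures"
    and geo: "\<And>j::nat. (\<lambda>k. hat (dilate ((1 + 1 / real (Suc j)) ^ k) \<psi>) \<nu>) \<longlonglongrightarrow> \<kappa>"
  shows "((\<lambda>R. hat (dilate R \<psi>) \<nu>) \<longlongrightarrow> \<kappa>) at_top"
proof (rule tendstoI)
  let ?N = "CARD('n)" and ?X = "\<lambda>R. hat (dilate R \<psi>) \<nu>"
  fix e :: real assume e: "0 < e"
  obtain C r where C: "0 < C" "0 < r" "\<And>x. \<bar>\<psi> x\<bar> \<le> C" "\<And>x. r \<le> norm x \<Longrightarrow> \<psi> x = 0"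
    by (rule Cc_bound[OF \<psi>]) blast
  let ?M = "r ^ ?N * enn2real (growth_bound \<nu>)"
  have M: "0 \<le> ?M" using C by simp
  \<comment> \<open>The summand 1 keeps the divisor positive when the growth bound is 0.\<close>
  define \<omega> where "\<omega> = e / (3 * (?M + 1))"
  have \<omega>: "0 < \<omega>" using e M by (simp add: \<omega>_def)
  have \<omega>M: "\<omega> * ?M < e / 3" using e M by (simp add: \<omega>_def field_simps)
  \<comment> \<open>As q is at most 2, v/S has norm at most 2 r whenever v/R lies in the ball of
    radius r.\<close>
  have "uniformly_continuous_on (cball 0 (2 * r)) \<psi>"
    using \<psi> by (intro compact_uniformly_continuous) (auto simp: Cc_iff intro: continuous_on_subset)
  then obtain \<delta> where \<delta>: "0 < \<delta>" "\<And>x y. x \<in> cball 0 (2 * r) \<Longrightarrow> y \<in> cball 0 (2 * r) \<Longrightarrow> dist y x < \<delta> \<Longrightarrow> dist (\<psi> y) (\<psi> x) < \<omega>"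
    unfolding uniformly_continuous_on_def using \<omega> by metis
  let ?q = "\<lambda>j::nat. 1 + 1 / real (Suc j)"
  have q_lim: "?q \<longlonglongrightarrow> 1 + 0"
    by (intro tendsto_add tendsto_const LIMSEQ_Suc[OF lim_1_over_n])
  have "(\<lambda>j. (?q j - 1) * r) \<longlonglongrightarrow> ((1 + 0) - 1) * r" "(\<lambda>j. (1 - (1 / ?q j) ^ ?N) * \<bar>\<kappa>\<bar>) \<longlonglongrightarrow> (1 - (1 / (1 + 0)) ^ ?N) * \<bar>\<kappa>\<bar>"
    by (intro tendsto_intros q_lim; simp)+
  then have "(\<lambda>j. (?q j - 1) * r) \<longlonglongrightarrow> 0" "(\<lambda>j. (1 - (1 / ?q j) ^ ?N) * \<bar>\<kappa>\<bar>) \<longlonglongrightarrow> 0" by simp_all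
  from order_tendstoD(2)[OF this(1) \<delta>(1)] order_tendstoD(2)[OF this(2), of "e / 3"] e
  have "\<forall>\<^sub>F j in sequentially. (?q j - 1) * r < \<delta> \<and> (1 - (1 / ?q j) ^ ?N) * \<bar>\<kappa>\<bar> < e / 3"
    by (simp add: eventually_conj)
  then obtain j where j: "(?q j - 1) * r < \<delta>" "(1 - (1 / ?q j) ^ ?N) * \<bar>\<kappa>\<bar> < e / 3"
    unfolding eventually_sequentially by blast
  define q where "q = ?q j"
  have q: "1 < q" "q \<le> 2" by (simp_all add: q_def)
  obtain m where m: "\<And>k. m \<le> k \<Longrightarrow> \<bar>?X (q ^ k) - \<kappa>\<bar> < e / 3"
    using tendstoD[OF geo[of j], of "e / 3"] e unfolding q_def eventually_sequentially dist_real_def by auto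
  have "dist (?X R) \<kappa> < e" if R: "q ^ m \<le> R" for R
  proof -
    obtain k where k: "m \<le> k" "q ^ k \<le> R" "R < q ^ Suc k" by (rule geometric_bracket[OF q(1) R])
    define S where "S = q ^ k"
    have S: "0 < S" "S \<le> R" "R < q * S" using q k by (simp_all add: S_def)
    have near: "\<bar>\<psi> (v /\<^sub>R R) - \<psi> (v /\<^sub>R S)\<bar> \<le> \<omega> * indicator (ball 0 (R * r)) v" for v
    proof (cases "norm v < R * r")
      case False
      then have "R * r \<le> norm v" "S * r \<le> norm v" using S C(2) mult_right_mono[of S R r] by linarith+
      then have "r \<le> norm (v /\<^sub>R R)" "r \<le> norm (v /\<^sub>R S)" using S by (simp_all add: field_simps)
      then show ?thesis using \<omega> by (simp add: C(4))
    next
      case True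
      let ?w = "v /\<^sub>R R"
      have w: "norm ?w < r" using True S by (simp add: field_simps)
      have RS: "1 \<le> R / S" "R / S < q" using S by (simp_all add: field_simps)
      have v: "v /\<^sub>R S = (R / S) *\<^sub>R ?w" using S by (simp add: inverse_eq_divide)
      have "norm (v /\<^sub>R S) \<le> q * r"
        unfolding v norm_scaleR using RS w by (intro mult_mono) auto
      also have "\<dots> \<le> 2 * r" using q C(2) by simp
      finally have 1: "norm (v /\<^sub>R S) \<le> 2 * r" .
      have "?w - v /\<^sub>R S = (1 - R / S) *\<^sub>R ?w" unfolding v by (simp add: algebra_simps)
      then have "dist ?w (v /\<^sub>R S) = \<bar>1 - R / S\<bar> * norm ?w" by (simp only: dist_norm norm_scaleR)
      also have "\<dots> = (R / S - 1) * norm ?w" using RS by simp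
      also have "\<dots> \<le> (q - 1) * r" using RS w by (intro mult_mono) auto
      also have "\<dots> < \<delta>" using j(1) by (simp add: q_def)
      finally have "dist (\<psi> ?w) (\<psi> (v /\<^sub>R S)) < \<omega>" using 1 w C(2) by (intro \<delta>(2)) auto
      then show ?thesis using True by (simp add: dist_real_def)
    qed
    let ?t = "(S / R) ^ ?N"
    have t: "?t \<le> 1" "(1 / q) ^ ?N \<le> ?t" using S q
      by (intro power_le_one power_mono; simp add: field_simps)+
    then have t0: "0 \<le> ?t" using S by simp
    have "\<bar>?X R - ?t * ?X S\<bar> < e / 3"
      using hat_dilate_compare[OF \<psi> \<nu> S(1,2) C(2) less_imp_le[OF \<omega>] near] \<omega>M by linarith
    moreover have "\<bar>?t * (?X S - \<kappa>)\<bar> < e / 3"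
      using m[OF k(1)] t t0 mult_right_mono[OF t(1), of "\<bar>?X S - \<kappa>\<bar>"] by (simp add: abs_mult S_def)
    moreover have "\<bar>(1 - ?t) * \<kappa>\<bar> < e / 3"
    proof -
      have "\<bar>(1 - ?t) * \<kappa>\<bar> = (1 - ?t) * \<bar>\<kappa>\<bar>" using t by (simp add: abs_mult)
      also have "\<dots> \<le> (1 - (1 / q) ^ ?N) * \<bar>\<kappa>\<bar>" using t by (intro mult_right_mono) auto
      finally show ?thesis using j(2) by (simp add: q_def)
    qed
    \<comment> \<open>Three errors below e/3: the change of radius, the convergence along the
      powers, and the factor \<open>?t\<close>.\<close>
    moreover have "?X R - \<kappa> = (?X R - ?t * ?X S) + ?t * (?X S - \<kappa>) - (1 - ?t) * \<kappa>" by (simp add: algebra_simps)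
    ultimately show ?thesis unfolding dist_real_def by linarith
  qed
  then show "\<forall>\<^sub>F R in at_top. dist (?X R) \<kappa> < e" unfolding eventually_at_top_linorder by blast
qed

text \<open>Piecewise linear approximations of the indicator of the unit ball, with slope n + 1:
  from below for a = 0, from above for a = 1.\<close>

definition tent :: "real \<Rightarrow> nat \<Rightarrow> real ^ 'n \<Rightarrow> real" where
  "tent a n x = max 0 (min 1 (a + real (Suc n) * (1 - norm x)))"

lemma tent_Cc: assumes "a \<le> 1" shows "tent a n \<in> Cc"
proof (rule CcI[of _ 2])
  show "continuous_on UNIV (tent a n)" unfolding tent_def[abs_def] by (intro continuous_intros)
  fix x :: "real ^ 'n" assume "2 \<le> norm x"
  then have "real (Suc n) * (1 - norm x) \<le> real (Suc n) * (- 1)" by (intro mult_left_mono) auto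
  also have "\<dots> \<le> - 1" by simp
  finally show "tent a n x = 0" using assms by (simp add: tent_def)
qed

lemma tent_bounds:
  "tent 0 n x \<le> indicator (ball 0 1) x" "indicator (ball 0 1) x \<le> tent 1 n x"
  by (auto simp: tent_def indicator_def min_le_iff_disj mult_nonneg_nonpos)

lemma tent_tendsto:
  fixes x :: "real ^ 'n"
  assumes "norm x \<noteq> 1"
  shows "(\<lambda>n. tent a n x) \<longlonglongrightarrow> indicator (ball 0 1) x"
proof -
  have lim: "filterlim (\<lambda>n. real (Suc n)) at_top sequentially"
    by (rule filterlim_compose[OF filterlim_real_sequentially filterlim_Suc])
  show ?thesis
  proof (cases "norm x < 1")
    case True
    have "filterlim (\<lambda>n. (1 - norm x) * real (Suc n)) at_top sequentially"
      using True by (intro filterlim_tendsto_pos_mult_at_top[OF tendsto_const _ lim]) simp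
    then have "\<forall>\<^sub>F n in sequentially. 1 - a \<le> (1 - norm x) * real (Suc n)" by (simp add: filterlim_at_top)
    then have "\<forall>\<^sub>F n in sequentially. tent a n x = 1"
      by eventually_elim (auto simp: tent_def mult.commute)
    then show ?thesis using True by (auto intro: tendsto_eventually)
  next
    case False
    have "filterlim (\<lambda>n. (norm x - 1) * real (Suc n)) at_top sequentially"
      using False assms by (intro filterlim_tendsto_pos_mult_at_top[OF tendsto_const _ lim]) simp
    then have "\<forall>\<^sub>F n in sequentially. a \<le> (norm x - 1) * real (Suc n)" by (simp add: filterlim_at_top)
    then have "\<forall>\<^sub>F n in sequentially. tent a n x = 0"
      by eventually_elim (simp add: tent_def algebra_simps)
    then show ?thesis using False by (auto intro: tendsto_eventually)
  qed
qed

lemma tent_integral_tendsto: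
  assumes "a \<le> 1"
  shows "(\<lambda>n. \<integral>x. tent a n (x :: real ^ 'n) \<partial>lborel) \<longlonglongrightarrow> measure lborel (ball (0 :: real ^ 'n) 1)"
proof -
  have "(\<lambda>n. \<integral>x. tent a n (x :: real ^ 'n) \<partial>lborel) \<longlonglongrightarrow> (\<integral>x. indicator (ball (0 :: real ^ 'n) 1) x \<partial>lborel)"
  proof (rule integral_dominated_convergence[where w = "indicator (ball 0 2)"])
    show "integrable lborel (indicator (ball (0 :: real ^ 'n) 2) :: _ \<Rightarrow> real)"
      using emeasure_lborel_ball_finite[of "0 :: real ^ 'n" 2] by (intro integrable_real_indicator) auto
    show "AE x in lborel. norm (tent a n x) \<le> indicator (ball (0 :: real ^ 'n) 2) x" for n
    proof (rule AE_I2)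
      fix x :: "real ^ 'n"
      show "norm (tent a n x) \<le> indicator (ball 0 2) x"
      proof (cases "norm x < 2")
        case False
        then have "real (Suc n) * (1 - norm x) \<le> real (Suc n) * (- 1)" by (intro mult_left_mono) auto
        also have "\<dots> \<le> - 1" by simp
        finally show ?thesis using assms by (simp add: tent_def)
      qed (simp add: tent_def)
    qed
    \<comment> \<open>On the unit sphere itself the tents do not depend on n and may miss the
      indicator, but the sphere is null.\<close>
    have "AE x in lborel. x \<notin> sphere (0 :: real ^ 'n) 1"
      using negligible_sphere[of "0 :: real ^ 'n" 1]
      by (intro AE_not_in) (simp add: null_sets_def negligible_iff_emeasure0)
    then show "AE x :: real ^ 'n in lborel. (\<lambda>n. tent a n x) \<longlonglongrightarrow> indicator (ball 0 1) x"
      by eventually_elim (simp add: tent_tendsto)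
  qed (auto intro!: Cc_measurable tent_Cc assms borel_measurable_indicator)
  then show ?thesis by simp
qed

lemma hat_dilate_ball:
  fixes \<nu> :: "(real ^ 'n) measure"
  assumes "sets \<nu> = sets borel" "0 < R"
  shows "hat (dilate R (indicator (ball 0 1))) \<nu> = enn2real (mass_in_ball \<nu> R) / R ^ CARD('n)"
proof -
  have "indicator (ball 0 1) (v /\<^sub>R R) = (indicator (ball 0 R) v :: real)" for v :: "real ^ 'n"
    using assms(2) by (simp add: indicator_def field_simps)
  then have "hat (dilate R (indicator (ball 0 1))) \<nu> = hat (indicator (ball 0 R)) \<nu> / R ^ CARD('n)"
    unfolding hat_dilate by (simp only: hat_def)
  then show ?thesis
    using mass_indicator[OF assms(1), of "ball 0 R"] by (simp add: measure_def mass_in_ball_def)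
qed

context siegel_L2
begin

text \<open>Countably many ratios share one null set; outside it the interpolation works for each
  \<nu> separately.\<close>

theorem AE_hat_dilate_tendsto:
  fixes \<psi> :: "real ^ 'n \<Rightarrow> real"
  assumes \<psi>: "\<psi> \<in> Cc"
  shows "AE \<nu> in \<mu>. ((\<lambda>R. hat (dilate R \<psi>) \<nu>) \<longlongrightarrow> mean_density * (\<integral>u. \<psi> u \<partial>lborel)) at_top"
proof -
  have "AE \<nu> in \<mu>. \<forall>j::nat. (\<lambda>k. hat (dilate ((1 + 1 / real (Suc j)) ^ k) \<psi>) \<nu>) \<longlonglongrightarrow> mean_density * (\<integral>u. \<psi> u \<partial>lborel)"
    unfolding AE_all_countable by (intro allI hat_dilate_geometric \<psi>) simp
  with AE_space show ?thesis
    by eventually_elim (auto intro!: tendsto_hat_dilate_geometric \<psi>)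
qed

text \<open>The indicator of the ball is not continuous; tents squeeze it from both sides, with one
  null set for all n and integrals tending to the volume of the ball.\<close>

theorem AE_hat_dilate_ball_tendsto:
  "AE \<nu> in \<mu>. ((\<lambda>R. hat (dilate R (indicator (ball 0 1))) \<nu>) \<longlongrightarrow>
     mean_density * measure lborel (ball (0 :: real ^ 'n) 1)) at_top"
proof -
  let ?\<kappa> = "mean_density * measure lborel (ball (0 :: real ^ 'n) 1)"
  let ?I = "\<lambda>a n. mean_density * (\<integral>u. tent a n (u :: real ^ 'n) \<partial>lborel)"
  have "AE \<nu> in \<mu>. \<forall>n. ((\<lambda>R. hat (dilate R (tent 0 n)) \<nu>) \<longlongrightarrow> ?I 0 n) at_top"
    "AE \<nu> in \<mu>. \<forall>n. ((\<lambda>R. hat (dilate R (tent 1 n)) \<nu>) \<longlongrightarrow> ?I 1 n) at_top"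
    unfolding AE_all_countable by (intro allI AE_hat_dilate_tendsto tent_Cc; simp)+
  with AE_space show ?thesis
  proof eventually_elim
    case (elim \<nu>)
    then have \<nu>: "\<nu> \<in> growth_measures" by simp
    let ?X = "\<lambda>R. hat (dilate R (indicator (ball 0 1))) \<nu>"
    have ball_int: "integrable \<nu> (dilate R (indicator (ball 0 1)))" if R: "0 < R" for R
    proof -
      have "dilate R (indicator (ball 0 1)) = (\<lambda>v::real ^ 'n. indicator (ball 0 R) v / R ^ CARD('n))"
        using R by (auto simp: fun_eq_iff dilate_def indicator_def field_simps)
      moreover have "integrable \<nu> (\<lambda>v::real ^ 'n. indicator (ball 0 R) v / R ^ CARD('n))"
        using growth_measure_bounded_finite[OF \<nu>, of "ball 0 R"] sets_growth_measure[OF \<nu>]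
        by (intro integrable_divide integrable_real_indicator) auto
      ultimately show ?thesis by simp
    qed
    have le: "hat (dilate R (tent 0 n)) \<nu> \<le> ?X R" "?X R \<le> hat (dilate R (tent 1 n)) \<nu>" if R: "0 < R" for R n
      unfolding hat_def using R
      by (intro integral_mono ball_int Cc_integrable \<nu> Cc_dilate tent_Cc;
          simp add: dilate_def divide_right_mono tent_bounds)+
    have I_lim: "(\<lambda>n. ?I a n) \<longlonglongrightarrow> ?\<kappa>" if "a \<le> 1" for a
      by (intro tendsto_mult tendsto_const tent_integral_tendsto that)
    show ?case
    proof (rule order_tendstoI)
      fix b assume "b < ?\<kappa>"
      then have "\<forall>\<^sub>F n in sequentially. b < ?I 0 n" using order_tendstoD(1)[OF I_lim[of 0]] by simp
      then obtain n where "b < ?I 0 n" unfolding eventually_sequentially by blast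
      with elim(2) have "\<forall>\<^sub>F R in at_top. b < hat (dilate R (tent 0 n)) \<nu>" by (metis order_tendstoD(1))
      with eventually_gt_at_top[of 0] show "\<forall>\<^sub>F R in at_top. b < ?X R"
        by eventually_elim (rule less_le_trans[OF _ le(1)])
    next
      fix b assume "?\<kappa> < b"
      then have "\<forall>\<^sub>F n in sequentially. ?I 1 n < b" using order_tendstoD(2)[OF I_lim[of 1]] by simp
      then obtain n where "?I 1 n < b" unfolding eventually_sequentially by blast
      with elim(3) have "\<forall>\<^sub>F R in at_top. hat (dilate R (tent 1 n)) \<nu> < b" by (metis order_tendstoD(2))
      with eventually_gt_at_top[of 0] show "\<forall>\<^sub>F R in at_top. ?X R < b"
        by eventually_elim (rule le_less_trans[OF le(2)])
    qed
  qed
qed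

end

lemma unit_ball_measure:
  "measure lborel (ball (0 :: real ^ 'n) 1) = unit_sphere_area TYPE('n) / CARD('n)"
  using content_ball[of 1 "0 :: real ^ 'n"] by (simp add: unit_sphere_area_eq)

theorem theorem0p12:
  fixes \<mu> :: "(real ^ 'n) measure measure"
  assumes "CARD('n) > 1" and "Siegel_measure \<mu>"
  shows "\<exists>c::real. 0 \<le> c \<and>
    (\<forall>\<psi> :: real ^ 'n \<Rightarrow> ennreal. \<psi> \<in> borel_measurable borel \<longrightarrow>
       nn_hat \<psi> \<in> borel_measurable \<mu> \<and>
       (\<integral>\<^sup>+\<nu>. nn_hat \<psi> \<nu> \<partial>\<mu>) = ennreal c * (\<integral>\<^sup>+u. \<psi> u \<partial>lborel)) \<and>
    ((\<forall>R>0. integrable \<mu> (\<lambda>\<nu>. enn2real (mass_in_ball \<nu> R))) \<and>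
     ((\<lambda>R. \<integral>\<nu>. \<bar>enn2real (mass_in_ball \<nu> R) / R ^ CARD('n)
                   - c * (unit_sphere_area TYPE('n) / CARD('n))\<bar> \<partial>\<mu>) \<longlongrightarrow> 0) at_top) \<and>
    ((AE \<nu> in \<mu>. \<nu> \<in> even_growth_measures) \<longrightarrow>
     (\<forall>\<psi>\<in>Cc.
        (\<forall>R>0. integrable \<mu> (\<lambda>\<nu>. \<integral>v. \<psi> (v /\<^sub>R R) \<partial>\<nu>)) \<and>
        ((\<lambda>R. \<integral>\<nu>. \<bar>(\<integral>v. \<psi> (v /\<^sub>R R) \<partial>\<nu>) / R ^ CARD('n)
                      - c * (\<integral>u. \<psi> u \<partial>lborel)\<bar> \<partial>\<mu>) \<longlongrightarrow> 0) at_top)) \<and>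
    (CARD('n) > 2 \<and>
     (\<forall>\<psi>\<in>Cc. hat \<psi> \<in> borel_measurable \<mu> \<and> integrable \<mu> (\<lambda>\<nu>. (hat \<psi> \<nu>)\<^sup>2)) \<longrightarrow>
       (AE \<nu> in \<mu>. ((\<lambda>R. enn2real (mass_in_ball \<nu> R) / R ^ CARD('n))
                     \<longlongrightarrow> c * (unit_sphere_area TYPE('n) / CARD('n))) at_top) \<and>
       ((AE \<nu> in \<mu>. \<nu> \<in> even_growth_measures) \<longrightarrow>
        (\<forall>\<psi>\<in>Cc. AE \<nu> in \<mu>. ((\<lambda>R. (\<integral>v. \<psi> (v /\<^sub>R R) \<partial>\<nu>) / R ^ CARD('n))
                                  \<longlongrightarrow> c * (\<integral>u. \<psi> u \<partial>lborel)) at_top)))"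
proof -
  interpret siegel \<mu> by unfold_locales fact+
  let ?c = mean_density and ?B = "indicator (ball 0 1) :: real ^ 'n \<Rightarrow> real"
  have B_int: "integrable lborel (indicator (ball (0 :: real ^ 'n) R) :: _ \<Rightarrow> real)" for R
    using emeasure_lborel_ball_finite[of "0 :: real ^ 'n" R] by (intro integrable_real_indicator) auto
  have I: "nn_hat \<psi> \<in> borel_measurable \<mu> \<and> (\<integral>\<^sup>+\<nu>. nn_hat \<psi> \<nu> \<partial>\<mu>) = ennreal ?c * (\<integral>\<^sup>+u. \<psi> u \<partial>lborel)"
    if "\<psi> \<in> borel_measurable borel" for \<psi> :: "real ^ 'n \<Rightarrow> ennreal"
    using nn_hat_measurable[OF that] mean_value[OF that] by (simp add: measurable_cong_sets[OF sets_mu refl])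
  have IIa: "integrable \<mu> (\<lambda>\<nu>. enn2real (mass_in_ball \<nu> R))" for R
  proof -
    have int: "integrable \<mu> (hat (indicator (ball 0 R)))" by (rule hat_integrable(1)[OF B_int])
    have eq: "hat (indicator (ball 0 R)) \<nu> = enn2real (mass_in_ball \<nu> R)" if "\<nu> \<in> space \<mu>" for \<nu> :: "(real ^ 'n) measure"
      using that mass_indicator[OF sets_growth_measure, of \<nu> "ball 0 R"] by (simp add: measure_def mass_in_ball_def)
    show ?thesis by (rule iffD1[OF Bochner_Integration.integrable_cong[OF refl] int]) (rule eq)
  qed
  have ball: "hat (dilate R ?B) \<nu> = enn2real (mass_in_ball \<nu> R) / R ^ CARD('n)"
    if "0 < R" "\<nu> \<in> space \<mu>" for R \<nu>
    using that by (intro hat_dilate_ball) (auto simp: sets_growth_measure)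
  have IIb: "((\<lambda>R. \<integral>\<nu>. \<bar>enn2real (mass_in_ball \<nu> R) / R ^ CARD('n)
                   - ?c * (unit_sphere_area TYPE('n) / CARD('n))\<bar> \<partial>\<mu>) \<longlongrightarrow> 0) at_top"
  proof (rule Lim_transform_eventually)
    \<comment> \<open>The normalized ball count is the \<open>hat\<close> of a dilated indicator,
      and the volume of the unit ball is the sphere area divided by N.\<close>
    show "((\<lambda>R. deviation R ?B) \<longlongrightarrow> 0) at_top"
      using equidistributes_integrable[OF B_int] by (simp add: equidistributes_def)
    show "\<forall>\<^sub>F R in at_top. deviation R ?B = (\<integral>\<nu>. \<bar>enn2real (mass_in_ball \<nu> R) / R ^ CARD('n)
                   - ?c * (unit_sphere_area TYPE('n) / CARD('n))\<bar> \<partial>\<mu>)"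
      using eventually_gt_at_top[of 0]
    proof eventually_elim
      case (elim R)
      show ?case unfolding deviation_def unit_ball_measure[symmetric]
        by (intro Bochner_Integration.integral_cong refl) (simp add: ball[OF elim] del: space_mu)
    qed
  qed
  have IIIa: "integrable \<mu> (\<lambda>\<nu>. \<integral>v. \<psi> (v /\<^sub>R R) \<partial>\<nu>)" if "\<psi> \<in> Cc" "0 < R" for \<psi> :: "real ^ 'n \<Rightarrow> real" and R
    using hat_integrable(1)[OF dilation_lborel(1)[OF Cc_lborel_integrable[OF that(1)] that(2)]]
    by (simp add: hat_def[abs_def])
  have IIIb: "((\<lambda>R. \<integral>\<nu>. \<bar>(\<integral>v. \<psi> (v /\<^sub>R R) \<partial>\<nu>) / R ^ CARD('n)
                      - ?c * (\<integral>u. \<psi> u \<partial>lborel)\<bar> \<partial>\<mu>) \<longlongrightarrow> 0) at_top" if "\<psi> \<in> Cc" for \<psi> :: "real ^ 'n \<Rightarrow> real"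
    using equidistributes_integrable[OF Cc_lborel_integrable[OF that]]
    by (simp add: equidistributes_def deviation_def hat_dilate)
  have IV: "(AE \<nu> in \<mu>. ((\<lambda>R. enn2real (mass_in_ball \<nu> R) / R ^ CARD('n))
                     \<longlongrightarrow> ?c * (unit_sphere_area TYPE('n) / CARD('n))) at_top) \<and>
       (\<forall>\<psi>\<in>Cc. AE \<nu> in \<mu>. ((\<lambda>R. (\<integral>v. \<psi> (v /\<^sub>R R) \<partial>\<nu>) / R ^ CARD('n))
                                  \<longlongrightarrow> ?c * (\<integral>u. \<psi> u \<partial>lborel)) at_top)"
    if "CARD('n) > 2" "\<forall>\<psi>\<in>Cc. integrable \<mu> (\<lambda>\<nu>. (hat \<psi> \<nu>)\<^sup>2)"
  proof -
    interpret siegel_L2 \<mu> by unfold_locales (use that in auto)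
    show ?thesis
    proof (intro conjI ballI)
      show "AE \<nu> in \<mu>. ((\<lambda>R. enn2real (mass_in_ball \<nu> R) / R ^ CARD('n))
                     \<longlongrightarrow> ?c * (unit_sphere_area TYPE('n) / CARD('n))) at_top"
        using AE_hat_dilate_ball_tendsto AE_space
      proof eventually_elim
        case (elim \<nu>)
        have "\<forall>\<^sub>F R in at_top. hat (dilate R ?B) \<nu> = enn2real (mass_in_ball \<nu> R) / R ^ CARD('n)"
          using eventually_gt_at_top[of 0] by eventually_elim (rule ball[OF _ elim(2)])
        from Lim_transform_eventually[OF elim(1) this] show ?case
          unfolding unit_ball_measure[symmetric] .
      qed
      fix \<psi> :: "real ^ 'n \<Rightarrow> real" assume "\<psi> \<in> Cc"
      from AE_hat_dilate_tendsto[OF this]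
      show "AE \<nu> in \<mu>. ((\<lambda>R. (\<integral>v. \<psi> (v /\<^sub>R R) \<partial>\<nu>) / R ^ CARD('n)) \<longlongrightarrow> ?c * (\<integral>u. \<psi> u \<partial>lborel)) at_top"
        unfolding hat_dilate .
    qed
  qed
  show ?thesis
    by (rule exI[of _ ?c]) (use mean_density(1) I IIa IIb IIIa IIIb IV in blast)
qed

end
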